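(* The algebra $\mathcal{S}=\bigoplus_{h\in\mathbb{Q}^4}\mathcal{S}(h)$ of symmetric shift operators is generated over $K$ by \[ G^q_+,\quad G^q_-,\quad E^q_{ij}\qquad(1\le i<j\le 4). \]
   Context: Let $K=\mathbb{Q}(\sqrt{-ab},b,\sqrt{-cd},d,q^{1/2})$ be the field of rational functions in the five indeterminates $\sqrt{-ab},b,\sqrt{-cd},d,q^{1/2}$; put $a=-(\sqrt{-ab})^2/b$, $c=-(\sqrt{-cd})^2/d$. Let $*$ be the field involution of $K$ inverting the five generators. Let $\mathcal{A}=K[z,z^{-1}]$ and $\mathcal{A}_0=\{f\in\mathcal{A}: f(z)=f(z^{-1})\}$. For $f=\sum_n f_nz^n$ put $f^*=\sum_n f_n^*z^{-n}$. Write $(x;q)_\infty=\prod_{j\ge0}(1-xq^j)$ and $(x_1,\dots,x_r;q)_\infty=\prod_i(x_i;q)_\infty$. Let \[ \Delta=\frac{(z^2,qz^{-2};q)_\infty}{(az,bz,cz,dz,aqz^{-1},bqz^{-1},cz^{-1},dz^{-1};q)_\infty}, \] expanded as a power series in $z$ and $q^{1/2}z^{-1}$ with coefficients in $\mathcal{R}=\mathbb{Q}[a^{\pm1},b^{\pm1},(cq^{-1/2})^{\pm1},(dq^{-1/2})^{\pm1}]$, hence regarded as an element of $\mathcal{R}((q^{1/2}))[[z^{\pm1}]]$. With $\mathrm{ct}$ denoting the coefficient of $z^0$, put $(f,g)=\mathrm{ct}(fg^*\Delta)\in K\otimes_{\mathcal{R}[q^{\pm1/2}]}\mathcal{R}((q^{1/2}))$.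 The symmetric Askey--Wilson polynomial $P_n=P_{n,k}\in\mathcal{A}_0$ ($n\in\mathbb{N}_0$) is the unique element with $P_0=1$ and, for $n\ge1$, $P_n=z^n+z^{-n}+$ (a $K$-linear combination of $z^j+z^{-j}$, $0\le j<n$), such that $(P_n,z^m+z^{-m})=0$ for $0\le m<n$. Here $k$ is a formal label for the parameters $(a,b,c,d)$; for $h\in\mathbb{Q}^4$, the subscript $k+h$ (on polynomials, scalars and operators) means that $(a,b,c,d)$ is replaced by $(aq^{h_1},bq^{h_2},cq^{h_3},dq^{h_4})$ and $\sqrt{-ab},\sqrt{-cd}$ by $q^{(h_1+h_2)/2}\sqrt{-ab},q^{(h_3+h_4)/2}\sqrt{-cd}$ (adjoining further rational powers of $q$ to $K$ if needed). Put $P_{n,k+h}=0$ if $n\notin\mathbb{N}_0$. Let $(Tf)(z)=f(q^{1/2}z)$. A symmetric difference operator is an operator $S=S_k=\sum_{n\in\mathbb{Z}}c_n(z)T^n$ with $c_n\in K(z)$, almost all zero, with $S\mathcal{A}_0\subset\mathcal{A}_0$. It is a shift operator with shift $h\in\mathbb{Q}^4$ if for every $m\in\mathbb{N}_0$ there is $C\in K$ with $S_kP_{m,k}=C\,P_{m+d',k+h}$, where $2d'+h_1+h_2+h_3+h_4=0$. $\mathcal{S}(h)$ is the $K$-vector space of these operators. The product on $\mathcal{S}$ is the $\mathbb{Q}$-bilinear one given for $S\in\mathcal{S}(h)$, $S'\in\mathcal{S}(h')$ by $(S\circ S')_k=S_{k+h'}S'_k\in\mathcal{S}(h+h')$; $K\subset\mathcal{S}(0)$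 via scalar multiplications. "Generated over $K$" means that $\mathcal{S}$ is the smallest subring containing $K$ and the given elements. Operators: with \[ A_1(z)=q^{-1/2}z^{-2}(1-aq^{-1/2}z)(1-bq^{-1/2}z)(1-cq^{-1/2}z)(1-dq^{-1/2}z), \] \[ A_{ij}(z)=-z^{-1}(1-u_iq^{-1/2}z)(1-u_jq^{-1/2}z),\qquad (u_1,u_2,u_3,u_4)=(a,b,c,d), \] one sets \[ G^q_+=\frac{T-T^{-1}}{z-z^{-1}},\quad G^q_-=\frac{A_1(z)T-A_1(z^{-1})T^{-1}}{z-z^{-1}},\quad E^q_{ij}=\frac{A_{ij}(z)T-A_{ij}(z^{-1})T^{-1}}{z-z^{-1}}. \] With $v_1=\frac12(1,1,1,1)$, $v_2=\frac12(1,1,-1,-1)$, $v_3=\frac12(1,-1,1,-1)$, $v_4=\frac12(1,-1,-1,1)$, the operators $G^q_+,G^q_-,E^q_{12},E^q_{13},E^q_{14},E^q_{23},E^q_{24},E^q_{34}$ are shift operators with shifts $v_1,-v_1,-v_2,-v_3,-v_4,v_4,v_3,v_2$, respectively. *)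

theory Defs
  imports
    "HOL-Library.Poly_Mapping"
    "HOL-Computational_Algebra.Fraction_Field"
    "HOL-Computational_Algebra.Formal_Laurent_Series"
    "HOL-Analysis.Infinite_Products"
    "HOL-Algebra.Generated_Rings"
begin

section \<open>Extending ring homomorphisms to fractions\<close>

text \<open>
  If \<open>\<phi>\<close> is an injective ring homomorphism on a subring \<open>A\<close>, then \<open>fract_ext A \<phi>\<close> is its unique
  extension to the field of fractions of \<open>A\<close>; see \<open>fract_ext_Fract\<close>.
\<close>

definition fract_ext :: "'a::idom set \<Rightarrow> ('a \<Rightarrow> 'b::field) \<Rightarrow> 'a fract \<Rightarrow> 'b" where
  "fract_ext A \<phi> x =
     (THE y. \<exists>u\<in>A. \<exists>v\<in>A. v \<noteq> 0 \<and> x = Fraction_Field.Fract u v \<and> y = \<phi> u / \<phi> v)"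

lemma fract_ext_Fract:
  assumes mult: "\<And>u v. u \<in> A \<Longrightarrow> v \<in> A \<Longrightarrow> \<phi> (u * v) = \<phi> u * \<phi> v"
    and nz: "\<And>u. u \<in> A \<Longrightarrow> u \<noteq> 0 \<Longrightarrow> \<phi> u \<noteq> 0"
    and uv: "u \<in> A" "v \<in> A" "v \<noteq> 0"
  shows "fract_ext A \<phi> (Fraction_Field.Fract u v) = \<phi> u / \<phi> v"
  unfolding fract_ext_def
proof (rule the_equality)
  show "\<exists>u'\<in>A. \<exists>v'\<in>A. v' \<noteq> 0 \<and> Fraction_Field.Fract u v = Fraction_Field.Fract u' v' \<and>
          \<phi> u / \<phi> v = \<phi> u' / \<phi> v'"
    using uv by blast
next
  fix y
  assume "\<exists>u'\<in>A. \<exists>v'\<in>A. v' \<noteq> 0 \<and> Fraction_Field.Fract u v = Fraction_Field.Fract u' v' \<and>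
            y = \<phi> u' / \<phi> v'"
  then obtain u' v' where *: "u' \<in> A" "v' \<in> A" "v' \<noteq> 0"
    "Fraction_Field.Fract u v = Fraction_Field.Fract u' v'" "y = \<phi> u' / \<phi> v'"
    by blast
  then have "u * v' = u' * v"
    using uv by (simp add: eq_fract)
  then have "\<phi> u * \<phi> v' = \<phi> u' * \<phi> v"
    using mult * uv by metis
  then show "y = \<phi> u / \<phi> v"
    using nz[of v] nz[of v'] * uv by (simp add: frac_eq_eq)
qed


section \<open>The coefficient field\<close>

text \<open>
  The indeterminates stand for \<open>sqrt(-ab)\<close>, \<open>b\<close>, \<open>sqrt(-cd)\<close>, \<open>d\<close> and \<open>q^(1/2)\<close>.  All computations
  take place in the fraction field \<open>kk\<close> of the group algebra over the rationals of the group of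
  monomials with rational exponents (the linear order on the indeterminates serves only to make
  this group algebra an integral domain).  It contains the field \<open>K\<close> of rational functions, below
  \<open>KK\<close>, together with all rational powers of \<open>q\<close>.
\<close>

datatype indet = ISqrtAB | IB | ISqrtCD | ID | ISqrtQ

instantiation indet :: linorder
begin

primrec indet_rank :: "indet \<Rightarrow> nat" where
  "indet_rank ISqrtAB = 0"
| "indet_rank IB = 1"
| "indet_rank ISqrtCD = 2"
| "indet_rank ID = 3"
| "indet_rank ISqrtQ = 4"

definition less_eq_indet :: "indet \<Rightarrow> indet \<Rightarrow> bool" where
  "x \<le> y \<longleftrightarrow> indet_rank x \<le> indet_rank y"

definition less_indet :: "indet \<Rightarrow> indet \<Rightarrow> bool" where
  "x < y \<longleftrightarrow> indet_rank x < indet_rank y"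

lemma indet_rank_inject: "indet_rank x = indet_rank y \<longleftrightarrow> x = y"
  by (cases x; cases y) simp_all

instance
  by standard
    (auto simp: less_eq_indet_def less_indet_def indet_rank_inject [symmetric])

end

type_synonym expo = "indet \<Rightarrow>\<^sub>0 rat"
type_synonym kk = "(expo \<Rightarrow>\<^sub>0 rat) fract"

instance fract :: ("{idom, ring_char_0}") field_char_0
proof
  show "inj (of_nat :: nat \<Rightarrow> 'a fract)"
    by (auto simp: inj_on_def of_nat_fract eq_fract)
qed

definition mon :: "expo \<Rightarrow> kk" where
  "mon g = Fraction_Field.Fract (Poly_Mapping.single g 1) 1"

definition K_exponents :: "expo set" where
  "K_exponents = {g. \<forall>v. Poly_Mapping.lookup g v \<in> \<int>}"

definition K_laurent :: "(expo \<Rightarrow>\<^sub>0 rat) set" where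
  "K_laurent = {u. Poly_Mapping.keys u \<subseteq> K_exponents}"

definition KK :: "kk set" where
  "KK = {Fraction_Field.Fract u v | u v. u \<in> K_laurent \<and> v \<in> K_laurent \<and> v \<noteq> 0}"

definition sqrt_ab :: kk where "sqrt_ab = mon (Poly_Mapping.single ISqrtAB 1)"
definition par_b :: kk where "par_b = mon (Poly_Mapping.single IB 1)"
definition sqrt_cd :: kk where "sqrt_cd = mon (Poly_Mapping.single ISqrtCD 1)"
definition par_d :: kk where "par_d = mon (Poly_Mapping.single ID 1)"

definition qpow :: "rat \<Rightarrow> kk" where
  "qpow r = mon (Poly_Mapping.single ISqrtQ (2 * r))"

definition par_a :: kk where "par_a = - (sqrt_ab\<^sup>2 / par_b)"
definition par_c :: kk where "par_c = - (sqrt_cd\<^sup>2 / par_d)"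

text \<open>
  For a character \<open>e\<close> of the group of monomials, \<open>eval_mon e\<close> is the induced ring homomorphism.
\<close>

definition eval_mon :: "(expo \<Rightarrow> 'b::field_char_0) \<Rightarrow> (expo \<Rightarrow>\<^sub>0 rat) \<Rightarrow> 'b" where
  "eval_mon e u = (\<Sum>g\<in>Poly_Mapping.keys u. of_rat (Poly_Mapping.lookup u g) * e g)"

definition star :: "kk \<Rightarrow> kk" where
  "star = fract_ext UNIV (eval_mon (\<lambda>g. mon (- g)))"

type_synonym rat4 = "rat \<times> rat \<times> rat \<times> rat"

text \<open>
  The substitution \<open>k \<mapsto> k + h\<close>: \<open>b\<close>, \<open>d\<close>, \<open>sqrt(-ab)\<close> and \<open>sqrt(-cd)\<close> are multiplied by
  \<open>q^h2\<close>, \<open>q^h4\<close>, \<open>q^((h1+h2)/2)\<close> and \<open>q^((h3+h4)/2)\<close>, and powers of \<open>q\<close> are fixed; hence \<open>a\<close> and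
  \<open>c\<close> are multiplied by \<open>q^h1\<close> and \<open>q^h3\<close>.
\<close>

fun par_shift :: "rat4 \<Rightarrow> kk \<Rightarrow> kk" where
  "par_shift (h1, h2, h3, h4) = fract_ext UNIV (eval_mon (\<lambda>g. mon g *
     qpow ((h1 + h2) / 2 * Poly_Mapping.lookup g ISqrtAB + h2 * Poly_Mapping.lookup g IB +
           (h3 + h4) / 2 * Poly_Mapping.lookup g ISqrtCD + h4 * Poly_Mapping.lookup g ID)))"


section \<open>Laurent polynomials and rational functions in \<open>z\<close>\<close>

type_synonym lpoly = "int \<Rightarrow>\<^sub>0 kk"
type_synonym kz = "lpoly fract"

definition lmon :: "kk \<Rightarrow> int \<Rightarrow> lpoly" where
  "lmon x n = Poly_Mapping.single n x"

definition lsym :: "nat \<Rightarrow> lpoly" where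
  "lsym n = lmon 1 (int n) + lmon 1 (- int n)"

definition laurent_K :: "lpoly set" where
  "laurent_K = {f. \<forall>n. Poly_Mapping.lookup f n \<in> KK}"

definition sym_laurent_K :: "lpoly set" where
  "sym_laurent_K =
     {f \<in> laurent_K. \<forall>n. Poly_Mapping.lookup f (- n) = Poly_Mapping.lookup f n}"

definition lstar :: "lpoly \<Rightarrow> lpoly" where
  "lstar f = (\<Sum>n\<in>Poly_Mapping.keys f. lmon (star (Poly_Mapping.lookup f n)) (- n))"

definition of_lpoly :: "lpoly \<Rightarrow> kz" where
  "of_lpoly f = Fraction_Field.Fract f 1"

definition ratfun_K :: "kz set" where
  "ratfun_K = {Fraction_Field.Fract f g | f g. f \<in> laurent_K \<and> g \<in> laurent_K \<and> g \<noteq> 0}"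

definition zz :: kz where "zz = of_lpoly (lmon 1 1)"
definition scal :: "kk \<Rightarrow> kz" where "scal x = of_lpoly (lmon x 0)"


section \<open>The weight function and the pairing\<close>

text \<open>
  The weight is expanded in \<open>z\<close> and \<open>w = q^(1/2) z^(-1)\<close>.  The elements of \<open>kk fps fps fps\<close> are
  regarded as power series in \<open>t = q^(1/2)\<close> (outermost) whose coefficients are power series in
  \<open>w\<close> (middle) and \<open>z\<close> (innermost).  As the topology of the outermost layer is the \<open>t\<close>-adic one, the
  infinite products converge.
\<close>

type_synonym series = "kk fps fps fps"

definition ser_z :: series where "ser_z = fps_const (fps_const fps_X)"
definition ser_w :: series where "ser_w = fps_const fps_X"
definition ser_t :: series where "ser_t = fps_X"
definition ser_const :: "kk \<Rightarrow> series" where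
  "ser_const x = fps_const (fps_const (fps_const x))"

definition qpoch :: "series \<Rightarrow> series" where
  "qpoch x = prodinf (\<lambda>j. 1 - x * (ser_t\<^sup>2) ^ j)"

text \<open>
  In terms of \<open>z\<close>, \<open>w\<close>, \<open>t\<close> and the elements \<open>a\<close>, \<open>b\<close>, \<open>c q^(-1/2)\<close>, \<open>d q^(-1/2)\<close> generating the
  ring of coefficients, \<open>q z^(-2) = w\<^sup>2\<close>, \<open>c z = (c q^(-1/2)) t z\<close>, \<open>a q z^(-1) = a t w\<close> and
  \<open>c z^(-1) = (c q^(-1/2)) w\<close>.
\<close>

definition Delta_series :: series where
  "Delta_series =
     (let A = ser_const par_a; B = ser_const par_b;
          C = ser_const (par_c * qpow (-1/2)); D = ser_const (par_d * qpow (-1/2))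
      in qpoch (ser_z\<^sup>2) * qpoch (ser_w\<^sup>2) *
         inverse
          (qpoch (A * ser_z) * qpoch (B * ser_z) *
           qpoch (C * ser_t * ser_z) * qpoch (D * ser_t * ser_z) *
           qpoch (A * ser_t * ser_w) * qpoch (B * ser_t * ser_w) *
           qpoch (C * ser_w) * qpoch (D * ser_w)))"

text \<open>
  The coefficient of \<open>z^n\<close> of the weight, a Laurent series in \<open>t\<close>: the monomials contributing to
  it are \<open>t^m w^j z^i\<close> with \<open>i - j = n\<close>, and such a monomial equals \<open>t^(m+j) z^n\<close>.
\<close>

definition Delta :: "int \<Rightarrow> kk fls" where
  "Delta n = fps_to_fls (Abs_fps (\<lambda>l. \<Sum>j | j \<le> l \<and> 0 \<le> n + int j.
     fps_nth (fps_nth (fps_nth Delta_series (l - j)) j) (nat (n + int j))))"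

text \<open>
  Scalars from \<open>K\<close> are multiplied with coefficients of the weight by means of the field embedding
  of \<open>K\<close> into the Laurent series in \<open>t\<close> that sends \<open>sqrt(-ab)\<close>, \<open>b\<close>, \<open>sqrt(-cd)\<close>, \<open>d\<close>, \<open>q^(1/2)\<close> to
  \<open>sqrt(-ab)\<close>, \<open>b\<close>, \<open>(sqrt(-cd) q^(-1/2)) t\<close>, \<open>(d q^(-1/2)) t\<close>, \<open>t\<close>.  It induces an injective
  homomorphism from the tensor product of \<open>K\<close> with \<open>R((q^(1/2)))\<close> over \<open>R[q^(1/2), q^(-1/2)]\<close>,
  where \<open>R\<close> is the Laurent polynomial ring in \<open>a\<close>, \<open>b\<close>, \<open>c q^(-1/2)\<close>, \<open>d q^(-1/2)\<close>; the values of
  the pairing are identified with their images.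
\<close>

definition t_degree :: "expo \<Rightarrow> rat" where
  "t_degree g = Poly_Mapping.lookup g ISqrtCD + Poly_Mapping.lookup g ID + Poly_Mapping.lookup g ISqrtQ"

definition t_expand :: "kk \<Rightarrow> kk fls" where
  "t_expand = fract_ext K_laurent (eval_mon (\<lambda>g.
     fls_const (mon g * qpow (- t_degree g / 2)) * fls_X_intpow \<lfloor>t_degree g\<rfloor>))"

definition pairing :: "lpoly \<Rightarrow> lpoly \<Rightarrow> kk fls" where
  "pairing f g = (\<Sum>n\<in>Poly_Mapping.keys (f * lstar g).
     t_expand (Poly_Mapping.lookup (f * lstar g) n) * Delta (- n))"


section \<open>Symmetric Askey--Wilson polynomials\<close>

definition AW :: "nat \<Rightarrow> lpoly" where
  "AW n = (THE p. p \<in> sym_laurent_K \<and>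
     (if n = 0 then p = 1
      else (\<exists>e. (\<forall>j<n. e j \<in> KK) \<and> p = lsym n + (\<Sum>j<n. lmon (e j) 0 * lsym j)) \<and>
           (\<forall>m<n. pairing p (lsym m) = 0)))"

definition AW_shifted :: "rat4 \<Rightarrow> rat \<Rightarrow> lpoly" where
  "AW_shifted h r = (if r \<in> \<nat> then Poly_Mapping.map (par_shift h) (AW (nat \<lfloor>r\<rfloor>)) else 0)"


section \<open>Symmetric difference operators and shift operators\<close>

text \<open>
  The operator \<open>\<Sum>n. c\<^sub>n(z) T^n\<close> is represented by the finitely supported family of its
  coefficients.  The ring multiplication of \<open>poly_mapping\<close> is not the composition of operators,
  which is \<open>op_comp\<close>.
\<close>

type_synonym diff_op = "int \<Rightarrow>\<^sub>0 kz"

definition T_pow :: "int \<Rightarrow> kz \<Rightarrow> kz" where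
  "T_pow n = fract_ext UNIV (\<lambda>f. \<Sum>j\<in>Poly_Mapping.keys f.
     of_lpoly (lmon (qpow (of_int (n * j) / 2) * Poly_Mapping.lookup f j) j))"

definition op_apply :: "diff_op \<Rightarrow> kz \<Rightarrow> kz" where
  "op_apply S f = (\<Sum>n\<in>Poly_Mapping.keys S. Poly_Mapping.lookup S n * T_pow n f)"

definition op_comp :: "diff_op \<Rightarrow> diff_op \<Rightarrow> diff_op" where
  "op_comp S S' = (\<Sum>n\<in>Poly_Mapping.keys S. \<Sum>m\<in>Poly_Mapping.keys S'.
     Poly_Mapping.single (n + m) (Poly_Mapping.lookup S n * T_pow n (Poly_Mapping.lookup S' m)))"

definition ratfun_shift :: "rat4 \<Rightarrow> kz \<Rightarrow> kz" where
  "ratfun_shift h = fract_ext UNIV (\<lambda>f. of_lpoly (Poly_Mapping.map (par_shift h) f))"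

definition op_shift :: "rat4 \<Rightarrow> diff_op \<Rightarrow> diff_op" where
  "op_shift h S = Poly_Mapping.map (ratfun_shift h) S"

definition symmetric_diff_op :: "diff_op \<Rightarrow> bool" where
  "symmetric_diff_op S \<longleftrightarrow> (\<forall>n. Poly_Mapping.lookup S n \<in> ratfun_K) \<and>
     (\<forall>f\<in>sym_laurent_K. op_apply S (of_lpoly f) \<in> of_lpoly ` sym_laurent_K)"

fun degree_shift :: "rat4 \<Rightarrow> rat" where
  "degree_shift (h1, h2, h3, h4) = - (h1 + h2 + h3 + h4) / 2"

definition shift_ops :: "rat4 \<Rightarrow> diff_op set" where
  "shift_ops h = {S. symmetric_diff_op S \<and>
     (\<forall>m. \<exists>C\<in>KK. op_apply S (of_lpoly (AW m)) =
        scal C * of_lpoly (AW_shifted h (of_nat m + degree_shift h)))}"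

text \<open>
  An element of the external direct sum of the spaces \<open>shift_ops h\<close> is the finitely supported
  family of its homogeneous components.
\<close>

definition shift_algebra :: "(rat4 \<Rightarrow>\<^sub>0 diff_op) ring" where
  "shift_algebra =
     \<lparr>carrier = {X. \<forall>h. Poly_Mapping.lookup X h \<in> shift_ops h},
      monoid.mult = (\<lambda>X Y. \<Sum>h\<in>Poly_Mapping.keys X. \<Sum>h'\<in>Poly_Mapping.keys Y.
        Poly_Mapping.single (h + h')
          (op_comp (op_shift h' (Poly_Mapping.lookup X h)) (Poly_Mapping.lookup Y h'))),
      one = Poly_Mapping.single 0 (Poly_Mapping.single 0 1),
      ring.zero = 0,
      add = (+)\<rparr>"

definition scalar_op :: "kk \<Rightarrow> diff_op" where
  "scalar_op x = Poly_Mapping.single 0 (scal x)"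


section \<open>The generators\<close>

definition two_term_op :: "(kz \<Rightarrow> kz) \<Rightarrow> diff_op" where
  "two_term_op A = Poly_Mapping.single 1 (A zz / (zz - inverse zz)) -
     Poly_Mapping.single (- 1) (A (inverse zz) / (zz - inverse zz))"

definition coeff_A1 :: "kz \<Rightarrow> kz" where
  "coeff_A1 x = scal (qpow (-1/2)) * inverse (x\<^sup>2) *
     (1 - scal (par_a * qpow (-1/2)) * x) * (1 - scal (par_b * qpow (-1/2)) * x) *
     (1 - scal (par_c * qpow (-1/2)) * x) * (1 - scal (par_d * qpow (-1/2)) * x)"

definition coeff_A2 :: "kk \<Rightarrow> kk \<Rightarrow> kz \<Rightarrow> kz" where
  "coeff_A2 u u' x = - inverse x *
     (1 - scal (u * qpow (-1/2)) * x) * (1 - scal (u' * qpow (-1/2)) * x)"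

definition Gq_plus :: diff_op where "Gq_plus = two_term_op (\<lambda>_. 1)"
definition Gq_minus :: diff_op where "Gq_minus = two_term_op coeff_A1"

definition Eq :: "nat \<Rightarrow> nat \<Rightarrow> diff_op" where
  "Eq i j = (let u = [par_a, par_b, par_c, par_d]
     in two_term_op (coeff_A2 (u ! (i - 1)) (u ! (j - 1))))"

definition v1 :: rat4 where "v1 = (1/2, 1/2, 1/2, 1/2)"
definition v2 :: rat4 where "v2 = (1/2, 1/2, -1/2, -1/2)"
definition v3 :: rat4 where "v3 = (1/2, -1/2, 1/2, -1/2)"
definition v4 :: rat4 where "v4 = (1/2, -1/2, -1/2, 1/2)"

definition shift_generators :: "(rat4 \<Rightarrow>\<^sub>0 diff_op) set" where
  "shift_generators =
     {Poly_Mapping.single v1 Gq_plus, Poly_Mapping.single (- v1) Gq_minus,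
      Poly_Mapping.single (- v2) (Eq 1 2), Poly_Mapping.single (- v3) (Eq 1 3),
      Poly_Mapping.single (- v4) (Eq 1 4), Poly_Mapping.single v4 (Eq 2 3),
      Poly_Mapping.single v3 (Eq 2 4), Poly_Mapping.single v2 (Eq 3 4)}"

definition shift_scalars :: "(rat4 \<Rightarrow>\<^sub>0 diff_op) set" where
  "shift_scalars = (\<lambda>x. Poly_Mapping.single 0 (scalar_op x)) ` KK"

end

theory Submission
  imports Defs "HOL-Computational_Algebra.Polynomial_Factorial"
begin

text \<open>Let D_h be the Askey-Wilson second order q-difference operator at the parameters k+h,
  normalised (\<open>opD\<close>) so that its eigenvalues are gamma q^n + 1/(gamma q^n) with gamma^2
  = abcd/q. For every set I of parameters with an even number of elements there is a first order
  operator E_I (\<open>opE\<close>) whose shift v_I has the entry -1/2 at the places in I and 1/2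
  elsewhere. Up to scalars in K these eight operators are the generators. They factorise the
  Askey-Wilson operator: with J the complement of I, nu E_J E_I = D_h - lambda
  (\<open>opE_fact\<close>). Hence E_I intertwines D_h with D_(h+v_I) (\<open>opE_opD\<close>), and
  D itself lies in the generated ring.

  To use this, the Askey-Wilson polynomials, which are defined by orthogonality, have to be
  recognised as the eigenpolynomials of D (\<open>AW_eq\<close>). Multiplied by (1-az)(1-bz)/z or by
  (z-c)(z-d)/z, the weight becomes antisymmetric under z -> 1/z or z -> q/z, so certain constant
  terms vanish (\<open>Lam_Pab\<close>, \<open>Lam_Pcd\<close>). This makes D self-adjoint
  (\<open>opD_symmetric\<close>). The eigenvalues are distinct (\<open>eig_eq\<close>) and the
  pairing is nondegenerate (\<open>Lam_nondegenerate\<close>), so the eigenpolynomials are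
  orthogonal with nonzero norms.

  A difference operator is determined by its values on symmetric Laurent polynomials
  (\<open>op_eq_0\<close>). Therefore a shift operator S with shift h is invariant under z -> 1/z
  and satisfies S D_0 = D_h S (\<open>shift_ops_intertw\<close>). These properties form
  \<open>intertw\<close>, and the generation statement is a descent on h for such operators. If h is
  nonzero, some v_I has a positive inner product n with h, and then S is right divisible by E_I
  (\<open>intertw_peel\<close>). The quotient is an intertwiner with shift h - v_I, which is smaller
  (\<open>shift_size_vsh\<close>). If h = 0, then S commutes with D, and comparison of leading
  coefficients shows that S is a polynomial in D over K (\<open>intertw_0_gen\<close>).

  The divisibility is the core. The top coefficient of S solves a first order q-difference equation;
  as it is rational, zeros have to match along q-orbits, which makes h integral relative to the
  exponents of S (\<open>intertw_lattice\<close>) and forces all exponents of S to have the same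
  parity (\<open>intertw_parity\<close>). Division by E_I therefore leaves one term r T^j. The
  intertwining relation, reduced modulo left multiples of E_I and conjugated by a rational function,
  says that r solves the eigenvalue equation of the Askey-Wilson operator with u_i replaced by q/u_i
  for i in I (\<open>twisted_eigen\<close>). For generic parameters a solution has no poles outside
  0 (\<open>no_poles\<close>), so it is a Laurent polynomial. Its top exponent must be -n and, by
  the symmetry z -> 1/z, its bottom exponent must be n (\<open>twisted_eigen_top\<close>). For n > 0
  this is impossible unless r = 0.\<close>

lemmas lookup_if_single = lookup_single when_def

section \<open>Field embeddings\<close>

locale field_emb =
  fixes f :: "'a::field \<Rightarrow> 'b::field"
  assumes add: "f (x + y) = f x + f y"
    and mult: "f (x * y) = f x * f y"
    and one: "f 1 = 1"
begin

lemma zero: "f 0 = 0"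
  using add[of 0 0] by (metis add_0_left add_cancel_right_left)

lemma minus: "f (- x) = - f x"
  using add[of x "- x"] zero by (simp add: eq_neg_iff_add_eq_0 add.commute)

lemma diff: "f (x - y) = f x - f y"
  using add[of x "- y"] minus by simp

lemma eq_zero: "f x = 0 \<longleftrightarrow> x = 0"
proof
  assume "f x = 0"
  show "x = 0"
  proof (rule ccontr)
    assume "x \<noteq> 0"
    then have "f x * f (inverse x) = 1" using mult[of x "inverse x"] one by simp
    then show False using \<open>f x = 0\<close> by simp
  qed
qed (simp add: zero)

lemma inverse: "f (inverse x) = inverse (f x)"
proof (cases "x = 0")
  case False
  then have "f x * f (inverse x) = 1" using mult[of x "inverse x"] one by simp
  then show ?thesis by (metis inverse_unique)
qed (simp add: zero)

lemma divide: "f (x / y) = f x / f y"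
  by (simp add: field_class.field_divide_inverse mult inverse)

lemma power: "f (x ^ n) = f x ^ n"
  by (induction n) (simp_all add: one mult)

lemma sum: "f (\<Sum>i\<in>I. g i) = (\<Sum>i\<in>I. f (g i))"
  by (induction I rule: infinite_finite_induct) (simp_all add: zero add)

lemma prod: "f (\<Prod>i\<in>I. g i) = (\<Prod>i\<in>I. f (g i))"
  by (induction I rule: infinite_finite_induct) (simp_all add: one mult)

lemma inj: "inj f"
  using diff eq_zero by (metis injI right_minus_eq)

lemma eq_iff: "f x = f y \<longleftrightarrow> x = y"
  using inj by (auto dest: injD)

lemma of_nat: "f (of_nat n) = of_nat n"
  by (induction n) (simp_all add: zero one add)

lemma numeral: "f (numeral n) = numeral n"
  using of_nat[of "numeral n"] by simp

lemmas simps = add mult one zero minus diff eq_zero inverse divide power sum prod numeral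

end

section \<open>Extension of ring homomorphisms to fractions\<close>

definition Fracts :: "'a::idom set \<Rightarrow> 'a fract set" where
  "Fracts A = {Fraction_Field.Fract u v | u v. u \<in> A \<and> v \<in> A \<and> v \<noteq> 0}"

locale fract_extension =
  fixes A :: "'a::idom set" and \<phi> :: "'a \<Rightarrow> 'b::field"
  assumes A_one: "1 \<in> A" and A_add: "u \<in> A \<Longrightarrow> v \<in> A \<Longrightarrow> u + v \<in> A"
    and A_mult: "u \<in> A \<Longrightarrow> v \<in> A \<Longrightarrow> u * v \<in> A"
    and hom_one: "\<phi> 1 = 1" and hom_add: "u \<in> A \<Longrightarrow> v \<in> A \<Longrightarrow> \<phi> (u + v) = \<phi> u + \<phi> v"
    and hom_mult: "u \<in> A \<Longrightarrow> v \<in> A \<Longrightarrow> \<phi> (u * v) = \<phi> u * \<phi> v"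
    and hom_nz: "u \<in> A \<Longrightarrow> u \<noteq> 0 \<Longrightarrow> \<phi> u \<noteq> 0"
begin

lemma ext_Fract: "u \<in> A \<Longrightarrow> v \<in> A \<Longrightarrow> v \<noteq> 0 \<Longrightarrow>
    fract_ext A \<phi> (Fraction_Field.Fract u v) = \<phi> u / \<phi> v"
  by (rule fract_ext_Fract) (simp_all add: hom_mult hom_nz)

lemma ext_of: "u \<in> A \<Longrightarrow> fract_ext A \<phi> (Fraction_Field.Fract u 1) = \<phi> u"
  by (simp add: ext_Fract A_one hom_one)

lemma ext_add:
  assumes "x \<in> Fracts A" "y \<in> Fracts A"
  shows "fract_ext A \<phi> (x + y) = fract_ext A \<phi> x + fract_ext A \<phi> y"
proof -
  obtain u v u' v' where *: "x = Fraction_Field.Fract u v" "y = Fraction_Field.Fract u' v'"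
    "u \<in> A" "v \<in> A" "v \<noteq> 0" "u' \<in> A" "v' \<in> A" "v' \<noteq> 0"
    using assms unfolding Fracts_def by blast
  then show ?thesis
    using hom_nz[of v] hom_nz[of v']
    by (simp add: ext_Fract A_add A_mult hom_add hom_mult add_frac_eq)
qed

lemma ext_mult:
  assumes "x \<in> Fracts A" "y \<in> Fracts A"
  shows "fract_ext A \<phi> (x * y) = fract_ext A \<phi> x * fract_ext A \<phi> y"
proof -
  obtain u v u' v' where *: "x = Fraction_Field.Fract u v" "y = Fraction_Field.Fract u' v'"
    "u \<in> A" "v \<in> A" "v \<noteq> 0" "u' \<in> A" "v' \<in> A" "v' \<noteq> 0"
    using assms unfolding Fracts_def by blast
  then show ?thesis
    by (simp add: ext_Fract A_mult hom_mult)
qed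

lemma ext_one: "fract_ext A \<phi> 1 = 1"
  using ext_of[OF A_one] by (simp add: One_fract_def hom_one)

lemma field_emb_ext:
  assumes "A = UNIV"
  shows "field_emb (fract_ext A \<phi>)"
proof -
  have "x \<in> Fracts A" for x
    unfolding Fracts_def assms by (cases x) auto
  then show ?thesis
    by unfold_locales (simp_all add: ext_add ext_mult ext_one)
qed

end

section \<open>Additive maps defined term by term\<close>

lemma sum_superset_lookup:
  fixes F :: "'a \<Rightarrow> 'b::zero \<Rightarrow> 'c::comm_monoid_add"
  assumes "finite I" "Poly_Mapping.keys f \<subseteq> I" "\<And>k. F k 0 = 0"
  shows "(\<Sum>k\<in>Poly_Mapping.keys f. F k (Poly_Mapping.lookup f k)) =
         (\<Sum>k\<in>I. F k (Poly_Mapping.lookup f k))"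
  by (rule sum.mono_neutral_left) (use assms in \<open>auto simp: in_keys_iff\<close>)

lemma poly_mapping_sum_single:
  "(\<Sum>k\<in>Poly_Mapping.keys f. Poly_Mapping.single k (Poly_Mapping.lookup f k)) = f"
  for f :: "'a \<Rightarrow>\<^sub>0 'b::comm_monoid_add"
  by (rule poly_mapping_eqI)
    (simp add: lookup_sum lookup_single when_def in_keys_iff)

lemma poly_mapping_add_induct [case_names single add]:
  fixes f :: "'a \<Rightarrow>\<^sub>0 'b::comm_monoid_add"
  assumes "\<And>k x. P (Poly_Mapping.single k x)"
    and "\<And>f g. P f \<Longrightarrow> P g \<Longrightarrow> P (f + g)"
  shows "P f"
proof -
  have "P (\<Sum>k\<in>I. Poly_Mapping.single k (Poly_Mapping.lookup f k))" if "finite I" for I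
    using that
  proof (induction I)
    case empty
    show ?case using assms(1)[of undefined 0] by simp
  qed (simp add: assms)
  from this[OF finite_keys[of f]] show ?thesis by (simp add: poly_mapping_sum_single)
qed

text \<open>Evaluation of monomials, substitutions in z, application of an operator and the constant
  term functional are all of this form, so additivity and multiplicativity are settled once.\<close>

definition lin_ext :: "('a \<Rightarrow> 'b \<Rightarrow> 'c::comm_monoid_add) \<Rightarrow> ('a \<Rightarrow>\<^sub>0 'b::zero) \<Rightarrow> 'c" where
  "lin_ext F f = (\<Sum>k\<in>Poly_Mapping.keys f. F k (Poly_Mapping.lookup f k))"

lemma lin_ext_single: "(\<And>k. F k 0 = 0) \<Longrightarrow> lin_ext F (Poly_Mapping.single k x) = F k x"
  by (simp add: lin_ext_def)

lemma lin_ext_add: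
  fixes F :: "'a \<Rightarrow> 'b::comm_monoid_add \<Rightarrow> 'c::comm_monoid_add"
  assumes "\<And>k. F k 0 = 0" "\<And>k x y. F k (x + y) = F k x + F k y"
  shows "lin_ext F (f + g) = lin_ext F f + lin_ext F g"
proof -
  let ?I = "Poly_Mapping.keys f \<union> Poly_Mapping.keys g"
  have "lin_ext F h = (\<Sum>k\<in>?I. F k (Poly_Mapping.lookup h k))"
    if "Poly_Mapping.keys h \<subseteq> ?I" for h
    unfolding lin_ext_def by (rule sum_superset_lookup) (use that assms in auto)
  then show ?thesis
    using Poly_Mapping.keys_add[of f g] by (simp add: lookup_add assms sum.distrib)
qed

text \<open>Variant for coefficient maps that are additive on a subset only, such as
  \<open>t_expand\<close> on K.\<close>

lemma lin_ext_add_on: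
  fixes F :: "'a \<Rightarrow> 'b::comm_monoid_add \<Rightarrow> 'c::comm_monoid_add"
  assumes "\<And>k. F k 0 = 0" "\<And>k x y. x \<in> C \<Longrightarrow> y \<in> C \<Longrightarrow> F k (x + y) = F k x + F k y"
    and "\<And>k. Poly_Mapping.lookup f k \<in> C" "\<And>k. Poly_Mapping.lookup g k \<in> C"
  shows "lin_ext F (f + g) = lin_ext F f + lin_ext F g"
proof -
  let ?I = "Poly_Mapping.keys f \<union> Poly_Mapping.keys g"
  have "lin_ext F h = (\<Sum>k\<in>?I. F k (Poly_Mapping.lookup h k))"
    if "Poly_Mapping.keys h \<subseteq> ?I" for h
    unfolding lin_ext_def by (rule sum_superset_lookup) (use that assms in auto)
  then show ?thesis
    using Poly_Mapping.keys_add[of f g] by (simp add: lookup_add assms sum.distrib)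
qed

lemma lin_ext_sum:
  fixes F :: "'a \<Rightarrow> 'b::comm_monoid_add \<Rightarrow> 'c::comm_monoid_add"
  assumes "\<And>k. F k 0 = 0" "\<And>k x y. F k (x + y) = F k x + F k y"
  shows "lin_ext F (\<Sum>i\<in>I. g i) = (\<Sum>i\<in>I. lin_ext F (g i))"
  by (induction I rule: infinite_finite_induct) (simp_all add: lin_ext_add assms, simp_all add: lin_ext_def)

lemma lin_ext_mult:
  fixes F :: "'a::monoid_add \<Rightarrow> 'b::semiring_0 \<Rightarrow> 'c::semiring_0"
  assumes F0: "\<And>k. F k 0 = 0" and Fadd: "\<And>k x y. F k (x + y) = F k x + F k y"
    and Fm: "\<And>k l x y. k \<in> Poly_Mapping.keys f \<Longrightarrow> l \<in> Poly_Mapping.keys g \<Longrightarrow>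
      F (k + l) (x * y) = F k x * F l y"
  shows "lin_ext F (f * g) = lin_ext F f * lin_ext F g"
proof -
  let ?s = Poly_Mapping.single
  have "f * g = (\<Sum>k\<in>Poly_Mapping.keys f. ?s k (Poly_Mapping.lookup f k)) *
                (\<Sum>l\<in>Poly_Mapping.keys g. ?s l (Poly_Mapping.lookup g l))"
    by (simp add: poly_mapping_sum_single)
  also have "\<dots> = (\<Sum>k\<in>Poly_Mapping.keys f. \<Sum>l\<in>Poly_Mapping.keys g.
      ?s (k + l) (Poly_Mapping.lookup f k * Poly_Mapping.lookup g l))"
    by (simp add: sum_product mult_single)
  finally have "lin_ext F (f * g) = (\<Sum>k\<in>Poly_Mapping.keys f. \<Sum>l\<in>Poly_Mapping.keys g.
      F (k + l) (Poly_Mapping.lookup f k * Poly_Mapping.lookup g l))"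
    by (simp add: lin_ext_sum lin_ext_single F0 Fadd)
  also have "\<dots> = lin_ext F f * lin_ext F g"
    by (simp add: lin_ext_def sum_product Fm)
  finally show ?thesis .
qed

text \<open>Substitutions: exponents move along \<alpha> while coefficients are changed by
  \<open>c\<close>. The dilations T^n, the reflection z -> 1/z and the parameter shifts are of this
  kind.\<close>

definition push :: "('a \<Rightarrow> 'b) \<Rightarrow> ('a \<Rightarrow> 'c \<Rightarrow> 'd) \<Rightarrow> ('a \<Rightarrow>\<^sub>0 'c::zero) \<Rightarrow> ('b \<Rightarrow>\<^sub>0 'd::comm_monoid_add)" where
  "push \<alpha> c = lin_ext (\<lambda>k x. Poly_Mapping.single (\<alpha> k) (c k x))"

lemma lookup_push:
  assumes "inj_on \<alpha> (insert k (Poly_Mapping.keys f))" "\<And>k. c k 0 = 0"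
  shows "Poly_Mapping.lookup (push \<alpha> c f) (\<alpha> k) = c k (Poly_Mapping.lookup f k)"
proof -
  have "Poly_Mapping.lookup (push \<alpha> c f) (\<alpha> k) =
      (\<Sum>l\<in>Poly_Mapping.keys f. if l = k then c l (Poly_Mapping.lookup f l) else 0)"
    unfolding push_def lin_ext_def lookup_sum lookup_single
    by (rule sum.cong) (use assms(1) in \<open>auto simp: when_def inj_on_def\<close>)
  then show ?thesis by (simp add: assms not_in_keys_iff_lookup_eq_zero)
qed

lemma push_eq_zero:
  assumes "inj_on \<alpha> (Poly_Mapping.keys f)" "\<And>k. c k 0 = 0" "\<And>k x. c k x = 0 \<Longrightarrow> x = 0"
    and "push \<alpha> c f = 0"
  shows "f = 0"
proof (rule ccontr)
  assume "f \<noteq> 0"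
  then obtain k where k: "k \<in> Poly_Mapping.keys f" by fastforce
  then have "c k (Poly_Mapping.lookup f k) = 0"
    using lookup_push[of \<alpha> k f c] assms(1,2,4) by (simp add: insert_absorb)
  then have "Poly_Mapping.lookup f k = 0" using assms(3) by blast
  with k show False by (simp add: in_keys_iff)
qed

lemma single_eq_zero_iff [simp]: "Poly_Mapping.single k x = 0 \<longleftrightarrow> x = 0"
  by (metis lookup_single_eq lookup_zero single_zero)

section \<open>Monomials and powers of q\<close>

lemma mon_add: "mon (g + h) = mon g * mon h"
  by (simp add: mon_def mult_single)

lemma mon_0: "mon 0 = 1"
  by (simp add: mon_def One_fract_def)

lemma mon_nz [simp]: "mon g \<noteq> 0"
  by (simp add: mon_def Zero_fract_def eq_fract)

lemma mon_uminus: "mon (- g) = inverse (mon g)"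
  using mon_add[of g "- g"] by (simp add: mon_0 inverse_unique)

lemma mon_minus: "mon (g - h) = mon g / mon h"
  using mon_add[of g "- h"] by (simp add: mon_uminus field_class.field_divide_inverse)

lemma mon_eq: "mon g = mon h \<longleftrightarrow> g = h"
  by (simp add: mon_def eq_fract) (metis inj_single lookup_single_eq lookup_single_not_eq zero_neq_one)

lemma mon_neq_minus: "mon g \<noteq> - mon h"
proof
  assume "mon g = - mon h"
  then have "Poly_Mapping.single g (1::rat) = Poly_Mapping.single h (- 1)"
    by (simp add: mon_def eq_fract flip: single_uminus)
  then have "Poly_Mapping.lookup (Poly_Mapping.single g (1::rat)) g =
      Poly_Mapping.lookup (Poly_Mapping.single h (- 1)) g" by simp
  then show False by (simp add: lookup_single when_def split: if_splits)
qed

lemma qpow_add: "qpow (r + s) = qpow r * qpow s"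
  by (simp add: qpow_def mon_add [symmetric] single_add [symmetric] distrib_left)

lemma qpow_0 [simp]: "qpow 0 = 1"
  by (simp add: qpow_def mon_0)

lemma qpow_nz [simp]: "qpow r \<noteq> 0"
  by (simp add: qpow_def)

lemma qpow_minus: "qpow (- r) = inverse (qpow r)"
  using qpow_add[of r "- r"] by (simp add: inverse_unique)

lemma qpow_diff: "qpow (r - s) = qpow r / qpow s"
  using qpow_add[of r "- s"] by (simp add: qpow_minus field_class.field_divide_inverse)

lemma qpow_power: "qpow r ^ n = qpow (of_nat n * r)"
  by (induction n) (simp_all add: algebra_simps qpow_add)

lemma qpow_power_int: "qpow r powi n = qpow (of_int n * r)"
proof (cases "n \<ge> 0")
  case True
  then obtain m where "n = int m" by (metis zero_le_imp_eq_int)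
  then show ?thesis by (simp add: qpow_power)
next
  case False
  then obtain m where "n = - int m" by (metis int_cases2 of_nat_0_le_iff)
  then show ?thesis by (simp add: power_int_minus qpow_power qpow_minus)
qed

lemma qpow_eq: "qpow r = qpow s \<longleftrightarrow> r = s"
  by (simp add: qpow_def mon_eq inj_eq[OF inj_single])

lemma qpow_eq_1: "qpow r = 1 \<longleftrightarrow> r = 0"
  using qpow_eq[of r 0] by simp

lemma qpow_neq_minus: "qpow r \<noteq> - qpow s"
  by (simp add: qpow_def mon_neq_minus)

text \<open>The test for genericity: a coincidence with a power of q, up to sign, forces all
  exponents except that of q^(1/2) to vanish.\<close>

lemma mon_eq_qpow:
  assumes "mon g = qpow r \<or> mon g = - qpow r" "v \<noteq> ISqrtQ"
  shows "Poly_Mapping.lookup g v = 0"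
proof -
  have "g = Poly_Mapping.single ISqrtQ (2 * r)"
    using assms(1) by (simp add: qpow_def mon_eq mon_neq_minus)
  then show ?thesis using assms(2) by (simp add: lookup_single)
qed

lemma fract_uminus: "- Fraction_Field.Fract u v = Fraction_Field.Fract (- u) v"
  by simp

lemma fract_of_rat: "Fraction_Field.Fract (Poly_Mapping.single 0 r) 1 = (of_rat r :: kk)"
proof -
  have nat: "Fraction_Field.Fract (of_nat n) 1 = (of_nat n :: kk)" for n
    by (simp add: of_nat_fract)
  have int: "Fraction_Field.Fract (of_int n) 1 = (of_int n :: kk)" for n
    by (cases n rule: int_cases2) (simp_all add: nat fract_uminus [symmetric])
  obtain a b where r: "r = of_int a / of_int b" "b \<noteq> 0"
    by (cases r) (auto simp: Fract_of_int_quotient)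
  have "Poly_Mapping.single 0 r * of_int b = (of_int a :: expo \<Rightarrow>\<^sub>0 rat)"
    using r by (simp add: mult_single flip: single_of_int)
  then have "Fraction_Field.Fract (Poly_Mapping.single 0 r) 1 * of_int b = (of_int a :: kk)"
    by (simp flip: int)
  then show ?thesis unfolding r(1) using r(2) by (simp add: of_rat_divide nonzero_eq_divide_eq)
qed

lemma Fract_lin_ext: "Fraction_Field.Fract u 1 = lin_ext (\<lambda>g x. of_rat x * mon g) u"
  for u :: "expo \<Rightarrow>\<^sub>0 rat"
proof (induction u rule: poly_mapping_add_induct)
  case (single g x)
  have "Fraction_Field.Fract (Poly_Mapping.single g x) 1 = of_rat x * mon g"
    unfolding fract_of_rat[symmetric] by (simp add: mon_def mult_single)
  then show ?case by (simp add: lin_ext_single)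
next
  case (add u v)
  have "Fraction_Field.Fract (u + v) 1 = Fraction_Field.Fract u 1 + Fraction_Field.Fract v 1"
    by simp
  then show ?case unfolding add by (simp add: lin_ext_add of_rat_add distrib_right)
qed

lemma eval_mon_eq: "eval_mon e u = lin_ext (\<lambda>g x. of_rat x * e g) u"
  by (simp add: eval_mon_def lin_ext_def)

lemma eval_mon_add: "eval_mon e (u + v) = eval_mon e u + eval_mon e v"
  by (simp add: eval_mon_eq lin_ext_add of_rat_add distrib_right)

lemma eval_mon_mult:
  assumes "\<And>g h. g \<in> Poly_Mapping.keys u \<Longrightarrow> h \<in> Poly_Mapping.keys v \<Longrightarrow> e (g + h) = e g * e h"
  shows "eval_mon e (u * v) = eval_mon e u * eval_mon e v"
  unfolding eval_mon_eq
  by (rule lin_ext_mult) (simp_all add: of_rat_add of_rat_mult distrib_right assms)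

lemma eval_mon_single: "eval_mon e (Poly_Mapping.single g x) = of_rat x * e g"
  by (simp add: eval_mon_eq lin_ext_single)

lemma eval_mon_1: "e 0 = 1 \<Longrightarrow> eval_mon e 1 = 1"
  using eval_mon_single[of e 0 1] by simp

lemma eval_mon_mon: "eval_mon (\<lambda>g. mon (\<alpha> g)) u = Fraction_Field.Fract (push \<alpha> (\<lambda>_ x. x) u) 1"
  by (induction u rule: poly_mapping_add_induct)
    (simp_all add: eval_mon_single push_def lin_ext_single eval_mon_add lin_ext_add
       single_add distrib_right of_rat_add Fract_lin_ext)

text \<open>An injective additive map of exponents keeps distinct monomials distinct. The induced
  map of group algebras is then injective and extends to the field of fractions.\<close>

lemma mon_hom:
  fixes \<alpha> :: "expo \<Rightarrow> expo"
  assumes add: "\<And>g h. \<alpha> (g + h) = \<alpha> g + \<alpha> h" and inj: "inj \<alpha>"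
  defines "f \<equiv> fract_ext UNIV (eval_mon (\<lambda>g. mon (\<alpha> g)))"
  shows "field_emb f" and "f (mon g) = mon (\<alpha> g)"
proof -
  have \<alpha>0: "\<alpha> 0 = 0" using add[of 0 0] by simp
  interpret fract_extension UNIV "eval_mon (\<lambda>g. mon (\<alpha> g))"
  proof
    fix u :: "expo \<Rightarrow>\<^sub>0 rat"
    assume "u \<noteq> 0"
    then have "push \<alpha> (\<lambda>_ x. x) u \<noteq> 0"
      using push_eq_zero[of \<alpha> u "\<lambda>_ x. x"] inj by (auto simp: inj_on_def)
    then show "eval_mon (\<lambda>g. mon (\<alpha> g)) u \<noteq> 0"
      by (simp add: eval_mon_mon Zero_fract_def eq_fract)
  qed (simp_all add: eval_mon_add eval_mon_mult eval_mon_1 add mon_add \<alpha>0 mon_0)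
  show "field_emb f" unfolding f_def by (rule field_emb_ext) simp
  show "f (mon g) = mon (\<alpha> g)"
    unfolding f_def mon_def[of g] by (simp add: ext_of eval_mon_single)
qed

lemma field_emb_of_rat:
  fixes f :: "'a::field_char_0 \<Rightarrow> 'b::field_char_0"
  assumes "field_emb f"
  shows "f (of_rat r) = of_rat r"
proof -
  interpret field_emb f by fact
  have int: "f (of_int n) = of_int n" for n
    by (cases n rule: int_cases2) (simp_all add: minus of_nat)
  obtain a b where r: "r = of_int a / of_int b" "b \<noteq> 0"
    by (cases r) (auto simp: Fract_of_int_quotient)
  show ?thesis by (simp add: r of_rat_divide divide int)
qed

text \<open>The monomials generate the field over the rationals, so identities between parameter
  shifts can be checked on monomials.\<close>

lemma kk_field_emb_eqI:
  fixes f g :: "kk \<Rightarrow> 'b::field_char_0"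
  assumes "field_emb f" "field_emb g" "\<And>h. f (mon h) = g (mon h)"
  shows "f = g"
proof
  fix x :: kk
  interpret f: field_emb f by fact
  interpret g: field_emb g by fact
  have *: "f (Fraction_Field.Fract u 1) = g (Fraction_Field.Fract u 1)" for u
    unfolding Fract_lin_ext lin_ext_def
    by (simp add: f.simps g.simps field_emb_of_rat[OF assms(1)] field_emb_of_rat[OF assms(2)] assms(3))
  obtain u v where x: "x = Fraction_Field.Fract u v" "v \<noteq> 0" by (cases x) auto
  then have "x = Fraction_Field.Fract u 1 / Fraction_Field.Fract v 1"
    by simp
  then show "f x = g x" by (simp only: f.divide g.divide *)
qed

section \<open>The substitution k -> k+h and the involution\<close>

definition shift_weight :: "rat4 \<Rightarrow> expo \<Rightarrow> rat" where
  "shift_weight h g = (case h of (h1, h2, h3, h4) \<Rightarrow>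
     (h1 + h2) / 2 * Poly_Mapping.lookup g ISqrtAB + h2 * Poly_Mapping.lookup g IB +
     (h3 + h4) / 2 * Poly_Mapping.lookup g ISqrtCD + h4 * Poly_Mapping.lookup g ID)"

lemma shift_weight_add: "shift_weight h (g + g') = shift_weight h g + shift_weight h g'"
  by (cases h) (simp add: shift_weight_def lookup_add algebra_simps add_divide_distrib)

lemma shift_weight_add_left: "shift_weight (h + h') g = shift_weight h g + shift_weight h' g"
  by (cases h; cases h') (simp add: shift_weight_def algebra_simps add_divide_distrib)

lemma shift_weight_0: "shift_weight 0 g = 0"
  by (simp add: shift_weight_def zero_prod_def)

lemma shift_weight_Q: "shift_weight h (Poly_Mapping.single ISqrtQ r) = 0"
  by (cases h) (simp add: shift_weight_def lookup_single)

lemma par_shift_eq: "par_shift h = fract_ext UNIV (eval_mon (\<lambda>g. mon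
    (g + Poly_Mapping.single ISqrtQ (2 * shift_weight h g))))"
  by (cases h) (simp add: shift_weight_def qpow_def mon_add)

lemma par_shift_emb: "field_emb (par_shift h)"
  and par_shift_mon: "par_shift h (mon g) = mon g * qpow (shift_weight h g)"
proof -
  let ?\<alpha> = "\<lambda>g. g + Poly_Mapping.single ISqrtQ (2 * shift_weight h g)"
  have add: "?\<alpha> (g + g') = ?\<alpha> g + ?\<alpha> g'" for g g'
    by (simp add: shift_weight_add distrib_left single_add)
  \<comment> \<open>The weight ignores the exponent of q^(1/2), the only exponent that is altered,
    so it can be recovered from the image.\<close>
  have *: "g = g'" if "?\<alpha> g = ?\<alpha> g'" for g g'
  proof -
    have "shift_weight h (?\<alpha> g) = shift_weight h (?\<alpha> g')" using that by simp
    then have "shift_weight h g = shift_weight h g'"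
      unfolding shift_weight_add shift_weight_Q by simp
    then show ?thesis using that by simp
  qed
  have inj: "inj ?\<alpha>" by (rule injI, rule *)
  show "field_emb (par_shift h)" "par_shift h (mon g) = mon g * qpow (shift_weight h g)"
    unfolding par_shift_eq using mon_hom[OF add inj] by (simp_all add: mon_add qpow_def)
qed

interpretation ps: field_emb "par_shift h" for h
  by (rule par_shift_emb)

lemma par_shift_qpow [simp]: "par_shift h (qpow r) = qpow r"
  unfolding qpow_def by (subst par_shift_mon) (simp add: shift_weight_Q)

lemma par_shift_comp: "par_shift h (par_shift h' x) = par_shift (h + h') x"
proof -
  have "field_emb (\<lambda>x. par_shift h (par_shift h' x))"
    by unfold_locales (simp_all add: ps.simps)
  then have "(\<lambda>x. par_shift h (par_shift h' x)) = par_shift (h + h')"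
    by (rule kk_field_emb_eqI[OF _ par_shift_emb])
      (simp add: par_shift_mon ps.mult shift_weight_add_left qpow_add)
  then show ?thesis by (rule fun_cong)
qed

lemma par_shift_0: "par_shift 0 x = x"
proof -
  have "field_emb (\<lambda>x::kk. x)" by unfold_locales simp_all
  then have "par_shift 0 = (\<lambda>x. x)"
    by (rule kk_field_emb_eqI[OF par_shift_emb])
      (simp add: par_shift_mon shift_weight_0)
  then show ?thesis by (rule fun_cong)
qed

lemma star_emb: "field_emb star"
  unfolding star_def by (rule mon_hom) (auto simp: inj_def)

interpretation star: field_emb star
  by (rule star_emb)

subsection \<open>The parameters\<close>

definition par :: "nat \<Rightarrow> kk" where
  "par i = [par_a, par_b, par_c, par_d] ! i"

definition hc :: "rat4 \<Rightarrow> nat \<Rightarrow> rat" where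
  "hc h i = (case h of (h1, h2, h3, h4) \<Rightarrow> [h1, h2, h3, h4] ! i)"

definition upar :: "rat4 \<Rightarrow> nat \<Rightarrow> kk" where
  "upar h i = par i * qpow (hc h i)"

text \<open>The square root of abcd/q at the shifted parameters, see
  \<open>gam_square\<close>.\<close>

definition gam :: "rat4 \<Rightarrow> kk" where
  "gam h = sqrt_ab * sqrt_cd * qpow ((hc h 0 + hc h 1 + hc h 2 + hc h 3 - 1) / 2)"

lemma less_4_cases: "i < 4 \<Longrightarrow> (i = 0 \<Longrightarrow> P) \<Longrightarrow> (i = 1 \<Longrightarrow> P) \<Longrightarrow> (i = 2 \<Longrightarrow> P) \<Longrightarrow>
    (i = 3 \<Longrightarrow> P) \<Longrightarrow> P" for i :: nat
  by linarith

lemma less_4: "{..<4} = {0, 1, 2, 3::nat}"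
  by auto

lemma hc_add: "i < 4 \<Longrightarrow> hc (h + h') i = hc h i + hc h' i"
  by (erule less_4_cases; cases h; cases h') (simp_all add: hc_def)

lemma hc_uminus: "i < 4 \<Longrightarrow> hc (- h) i = - hc h i"
  by (erule less_4_cases; cases h) (simp_all add: hc_def)

lemma hc_0: "i < 4 \<Longrightarrow> hc 0 i = 0"
  by (erule less_4_cases) (simp_all add: hc_def zero_prod_def)

lemma hc_eqI: "(\<And>i. i < 4 \<Longrightarrow> hc h i = hc h' i) \<Longrightarrow> h = h'"
proof -
  assume *: "\<And>i. i < 4 \<Longrightarrow> hc h i = hc h' i"
  show "h = h'"
    using *[of 0] *[of 1] *[of 2] *[of 3] by (cases h; cases h') (simp add: hc_def)
qed

definition par_expo :: "nat \<Rightarrow> expo" where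
  "par_expo i = [Poly_Mapping.single ISqrtAB 2 - Poly_Mapping.single IB 1,
     Poly_Mapping.single IB 1, Poly_Mapping.single ISqrtCD 2 - Poly_Mapping.single ID 1,
     Poly_Mapping.single ID 1] ! i"

lemma mon_single_2: "mon (Poly_Mapping.single v 1) ^ 2 = mon (Poly_Mapping.single v 2)"
  by (simp add: power2_eq_square mon_add [symmetric] single_add [symmetric])

lemma par_mon: "i < 4 \<Longrightarrow> par i = (if even i then - mon (par_expo i) else mon (par_expo i))"
  by (erule less_4_cases)
    (simp_all add: par_def par_expo_def par_a_def par_b_def par_c_def par_d_def mon_minus
      sqrt_ab_def sqrt_cd_def mon_single_2)

lemma par_nz [simp]: "i < 4 \<Longrightarrow> par i \<noteq> 0"
  by (simp add: par_mon)

lemma upar_nz [simp]: "i < 4 \<Longrightarrow> upar h i \<noteq> 0"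
  by (simp add: upar_def)

lemma shift_weight_par: "i < 4 \<Longrightarrow> shift_weight h (par_expo i) = hc h i"
  by (erule less_4_cases; cases h)
    (simp_all add: shift_weight_def par_expo_def hc_def lookup_single lookup_minus field_simps)

lemma par_shift_par: "i < 4 \<Longrightarrow> par_shift h (par i) = upar h i"
  by (simp add: par_mon upar_def ps.minus par_shift_mon shift_weight_par)

lemma par_shift_upar: "i < 4 \<Longrightarrow> par_shift h (upar h' i) = upar (h + h') i"
  by (simp add: upar_def ps.mult par_shift_par hc_add qpow_add)

lemma upar_0: "i < 4 \<Longrightarrow> upar 0 i = par i"
  by (simp add: upar_def hc_0)

lemma gam_nz [simp]: "gam h \<noteq> 0"
  by (simp add: gam_def sqrt_ab_def sqrt_cd_def)

lemma par_shift_gam: "par_shift h (gam h') = gam (h + h')"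
proof -
  have "par_shift h (sqrt_ab * sqrt_cd) =
      sqrt_ab * sqrt_cd * qpow ((hc h 0 + hc h 1 + hc h 2 + hc h 3) / 2)"
    unfolding sqrt_ab_def sqrt_cd_def ps.mult par_shift_mon
    by (cases h) (simp add: shift_weight_def lookup_single hc_def add_divide_distrib qpow_add)
  then have "par_shift h (gam h') = sqrt_ab * sqrt_cd *
      qpow ((hc h 0 + hc h 1 + hc h 2 + hc h 3) / 2 + (hc h' 0 + hc h' 1 + hc h' 2 + hc h' 3 - 1) / 2)"
    unfolding gam_def ps.mult[of h "sqrt_ab * sqrt_cd"] by (simp add: qpow_add)
  then show ?thesis by (simp add: gam_def hc_add add_divide_distrib diff_divide_distrib algebra_simps)
qed

lemma gam_square: "gam h ^ 2 * qpow 1 = upar h 0 * upar h 1 * upar h 2 * upar h 3"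
proof -
  have two: "of_nat 2 * (x / 2) = x" for x :: rat by simp
  have "gam h ^ 2 * qpow 1 = sqrt_ab ^ 2 * sqrt_cd ^ 2 * (qpow (hc h 0 + hc h 1 + hc h 2 + hc h 3 - 1) * qpow 1)"
    by (simp only: gam_def power_mult_distrib qpow_power two mult.assoc)
  also have "\<dots> = sqrt_ab ^ 2 * sqrt_cd ^ 2 * qpow (hc h 0 + hc h 1 + hc h 2 + hc h 3)"
    by (simp add: qpow_add [symmetric])
  finally show ?thesis
    by (simp add: upar_def par_def par_a_def par_c_def qpow_add par_b_def par_d_def field_simps)
qed

text \<open>Some exponent other than that of q^(1/2) survives in the product. Together with
  \<open>par_neq_par_qpow\<close> this is the genericity that keeps zeros of the difference
  equations on distinct q-orbits.\<close>

lemma par_prod_neq_qpow: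
  assumes "i < 4" "j < 4"
  shows "par i * par j \<noteq> qpow r"
proof
  assume "par i * par j = qpow r"
  then have "mon (par_expo i + par_expo j) = qpow r \<or> mon (par_expo i + par_expo j) = - qpow r"
    using assms by (auto simp: par_mon mon_add minus_equation_iff split: if_splits)
  then have "Poly_Mapping.lookup (par_expo i + par_expo j) v = 0" if "v \<noteq> ISqrtQ" for v
    using that mon_eq_qpow by blast
  from this[of ISqrtAB] this[of IB] this[of ISqrtCD] this[of ID] show False
    using assms by (auto elim!: less_4_cases simp: par_expo_def lookup_add lookup_minus lookup_single)
qed

lemma par_neq_par_qpow:
  assumes "i < 4" "j < 4" "i \<noteq> j"
  shows "par i \<noteq> par j * qpow r"
proof
  assume "par i = par j * qpow r"
  then have "mon (par_expo i - par_expo j) = qpow r \<or> mon (par_expo i - par_expo j) = - qpow r"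
    using assms by (auto simp: par_mon mon_minus minus_equation_iff field_simps split: if_splits)
  then have "Poly_Mapping.lookup (par_expo i - par_expo j) v = 0" if "v \<noteq> ISqrtQ" for v
    using that mon_eq_qpow by blast
  from this[of ISqrtAB] this[of IB] this[of ISqrtCD] this[of ID] show False
    using assms by (auto elim!: less_4_cases simp: par_expo_def lookup_add lookup_minus lookup_single)
qed

context field_emb begin

lemma power_int: "f (x powi n) = f x powi n"
  by (cases n rule: int_cases2) (simp_all add: power power_int_minus inverse)

end

section \<open>The field K and the shifts that preserve it\<close>

locale subring_set =
  fixes A :: "'a::idom set"
  assumes one_in: "1 \<in> A" and add_in: "u \<in> A \<Longrightarrow> v \<in> A \<Longrightarrow> u + v \<in> A"
    and mult_in: "u \<in> A \<Longrightarrow> v \<in> A \<Longrightarrow> u * v \<in> A" and uminus_in: "u \<in> A \<Longrightarrow> - u \<in> A"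
begin

lemma zero_in: "0 \<in> A"
  using add_in[OF one_in uminus_in[OF one_in]] by simp

lemma Fr_incl: "u \<in> A \<Longrightarrow> Fraction_Field.Fract u 1 \<in> Fracts A"
  unfolding Fracts_def using one_in by force

lemma Fr_0: "0 \<in> Fracts A"
  using Fr_incl[OF zero_in] by (simp add: Zero_fract_def)

lemma Fr_1: "1 \<in> Fracts A"
  using Fr_incl[OF one_in] by (simp add: One_fract_def)

lemma Fr_add: "x \<in> Fracts A \<Longrightarrow> y \<in> Fracts A \<Longrightarrow> x + y \<in> Fracts A"
proof -
  assume "x \<in> Fracts A" "y \<in> Fracts A"
  then obtain u v u' v' where *: "x = Fraction_Field.Fract u v" "y = Fraction_Field.Fract u' v'"
    "u \<in> A" "v \<in> A" "v \<noteq> 0" "u' \<in> A" "v' \<in> A" "v' \<noteq> 0"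
    unfolding Fracts_def by blast
  then have "x + y = Fraction_Field.Fract (u * v' + u' * v) (v * v')" by simp
  then show ?thesis
    unfolding Fracts_def using * add_in mult_in no_zero_divisors by blast
qed

lemma Fr_mult: "x \<in> Fracts A \<Longrightarrow> y \<in> Fracts A \<Longrightarrow> x * y \<in> Fracts A"
proof -
  assume "x \<in> Fracts A" "y \<in> Fracts A"
  then obtain u v u' v' where *: "x = Fraction_Field.Fract u v" "y = Fraction_Field.Fract u' v'"
    "u \<in> A" "v \<in> A" "v \<noteq> 0" "u' \<in> A" "v' \<in> A" "v' \<noteq> 0"
    unfolding Fracts_def by blast
  then have "x * y = Fraction_Field.Fract (u * u') (v * v')" by simp
  then show ?thesis
    unfolding Fracts_def using * mult_in no_zero_divisors by blast
qed

lemma Fr_uminus: "x \<in> Fracts A \<Longrightarrow> - x \<in> Fracts A"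
  using Fr_mult[OF Fr_incl[OF uminus_in[OF one_in]], of x] by (simp add: One_fract_def [symmetric] flip: fract_uminus)

lemma Fr_diff: "x \<in> Fracts A \<Longrightarrow> y \<in> Fracts A \<Longrightarrow> x - y \<in> Fracts A"
  using Fr_add[OF _ Fr_uminus] by (simp only: diff_conv_add_uminus)

lemma Fr_inverse: "x \<in> Fracts A \<Longrightarrow> inverse x \<in> Fracts A"
proof (cases "x = 0")
  case False
  assume "x \<in> Fracts A"
  then obtain u v where *: "x = Fraction_Field.Fract u v" "u \<in> A" "v \<in> A" "v \<noteq> 0"
    unfolding Fracts_def by blast
  then have "u \<noteq> 0" using False by (auto simp: Zero_fract_def eq_fract)
  then show ?thesis using * unfolding Fracts_def by auto
qed (simp add: Fr_0)

lemma Fr_divide: "x \<in> Fracts A \<Longrightarrow> y \<in> Fracts A \<Longrightarrow> x / y \<in> Fracts A"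
  using Fr_mult[OF _ Fr_inverse] by (simp only: field_class.field_divide_inverse)

lemma Fr_power: "x \<in> Fracts A \<Longrightarrow> x ^ n \<in> Fracts A"
  by (induction n) (simp_all add: Fr_1 Fr_mult)

lemma Fr_power_int: "x \<in> Fracts A \<Longrightarrow> x powi n \<in> Fracts A"
  by (cases n rule: int_cases2) (simp_all add: Fr_power power_int_minus Fr_inverse)

lemma Fr_sum: "(\<And>i. i \<in> I \<Longrightarrow> g i \<in> Fracts A) \<Longrightarrow> (\<Sum>i\<in>I. g i) \<in> Fracts A"
  by (induction I rule: infinite_finite_induct) (simp_all add: Fr_0 Fr_add)

lemma Fr_prod: "(\<And>i. i \<in> I \<Longrightarrow> g i \<in> Fracts A) \<Longrightarrow> (\<Prod>i\<in>I. g i) \<in> Fracts A"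
  by (induction I rule: infinite_finite_induct) (simp_all add: Fr_1 Fr_mult)

lemma Fr_of_nat: "of_nat n \<in> Fracts A"
  by (induction n) (simp_all add: Fr_0 Fr_1 Fr_add)

lemma Fr_numeral: "numeral n \<in> Fracts A"
  using Fr_of_nat[of "numeral n"] by simp

lemma sum_in: "(\<And>i. i \<in> I \<Longrightarrow> g i \<in> A) \<Longrightarrow> (\<Sum>i\<in>I. g i) \<in> A"
  by (induction I rule: infinite_finite_induct) (simp_all add: zero_in add_in)

lemmas Fr_intros = Fr_0 Fr_1 Fr_add Fr_mult Fr_uminus Fr_diff Fr_inverse Fr_divide Fr_power
  Fr_power_int Fr_sum Fr_prod Fr_numeral

end

lemma K_exponents_add: "g \<in> K_exponents \<Longrightarrow> h \<in> K_exponents \<Longrightarrow> g + h \<in> K_exponents"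
  by (simp add: K_exponents_def lookup_add)

lemma K_laurent_add: "u \<in> K_laurent \<Longrightarrow> v \<in> K_laurent \<Longrightarrow> u + v \<in> K_laurent"
  using Poly_Mapping.keys_add[of u v] by (auto simp: K_laurent_def)

lemma K_laurent_mult: "u \<in> K_laurent \<Longrightarrow> v \<in> K_laurent \<Longrightarrow> u * v \<in> K_laurent"
  using keys_mult[of u v] K_exponents_add by (fastforce simp: K_laurent_def)

lemma K_laurent_single: "g \<in> K_exponents \<Longrightarrow> Poly_Mapping.single g x \<in> K_laurent"
  by (auto simp: K_laurent_def)

lemma K_laurent_1: "1 \<in> K_laurent"
  using K_laurent_single[of 0 1] by (simp add: K_exponents_def)

interpretation KL: subring_set K_laurent
  by unfold_locales
    (simp_all add: K_laurent_add K_laurent_mult K_laurent_1, simp add: K_laurent_def)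

lemma KK_eq: "KK = Fracts K_laurent"
  by (simp add: KK_def Fracts_def)

lemmas KK_intros = KL.Fr_intros [folded KK_eq]

lemma mon_KK: "g \<in> K_exponents \<Longrightarrow> mon g \<in> KK"
  unfolding mon_def KK_eq by (intro KL.Fr_incl K_laurent_single)

lemma qpow_KK: "2 * r \<in> \<int> \<Longrightarrow> qpow r \<in> KK"
  unfolding qpow_def by (intro mon_KK) (simp add: K_exponents_def lookup_single when_def)

lemma of_rat_KK: "of_rat r \<in> KK"
  unfolding fract_of_rat[symmetric] KK_eq
  by (intro KL.Fr_incl K_laurent_single) (simp add: K_exponents_def)

lemma sqrt_ab_KK: "sqrt_ab \<in> KK" and par_b_KK: "par_b \<in> KK"
  and sqrt_cd_KK: "sqrt_cd \<in> KK" and par_d_KK: "par_d \<in> KK"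
  unfolding sqrt_ab_def par_b_def sqrt_cd_def par_d_def
  by (intro mon_KK; simp add: K_exponents_def lookup_single when_def)+

lemma par_KK: "i < 4 \<Longrightarrow> par i \<in> KK"
  by (erule less_4_cases)
    (simp_all add: par_def par_a_def par_c_def sqrt_ab_KK par_b_KK sqrt_cd_KK par_d_KK KK_intros)

lemma upar_KK: "i < 4 \<Longrightarrow> 2 * hc h i \<in> \<int> \<Longrightarrow> upar h i \<in> KK"
  by (simp add: upar_def par_KK qpow_KK KK_intros)

lemma gam_KK: "hc h 0 + hc h 1 + hc h 2 + hc h 3 \<in> \<int> \<Longrightarrow> gam h \<in> KK"
proof -
  assume *: "hc h 0 + hc h 1 + hc h 2 + hc h 3 \<in> \<int>"
  have "2 * (x / 2) = x" for x :: rat by simp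
  then show "gam h \<in> KK"
    unfolding gam_def using * by (intro KK_intros sqrt_ab_KK sqrt_cd_KK qpow_KK) (simp only: Ints_diff Ints_1)
qed

text \<open>The condition under which k -> k+h multiplies every generator of K by an integral power
  of q^(1/2), so that K is mapped into itself.\<close>

definition integral_shift :: "rat4 \<Rightarrow> bool" where
  "integral_shift h \<longleftrightarrow> (\<forall>i<4. 2 * hc h i \<in> \<int>) \<and> hc h 0 + hc h 1 \<in> \<int> \<and> hc h 2 + hc h 3 \<in> \<int>"

lemma par_shift_KK:
  assumes "integral_shift h" "x \<in> KK"
  shows "par_shift h x \<in> KK"
proof -
  have w: "2 * shift_weight h g \<in> \<int>" if "g \<in> K_exponents" for g
  proof -
    obtain h1 h2 h3 h4 where h: "h = (h1, h2, h3, h4)" by (cases h)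
    have i: "2 * h2 \<in> \<int>" "2 * h4 \<in> \<int>" "h1 + h2 \<in> \<int>" "h3 + h4 \<in> \<int>"
      using assms(1) by (auto simp: integral_shift_def h hc_def dest: spec[of _ 1] spec[of _ 3])
    have "2 * shift_weight h g = (h1 + h2) * Poly_Mapping.lookup g ISqrtAB
        + 2 * h2 * Poly_Mapping.lookup g IB + (h3 + h4) * Poly_Mapping.lookup g ISqrtCD
        + 2 * h4 * Poly_Mapping.lookup g ID"
      by (simp add: h shift_weight_def field_simps)
    then show ?thesis using i that by (simp add: K_exponents_def)
  qed
  have F: "par_shift h (Fraction_Field.Fract u 1) \<in> KK" if "u \<in> K_laurent" for u
  proof -
    have "of_rat (Poly_Mapping.lookup u g) * (mon g * qpow (shift_weight h g)) \<in> KK"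
      if "g \<in> Poly_Mapping.keys u" for g
      using that \<open>u \<in> K_laurent\<close> w
      by (intro KK_intros of_rat_KK mon_KK qpow_KK) (auto simp: K_laurent_def)
    then show ?thesis
      unfolding Fract_lin_ext lin_ext_def
      by (simp add: ps.sum ps.mult field_emb_of_rat[OF par_shift_emb] par_shift_mon KK_intros)
  qed
  obtain u v where x: "x = Fraction_Field.Fract u v" "u \<in> K_laurent" "v \<in> K_laurent" "v \<noteq> 0"
    using assms(2) unfolding KK_def by blast
  then have "x = Fraction_Field.Fract u 1 / Fraction_Field.Fract v 1"
    by simp
  then show ?thesis using F x by (simp add: ps.divide KK_intros del: divide_fract)
qed

subsection \<open>Rational functions\<close>

lemma of_lpoly_add: "of_lpoly (f + g) = of_lpoly f + of_lpoly g"
  and of_lpoly_mult: "of_lpoly (f * g) = of_lpoly f * of_lpoly g"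
  and of_lpoly_1: "of_lpoly 1 = 1"
  and of_lpoly_uminus: "of_lpoly (- f) = - of_lpoly f"
  and of_lpoly_0 [simp]: "of_lpoly 0 = 0"
  by (simp_all add: of_lpoly_def One_fract_def Zero_fract_def)

lemma of_lpoly_diff: "of_lpoly (f - g) = of_lpoly f - of_lpoly g"
  by (simp add: of_lpoly_def)

lemma of_lpoly_eq: "of_lpoly f = of_lpoly g \<longleftrightarrow> f = g"
  by (simp add: of_lpoly_def eq_fract)

lemma of_lpoly_eq_0 [simp]: "of_lpoly f = 0 \<longleftrightarrow> f = 0"
  using of_lpoly_eq[of f 0] by simp

lemma of_lpoly_sum: "of_lpoly (\<Sum>i\<in>I. g i) = (\<Sum>i\<in>I. of_lpoly (g i))"
  by (induction I rule: infinite_finite_induct) (simp_all add: of_lpoly_add)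

lemma Fract_of_lpoly: "Fraction_Field.Fract f g = of_lpoly f / of_lpoly g"
  by (simp add: of_lpoly_def)

lemma scal_emb: "field_emb scal"
  by unfold_locales
    (simp_all add: scal_def lmon_def single_add of_lpoly_add of_lpoly_1
      of_lpoly_mult [symmetric] mult_single)

interpretation scal: field_emb scal
  by (rule scal_emb)

lemma zz_nz [simp]: "zz \<noteq> 0"
  by (simp add: zz_def lmon_def)

lemma lmon_mult: "lmon x n * lmon y m = lmon (x * y) (n + m)"
  by (simp add: lmon_def mult_single)

lemma of_lpoly_lmon: "of_lpoly (lmon x n) = scal x * zz powi n"
proof -
  have nat: "of_lpoly (lmon 1 (int n)) = zz ^ n" for n
  proof (induction n)
    case 0
    show ?case by (simp add: lmon_def of_lpoly_1)
  next
    case (Suc n)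
    have "lmon 1 (int (Suc n)) = lmon 1 1 * lmon 1 (int n)" by (simp add: lmon_mult)
    then show ?case by (simp only: of_lpoly_mult Suc power_Suc zz_def)
  qed
  have "of_lpoly (lmon 1 n) = zz powi n"
  proof (cases n rule: int_cases2)
    case (nonpos m)
    have "lmon 1 (- int m) * lmon 1 (int m) = 1" by (simp add: lmon_mult) (simp add: lmon_def)
    then have "of_lpoly (lmon 1 (- int m)) * zz ^ m = 1"
      by (metis nat of_lpoly_1 of_lpoly_mult)
    then show ?thesis using nonpos by (simp add: power_int_minus) (metis inverse_unique mult.commute)
  qed (simp add: nat)
  moreover have "lmon x n = lmon x 0 * lmon 1 n" by (simp add: lmon_mult)
  ultimately show ?thesis by (simp add: of_lpoly_mult scal_def)
qed

lemma of_lpoly_lin_ext: "of_lpoly f = lin_ext (\<lambda>n x. scal x * zz powi n) f"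
proof (induction f rule: poly_mapping_add_induct)
  case (single k x)
  show ?case using of_lpoly_lmon[of x k] by (simp add: lin_ext_single scal.zero lmon_def)
next
  case (add f g)
  show ?case unfolding of_lpoly_add add by (simp add: lin_ext_add scal.simps distrib_right)
qed

lemma kz_field_emb_eqI:
  assumes "field_emb f" "field_emb g" "\<And>x. f (scal x) = g (scal x)" "f zz = g zz"
  shows "f = (g :: kz \<Rightarrow> 'b::field)"
proof
  fix x :: kz
  interpret f: field_emb f by fact
  interpret g: field_emb g by fact
  have *: "f (of_lpoly u) = g (of_lpoly u)" for u
    unfolding of_lpoly_lin_ext lin_ext_def by (simp add: f.simps g.simps f.power_int g.power_int assms)
  obtain u v where x: "x = Fraction_Field.Fract u v" "v \<noteq> 0" by (cases x) auto
  then have "x = of_lpoly u / of_lpoly v"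
    by (simp add: Fract_of_lpoly)
  then show "f x = g x" by (simp only: f.divide g.divide *)
qed

text \<open>The common source of the field automorphisms T^n, z -> 1/z and k -> k+h of the rational
  functions: an injective multiplicative relabelling of terms is an injective ring
  homomorphism.\<close>

lemma lpoly_hom:
  fixes \<alpha> :: "int \<Rightarrow> int" and c :: "int \<Rightarrow> kk \<Rightarrow> kk"
  assumes \<alpha>: "\<And>k l. \<alpha> (k + l) = \<alpha> k + \<alpha> l" "inj \<alpha>"
    and c: "\<And>k x y. c k (x + y) = c k x + c k y" "\<And>k x. c k x = 0 \<longleftrightarrow> x = 0"
      "\<And>k l x y. c (k + l) (x * y) = c k x * c l y" "c 0 1 = 1"
  defines "f \<equiv> fract_ext UNIV (\<lambda>p. of_lpoly (push \<alpha> c p))"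
  shows "field_emb f" and "f (of_lpoly p) = of_lpoly (push \<alpha> c p)"
proof -
  have \<alpha>0: "\<alpha> 0 = 0" using \<alpha>(1)[of 0 0] by simp
  have c0: "c k 0 = 0" for k by (simp add: c)
  have p1: "push \<alpha> c 1 = 1"
    using lin_ext_single[of "\<lambda>k x. Poly_Mapping.single (\<alpha> k) (c k x)" 0 1]
    by (simp add: push_def c0 c \<alpha>0)
  interpret fract_extension UNIV "\<lambda>p. of_lpoly (push \<alpha> c p)"
  proof
    fix u v :: lpoly
    show "of_lpoly (push \<alpha> c (u + v)) = of_lpoly (push \<alpha> c u) + of_lpoly (push \<alpha> c v)"
      by (simp add: push_def lin_ext_add c0 c single_add of_lpoly_add)
    show "of_lpoly (push \<alpha> c (u * v)) = of_lpoly (push \<alpha> c u) * of_lpoly (push \<alpha> c v)"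
      unfolding push_def of_lpoly_mult[symmetric]
      by (subst lin_ext_mult) (simp_all add: c0 c single_add \<alpha> mult_single)
    show "of_lpoly (push \<alpha> c u) \<noteq> 0" if "u \<noteq> 0"
      using push_eq_zero[of \<alpha> u c] \<alpha>(2) c that by (auto simp: inj_on_def)
  qed (simp_all add: p1 of_lpoly_1)
  show "field_emb f" unfolding f_def by (rule field_emb_ext) simp
  show "f (of_lpoly p) = of_lpoly (push \<alpha> c p)"
    unfolding f_def of_lpoly_def[of p] by (simp add: ext_of)
qed

lemma push_lmon: "c n 0 = 0 \<Longrightarrow> (\<And>k. c k 0 = 0) \<Longrightarrow> push \<alpha> c (lmon x n) = lmon (c n x) (\<alpha> n)"
  by (simp add: push_def lmon_def lin_ext_single)

lemma T_pow_eq: "T_pow n = fract_ext UNIV (\<lambda>p. of_lpoly (push (\<lambda>j. j)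
    (\<lambda>j x. qpow (of_int (n * j) / 2) * x) p))"
  by (simp add: T_pow_def push_def lin_ext_def of_lpoly_sum lmon_def)

lemma T_pow_emb: "field_emb (T_pow n)"
  and T_pow_of_lpoly: "T_pow n (of_lpoly p) =
    of_lpoly (push (\<lambda>j. j) (\<lambda>j x. qpow (of_int (n * j) / 2) * x) p)"
  unfolding T_pow_eq
  by (rule lpoly_hom;
      simp add: distrib_left distrib_right add_divide_distrib qpow_add)+

interpretation T: field_emb "T_pow n" for n
  by (rule T_pow_emb)

lemma T_pow_scal [simp]: "T_pow n (scal x) = scal x"
  by (simp add: scal_def T_pow_of_lpoly push_lmon)

lemma T_pow_zz: "T_pow n zz = scal (qpow (of_int n / 2)) * zz"
  by (simp add: zz_def T_pow_of_lpoly push_lmon)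
    (simp add: of_lpoly_lmon scal.one)

lemma T_pow_T_pow: "T_pow n (T_pow m x) = T_pow (n + m) x"
proof -
  have "(\<lambda>x. T_pow n (T_pow m x)) = T_pow (n + m)"
    by (rule kz_field_emb_eqI[OF _ T_pow_emb])
      (unfold_locales, simp_all add: T.simps T_pow_zz add_divide_distrib qpow_add scal.mult)
  then show ?thesis by (rule fun_cong)
qed

lemma id_emb: "field_emb (\<lambda>x. x)"
  by unfold_locales simp_all

lemma T_pow_0 [simp]: "T_pow 0 x = x"
proof -
  have "T_pow 0 = (\<lambda>x. x)"
    by (rule kz_field_emb_eqI[OF T_pow_emb id_emb]) (simp_all add: T_pow_zz scal.one)
  then show ?thesis by (rule fun_cong)
qed

definition zinv :: "kz \<Rightarrow> kz" where
  "zinv = fract_ext UNIV (\<lambda>p. of_lpoly (push uminus (\<lambda>_ x. x) p))"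

definition refl :: "lpoly \<Rightarrow> lpoly" where
  "refl = push uminus (\<lambda>_ x. x)"

lemma zinv_emb: "field_emb zinv"
  and zinv_of_lpoly: "zinv (of_lpoly p) = of_lpoly (refl p)"
  unfolding zinv_def refl_def by (rule lpoly_hom; auto simp: inj_def)+

interpretation zinv: field_emb zinv
  by (rule zinv_emb)

lemma lookup_refl: "Poly_Mapping.lookup (refl p) n = Poly_Mapping.lookup p (- n)"
  using lookup_push[of uminus "- n" p "\<lambda>_ x. x"] by (simp add: refl_def inj_on_def)

lemma zinv_scal [simp]: "zinv (scal x) = scal x"
  by (simp add: scal_def zinv_of_lpoly refl_def push_lmon)

lemma zinv_zz: "zinv zz = inverse zz"
  by (simp add: zz_def zinv_of_lpoly refl_def push_lmon) (simp add: of_lpoly_lmon scal.one power_int_minus)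

lemma zinv_zinv [simp]: "zinv (zinv x) = x"
proof -
  have "(\<lambda>x. zinv (zinv x)) = (\<lambda>x. x)"
    by (rule kz_field_emb_eqI[OF _ id_emb]) (unfold_locales, simp_all add: zinv.simps zinv_zz)
  then show ?thesis by (rule fun_cong)
qed

lemma zinv_T_pow: "zinv (T_pow n x) = T_pow (- n) (zinv x)"
proof -
  have "(\<lambda>x. zinv (T_pow n x)) = (\<lambda>x. T_pow (- n) (zinv x))"
    by (rule kz_field_emb_eqI)
      (unfold_locales, simp_all add: T.simps zinv.simps T_pow_zz zinv_zz qpow_minus scal.simps)
  then show ?thesis by (rule fun_cong)
qed

lemma map_eq_push: "f 0 = 0 \<Longrightarrow> Poly_Mapping.map f p = push (\<lambda>j. j) (\<lambda>_. f) p"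
  by (rule poly_mapping_eqI, subst lookup_push[of "\<lambda>j. j"])
    (simp_all add: Poly_Mapping.map.rep_eq when_def)

lemma map_par_shift: "Poly_Mapping.map (par_shift h) p = push (\<lambda>j. j) (\<lambda>_. par_shift h) p"
  by (rule map_eq_push) (rule ps.zero)

lemma ratfun_shift_emb: "field_emb (ratfun_shift h)"
  and ratfun_shift_of_lpoly: "ratfun_shift h (of_lpoly p) = of_lpoly (Poly_Mapping.map (par_shift h) p)"
  unfolding ratfun_shift_def map_par_shift
  by (rule lpoly_hom; simp add: ps.simps)+

interpretation rs: field_emb "ratfun_shift h" for h
  by (rule ratfun_shift_emb)

lemma ratfun_shift_scal [simp]: "ratfun_shift h (scal x) = scal (par_shift h x)"
  by (simp add: scal_def ratfun_shift_of_lpoly map_eq_push ps.simps push_lmon)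

lemma ratfun_shift_zz [simp]: "ratfun_shift h zz = zz"
  by (simp add: zz_def ratfun_shift_of_lpoly map_eq_push ps.simps push_lmon)

lemma ratfun_shift_T_pow: "ratfun_shift h (T_pow n x) = T_pow n (ratfun_shift h x)"
proof -
  have "(\<lambda>x. ratfun_shift h (T_pow n x)) = (\<lambda>x. T_pow n (ratfun_shift h x))"
    by (rule kz_field_emb_eqI)
      (unfold_locales, simp_all add: T.simps rs.simps T_pow_zz)
  then show ?thesis by (rule fun_cong)
qed

lemma ratfun_shift_zinv: "ratfun_shift h (zinv x) = zinv (ratfun_shift h x)"
proof -
  have "(\<lambda>x. ratfun_shift h (zinv x)) = (\<lambda>x. zinv (ratfun_shift h x))"
    by (rule kz_field_emb_eqI)
      (unfold_locales, simp_all add: zinv.simps rs.simps zinv_zz)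
  then show ?thesis by (rule fun_cong)
qed

lemma ratfun_shift_comp: "ratfun_shift h (ratfun_shift h' x) = ratfun_shift (h + h') x"
proof -
  have "(\<lambda>x. ratfun_shift h (ratfun_shift h' x)) = ratfun_shift (h + h')"
    by (rule kz_field_emb_eqI)
      (unfold_locales, simp_all add: rs.simps par_shift_comp)
  then show ?thesis by (rule fun_cong)
qed

lemma ratfun_shift_0: "ratfun_shift 0 x = x"
proof -
  have "ratfun_shift 0 = (\<lambda>x. x)"
    by (rule kz_field_emb_eqI[OF ratfun_shift_emb id_emb]) (simp_all add: par_shift_0)
  then show ?thesis by (rule fun_cong)
qed

subsection \<open>Coefficients in \<open>K\<close>\<close>

lemma lookup_mult_sum: "Poly_Mapping.lookup (f * g) n = (\<Sum>k\<in>Poly_Mapping.keys f.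
    Poly_Mapping.lookup f k * Poly_Mapping.lookup g (n - k))"
  for f g :: "int \<Rightarrow>\<^sub>0 'b::semiring_0"
proof (induction f rule: poly_mapping_add_induct)
  case (single k x)
  show ?case
  proof (induction g rule: poly_mapping_add_induct)
    case (single l y)
    show ?case by (auto simp: mult_single lookup_single when_def)
  qed (auto simp: distrib_left lookup_add)
next
  case (add f g')
  have *: "(\<Sum>k\<in>Poly_Mapping.keys p. Poly_Mapping.lookup p k * Poly_Mapping.lookup g (n - k)) =
     lin_ext (\<lambda>k x. x * Poly_Mapping.lookup g (n - k)) p" for p
    by (simp add: lin_ext_def)
  show ?case
    using add unfolding * by (simp add: distrib_right lookup_add lin_ext_add)
qed

lemma laurent_K_mult: "f \<in> laurent_K \<Longrightarrow> g \<in> laurent_K \<Longrightarrow> f * g \<in> laurent_K"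
  by (auto simp: laurent_K_def lookup_mult_sum intro!: KK_intros)

interpretation LK: subring_set laurent_K
  by unfold_locales
    (simp_all add: laurent_K_mult, simp_all add: laurent_K_def lookup_add lookup_one when_def KK_intros)

lemma ratfun_K_eq: "ratfun_K = Fracts laurent_K"
  by (simp add: ratfun_K_def Fracts_def)

lemmas RK_intros = LK.Fr_intros [folded ratfun_K_eq]

lemma of_lpoly_RK: "f \<in> laurent_K \<Longrightarrow> of_lpoly f \<in> ratfun_K"
  unfolding of_lpoly_def ratfun_K_eq by (rule LK.Fr_incl)

lemma lmon_LK: "x \<in> KK \<Longrightarrow> lmon x n \<in> laurent_K"
  by (simp add: lmon_def laurent_K_def lookup_single when_def KK_intros)

lemma scal_RK: "x \<in> KK \<Longrightarrow> scal x \<in> ratfun_K"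
  unfolding scal_def by (intro of_lpoly_RK lmon_LK)

lemma zz_RK: "zz \<in> ratfun_K"
  unfolding zz_def by (intro of_lpoly_RK lmon_LK KK_intros)

lemma ratfun_KE:
  assumes "x \<in> ratfun_K"
  obtains f g where "f \<in> laurent_K" "g \<in> laurent_K" "g \<noteq> 0" "x = of_lpoly f / of_lpoly g"
  using assms unfolding ratfun_K_def Fract_of_lpoly by blast

text \<open>Comparing one coefficient in x g = f writes x as a quotient of elements of K. This
  places the constants found by \<open>T_2_constant\<close> in K.\<close>

lemma scal_RK_imp:
  assumes "scal x \<in> ratfun_K"
  shows "x \<in> KK"
proof -
  obtain f g where fg: "f \<in> laurent_K" "g \<in> laurent_K" "g \<noteq> 0" "scal x = of_lpoly f / of_lpoly g"
    using assms by (rule ratfun_KE)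
  then have "of_lpoly (lmon x 0 * g) = of_lpoly f"
    by (simp add: of_lpoly_mult field_simps scal_def)
  then have eq: "lmon x 0 * g = f" by (simp add: of_lpoly_eq)
  obtain n where n: "Poly_Mapping.lookup g n \<noteq> 0"
    using fg(3) by (metis lookup_zero poly_mapping_eqI)
  have "Poly_Mapping.lookup f n = x * Poly_Mapping.lookup g n"
    by (auto simp: eq [symmetric] lmon_def lookup_mult_sum)
  then have "x = Poly_Mapping.lookup f n / Poly_Mapping.lookup g n" using n by simp
  then show ?thesis using fg by (simp add: laurent_K_def KK_intros)
qed

lemma push_LK:
  assumes "f \<in> laurent_K" "inj \<alpha>" "\<And>k x. x \<in> KK \<Longrightarrow> c k x \<in> KK" "\<And>k. c k 0 = 0"
  shows "push \<alpha> c f \<in> laurent_K"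
  unfolding push_def lin_ext_def
  using assms by (intro LK.sum_in lmon_LK[unfolded lmon_def]) (auto simp: laurent_K_def)

lemma T_pow_RK:
  assumes "x \<in> ratfun_K"
  shows "T_pow n x \<in> ratfun_K"
proof -
  have "T_pow n (of_lpoly f) \<in> ratfun_K" if "f \<in> laurent_K" for f
    unfolding T_pow_of_lpoly
    by (intro of_lpoly_RK push_LK that KK_intros qpow_KK) simp_all
  then show ?thesis using assms by (auto elim!: ratfun_KE simp: T.divide intro!: RK_intros)
qed

lemma zinv_RK:
  assumes "x \<in> ratfun_K"
  shows "zinv x \<in> ratfun_K"
proof -
  have "zinv (of_lpoly f) \<in> ratfun_K" if "f \<in> laurent_K" for f
    unfolding zinv_of_lpoly refl_def
    by (intro of_lpoly_RK push_LK that) (simp_all add: inj_def)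
  then show ?thesis using assms by (auto elim!: ratfun_KE simp: zinv.divide intro!: RK_intros)
qed

lemma ratfun_shift_RK:
  assumes "integral_shift h" "x \<in> ratfun_K"
  shows "ratfun_shift h x \<in> ratfun_K"
proof -
  have "ratfun_shift h (of_lpoly f) \<in> ratfun_K" if "f \<in> laurent_K" for f
    unfolding ratfun_shift_of_lpoly map_par_shift
    by (intro of_lpoly_RK push_LK that par_shift_KK assms) (simp_all add: ps.simps)
  then show ?thesis using assms(2) by (auto elim!: ratfun_KE simp: rs.divide intro!: RK_intros)
qed

subsection \<open>Operators\<close>

lemma op_apply_lin_ext: "op_apply S f = lin_ext (\<lambda>n c. c * T_pow n f) S"
  by (simp add: op_apply_def lin_ext_def)

lemma op_apply_add_op: "op_apply (S + S') f = op_apply S f + op_apply S' f"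
  by (simp add: op_apply_lin_ext lin_ext_add distrib_right)

lemma op_apply_single: "op_apply (Poly_Mapping.single n c) f = c * T_pow n f"
  by (simp add: op_apply_lin_ext lin_ext_single)

lemma op_apply_0_op [simp]: "op_apply 0 f = 0"
  by (simp add: op_apply_def)

lemma op_apply_uminus_op: "op_apply (- S) f = - op_apply S f"
  using op_apply_add_op[of S "- S" f] by (simp add: eq_neg_iff_add_eq_0 add.commute)

lemma op_apply_diff_op: "op_apply (S - S') f = op_apply S f - op_apply S' f"
  using op_apply_add_op[of S "- S'" f] by (simp add: op_apply_uminus_op)

lemma op_apply_sum_op: "op_apply (\<Sum>i\<in>I. S i) f = (\<Sum>i\<in>I. op_apply (S i) f)"
  by (induction I rule: infinite_finite_induct) (simp_all add: op_apply_add_op)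

lemma op_apply_add: "op_apply S (f + g) = op_apply S f + op_apply S g"
  by (simp add: op_apply_def T.add distrib_left sum.distrib)

lemma op_apply_scal: "op_apply S (scal x * f) = scal x * op_apply S f"
  by (simp add: op_apply_def T.mult sum_distrib_left algebra_simps)

lemma op_apply_0 [simp]: "op_apply S 0 = 0"
  by (simp add: op_apply_def T.zero)

lemma op_apply_diff: "op_apply S (f - g) = op_apply S f - op_apply S g"
  using op_apply_add[of S "f - g" g] by simp

lemma op_apply_sum: "op_apply S (\<Sum>i\<in>I. f i) = (\<Sum>i\<in>I. op_apply S (f i))"
  by (induction I rule: infinite_finite_induct) (simp_all add: op_apply_add)

lemma op_apply_comp: "op_apply (op_comp S S') f = op_apply S (op_apply S' f)"
  unfolding op_comp_def
  by (simp add: op_apply_sum_op op_apply_single op_apply_def[of S] op_apply_def[of S'] T.sum T.mult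
      T_pow_T_pow sum_distrib_left mult.assoc)

lemma LK_intros: "f \<in> laurent_K \<Longrightarrow> g \<in> laurent_K \<Longrightarrow> f + g \<in> laurent_K"
  "f \<in> laurent_K \<Longrightarrow> g \<in> laurent_K \<Longrightarrow> f * g \<in> laurent_K"
  "f \<in> laurent_K \<Longrightarrow> g \<in> laurent_K \<Longrightarrow> f - g \<in> laurent_K"
  "f \<in> laurent_K \<Longrightarrow> - f \<in> laurent_K" "0 \<in> laurent_K" "1 \<in> laurent_K"
  using LK.add_in LK.mult_in LK.uminus_in LK.zero_in LK.one_in
  by (auto simp only: diff_conv_add_uminus)

lemma refl_LK: "f \<in> laurent_K \<Longrightarrow> refl f \<in> laurent_K"
  by (simp add: laurent_K_def lookup_refl)

lemma sym_iff_refl: "f \<in> sym_laurent_K \<longleftrightarrow> f \<in> laurent_K \<and> refl f = f"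
  by (auto simp: sym_laurent_K_def lookup_refl poly_mapping_eq_iff fun_eq_iff)

lemma sym_zinv: "f \<in> sym_laurent_K \<Longrightarrow> zinv (of_lpoly f) = of_lpoly f"
  by (simp add: zinv_of_lpoly sym_iff_refl)

lemma refl_mult: "refl (f * g) = refl f * refl g" and refl_add: "refl (f + g) = refl f + refl g"
  and refl_1: "refl 1 = 1" and refl_0: "refl 0 = 0" and refl_uminus: "refl (- f) = - refl f"
  unfolding of_lpoly_eq[symmetric] of_lpoly_mult of_lpoly_add of_lpoly_uminus of_lpoly_1
    zinv_of_lpoly[symmetric] by (simp_all add: zinv.simps of_lpoly_mult of_lpoly_add of_lpoly_1 of_lpoly_uminus)

lemma sym_K_intros:
  "f \<in> sym_laurent_K \<Longrightarrow> g \<in> sym_laurent_K \<Longrightarrow> f + g \<in> sym_laurent_K"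
  "f \<in> sym_laurent_K \<Longrightarrow> g \<in> sym_laurent_K \<Longrightarrow> f * g \<in> sym_laurent_K"
  "f \<in> sym_laurent_K \<Longrightarrow> g \<in> sym_laurent_K \<Longrightarrow> f - g \<in> sym_laurent_K"
  "f \<in> sym_laurent_K \<Longrightarrow> - f \<in> sym_laurent_K" "0 \<in> sym_laurent_K" "1 \<in> sym_laurent_K"
  using refl_add[of f "- g"]
  by (simp_all add: sym_iff_refl LK_intros refl_mult refl_add refl_1 refl_0 refl_uminus)

lemma sym_K_sum: "(\<And>i. i \<in> I \<Longrightarrow> F i \<in> sym_laurent_K) \<Longrightarrow> (\<Sum>i\<in>I. F i) \<in> sym_laurent_K"
  by (induction I rule: infinite_finite_induct) (simp_all add: sym_K_intros)

lemma sym_K_power: "f \<in> sym_laurent_K \<Longrightarrow> f ^ n \<in> sym_laurent_K"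
  by (induction n) (simp_all add: sym_K_intros)

lemma lsym_sym: "lsym n \<in> sym_laurent_K"
  unfolding sym_iff_refl lsym_def
  by (simp add: LK_intros lmon_LK KK_intros refl_add) (simp add: refl_def push_lmon add.commute)

lemma const_sym: "x \<in> KK \<Longrightarrow> lmon x 0 \<in> sym_laurent_K"
  unfolding sym_iff_refl by (simp add: lmon_LK) (simp add: refl_def push_lmon)

lemma of_lpoly_power: "of_lpoly (f ^ n) = of_lpoly f ^ n"
  by (induction n) (simp_all add: of_lpoly_1 of_lpoly_mult)

text \<open>The points \<open>q^(n/2) z + q^(-n/2) z^(-1)\<close> are distinct, so this is a Vandermonde argument.\<close>

lemma op_eq_0:
  assumes "\<And>f. f \<in> sym_laurent_K \<Longrightarrow> op_apply S (of_lpoly f) = 0"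
  shows "S = 0"
proof (rule ccontr)
  assume "S \<noteq> 0"
  then obtain n where n: "n \<in> Poly_Mapping.keys S" by fastforce
  define x where "x m = T_pow m (of_lpoly (lsym 1))" for m
  have x: "x m = scal (qpow (of_int m / 2)) * zz + inverse (scal (qpow (of_int m / 2)) * zz)" for m
    by (simp add: x_def lsym_def of_lpoly_add of_lpoly_lmon T.simps T_pow_zz scal.one)
  have inj: "m = l" if "x m = x l" for m l
  proof -
    have X: "x m = of_lpoly (lmon (qpow (of_int m / 2)) 1 + lmon (qpow (- of_int m / 2)) (-1))" for m
      by (simp add: x of_lpoly_add of_lpoly_lmon qpow_minus scal.simps)
    have "Poly_Mapping.lookup (lmon (qpow (of_int m / 2)) 1 + lmon (qpow (- of_int m / 2)) (-1)) 1 =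
       Poly_Mapping.lookup (lmon (qpow (of_int l / 2)) 1 + lmon (qpow (- of_int l / 2)) (-1)) 1"
      using that unfolding X of_lpoly_eq by simp
    then show "m = l" by (simp add: lookup_add lmon_def lookup_single qpow_eq)
  qed
  have pow: "(\<Sum>m\<in>Poly_Mapping.keys S. Poly_Mapping.lookup S m * x m ^ k) = 0" for k
    using assms[OF sym_K_power[OF lsym_sym[of 1]], of k]
    by (simp add: op_apply_def x_def T.power [symmetric])
      (simp add: of_lpoly_power)
  have poly: "(\<Sum>m\<in>Poly_Mapping.keys S. Poly_Mapping.lookup S m * poly P (x m)) = 0" for P
  proof -
    have "(\<Sum>m\<in>Poly_Mapping.keys S. Poly_Mapping.lookup S m * poly P (x m)) =
       (\<Sum>i\<le>Polynomial.degree P. Polynomial.coeff P i * (\<Sum>m\<in>Poly_Mapping.keys S. Poly_Mapping.lookup S m * x m ^ i))"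
      by (simp add: poly_altdef sum_distrib_left mult.left_commute) (rule sum.swap)
    then show ?thesis by (simp add: pow)
  qed
  \<comment> \<open>The interpolation polynomial that vanishes at all nodes except the one belonging
    to n.\<close>
  define P where "P = (\<Prod>m\<in>Poly_Mapping.keys S - {n}. [:- x m, 1:])"
  have "poly P (x m) = 0" if "m \<in> Poly_Mapping.keys S" "m \<noteq> n" for m
    using that by (auto simp: P_def poly_prod)
  then have "Poly_Mapping.lookup S n * poly P (x n) = 0"
    using poly[of P] n by (subst (asm) sum.remove[OF finite_keys n]) simp
  moreover have "poly P (x n) \<noteq> 0"
    using inj by (auto simp: P_def poly_prod)
  ultimately show False using n by (simp add: in_keys_iff)
qed

lemma op_eqI_sym:
  assumes "\<And>f. f \<in> sym_laurent_K \<Longrightarrow> op_apply S (of_lpoly f) = op_apply S' (of_lpoly f)"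
  shows "S = S'"
  using op_eq_0[of "S - S'"] assms by (simp add: op_apply_diff_op)

lemma op_eqI: "(\<And>f. op_apply S f = op_apply S' f) \<Longrightarrow> S = S'"
  by (rule op_eqI_sym)

lemma op_shift_apply: "op_apply (op_shift h S) (ratfun_shift h f) = ratfun_shift h (op_apply S f)"
proof -
  have "op_shift h S = lin_ext (\<lambda>n c. Poly_Mapping.single n (ratfun_shift h c)) S"
    unfolding op_shift_def using map_eq_push[of "ratfun_shift h" S] by (simp add: rs.zero push_def)
  then show ?thesis
    by (simp add: lin_ext_def op_apply_sum_op op_apply_single op_apply_def[of S] rs.sum rs.mult ratfun_shift_T_pow)
qed

lemma op_shift_apply': "op_apply (op_shift h S) f = ratfun_shift h (op_apply S (ratfun_shift (- h) f))"
  using op_shift_apply[of h S "ratfun_shift (- h) f"] by (simp add: ratfun_shift_comp ratfun_shift_0)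

lemma lookup_op_shift: "Poly_Mapping.lookup (op_shift h S) n = ratfun_shift h (Poly_Mapping.lookup S n)"
  by (simp add: op_shift_def Poly_Mapping.map.rep_eq when_def rs.zero)

lemma op_shift_comp: "op_shift h (op_comp S S') = op_comp (op_shift h S) (op_shift h S')"
  by (rule op_eqI) (simp add: op_apply_comp op_shift_apply' ratfun_shift_comp ratfun_shift_0)

lemma op_shift_shift: "op_shift h (op_shift h' S) = op_shift (h + h') S"
  by (rule poly_mapping_eqI) (simp add: lookup_op_shift ratfun_shift_comp)

lemma op_shift_0: "op_shift 0 S = S"
  by (rule poly_mapping_eqI) (simp add: lookup_op_shift ratfun_shift_0)

lemma op_shift_zero [simp]: "op_shift h 0 = 0"
  by (rule poly_mapping_eqI) (simp add: lookup_op_shift rs.zero)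

text \<open>Conjugation of an operator by the reflection z -> 1/z, which exchanges T^n and
  T^(-n).\<close>

definition op_inv :: "diff_op \<Rightarrow> diff_op" where
  "op_inv S = push uminus (\<lambda>_. zinv) S"

lemma op_inv_apply: "op_apply (op_inv S) (zinv f) = zinv (op_apply S f)"
  by (simp add: op_inv_def push_def lin_ext_def op_apply_sum_op op_apply_single op_apply_def[of S]
      zinv.sum zinv.mult zinv_T_pow)

lemma op_inv_apply': "op_apply (op_inv S) f = zinv (op_apply S (zinv f))"
  using op_inv_apply[of S "zinv f"] by simp

lemma lookup_op_inv: "Poly_Mapping.lookup (op_inv S) n = zinv (Poly_Mapping.lookup S (- n))"
  using lookup_push[of uminus "- n" S "\<lambda>_. zinv"] by (simp add: op_inv_def inj_on_def zinv.zero)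

subsection \<open>The elementary operators\<close>

lemma denoms:
  fixes x t :: "'a::field"
  assumes "x \<noteq> 0" "t \<noteq> 0"
  shows "(x - 1/x) * (t*x - 1/(t*x)) = (1 - x^2) * (1 - t^2*x^2) / (t * x^2)"
    "(x - 1/x) * (x/t - t/x) = (x^2 - 1) * (x^2 - t^2) / (t * x^2)"
    "(1 - (1/x)^2) * (1 - t^2*(1/x)^2) = (x^2 - 1) * (x^2 - t^2) / x^4"
  using assms by (simp_all add: field_simps power2_eq_square power4_eq_xxxx)

lemma frac_step:
  fixes n :: "'a::field"
  assumes "n - n' / t = k * d2 * k'" "d2 \<noteq> 0"
  shows "n / (d1 * d2) - n' / (t * (d1 * d2)) = k * k' / d1"
proof -
  have "n / (d1 * d2) - n' / (t * (d1 * d2)) = (n - n' / t) / (d1 * d2)"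
    by (simp add: diff_divide_distrib)
  then show ?thesis using assms by simp
qed

lemma frac_add:
  fixes n :: "'a::field"
  assumes "1 - d \<noteq> 0" "n - n' = k * (1 - d)"
  shows "n / (1 - d) + n' / (d - 1) = k"
proof -
  have "n' / (d - 1) = - (n' / (1 - d))" by (metis minus_diff_eq minus_divide_right)
  then show ?thesis using assms by (simp add: diff_divide_distrib [symmetric])
qed

lemma combine_terms:
  fixes A1 :: "'a::field"
  shows "A1 - X1 = K1 \<Longrightarrow> A2 - X2 = K2 \<Longrightarrow> K1 + K2 = C \<Longrightarrow> - X1 - X2 = C - (A1 + A2)"
  by (auto simp: algebra_simps)

text \<open>The coefficient of T^0 in a product of two elementary operators when I has two elements.
  Here x is z, t is q^(1/2), m and p are the sum and product of the parameters in I, m' and p' those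
  of the remaining ones. Each term differs from A(x) or A(1/x) by a quotient whose denominator is 1
  - x^2 up to sign, and these poles cancel in the sum.\<close>

lemma fact2:
  fixes x t m p m' p' :: "'a::field"
  assumes nz: "x \<noteq> 0" "t \<noteq> 0" "x^2 \<noteq> 1" "t^2*x^2 \<noteq> 1" "x^2 \<noteq> t^2"
  defines "a \<equiv> \<lambda>x. inverse x * (1 - m' * x + p' * x^2)"
    and "b \<equiv> \<lambda>x. inverse x * (1 - m / t * x + p / t^2 * x^2)"
    and "A \<equiv> \<lambda>x. (1 - m * x + p * x^2) * (1 - m' * x + p' * x^2) / ((1 - x^2) * (1 - t^2 * x^2))"
  shows "- (a x * b (1/(t*x)) / ((x - 1/x) * (t*x - 1/(t*x))))
     - (a (1/x) * b (x/t) / ((x - 1/x) * (x/t - t/x))) = p * p' / t^2 + 1 - p' - p / t^2 - (A x + A (1/x))"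
proof -
  have nz': "1 - x^2 \<noteq> 0" "1 - t^2*x^2 \<noteq> 0" "x^2 - t^2 \<noteq> 0" "x^2 - 1 \<noteq> 0" using nz by auto
  have L1: "a x * b (1/(t*x)) / ((x - 1/x) * (t*x - 1/(t*x))) =
     (1 - m' * x + p' * x^2) * (t^4*x^2 - m*t^2*x + p) / (t^2 * ((1 - x^2) * (1 - t^2*x^2)))"
    unfolding a_def b_def denoms(1)[OF nz(1,2)] using nz nz'
    by (simp add: divide_simps) (simp add: algebra_simps power2_eq_square power4_eq_xxxx)
  have L2: "a (1/x) * b (x/t) / ((x - 1/x) * (x/t - t/x)) =
     (x^2 - m' * x + p') * (t^4 - m*t^2*x + p*x^2) / (t^2 * ((x^2 - 1) * (x^2 - t^2)))"
    unfolding a_def b_def denoms(2)[OF nz(1,2)] using nz nz'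
    by (simp add: divide_simps) (simp add: algebra_simps power2_eq_square power4_eq_xxxx)
  have L3: "A (1/x) = (x^2 - m * x + p) * (x^2 - m' * x + p') / ((x^2 - 1) * (x^2 - t^2))"
    unfolding A_def denoms(3)[OF nz(1,2)] using nz nz'
    by (simp add: divide_simps) (simp add: algebra_simps power2_eq_square power4_eq_xxxx)
  have "(1 - m * x + p * x^2) * (1 - m' * x + p' * x^2) - (1 - m' * x + p' * x^2) * (t^4*x^2 - m*t^2*x + p) / t^2
     = (1 - m' * x + p' * x^2) * (1 - t^2*x^2) * (1 - p/t^2)"
    using nz by (simp add: field_simps power2_eq_square power4_eq_xxxx)
  then have 1: "A x - a x * b (1/(t*x)) / ((x - 1/x) * (t*x - 1/(t*x))) = (1 - m' * x + p' * x^2) * (1 - p/t^2) / (1 - x^2)"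
    unfolding L1 unfolding A_def by (intro frac_step[OF _ nz'(2)])
  have "(x^2 - m * x + p) * (x^2 - m' * x + p') - (x^2 - m' * x + p') * (t^4 - m*t^2*x + p*x^2) / t^2
     = (x^2 - m' * x + p') * (x^2 - t^2) * (1 - p/t^2)"
    using nz by (simp add: field_simps power2_eq_square power4_eq_xxxx)
  then have 2: "A (1/x) - a (1/x) * b (x/t) / ((x - 1/x) * (x/t - t/x)) = (x^2 - m' * x + p') * (1 - p/t^2) / (x^2 - 1)"
    unfolding L2 L3 by (intro frac_step[OF _ nz'(3)])
  have "(1 - m' * x + p' * x^2) * (1 - p/t^2) / (1 - x^2) + (x^2 - m' * x + p') * (1 - p/t^2) / (x^2 - 1) =
     (1 - p/t^2) * (1 - p')"
    using nz' by (intro frac_add) (simp_all add: algebra_simps power2_eq_square add_divide_distrib diff_divide_distrib)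
  also have "\<dots> = p * p' / t^2 + 1 - p' - p / t^2"
    by (simp add: algebra_simps diff_divide_distrib)
  finally show ?thesis by (rule combine_terms[OF 1 2])
qed

text \<open>The coefficient of T^0 for empty I, with e1, ..., e4 the elementary symmetric functions
  of the parameters. Both terms already have the denominators of A.\<close>

lemma fact0:
  fixes x t e1 e2 e3 e4 :: "'a::field"
  assumes nz: "x \<noteq> 0" "t \<noteq> 0" "x^2 \<noteq> 1" "t^2*x^2 \<noteq> 1" "x^2 \<noteq> t^2"
  defines "P \<equiv> \<lambda>x. 1 - e1 * x + e2 * x^2 - e3 * x^3 + e4 * x^4"
  defines "a \<equiv> \<lambda>x. inverse (x^2) * P x"
    and "A \<equiv> \<lambda>x. P x / ((1 - x^2) * (1 - t^2 * x^2))"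
  shows "(- (a x / ((x - 1/x) * (t*x - 1/(t*x))))
     - (a (1/x) / ((x - 1/x) * (x/t - t/x)))) / t = - (A x + A (1/x))"
proof -
  define E1 where "E1 = (1 - x^2) * (1 - t^2 * x^2)"
  define E2 where "E2 = (x^2 - 1) * (x^2 - t^2)"
  have "E1 \<noteq> 0" "E2 \<noteq> 0" using nz by (auto simp: E1_def E2_def)
  then show ?thesis
    unfolding a_def A_def denoms(1,2,3)[OF nz(1,2)] E1_def [symmetric] E2_def [symmetric]
    using nz by (simp add: field_simps power2_eq_square power4_eq_xxxx)
qed

text \<open>The coefficient of T^0 when I consists of all four parameters. As in
  \<open>fact2\<close>, splitting off A leaves quotients with denominator 1 - x^2 up to sign, whose
  poles cancel.\<close>

lemma fact4:
  fixes x t e1 e2 e3 e4 :: "'a::field"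
  assumes nz: "x \<noteq> 0" "t \<noteq> 0" "x^2 \<noteq> 1" "t^2*x^2 \<noteq> 1" "x^2 \<noteq> t^2"
  defines "P \<equiv> \<lambda>x. 1 - e1 * x + e2 * x^2 - e3 * x^3 + e4 * x^4"
  defines "b \<equiv> \<lambda>x. inverse (x^2) * P (x / t)"
    and "A \<equiv> \<lambda>x. P x / ((1 - x^2) * (1 - t^2 * x^2))"
  shows "t * (- (b (1/(t*x)) / ((x - 1/x) * (t*x - 1/(t*x))))
     - (b (x/t) / ((x - 1/x) * (x/t - t/x)))) = e4/t^2 + 1 - t^2 - e4/t^4 - (A x + A (1/x))"
proof -
  have nz': "1 - x^2 \<noteq> 0" "1 - t^2*x^2 \<noteq> 0" "x^2 - t^2 \<noteq> 0" "x^2 - 1 \<noteq> 0" using nz by auto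
  define E1 where "E1 = (1 - x^2) * (1 - t^2 * x^2)"
  define E2 where "E2 = (x^2 - 1) * (x^2 - t^2)"
  have E: "E1 \<noteq> 0" "E2 \<noteq> 0" using nz by (auto simp: E1_def E2_def)
  have L1: "t * (b (1/(t*x)) / ((x - 1/x) * (t*x - 1/(t*x)))) =
     (t^4 * (x^4 * P (1/(t^2*x))) * t^2) / (t^2 * ((1 - x^2) * (1 - t^2*x^2)))"
    unfolding b_def denoms(1)[OF nz(1,2)] E1_def [symmetric] using nz E
    by (simp add: field_simps power2_eq_square power4_eq_xxxx)
  have L2: "t * (b (x/t) / ((x - 1/x) * (x/t - t/x))) =
     (t^4 * P (x/t^2) * t^2) / (t^2 * ((x^2 - 1) * (x^2 - t^2)))"
    unfolding b_def denoms(2)[OF nz(1,2)] E2_def [symmetric] using nz E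
    by (simp add: field_simps power2_eq_square power4_eq_xxxx)
  have L3: "A (1/x) = (x^4 * P (1/x)) / ((x^2 - 1) * (x^2 - t^2))"
    unfolding A_def denoms(3)[OF nz(1,2)] by simp
  have "P x - t^4 * (x^4 * P (1/(t^2*x))) * t^2 / t^2 =
      ((e3/t^2 - e1) * x + (1 - e4/t^4) * (1 + t^2*x^2)) * (1 - t^2*x^2) * 1"
    unfolding P_def using nz by (simp add: field_simps power2_eq_square power3_eq_cube power4_eq_xxxx)
  then have 1: "A x - t * (b (1/(t*x)) / ((x - 1/x) * (t*x - 1/(t*x)))) =
      ((e3/t^2 - e1) * x + (1 - e4/t^4) * (1 + t^2*x^2)) * 1 / (1 - x^2)"
    unfolding L1 unfolding A_def by (intro frac_step[OF _ nz'(2)])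
  have "x^4 * P (1/x) - t^4 * P (x/t^2) * t^2 / t^2 =
      ((e3/t^2 - e1) * x + (1 - e4/t^4) * (x^2 + t^2)) * (x^2 - t^2) * 1"
    unfolding P_def using nz by (simp add: field_simps power2_eq_square power3_eq_cube power4_eq_xxxx)
  then have 2: "A (1/x) - t * (b (x/t) / ((x - 1/x) * (x/t - t/x))) =
      ((e3/t^2 - e1) * x + (1 - e4/t^4) * (x^2 + t^2)) * 1 / (x^2 - 1)"
    unfolding L2 L3 by (intro frac_step[OF _ nz'(3)])
  have "((e3/t^2 - e1) * x + (1 - e4/t^4) * (1 + t^2*x^2)) * 1 / (1 - x^2) +
      ((e3/t^2 - e1) * x + (1 - e4/t^4) * (x^2 + t^2)) * 1 / (x^2 - 1) = (1 - e4/t^4) * (1 - t^2)"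
    by (intro frac_add nz'(1)) (simp add: algebra_simps power2_eq_square add_divide_distrib diff_divide_distrib)
  also have "\<dots> = e4/t^2 + 1 - t^2 - e4/t^4"
    using nz by (simp add: field_simps power2_eq_square power4_eq_xxxx)
  finally have "- (t * (b (1/(t*x)) / ((x - 1/x) * (t*x - 1/(t*x)))))
     - (t * (b (x/t) / ((x - 1/x) * (x/t - t/x)))) = e4/t^2 + 1 - t^2 - e4/t^4 - (A x + A (1/x))"
    by (rule combine_terms[OF 1 2])
  then show ?thesis by (simp add: right_diff_distrib)
qed

text \<open>With t = q^(1/2) this is the coefficient function of \<open>Gq_plus\<close>, of minus
  \<open>Eq\<close>, and of q^(1/2) times \<open>Gq_minus\<close> for I with zero, two and four
  elements. This uniform normalisation allows one formula for the factorisation.\<close>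

definition cAf :: "'a::field \<Rightarrow> (nat \<Rightarrow> 'a) \<Rightarrow> nat set \<Rightarrow> 'a \<Rightarrow> 'a" where
  "cAf t u I x = inverse (x ^ (card I div 2)) * (\<Prod>i\<in>I. 1 - u i / t * x)"

text \<open>The coefficient function of T^2 in the classical Askey-Wilson operator, with q =
  t^2.\<close>

definition Af :: "'a::field \<Rightarrow> (nat \<Rightarrow> 'a) \<Rightarrow> 'a \<Rightarrow> 'a" where
  "Af t u x = (\<Prod>i<4. 1 - u i * x) / ((1 - x^2) * (1 - t^2 * x^2))"

definition even_sets :: "nat set set" where
  "even_sets = {I. I \<subseteq> {..<4} \<and> even (card I)}"

lemma even_sets_compl: "I \<in> even_sets \<Longrightarrow> {..<4} - I \<in> even_sets"
  by (auto simp: even_sets_def card_Diff_subset finite_subset)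

lemma even_sets_cases:
  assumes "I \<in> even_sets"
  obtains "I = {}" | i j k l where "I = {i, j}" "{..<4} - I = {k, l}" "i \<noteq> j" "k \<noteq> l" "{..<4} = {i, j, k, l}"
      "i \<noteq> k" "i \<noteq> l" "j \<noteq> k" "j \<noteq> l"
    | "I = {..<4}"
proof -
  have fin: "finite I" "card I \<le> 4" using assms card_mono[of "{..<4::nat}" I]
    by (auto simp: even_sets_def intro: finite_subset)
  moreover have "even (card I)" using assms by (simp add: even_sets_def)
  ultimately have "card I = 0 \<or> card I = 2 \<or> card I = 4" by presburger
  then consider "card I = 0" | "card I = 2" | "card I = 4" by (elim disjE)
  then show thesis
  proof cases
    case 1
    then show ?thesis using that fin by simp
  next
    case 2
    then obtain i j where ij: "I = {i, j}" "i \<noteq> j" by (auto simp: card_2_iff)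
    have "card ({..<4} - I) = 2" using 2 assms fin by (simp add: even_sets_def card_Diff_subset)
    then obtain k l where kl: "{..<4} - I = {k, l}" "k \<noteq> l" by (auto simp: card_2_iff)
    have "I \<subseteq> {..<4}" using assms by (simp add: even_sets_def)
    then have "{..<4} = {i, j, k, l}" using kl(1) unfolding ij(1) by blast
    then show ?thesis using that(2)[OF ij(1) kl(1) ij(2) kl(2)] kl(1) unfolding ij(1) by blast
  next
    case 3
    then have "I = {..<4}" using assms fin card_subset_eq[of "{..<4::nat}" I] by (simp add: even_sets_def)
    then show ?thesis using that by simp
  qed
qed

lemma prod_4: "(\<Prod>i<4::nat. f i) = f 0 * f 1 * f 2 * (f 3 :: 'a::comm_monoid_mult)"
  by (simp add: less_4 mult.assoc)

text \<open>The coefficient of T^2 in the product. Outside I the shifted parameter cancels the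
  division by t, inside I the dilation x -> tx does, and the two partial products combine to the
  full numerator of A.\<close>

lemma cAf_coeff_2:
  fixes x t :: "'a::field" and u :: "nat \<Rightarrow> 'a"
  assumes I: "I \<in> even_sets" and nz: "x \<noteq> 0" "t \<noteq> 0"
  defines "u' \<equiv> \<lambda>i. if i \<in> I then u i / t else u i * t"
  shows "t ^ (card I div 2) / t * (cAf t u' ({..<4} - I) x * cAf t u I (t * x) /
     ((x - 1/x) * (t * x - 1/(t*x)))) = Af t u x"
proof -
  have fin: "finite I" "I \<subseteq> {..<4}" using I by (auto simp: even_sets_def intro: finite_subset)
  have c: "card I div 2 + card ({..<4} - I) div 2 = 2"
    using I by (cases rule: even_sets_cases) auto
  have p1: "(\<Prod>i\<in>{..<4} - I. 1 - u' i / t * x) = (\<Prod>i\<in>{..<4} - I. 1 - u i * x)"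
    by (rule prod.cong) (use nz in \<open>auto simp: u'_def\<close>)
  have p2: "(\<Prod>i\<in>I. 1 - u i / t * (t * x)) = (\<Prod>i\<in>I. 1 - u i * x)"
    by (rule prod.cong) (use nz in auto)
  have "(\<Prod>i\<in>{..<4} - I. 1 - u i * x) * (\<Prod>i\<in>I. 1 - u i * x) = (\<Prod>i<4. 1 - u i * x)"
    using fin by (intro prod.subset_diff [symmetric]) auto
  moreover have "x ^ (card ({..<4} - I) div 2) * x ^ (card I div 2) = x ^ 2"
    using c by (simp flip: power_add) (metis add.commute)
  ultimately have e: "cAf t u' ({..<4} - I) x * cAf t u I (t * x) =
      (\<Prod>i<4. 1 - u i * x) / (x^2 * t ^ (card I div 2))"
    unfolding cAf_def p1 p2 power_mult_distrib by (simp add: field_simps)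
  have simp: "c / t * (N / (x^2 * c) / (E / (t * x^2))) = N / E" if "c \<noteq> 0" for c N E :: 'a
    using that nz by simp
  show ?thesis
    unfolding e denoms(1)[OF nz] Af_def by (rule simp) (use nz in simp)
qed

text \<open>\<open>fact2\<close>, \<open>fact0\<close> and \<open>fact4\<close> in one formula. The
  part independent of x is what becomes the eigenvalue in the factorisation.\<close>

lemma cAf_coeff_0:
  fixes x t :: "'a::field" and u :: "nat \<Rightarrow> 'a"
  assumes I: "I \<in> even_sets"
    and nz: "x \<noteq> 0" "t \<noteq> 0" "x^2 \<noteq> 1" "t^2*x^2 \<noteq> 1" "x^2 \<noteq> t^2"
  defines "u' \<equiv> \<lambda>i. if i \<in> I then u i / t else u i * t"
  defines "a \<equiv> cAf t u' ({..<4} - I)" and "b \<equiv> cAf t u I"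
  shows "t ^ (card I div 2) / t * (- (a x * b (1/(t*x)) / ((x - 1/x) * (t*x - 1/(t*x))))
     - (a (1/x) * b (x/t) / ((x - 1/x) * (x/t - t/x)))) =
     1 + (\<Prod>i<4. u i) / t^2 - (\<Prod>i\<in>{..<4} - I. u i) * t ^ card I / t^2 - (\<Prod>i\<in>I. u i) / t ^ card I
     - (Af t u x + Af t u (1/x))"
  using I
proof (cases rule: even_sets_cases)
  case (2 i j k l)
  have a: "a x = inverse x * (1 - (u k + u l) * x + u k * u l * x^2)" for x
    unfolding a_def cAf_def 2(2) using 2 nz by (auto simp: u'_def algebra_simps power2_eq_square)
  have b: "b x = inverse x * (1 - (u i + u j) / t * x + u i * u j / t^2 * x^2)" for x
    unfolding b_def cAf_def 2(1) using 2(3) nz(1,2) by (simp add: algebra_simps power2_eq_square add_divide_distrib)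
  have A: "Af t u x = (1 - (u i + u j) * x + u i * u j * x^2) * (1 - (u k + u l) * x + u k * u l * x^2)
      / ((1 - x^2) * (1 - t^2 * x^2))" for x
    unfolding Af_def 2(5) using 2 by (simp add: algebra_simps power2_eq_square)
  have C: "card I = 2" using 2 by simp
  have U: "(\<Prod>i<4. u i) = u i * u j * (u k * u l)" unfolding 2(5) using 2 by simp
  have U': "(\<Prod>i\<in>{..<4} - I. u i) = u k * u l" "(\<Prod>i\<in>I. u i) = u i * u j"
    unfolding 2(2) using 2(1,3,4) by simp_all
  show ?thesis
    unfolding a b A C U U' using fact2[OF nz, of "u k + u l" "u k * u l" "u i + u j" "u i * u j"] nz(2)
    by (simp add: algebra_simps)
next
  case 1
  let ?e1 = "u 0 + u 1 + u 2 + u 3" and ?e2 = "u 0 * u 1 + u 0 * u 2 + u 0 * u 3 + u 1 * u 2 + u 1 * u 3 + u 2 * u 3"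
  let ?e3 = "u 0 * u 1 * u 2 + u 0 * u 1 * u 3 + u 0 * u 2 * u 3 + u 1 * u 2 * u 3" and ?e4 = "u 0 * u 1 * u 2 * u 3"
  have P: "(\<Prod>i<4. 1 - u i * x) = 1 - ?e1 * x + ?e2 * x^2 - ?e3 * x^3 + ?e4 * x^4" for x
    by (simp add: prod_4 algebra_simps power2_eq_square power3_eq_cube power4_eq_xxxx)
  have "a x = inverse (x^2) * (\<Prod>i<4. 1 - u i * x)" for x
    unfolding a_def cAf_def 1 using nz by (simp add: u'_def 1)
  moreover have "b x = 1" for x by (simp add: b_def cAf_def 1)
  ultimately show ?thesis
    using fact0[OF nz, of ?e1 ?e2 ?e3 ?e4] unfolding P[symmetric] Af_def 1 by (simp add: field_simps)
next
  case 3
  let ?e1 = "u 0 + u 1 + u 2 + u 3" and ?e2 = "u 0 * u 1 + u 0 * u 2 + u 0 * u 3 + u 1 * u 2 + u 1 * u 3 + u 2 * u 3"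
  let ?e3 = "u 0 * u 1 * u 2 + u 0 * u 1 * u 3 + u 0 * u 2 * u 3 + u 1 * u 2 * u 3" and ?e4 = "u 0 * u 1 * u 2 * u 3"
  have P: "1 - ?e1 * x + ?e2 * x^2 - ?e3 * x^3 + ?e4 * x^4 = (\<Prod>i<4. 1 - u i * x)" for x
    by (simp add: prod_4 algebra_simps power2_eq_square power3_eq_cube power4_eq_xxxx)
  have a: "a x = 1" for x by (simp add: a_def cAf_def 3)
  have b: "b x = inverse (x^2) * (\<Prod>i<4. 1 - u i * (x / t))" for x
    by (simp add: b_def cAf_def 3)
  have t: "t ^ (card I div 2) / t = t" using nz by (simp add: 3 power2_eq_square)
  have U: "(\<Prod>i<4. u i) = ?e4" by (simp add: prod_4)
  show ?thesis
    using fact4[OF nz, of ?e1 ?e2 ?e3 ?e4] nz(2) unfolding P a b t U Af_def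
    by (simp add: 3 U power2_eq_square power4_eq_xxxx)
qed

abbreviation tt :: kk where "tt \<equiv> qpow (1/2)"

lemma tt_square: "tt ^ 2 = qpow 1"
  by (simp add: qpow_power)

lemma qpow_half_minus: "qpow (-1/2) = inverse tt"
  using qpow_minus[of "1/2"] by simp

lemma zz_power_neq: "n \<noteq> 0 \<Longrightarrow> zz ^ n \<noteq> scal c"
proof
  assume "n \<noteq> 0" "zz ^ n = scal c"
  then have "of_lpoly (lmon 1 (int n)) = of_lpoly (lmon c 0)"
    by (simp add: of_lpoly_lmon scal.one)
  then have "Poly_Mapping.lookup (lmon 1 (int n)) (int n) = Poly_Mapping.lookup (lmon c 0) (int n)"
    by (simp add: of_lpoly_eq)
  then show False using \<open>n \<noteq> 0\<close> by (simp add: lmon_def lookup_single when_def)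
qed

lemma zz_neqs: "zz ^ 2 \<noteq> 1" "scal tt ^ 2 * zz ^ 2 \<noteq> 1" "zz ^ 2 \<noteq> scal tt ^ 2"
proof -
  show "zz ^ 2 \<noteq> 1" "zz ^ 2 \<noteq> scal tt ^ 2"
    using zz_power_neq[of 2 1] zz_power_neq[of 2 "tt ^ 2"] by (simp_all add: scal.simps)
  show "scal tt ^ 2 * zz ^ 2 \<noteq> 1"
  proof
    assume "scal tt ^ 2 * zz ^ 2 = 1"
    then have "zz ^ 2 = scal (inverse (tt ^ 2))"
      using inverse_unique[of "scal tt ^ 2" "zz ^ 2"] by (simp add: scal.simps)
    then show False using zz_power_neq[of 2 "inverse (tt ^ 2)"] by simp
  qed
qed

lemma zz_minus_inverse_nz: "zz - inverse zz \<noteq> 0" "zz - 1 / zz \<noteq> 0"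
  using zz_neqs(1) by (auto simp: field_simps power2_eq_square)

lemma field_emb_cAf: "field_emb \<phi> \<Longrightarrow> \<phi> (cAf t u I x) = cAf (\<phi> t) (\<lambda>i. \<phi> (u i)) I (\<phi> x)"
  by (simp add: cAf_def field_emb.simps)

lemma field_emb_Af: "field_emb \<phi> \<Longrightarrow> \<phi> (Af t u x) = Af (\<phi> t) (\<lambda>i. \<phi> (u i)) (\<phi> x)"
  by (simp add: Af_def field_emb.simps)

lemma cAf_cong: "(\<And>i. i \<in> I \<Longrightarrow> u i = u' i) \<Longrightarrow> cAf t u I x = cAf t u' I x"
  by (simp add: cAf_def)

lemma Af_cong: "(\<And>i. i < 4 \<Longrightarrow> u i = u' i) \<Longrightarrow> Af t u x = Af t u' x"
  by (simp add: Af_def)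

section \<open>The operators and the data attached to an even set of parameters\<close>

definition cA :: "rat4 \<Rightarrow> nat set \<Rightarrow> kz \<Rightarrow> kz" where
  "cA h = cAf (scal tt) (\<lambda>i. scal (upar h i))"

definition Acoef :: "rat4 \<Rightarrow> kz \<Rightarrow> kz" where
  "Acoef h = Af (scal tt) (\<lambda>i. scal (upar h i))"

definition opE :: "rat4 \<Rightarrow> nat set \<Rightarrow> diff_op" where
  "opE h I = two_term_op (cA h I)"

text \<open>The Askey-Wilson operator, see \<open>opD_apply\<close>. The division by
  \<open>gam\<close> and the added constant give eigenvalues of the form x + 1/x, and with this
  normalisation the elementary operators intertwine it without extra scalars.\<close>

definition opD :: "rat4 \<Rightarrow> diff_op" where
  "opD h = Poly_Mapping.single 2 (scal (1 / gam h) * Acoef h zz) +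
     Poly_Mapping.single (-2) (scal (1 / gam h) * Acoef h (1 / zz)) +
     Poly_Mapping.single 0 (scal (gam h + 1 / gam h) - scal (1 / gam h) * (Acoef h zz + Acoef h (1 / zz)))"

text \<open>The shift of the elementary operator of I; for even I these are the vectors v_1, ...,
  v_4 and their negatives.\<close>

definition vsh :: "nat set \<Rightarrow> rat4" where
  "vsh I = (let s = (\<lambda>i. if i \<in> I then -1/2 else 1/2) in (s 0, s 1, s 2, s 3))"

lemma hc_vsh: "i < 4 \<Longrightarrow> hc (vsh I) i = (if i \<in> I then -1/2 else 1/2)"
  by (erule less_4_cases) (simp_all add: hc_def vsh_def Let_def)

lemma vsh_compl: "vsh ({..<4} - I) = - vsh I"
proof (rule hc_eqI)
  fix i :: nat
  assume i: "i < 4"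
  show "hc (vsh ({..<4} - I)) i = hc (- vsh I) i"
    unfolding hc_uminus[OF i] hc_vsh[OF i] using i by auto
qed

lemma upar_vsh:
  assumes "i < 4"
  shows "upar (h + vsh I) i = (if i \<in> I then upar h i / tt else upar h i * tt)"
proof -
  have "upar (h + vsh I) i = upar h i * qpow (if i \<in> I then -1/2 else 1/2)"
    unfolding upar_def hc_add[OF assms] hc_vsh[OF assms] qpow_add by (simp only: mult.assoc)
  then show ?thesis by (cases "i \<in> I") (simp_all only: if_True if_False qpow_half_minus field_class.field_divide_inverse[of "upar h i"])
qed

lemma sum_hc_vsh:
  assumes "I \<in> even_sets"
  shows "hc (vsh I) 0 + hc (vsh I) 1 + hc (vsh I) 2 + hc (vsh I) 3 = 2 - of_nat (card I)"
  using assms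
proof (cases rule: even_sets_cases)
  case (2 i j k l)
  have "(\<Sum>i<4. hc (vsh I) i) = hc (vsh I) i + hc (vsh I) j + hc (vsh I) k + hc (vsh I) l"
    unfolding 2(5) using 2 by simp
  moreover have "i < 4" "j < 4" "k < 4" "l < 4" using 2(5) by auto
  moreover have "i \<in> I" "j \<in> I" "k \<notin> I" "l \<notin> I" using 2 by auto
  ultimately have "(\<Sum>i<4. hc (vsh I) i) = 0" by (simp add: hc_vsh)
  then show ?thesis using 2(1,3) by (simp add: less_4 add.assoc)
qed (simp_all add: hc_vsh)

text \<open>What \<open>gam\<close> becomes when u_i is replaced by q/u_i for all i in I.
  Accordingly \<open>lam\<close> is the eigenvalue of the constants for the Askey-Wilson operator
  with these parameters.\<close>

definition rho :: "rat4 \<Rightarrow> nat set \<Rightarrow> kk" where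
  "rho h I = qpow (of_nat (card I) / 2) * gam h / (\<Prod>i\<in>I. upar h i)"

definition lam :: "rat4 \<Rightarrow> nat set \<Rightarrow> kk" where
  "lam h I = rho h I + 1 / rho h I"

definition nu :: "rat4 \<Rightarrow> nat set \<Rightarrow> kk" where
  "nu h I = qpow (of_nat (card I) / 4 - 1/2) / gam h"

lemma gam_vsh:
  assumes "I \<in> even_sets"
  shows "gam (h + vsh I) = gam h * qpow (1 - of_nat (card I) / 2)"
proof -
  have "hc (h + vsh I) 0 + hc (h + vsh I) 1 + hc (h + vsh I) 2 + hc (h + vsh I) 3 =
      (hc h 0 + hc h 1 + hc h 2 + hc h 3) + (2 - of_nat (card I))"
    using sum_hc_vsh[OF assms] by (simp add: hc_add)
  then have "(hc (h + vsh I) 0 + hc (h + vsh I) 1 + hc (h + vsh I) 2 + hc (h + vsh I) 3 - 1) / 2 =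
      (hc h 0 + hc h 1 + hc h 2 + hc h 3 - 1) / 2 + (1 - of_nat (card I) / 2)"
    by (simp add: field_simps)
  then show ?thesis by (simp only: gam_def qpow_add mult.assoc)
qed

lemma even_sets_subset: "I \<in> even_sets \<Longrightarrow> i \<in> I \<Longrightarrow> i < 4"
  by (auto simp: even_sets_def)

lemma prod_upar_nz: "I \<in> even_sets \<Longrightarrow> (\<Prod>i\<in>I. upar h i) \<noteq> 0"
  using even_sets_subset by (auto simp: prod_zero_iff even_sets_def finite_subset)

lemma card_compl: "I \<in> even_sets \<Longrightarrow> card ({..<4} - I) = 4 - card I" "I \<in> even_sets \<Longrightarrow> card I \<le> 4"
  using card_mono[of "{..<4::nat}" I] by (auto simp: even_sets_def card_Diff_subset finite_subset)

lemma prod_upar_split: "I \<in> even_sets \<Longrightarrow>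
    (\<Prod>i\<in>{..<4} - I. upar h i) * (\<Prod>i\<in>I. upar h i) = gam h ^ 2 * qpow 1"
  using prod.subset_diff[of I "{..<4}" "upar h"] by (simp add: even_sets_def gam_square prod_4)

lemma rho_nz [simp]: "I \<in> even_sets \<Longrightarrow> rho h I \<noteq> 0"
  by (simp add: rho_def prod_upar_nz)

text \<open>Passing to the complement at the shifted parameters inverts \<open>rho\<close>. With
  \<open>nu_compl\<close> this makes the two factorisations used in \<open>opE_opD\<close> have the
  same constants.\<close>

lemma lam_compl:
  assumes I: "I \<in> even_sets"
  shows "lam (h + vsh I) ({..<4} - I) = lam h I"
proof -
  have "(\<Prod>i\<in>{..<4} - I. upar (h + vsh I) i) = (\<Prod>i\<in>{..<4} - I. upar h i * tt)"
    by (rule prod.cong) (auto simp: upar_vsh)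
  also have "\<dots> = (\<Prod>i\<in>{..<4} - I. upar h i) * qpow (2 - of_nat (card I) / 2)"
    using card_compl[OF I] by (simp add: prod.distrib qpow_power of_nat_diff diff_divide_distrib)
  finally have P: "(\<Prod>i\<in>{..<4} - I. upar (h + vsh I) i) =
      (\<Prod>i\<in>{..<4} - I. upar h i) * qpow (2 - of_nat (card I) / 2)" .
  have C: "of_nat (card ({..<4} - I)) / 2 = (2 - of_nat (card I) / 2 :: rat)"
    using card_compl[OF I] by (simp add: of_nat_diff diff_divide_distrib)
  have "rho (h + vsh I) ({..<4} - I) = gam h * qpow (1 - of_nat (card I) / 2) / (\<Prod>i\<in>{..<4} - I. upar h i)"
    unfolding rho_def C P gam_vsh[OF I] by simp
  also have "\<dots> = (gam h * qpow (1 - of_nat (card I) / 2)) * (\<Prod>i\<in>I. upar h i) /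
      ((\<Prod>i\<in>{..<4} - I. upar h i) * (\<Prod>i\<in>I. upar h i))"
    using prod_upar_nz[OF I] by simp
  also have "\<dots> = 1 / rho h I"
    unfolding prod_upar_split[OF I] rho_def qpow_diff
    by (simp add: field_simps power2_eq_square)
  finally show ?thesis by (simp add: lam_def)
qed

lemma nu_compl:
  assumes I: "I \<in> even_sets"
  shows "nu (h + vsh I) ({..<4} - I) = nu h I"
proof -
  have "of_nat (card ({..<4} - I)) / 4 - 1/2 = (of_nat (card I) / 4 - 1/2) + (1 - of_nat (card I) / 2 :: rat)"
    using card_compl[OF I] by (simp add: of_nat_diff field_simps)
  then have "qpow (of_nat (card ({..<4} - I)) / 4 - 1/2) =
     qpow (of_nat (card I) / 4 - 1/2) * qpow (1 - of_nat (card I) / 2)"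
    by (simp only: qpow_add)
  then show ?thesis
    unfolding nu_def gam_vsh[OF I] by simp
qed

lemma nu_nz [simp]: "nu h I \<noteq> 0"
  by (simp add: nu_def)

lemma opE_apply: "op_apply (opE h I) f =
    (cA h I zz * T_pow 1 f - cA h I (1 / zz) * T_pow (-1) f) / (zz - 1 / zz)"
  by (simp add: opE_def two_term_op_def op_apply_diff_op op_apply_single diff_divide_distrib inverse_eq_divide)

lemma opD_apply: "op_apply (opD h) f = scal (1 / gam h) * (Acoef h zz * (T_pow 2 f - f) +
    Acoef h (1 / zz) * (T_pow (-2) f - f)) + scal (gam h + 1 / gam h) * f"
  by (simp add: opD_def op_apply_add_op op_apply_single algebra_simps)

lemma T_cA: "T_pow n (cA h I x) = cA h I (T_pow n x)"
  by (simp add: cA_def field_emb_cAf[OF T_pow_emb])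

lemma zinv_cA: "zinv (cA h I x) = cA h I (zinv x)"
  by (simp add: cA_def field_emb_cAf[OF zinv_emb])

lemma rs_cA: "I \<in> even_sets \<Longrightarrow> ratfun_shift h (cA h' I x) = cA (h + h') I (ratfun_shift h x)"
  unfolding cA_def field_emb_cAf[OF ratfun_shift_emb]
  by (simp, rule cAf_cong) (simp add: par_shift_upar even_sets_subset)

lemma T_Acoef: "T_pow n (Acoef h x) = Acoef h (T_pow n x)"
  by (simp add: Acoef_def field_emb_Af[OF T_pow_emb])

lemma zinv_Acoef: "zinv (Acoef h x) = Acoef h (zinv x)"
  by (simp add: Acoef_def field_emb_Af[OF zinv_emb])

lemma rs_Acoef: "ratfun_shift h (Acoef h' x) = Acoef (h + h') (ratfun_shift h x)"
  unfolding Acoef_def field_emb_Af[OF ratfun_shift_emb]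
  by (simp, rule Af_cong) (simp add: par_shift_upar)

lemma T_1_zz: "T_pow 1 zz = scal tt * zz" "T_pow (-1) zz = zz / scal tt"
  "T_pow 2 zz = scal (qpow 1) * zz" "T_pow (-2) zz = zz / scal (qpow 1)"
  unfolding T_pow_zz using qpow_minus[of "1/2"] qpow_minus[of 1]
  by (simp_all add: scal.inverse field_class.field_divide_inverse[of zz] mult.commute)

section \<open>Factorisation and intertwining\<close>

text \<open>Comparison of the coefficients of T^2, T^(-2) and T^0. The first two come from
  \<open>cAf_coeff_2\<close>; the third agrees with that of D up to a constant, by
  \<open>cAf_coeff_0\<close>, and the constant is evaluated with gam^2 q = abcd.\<close>

lemma opE_fact:
  assumes I: "I \<in> even_sets"
  shows "scal (nu h I) * op_apply (opE (h + vsh I) ({..<4} - I)) (op_apply (opE h I) f) =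
    op_apply (opD h) f - scal (lam h I) * f"
proof -
  define a where "a = cA (h + vsh I) ({..<4} - I)"
  define b where "b = cA h I"
  let ?t = "scal tt"
  let ?u = "\<lambda>i. scal (upar h i)"
  have t: "?t \<noteq> 0" by (simp add: scal.simps)
  define u' where "u' = (\<lambda>i. if i \<in> I then ?u i / ?t else ?u i * ?t)"
  have a: "a x = cAf ?t u' ({..<4} - I) x" for x
    unfolding a_def cA_def by (rule cAf_cong) (auto simp: upar_vsh u'_def scal.simps)
  have b: "b x = cAf ?t ?u I x" for x
    by (simp add: b_def cA_def)
  define n where "n = ?t ^ (card I div 2) / ?t"
  have gn: "scal (nu h I) = scal (1 / gam h) * n"
  proof -
    have "even (card I)" using I by (simp add: even_sets_def)
    then have "qpow (of_nat (card I) / 4) = tt ^ (card I div 2)"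
      by (auto simp: qpow_power elim!: evenE)
    then have "nu h I = 1 / gam h * (tt ^ (card I div 2) / tt)"
      by (simp add: nu_def qpow_diff)
    then show ?thesis by (simp add: n_def scal.simps)
  qed
  let ?d = "zz - 1 / zz"
  let ?d1 = "?t * zz - 1 / (?t * zz)" and ?d2 = "zz / ?t - ?t / zz"
  have C2: "n * (a zz * b (?t * zz) / (?d * ?d1)) = Acoef h zz"
    unfolding n_def a b Acoef_def u'_def by (rule cAf_coeff_2[OF I]) (simp_all add: scal.simps)
  \<comment> \<open>The coefficient of T^(-2) is that of T^2 at 1/z; both differences in the
    denominator change sign.\<close>
  have C2': "n * (a (1 / zz) * b (?t / zz) / (?d * ?d2)) = Acoef h (1 / zz)"
  proof -
    have "n * (a (1/zz) * b (?t * (1/zz)) / ((1/zz - 1/(1/zz)) * (?t * (1/zz) - 1 / (?t * (1/zz))))) = Acoef h (1/zz)"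
      unfolding n_def a b Acoef_def u'_def by (rule cAf_coeff_2[OF I]) (simp_all add: scal.simps)
    moreover have "1/zz - 1/(1/zz) = - ?d" "?t * (1/zz) - 1 / (?t * (1/zz)) = - ?d2" "?t * (1 / zz) = ?t / zz"
      by simp_all
    ultimately show ?thesis by (simp only: minus_mult_minus)
  qed
  have C0: "n * (- (a zz * b (1 / (?t * zz)) / (?d * ?d1)) - (a (1 / zz) * b (zz / ?t) / (?d * ?d2))) =
     1 + (\<Prod>i<4. ?u i) / ?t^2 - (\<Prod>i\<in>{..<4} - I. ?u i) * ?t ^ card I / ?t^2 - (\<Prod>i\<in>I. ?u i) / ?t ^ card I
     - (Acoef h zz + Acoef h (1 / zz))"
    unfolding n_def a b Acoef_def u'_def by (rule cAf_coeff_0[OF I zz_nz t zz_neqs])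
  have K: "1 / gam h * (1 + (\<Prod>i<4. upar h i) / tt^2 - (\<Prod>i\<in>{..<4} - I. upar h i) * tt ^ card I / tt^2 -
     (\<Prod>i\<in>I. upar h i) / tt ^ card I) = gam h + 1 / gam h - lam h I"
  proof -
    have r: "qpow (of_nat (card I) / 2) = tt ^ card I" by (simp add: qpow_power)
    have U: "(\<Prod>i<4. upar h i) = gam h ^ 2 * qpow 1" by (simp add: prod_4 gam_square)
    have U': "(\<Prod>i\<in>{..<4} - I. upar h i) = gam h ^ 2 * qpow 1 / (\<Prod>i\<in>I. upar h i)"
      using prod_upar_split[OF I, of h] prod_upar_nz[OF I] by (simp add: field_simps)
    show ?thesis
      unfolding lam_def rho_def r U U' tt_square using prod_upar_nz[OF I]
      by (simp add: field_simps power2_eq_square)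
  qed
  have K': "scal (1 / gam h) * (1 + (\<Prod>i<4. ?u i) / ?t^2 - (\<Prod>i\<in>{..<4} - I. ?u i) * ?t ^ card I / ?t^2 - (\<Prod>i\<in>I. ?u i) / ?t ^ card I)
     = scal (gam h + 1 / gam h - lam h I)"
    unfolding K[symmetric] by (simp add: scal.simps)
  have E: "op_apply (opE (h + vsh I) ({..<4} - I)) (op_apply (opE h I) f) =
     a zz * b (?t * zz) / (?d * ?d1) * T_pow 2 f + a (1 / zz) * b (?t / zz) / (?d * ?d2) * T_pow (-2) f +
     (- (a zz * b (1 / (?t * zz)) / (?d * ?d1)) - (a (1 / zz) * b (zz / ?t) / (?d * ?d2))) * f"
    unfolding opE_apply a_def[symmetric] b_def[symmetric]
    by (simp add: T.simps T_pow_T_pow T_1_zz T_cA[folded b_def] b_def T_cA add_divide_distrib diff_divide_distrib algebra_simps)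
  have "scal (nu h I) * op_apply (opE (h + vsh I) ({..<4} - I)) (op_apply (opE h I) f) =
     scal (1 / gam h) * (n * (a zz * b (?t * zz) / (?d * ?d1)) * T_pow 2 f +
       n * (a (1 / zz) * b (?t / zz) / (?d * ?d2)) * T_pow (-2) f +
     n * (- (a zz * b (1 / (?t * zz)) / (?d * ?d1)) - (a (1 / zz) * b (zz / ?t) / (?d * ?d2))) * f)"
    unfolding E gn by (simp only: distrib_left mult.assoc)
  also have "\<dots> = op_apply (opD h) f - scal (lam h I) * f"
  proof -
    have "scal (1 / gam h) * (X * F2 + Y * F0 + (c - (X + Y)) * F) =
       (scal (1 / gam h) * (X * (F2 - F) + Y * (F0 - F)) + scal g * F) - scal l * F"
      if "scal (1 / gam h) * c = scal (g - l)" for X Y F2 F0 F c g l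
    proof -
      have "scal (1 / gam h) * ((c - (X + Y)) * F) = (scal (1 / gam h) * c) * F - scal (1 / gam h) * ((X + Y) * F)"
        by (simp only: left_diff_distrib right_diff_distrib mult.assoc)
      then show ?thesis unfolding that by (simp add: scal.diff algebra_simps)
    qed
    from this[OF K'] show ?thesis unfolding C2 C2' C0 opD_apply .
  qed
  finally show ?thesis .
qed

text \<open>With E for the elementary operator and F for its partner with the complementary set, D_h
  = nu F E + lam and D_(h+v) = nu E F + lam with the same scalars. Both sides are therefore nu E F E
  + lam E.\<close>

lemma opE_opD:
  assumes I: "I \<in> even_sets"
  shows "op_comp (opE h I) (opD h) = op_comp (opD (h + vsh I)) (opE h I)"
proof (rule op_eqI)
  fix f
  let ?J = "{..<4} - I"
  have J: "?J \<in> even_sets" "{..<4} - ?J = I" "h + vsh I + vsh ?J = h"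
    using I even_sets_compl by (auto simp: vsh_compl even_sets_def)
  have 1: "op_apply (opD h) f = scal (nu h I) * op_apply (opE (h + vsh I) ?J) (op_apply (opE h I) f) + scal (lam h I) * f"
    by (simp add: opE_fact[OF I])
  have 2: "op_apply (opD (h + vsh I)) g =
     scal (nu h I) * op_apply (opE h I) (op_apply (opE (h + vsh I) ?J) g) + scal (lam h I) * g" for g
    using opE_fact[OF J(1), of "h + vsh I" g] unfolding J(2,3) by (simp add: nu_compl I lam_compl)
  show "op_apply (op_comp (opE h I) (opD h)) f = op_apply (op_comp (opD (h + vsh I)) (opE h I)) f"
    unfolding op_apply_comp 1 2 op_apply_add op_apply_scal ..
qed

lemma op_shift_opE:
  assumes "I \<in> even_sets"
  shows "op_shift h (opE h' I) = opE (h + h') I"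
  by (rule op_eqI)
    (simp add: op_shift_apply' opE_apply rs.simps rs_cA assms ratfun_shift_T_pow ratfun_shift_comp ratfun_shift_0)

lemma op_shift_opD: "op_shift h (opD h') = opD (h + h')"
  by (rule op_eqI)
    (simp add: op_shift_apply' opD_apply rs.simps rs_Acoef par_shift_gam ps.simps scal.simps
      ratfun_shift_T_pow ratfun_shift_comp ratfun_shift_0)

lemma op_inv_opE: "op_inv (opE h I) = opE h I"
proof (rule op_eqI)
  fix f
  have "op_apply (op_inv (opE h I)) f =
    (cA h I (inverse zz) * T_pow (-1) f - cA h I (inverse (inverse zz)) * T_pow 1 f) / (inverse zz - zz)"
    by (simp add: op_inv_apply' opE_apply zinv.simps zinv_cA zinv_T_pow zinv_zz inverse_eq_divide)
  also have "\<dots> = op_apply (opE h I) f"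
    unfolding opE_apply by (simp add: inverse_eq_divide flip: minus_divide_divide[of _ "1 / zz - zz"])
  finally show "op_apply (op_inv (opE h I)) f = op_apply (opE h I) f" .
qed

lemma op_inv_opD: "op_inv (opD h) = opD h"
  by (rule op_eqI)
    (simp add: op_inv_apply' opD_apply zinv.simps zinv_Acoef zinv_T_pow zinv_zz algebra_simps inverse_eq_divide)

subsection \<open>Laurent polynomials in \<open>K(z)\<close>\<close>

definition LZ :: "kz set" where "LZ = of_lpoly ` laurent_K"

definition SZ :: "kz set" where "SZ = of_lpoly ` sym_laurent_K"

lemma LZ_intros:
  "x \<in> LZ \<Longrightarrow> y \<in> LZ \<Longrightarrow> x + y \<in> LZ" "x \<in> LZ \<Longrightarrow> y \<in> LZ \<Longrightarrow> x * y \<in> LZ"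
  "x \<in> LZ \<Longrightarrow> y \<in> LZ \<Longrightarrow> x - y \<in> LZ" "1 \<in> LZ"
  unfolding LZ_def by (auto simp: of_lpoly_add [symmetric] of_lpoly_mult [symmetric]
      of_lpoly_diff [symmetric] of_lpoly_1 [symmetric] LK_intros intro!: imageI)

lemma LZ_scal: "x \<in> KK \<Longrightarrow> scal x \<in> LZ"
  unfolding LZ_def scal_def by (intro imageI lmon_LK)

lemma LZ_zz: "zz powi n \<in> LZ"
proof -
  have "zz powi n = of_lpoly (lmon 1 n)" by (simp add: of_lpoly_lmon scal.one)
  then show ?thesis unfolding LZ_def by (simp add: lmon_LK KK_intros)
qed

lemma LZ_zz': "zz \<in> LZ" "inverse (zz ^ n) \<in> LZ"
  using LZ_zz[of 1] LZ_zz[of "- int n"] by (simp_all add: power_int_minus)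

lemma LZ_prod: "(\<And>i. i \<in> I \<Longrightarrow> f i \<in> LZ) \<Longrightarrow> (\<Prod>i\<in>I. f i) \<in> LZ"
  by (induction I rule: infinite_finite_induct) (simp_all add: LZ_intros)

definition lT :: "int \<Rightarrow> lpoly \<Rightarrow> lpoly" where
  "lT n = push (\<lambda>j. j) (\<lambda>j x. qpow (of_int (n * j) / 2) * x)"

lemma T_of_lpoly: "T_pow n (of_lpoly p) = of_lpoly (lT n p)"
  by (simp add: T_pow_of_lpoly lT_def)

lemma lookup_lT: "Poly_Mapping.lookup (lT n p) j = qpow (of_int (n * j) / 2) * Poly_Mapping.lookup p j"
  unfolding lT_def by (subst lookup_push[of "\<lambda>j. j"]) simp_all

lemma lT_LK: "f \<in> laurent_K \<Longrightarrow> lT n f \<in> laurent_K"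
  by (simp add: laurent_K_def lookup_lT KK_intros qpow_KK)

lemma LZ_T: "x \<in> LZ \<Longrightarrow> T_pow n x \<in> LZ"
  unfolding LZ_def by (auto simp: T_of_lpoly lT_LK)

lemma SZ_intros:
  "x \<in> SZ \<Longrightarrow> y \<in> SZ \<Longrightarrow> x + y \<in> SZ" "x \<in> SZ \<Longrightarrow> y \<in> SZ \<Longrightarrow> x * y \<in> SZ"
  "x \<in> SZ \<Longrightarrow> y \<in> SZ \<Longrightarrow> x - y \<in> SZ" "1 \<in> SZ" "0 \<in> SZ" "x \<in> SZ \<Longrightarrow> - x \<in> SZ"
  unfolding SZ_def by (auto simp: of_lpoly_add [symmetric] of_lpoly_mult [symmetric]
      of_lpoly_diff [symmetric] of_lpoly_1 [symmetric] of_lpoly_0 [symmetric]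
      of_lpoly_uminus [symmetric] sym_K_intros simp del: of_lpoly_0 of_lpoly_eq_0 intro!: imageI)

lemma SZ_scal: "x \<in> KK \<Longrightarrow> scal x \<in> SZ"
  unfolding SZ_def scal_def by (intro imageI const_sym)

lemma SZ_sum: "(\<And>i. i \<in> I \<Longrightarrow> f i \<in> SZ) \<Longrightarrow> (\<Sum>i\<in>I. f i) \<in> SZ"
  by (induction I rule: infinite_finite_induct) (simp_all add: SZ_intros)

lemma SZ_LZ: "x \<in> SZ \<Longrightarrow> x \<in> LZ"
  by (auto simp: SZ_def LZ_def sym_iff_refl)

lemma SZ_zinv: "x \<in> SZ \<Longrightarrow> zinv x = x"
  by (auto simp: SZ_def sym_zinv)

text \<open>The quotients are Chebyshev polynomials of the second kind in z + 1/z, and the induction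
  follows their three-term recurrence.\<close>

lemma antisym_quotient_power: "\<exists>y\<in>SZ. y * (zz - 1 / zz) = zz ^ n - 1 / zz ^ n"
proof (induction n rule: less_induct)
  case (less n)
  have l1: "zz + 1 / zz \<in> SZ"
  proof -
    have "zz + 1 / zz = of_lpoly (lsym 1)"
      by (simp add: lsym_def of_lpoly_add of_lpoly_lmon scal.one power_int_minus inverse_eq_divide)
    then show ?thesis unfolding SZ_def using lsym_sym by simp
  qed
  consider "n = 0" | "n = 1" | m where "n = Suc (Suc m)"
    by (metis One_nat_def not0_implies_Suc)
  then show ?case
  proof cases
    case 1
    then show ?thesis using SZ_intros(5) by force
  next
    case 2
    then show ?thesis using SZ_intros(4) by force
  next
    case 3
    obtain y y' where y: "y \<in> SZ" "y * (zz - 1 / zz) = zz ^ m - 1 / zz ^ m"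
      "y' \<in> SZ" "y' * (zz - 1 / zz) = zz ^ Suc m - 1 / zz ^ Suc m"
      using less[of m] less[of "Suc m"] 3 by auto
    have "((zz + 1 / zz) * y' - y) * (zz - 1 / zz) = (zz + 1 / zz) * (zz ^ Suc m - 1 / zz ^ Suc m) - (zz ^ m - 1 / zz ^ m)"
      by (simp only: left_diff_distrib mult.assoc y)
    also have "\<dots> = zz ^ n - 1 / zz ^ n"
      unfolding 3 by (simp add: field_simps)
    finally show ?thesis using y l1 SZ_intros by blast
  qed
qed

text \<open>By linearity only powers of z matter. This division is what keeps elementary operators
  inside the symmetric Laurent polynomials, and it supplies the symmetric functions in the proofs of
  self-adjointness and nondegeneracy.\<close>

lemma antisym_quotient:
  assumes "x \<in> LZ"
  shows "\<exists>y\<in>SZ. y * (zz - 1 / zz) = x - zinv x"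
proof -
  have pow: "\<exists>y\<in>SZ. y * (zz - 1 / zz) = zz powi n - zinv (zz powi n)" for n
  proof (cases n rule: int_cases2)
    case (nonneg m)
    then show ?thesis using antisym_quotient_power[of m]
      by (simp add: zinv.power zinv_zz inverse_eq_divide power_one_over)
  next
    case (nonpos m)
    obtain y where "y \<in> SZ" "y * (zz - 1 / zz) = zz ^ m - 1 / zz ^ m"
      using antisym_quotient_power by blast
    then have "- y \<in> SZ" "(- y) * (zz - 1 / zz) = 1 / zz ^ m - zz ^ m"
      by (simp_all add: SZ_intros)
    then show ?thesis unfolding nonpos
      by (intro bexI[of _ "- y"]) (simp_all add: zinv.power zinv.inverse zinv.divide zinv.one zinv_zz inverse_eq_divide power_int_minus power_one_over)
  qed
  then obtain y where y: "y n \<in> SZ" "y n * (zz - 1 / zz) = zz powi n - zinv (zz powi n)" for n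
    by metis
  obtain f where f: "f \<in> laurent_K" "x = of_lpoly f"
    using assms by (auto simp: LZ_def)
  let ?Y = "\<Sum>n\<in>Poly_Mapping.keys f. scal (Poly_Mapping.lookup f n) * y n"
  have "?Y \<in> SZ"
    using f(1) by (intro SZ_sum SZ_intros SZ_scal y) (simp add: laurent_K_def)
  moreover have "?Y * (zz - 1 / zz) = x - zinv x"
    unfolding f(2) of_lpoly_lin_ext lin_ext_def sum_distrib_right mult.assoc y
    by (simp add: zinv.sum zinv.mult sum_subtractf right_diff_distrib)
  ultimately show ?thesis by blast
qed

lemma integral_upar_KK: "integral_shift h \<Longrightarrow> i < 4 \<Longrightarrow> upar h i \<in> KK"
  by (intro upar_KK) (auto simp: integral_shift_def)

lemma cA_LZ:
  assumes "integral_shift h" "I \<in> even_sets"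
  shows "cA h I zz \<in> LZ"
  unfolding cA_def cAf_def scal.divide [symmetric]
  using assms by (intro LZ_intros LZ_zz' LZ_prod LZ_scal KK_intros integral_upar_KK even_sets_subset qpow_KK) auto

text \<open>The image of f is the antisymmetrisation of c(z) f(q^(1/2) z), divided by z -
  1/z.\<close>

lemma opE_SZ:
  assumes "integral_shift h" "I \<in> even_sets" "f \<in> SZ"
  shows "op_apply (opE h I) f \<in> SZ"
proof -
  have "cA h I zz * T_pow 1 f \<in> LZ"
    using assms by (intro LZ_intros LZ_T SZ_LZ cA_LZ)
  then obtain y where y: "y \<in> SZ" "y * (zz - 1 / zz) = cA h I zz * T_pow 1 f - zinv (cA h I zz * T_pow 1 f)"
    using antisym_quotient by blast
  have "zinv (cA h I zz * T_pow 1 f) = cA h I (1 / zz) * T_pow (-1) f"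
    by (simp add: zinv.mult zinv_cA zinv_zz zinv_T_pow SZ_zinv assms(3) inverse_eq_divide)
  then have "op_apply (opE h I) f = y"
    unfolding opE_apply using y(2) zz_minus_inverse_nz by (simp add: field_simps)
  then show ?thesis using y by simp
qed

lemma integral_0: "integral_shift 0"
  by (simp add: integral_shift_def hc_0)

lemma integral_vsh: "integral_shift (vsh I)"
  by (auto simp: integral_shift_def hc_vsh)

lemma integral_add: "integral_shift h \<Longrightarrow> integral_shift h' \<Longrightarrow> integral_shift (h + h')"
  unfolding integral_shift_def
proof (intro conjI allI impI)
  assume *: "(\<forall>i<4. 2 * hc h i \<in> \<int>) \<and> hc h 0 + hc h 1 \<in> \<int> \<and> hc h 2 + hc h 3 \<in> \<int>"
    "(\<forall>i<4. 2 * hc h' i \<in> \<int>) \<and> hc h' 0 + hc h' 1 \<in> \<int> \<and> hc h' 2 + hc h' 3 \<in> \<int>"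
  show "2 * hc (h + h') i \<in> \<int>" if "i < 4" for i
    using * that by (simp add: hc_add distrib_left)
  have "(hc h 0 + hc h 1) + (hc h' 0 + hc h' 1) \<in> \<int>" "(hc h 2 + hc h 3) + (hc h' 2 + hc h' 3) \<in> \<int>"
    using * by (auto intro!: Ints_add)
  then show "hc (h + h') 0 + hc (h + h') 1 \<in> \<int>" "hc (h + h') 2 + hc (h + h') 3 \<in> \<int>"
    by (simp_all add: hc_add algebra_simps)
qed

lemma integral_uminus: "integral_shift h \<Longrightarrow> integral_shift (- h)"
proof -
  assume *: "integral_shift h"
  have "- (hc h 0 + hc h 1) \<in> \<int>" "- (hc h 2 + hc h 3) \<in> \<int>"
    using * unfolding integral_shift_def by (intro Ints_minus; blast)+
  then show ?thesis using * by (simp add: integral_shift_def hc_uminus)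
qed

lemma empty_even_sets: "{} \<in> even_sets"
  by (simp add: even_sets_def)

text \<open>The coefficients of D have poles, but the factorisation with empty I expresses D through
  operators that are known to preserve symmetric Laurent polynomials.\<close>

lemma opD_SZ:
  assumes "f \<in> SZ"
  shows "op_apply (opD 0) f \<in> SZ"
proof -
  have K: "gam 0 \<in> KK" by (rule gam_KK) (simp add: hc_0)
  have "op_apply (opD 0) f = scal (nu 0 {}) * op_apply (opE (0 + vsh {}) ({..<4} - {})) (op_apply (opE 0 {}) f)
      + scal (lam 0 {}) * f"
    unfolding opE_fact[OF empty_even_sets] by simp
  also have "\<dots> \<in> SZ"
    using assms K unfolding nu_def lam_def rho_def
    by (intro SZ_intros SZ_scal opE_SZ integral_add integral_0 integral_vsh even_sets_compl empty_even_sets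
        KK_intros qpow_KK) simp_all
  finally show ?thesis .
qed

subsection \<open>Leading coefficients\<close>

definition top_le :: "lpoly \<Rightarrow> int \<Rightarrow> bool" where
  "top_le f m \<longleftrightarrow> (\<forall>k>m. Poly_Mapping.lookup f k = 0)"

lemma top_le_mono: "top_le f m \<Longrightarrow> m \<le> n \<Longrightarrow> top_le f n"
  by (auto simp: top_le_def)

lemma top_le_add: "top_le f m \<Longrightarrow> top_le g m \<Longrightarrow> top_le (f + g) m"
  by (simp add: top_le_def lookup_add)

lemma top_le_diff: "top_le f m \<Longrightarrow> top_le g m \<Longrightarrow> top_le (f - g) m"
  by (simp add: top_le_def lookup_minus)

lemma top_le_lT: "top_le f m \<Longrightarrow> top_le (lT n f) m"
  by (simp add: top_le_def lookup_lT)

lemma top_mult: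
  assumes "top_le f m" "top_le g n"
  shows "top_le (f * g) (m + n)"
    and "Poly_Mapping.lookup (f * g) (m + n) = Poly_Mapping.lookup f m * Poly_Mapping.lookup g n"
proof -
  have "Poly_Mapping.lookup (f * g) k = (if k = m + n then Poly_Mapping.lookup f m * Poly_Mapping.lookup g n else 0)"
    if "k \<ge> m + n" for k
  proof -
    have z: "Poly_Mapping.lookup f l * Poly_Mapping.lookup g (k - l) = 0" if "l \<noteq> m \<or> k \<noteq> m + n" for l
    proof (cases "l > m")
      case False
      then have "k - l > n" using that \<open>k \<ge> m + n\<close> by auto
      then show ?thesis using assms by (simp add: top_le_def)
    qed (use assms in \<open>simp add: top_le_def\<close>)
    show ?thesis
    proof (cases "k = m + n")
      case True
      have "Poly_Mapping.lookup (f * g) k =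
          (\<Sum>l\<in>Poly_Mapping.keys f. if l = m then Poly_Mapping.lookup f m * Poly_Mapping.lookup g n else 0)"
        unfolding lookup_mult_sum by (rule sum.cong) (use z True in auto)
      then show ?thesis using True by (simp add: not_in_keys_iff_lookup_eq_zero)
    next
      case False
      then show ?thesis unfolding lookup_mult_sum using z by (simp add: sum.neutral)
    qed
  qed
  then show "top_le (f * g) (m + n)"
    "Poly_Mapping.lookup (f * g) (m + n) = Poly_Mapping.lookup f m * Poly_Mapping.lookup g n"
    by (auto simp: top_le_def)
qed

lemma top_prod:
  assumes "finite I" "\<And>i. i \<in> I \<Longrightarrow> top_le (f i) (m i)"
  shows "top_le (\<Prod>i\<in>I. f i) (\<Sum>i\<in>I. m i) \<and>
    Poly_Mapping.lookup (\<Prod>i\<in>I. f i) (\<Sum>i\<in>I. m i) = (\<Prod>i\<in>I. Poly_Mapping.lookup (f i) (m i))"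
  using assms
proof (induction I)
  case empty
  show ?case by (simp add: top_le_def lookup_one)
next
  case (insert i I)
  then show ?case using top_mult[of "f i" "m i" "\<Prod>i\<in>I. f i" "\<Sum>i\<in>I. m i"] by simp
qed

lemma obtain_top:
  assumes "f \<noteq> 0"
  obtains N where "top_le f N" "Poly_Mapping.lookup f N \<noteq> 0"
proof -
  have ne: "Poly_Mapping.keys f \<noteq> {}" using assms by simp
  let ?N = "Max (Poly_Mapping.keys f)"
  have "?N \<in> Poly_Mapping.keys f" using ne by (intro Max_in) simp_all
  moreover have "top_le f ?N"
    unfolding top_le_def
  proof (intro allI impI)
    fix k
    assume "k > ?N"
    then have "k \<notin> Poly_Mapping.keys f" by (metis Max_ge finite_keys linorder_not_less)
    then show "Poly_Mapping.lookup f k = 0" by (simp add: in_keys_iff)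
  qed
  ultimately show thesis using that by (simp add: in_keys_iff)
qed

lemma top_le_divide:
  assumes "top_le d m" "Poly_Mapping.lookup d m \<noteq> 0" "top_le (d * g) (m + n)"
  shows "top_le g n"
proof (cases "g = 0")
  case False
  then obtain N where N: "top_le g N" "Poly_Mapping.lookup g N \<noteq> 0" by (rule obtain_top)
  have "Poly_Mapping.lookup (d * g) (m + N) \<noteq> 0" using top_mult(2)[OF assms(1) N(1)] assms(2) N(2) by simp
  then have "\<not> m + N > m + n" using assms(3) unfolding top_le_def by blast
  then show ?thesis using N(1) top_le_mono by simp
qed (simp add: top_le_def)

text \<open>The top coefficient of \<open>a T^2 r + b T^(-2) r + c r\<close>.\<close>

lemma top_difference_op:
  assumes "top_le a M" "top_le b M" "top_le c M" "top_le r N"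
  defines "w \<equiv> a * lT 2 r + b * lT (-2) r + c * r"
  shows "top_le w (M + N)"
    "Poly_Mapping.lookup w (M + N) = (Poly_Mapping.lookup a M * qpow (of_int N) +
       Poly_Mapping.lookup b M * qpow (- of_int N) + Poly_Mapping.lookup c M) * Poly_Mapping.lookup r N"
proof -
  note t = top_mult[OF assms(1) top_le_lT[OF assms(4), of 2]]
    top_mult[OF assms(2) top_le_lT[OF assms(4), of "-2"]] top_mult[OF assms(3,4)]
  show "top_le w (M + N)" unfolding w_def by (intro top_le_add t)
  show "Poly_Mapping.lookup w (M + N) = (Poly_Mapping.lookup a M * qpow (of_int N) +
       Poly_Mapping.lookup b M * qpow (- of_int N) + Poly_Mapping.lookup c M) * Poly_Mapping.lookup r N"
    unfolding w_def lookup_add t lookup_lT by (simp add: algebra_simps)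
qed

definition lin :: "kk \<Rightarrow> kk \<Rightarrow> int \<Rightarrow> lpoly" where
  "lin x y m = lmon x 0 + lmon y m"

lemma of_lpoly_lin: "of_lpoly (lin x y m) = scal x + scal y * zz powi m"
  by (simp add: lin_def of_lpoly_add of_lpoly_lmon)

lemma top_lin: "m > 0 \<Longrightarrow> top_le (lin x y m) m" "m > 0 \<Longrightarrow> Poly_Mapping.lookup (lin x y m) m = y"
  by (auto simp: lin_def top_le_def lookup_add lmon_def lookup_single when_def)

lemma of_lpoly_prod: "of_lpoly (\<Prod>i\<in>I. f i) = (\<Prod>i\<in>I. of_lpoly (f i))"
  by (induction I rule: infinite_finite_induct) (simp_all add: of_lpoly_1 of_lpoly_mult)

definition eig :: "rat4 \<Rightarrow> rat \<Rightarrow> kk" where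
  "eig h r = gam h * qpow r + 1 / (gam h * qpow r)"

text \<open>Clearing denominators in the Askey--Wilson operator.\<close>

lemma Acoef_clear:
  defines "q \<equiv> scal (qpow 1)"
  defines "d \<equiv> (1 - zz^2) * (1 - q * zz^2) * (zz^2 - q)"
  shows "d \<noteq> 0" and "d * Acoef h zz = (\<Prod>i<4. 1 - scal (upar h i) * zz) * (zz^2 - q)"
    and "d * Acoef h (1 / zz) = - ((\<Prod>i<4. zz - scal (upar h i)) * (1 - q * zz^2))"
proof -
  have q: "scal tt ^ 2 = q" by (simp add: q_def scal.power [symmetric] tt_square)
  have nz: "1 - zz^2 \<noteq> 0" "1 - q * zz^2 \<noteq> 0" "zz^2 - q \<noteq> 0" "zz^2 - 1 \<noteq> 0"
    using zz_neqs by (auto simp: q)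
  then show "d \<noteq> 0" by (simp add: d_def)
  show "d * Acoef h zz = (\<Prod>i<4. 1 - scal (upar h i) * zz) * (zz^2 - q)"
    unfolding Acoef_def Af_def q d_def using nz by simp
  have P: "(\<Prod>i<4. 1 - scal (upar h i) * (1 / zz)) = (\<Prod>i<4. zz - scal (upar h i)) / zz^4"
    by (simp add: prod_4 field_simps power4_eq_xxxx)
  have D: "(1 - (1 / zz)^2) * (1 - q * (1 / zz)^2) = (zz^2 - 1) * (zz^2 - q) / zz^4"
    by (simp add: field_simps power2_eq_square power4_eq_xxxx)
  have A: "Acoef h (1 / zz) = (\<Prod>i<4. zz - scal (upar h i)) / ((zz^2 - 1) * (zz^2 - q))"
    unfolding Acoef_def Af_def q P D by simp
  have dd: "d = - ((zz^2 - 1) * (zz^2 - q) * (1 - q * zz^2))"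
    by (simp add: d_def algebra_simps)
  have "d * Acoef h (1 / zz) = - ((zz^2 - 1) * (zz^2 - q) * (1 - q * zz^2)) * ((\<Prod>i<4. zz - scal (upar h i)) / ((zz^2 - 1) * (zz^2 - q)))"
    by (simp only: A dd)
  also have "\<dots> = - ((\<Prod>i<4. zz - scal (upar h i)) * (1 - q * zz^2))"
    using nz by simp
  finally show "d * Acoef h (1 / zz) = - ((\<Prod>i<4. zz - scal (upar h i)) * (1 - q * zz^2))" .
qed

text \<open>D is triangular for the degree. After clearing denominators the equation D f = g holds
  between Laurent polynomials, and its top coefficients give the diagonal entry.\<close>

lemma opD_top:
  assumes "op_apply (opD h) (of_lpoly f) = of_lpoly g" "top_le f N"
  shows "top_le g N" "Poly_Mapping.lookup g N = eig h (of_int N) * Poly_Mapping.lookup f N"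
proof -
  let ?q = "scal (qpow 1)"
  let ?d = "(1 - zz^2) * (1 - ?q * zz^2) * (zz^2 - ?q)"
  \<comment> \<open>The common denominator d; then a, b, c are the coefficients of T^2, T^(-2), T^0
    of gam D multiplied by d. All have degree at most 6, and the coefficient of degree 6 in c is
    (gam^2 + 1) q - gam^2 q - q = 0.\<close>
  define d where "d = lin 1 (-1) 2 * lin 1 (- qpow 1) 2 * lin (- qpow 1) 1 2"
  define a where "a = (\<Prod>i<4. lin 1 (- upar h i) 1) * lin (- qpow 1) 1 2"
  define b where "b = - ((\<Prod>i<4. lin (- upar h i) 1 1) * lin 1 (- qpow 1) 2)"
  define c where "c = lmon (gam h ^ 2 + 1) 0 * d - (a + b)"
  have of: "of_lpoly d = ?d" "of_lpoly a = (\<Prod>i<4. 1 - scal (upar h i) * zz) * (zz^2 - ?q)"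
    "of_lpoly b = - ((\<Prod>i<4. zz - scal (upar h i)) * (1 - ?q * zz^2))"
    unfolding d_def a_def b_def of_lpoly_mult of_lpoly_uminus of_lpoly_prod of_lpoly_lin
    by (simp_all add: scal.simps)
  have "of_lpoly (lmon (gam h) 0 * d * g) = scal (gam h) * (?d * op_apply (opD h) (of_lpoly f))"
    by (simp add: of_lpoly_mult of assms(1) scal_def mult.assoc)
  also have "\<dots> = (?d * Acoef h zz) * (T_pow 2 (of_lpoly f) - of_lpoly f) +
     (?d * Acoef h (1 / zz)) * (T_pow (-2) (of_lpoly f) - of_lpoly f) + scal (gam h ^ 2 + 1) * ?d * of_lpoly f"
    unfolding opD_apply by (simp add: scal.simps field_simps power2_eq_square)
  also have "\<dots> = of_lpoly (a * lT 2 f + b * lT (-2) f + c * f)"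
    unfolding Acoef_clear by (simp add: of_lpoly_add of_lpoly_mult of_lpoly_diff of T_of_lpoly c_def scal_def [symmetric] algebra_simps)
  finally have eq: "lmon (gam h) 0 * d * g = a * lT 2 f + b * lT (-2) f + c * f"
    by (simp only: of_lpoly_eq)
  have td: "top_le d 6" "Poly_Mapping.lookup d 6 = qpow 1"
    using top_mult[OF top_mult(1)[OF top_lin(1) top_lin(1)] top_lin(1), of 2 2 2 1 "-1" 1 "- qpow 1" "- qpow 1" 1]
      top_mult(2)[OF top_lin(1) top_lin(1), of 2 2 1 "-1" 1 "- qpow 1"]
    by (simp_all add: d_def top_lin)
  have "top_le (\<Prod>i<4. lin 1 (- upar h i) 1) 4 \<and> Poly_Mapping.lookup (\<Prod>i<4. lin 1 (- upar h i) 1) 4 = gam h ^ 2 * qpow 1"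
    using top_prod[of "{..<4::nat}" "\<lambda>i. lin 1 (- upar h i) 1" "\<lambda>_. 1"]
    by (simp add: top_lin) (simp add: prod_4 gam_square)
  then have ta: "top_le a 6" "Poly_Mapping.lookup a 6 = gam h ^ 2 * qpow 1"
    using top_mult[OF _ top_lin(1), of "\<Prod>i<4. lin 1 (- upar h i) 1" 4 2 "- qpow 1" 1]
    by (simp_all add: a_def top_lin)
  have "top_le (\<Prod>i<4. lin (- upar h i) 1 1) 4 \<and> Poly_Mapping.lookup (\<Prod>i<4. lin (- upar h i) 1 1) 4 = 1"
    using top_prod[of "{..<4::nat}" "\<lambda>i. lin (- upar h i) 1 1" "\<lambda>_. 1"]
    by (simp add: top_lin)
  then have tb: "top_le b 6" "Poly_Mapping.lookup b 6 = qpow 1"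
    using top_mult[OF _ top_lin(1), of "\<Prod>i<4. lin (- upar h i) 1 1" 4 2 1 "- qpow 1"]
    by (simp_all add: b_def top_lin top_le_def)
  have l0: "top_le (lmon x 0) 0" "Poly_Mapping.lookup (lmon x 0) 0 = x" for x
    by (simp_all add: top_le_def lmon_def lookup_single)
  have tc: "top_le c 6" "Poly_Mapping.lookup c 6 = - qpow 1 * 0"
    using top_mult[OF l0(1) td(1), of "gam h ^ 2 + 1"] ta tb td
    by (simp_all add: c_def top_le_diff top_le_add lookup_minus lookup_add l0 algebra_simps)
  have tgd: "top_le (lmon (gam h) 0 * d) 6" "Poly_Mapping.lookup (lmon (gam h) 0 * d) 6 = gam h * qpow 1"
    using top_mult[OF l0(1) td(1), of "gam h"] td by (simp_all add: l0)
  note w = top_difference_op[OF ta(1) tb(1) tc(1) assms(2), folded eq]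
  show g: "top_le g N"
    by (rule top_le_divide[OF tgd(1) _ w(1)]) (simp add: tgd)
  have "gam h * qpow 1 * Poly_Mapping.lookup g N =
      (gam h ^ 2 * qpow 1 * qpow (of_int N) + qpow 1 * qpow (- of_int N)) * Poly_Mapping.lookup f N"
    using w(2) unfolding top_mult(2)[OF tgd(1) g] tgd(2) ta tb tc by simp
  then have "Poly_Mapping.lookup g N = (gam h ^ 2 * qpow 1 * qpow (of_int N) + qpow 1 * qpow (- of_int N)) / (gam h * qpow 1) * Poly_Mapping.lookup f N"
    by (simp add: field_simps)
  also have "(gam h ^ 2 * qpow 1 * qpow (of_int N) + qpow 1 * qpow (- of_int N)) / (gam h * qpow 1) = eig h (of_int N)"
    unfolding eig_def qpow_minus by (simp add: field_simps power2_eq_square)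
  finally show "Poly_Mapping.lookup g N = eig h (of_int N) * Poly_Mapping.lookup f N" .
qed

subsection \<open>Eigenpolynomials\<close>

lemma gam_square_neq_qpow: "gam h ^ 2 \<noteq> qpow r"
proof
  let ?s = "(hc h 0 + hc h 1 + hc h 2 + hc h 3 - 1) / 2"
  let ?g = "Poly_Mapping.single ISqrtAB 1 + Poly_Mapping.single ISqrtCD 1 :: expo"
  have g: "gam h = mon ?g * qpow ?s"
    by (simp add: gam_def sqrt_ab_def sqrt_cd_def mon_add)
  assume "gam h ^ 2 = qpow r"
  then have "mon (?g + ?g) * qpow (?s + ?s) = qpow r"
    unfolding g power2_eq_square mon_add qpow_add by (simp only: ac_simps)
  then have "mon (?g + ?g) = qpow (r - (?s + ?s))"
    unfolding qpow_diff by (simp add: field_simps)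
  then have "Poly_Mapping.lookup (?g + ?g) ISqrtAB = 0"
    by (intro mon_eq_qpow[of _ "r - (?s + ?s)"]) simp_all
  then show False by (simp add: lookup_add lookup_single)
qed

lemma add_inverse_eq:
  fixes x y :: "'a::field"
  assumes "x + 1 / x = y + 1 / y" "x \<noteq> 0" "y \<noteq> 0"
  shows "x = y \<or> x * y = 1"
proof -
  have "(x - y) * (x * y - 1) = 0"
    using assms by (simp add: field_simps)
  then show ?thesis by simp
qed

text \<open>Equality of x + 1/x and y + 1/y means x = y or x y = 1; the second case would make gam^2
  a power of q.\<close>

lemma eig_eq: "eig h r = eig h s \<longleftrightarrow> r = s"
proof
  assume "eig h r = eig h s"
  then have "gam h * qpow r = gam h * qpow s \<or> (gam h * qpow r) * (gam h * qpow s) = 1"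
    unfolding eig_def by (rule add_inverse_eq) simp_all
  moreover have "(gam h * qpow r) * (gam h * qpow s) \<noteq> 1"
  proof
    assume "(gam h * qpow r) * (gam h * qpow s) = 1"
    then have "gam h ^ 2 * qpow (r + s) = 1" by (simp add: power2_eq_square qpow_add algebra_simps)
    then have "gam h ^ 2 = qpow (- (r + s))" unfolding qpow_minus by (simp add: field_simps)
    then show False using gam_square_neq_qpow by blast
  qed
  ultimately show "r = s" by (simp add: qpow_eq)
qed simp

lemma sym_lookup: "f \<in> sym_laurent_K \<Longrightarrow> Poly_Mapping.lookup f (- n) = Poly_Mapping.lookup f n"
  by (simp add: sym_laurent_K_def)

lemma sym_lookup_KK: "f \<in> sym_laurent_K \<Longrightarrow> Poly_Mapping.lookup f n \<in> KK"
  by (simp add: sym_laurent_K_def laurent_K_def)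

lemma sym_top_nonneg:
  assumes "f \<in> sym_laurent_K" "top_le f N" "Poly_Mapping.lookup f N \<noteq> 0"
  shows "N \<ge> 0"
proof (rule ccontr)
  assume "\<not> N \<ge> 0"
  then have "Poly_Mapping.lookup f (- N) = 0" using assms(2) by (simp add: top_le_def)
  then show False using assms sym_lookup by simp
qed

definition basis_below :: "(nat \<Rightarrow> lpoly) \<Rightarrow> nat \<Rightarrow> bool" where
  "basis_below B n \<longleftrightarrow> (\<forall>j<n. B j \<in> sym_laurent_K \<and> top_le (B j) (int j) \<and>
     Poly_Mapping.lookup (B j) (int j) \<noteq> 0)"

lemma lookup_const_mult: "Poly_Mapping.lookup (lmon c 0 * f) n = c * Poly_Mapping.lookup f n"
  unfolding lookup_mult_sum by (cases "c = 0") (simp_all add: lmon_def)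

text \<open>Triangularity: subtracting a multiple of the last basis element lowers the degree, and a
  symmetric element of negative degree is zero.\<close>

lemma span_below:
  assumes "basis_below B n" "g \<in> sym_laurent_K" "top_le g (int n - 1)"
  shows "\<exists>c. (\<forall>j. c j \<in> KK) \<and> g = (\<Sum>j<n. lmon (c j) 0 * B j)"
  using assms
proof (induction n arbitrary: g)
  case 0
  have "Poly_Mapping.lookup g k = 0" for k
  proof (cases "k \<ge> 0")
    case False
    then have "Poly_Mapping.lookup g (- k) = 0" using "0.prems"(3) by (simp add: top_le_def)
    then show ?thesis using sym_lookup[OF "0.prems"(2)] by simp
  qed (use "0.prems"(3) in \<open>simp add: top_le_def\<close>)
  then have "g = 0" by (intro poly_mapping_eqI) simp
  then show ?case by (intro exI[of _ "\<lambda>_. 0"]) (simp add: KK_intros)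
next
  case (Suc n)
  have B: "B n \<in> sym_laurent_K" "top_le (B n) (int n)" "Poly_Mapping.lookup (B n) (int n) \<noteq> 0"
    "basis_below B n"
    using Suc.prems(1) by (simp_all add: basis_below_def)
  let ?c = "Poly_Mapping.lookup g (int n) / Poly_Mapping.lookup (B n) (int n)"
  have cK: "?c \<in> KK" using B Suc.prems by (intro KK_intros sym_lookup_KK)
  let ?g = "g - lmon ?c 0 * B n"
  have g: "?g \<in> sym_laurent_K"
    using B Suc.prems cK by (intro sym_K_intros const_sym)
  have "top_le ?g (int n - 1)"
    unfolding top_le_def
  proof (intro allI impI)
    fix k
    assume k: "int n - 1 < k"
    show "Poly_Mapping.lookup ?g k = 0"
    proof (cases "k = int n")
      case True
      then show ?thesis using B(3) by (simp add: lookup_minus lookup_const_mult)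
    next
      case False
      then show ?thesis using k B(2) Suc.prems(3) by (simp add: lookup_minus lookup_const_mult top_le_def)
    qed
  qed
  from Suc.IH[OF B(4) g this] obtain c where c: "\<forall>j. c j \<in> KK" "?g = (\<Sum>j<n. lmon (c j) 0 * B j)"
    by blast
  have "(\<Sum>j<Suc n. lmon ((c(n := ?c)) j) 0 * B j) = (\<Sum>j<n. lmon (c j) 0 * B j) + lmon ?c 0 * B n"
    by simp
  also have "\<dots> = g" unfolding c(2)[symmetric] by simp
  finally show ?case using c(1) cK by (intro exI[of _ "c(n := ?c)"]) simp
qed

definition is_eigenpoly :: "nat \<Rightarrow> lpoly \<Rightarrow> bool" where
  "is_eigenpoly n Q \<longleftrightarrow> Q \<in> sym_laurent_K \<and>
     op_apply (opD 0) (of_lpoly Q) = scal (eig 0 (of_nat n)) * of_lpoly Q \<and>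
     top_le Q (int n) \<and> Poly_Mapping.lookup Q (int n) = 1"

lemma eig_KK: "2 * r \<in> \<int> \<Longrightarrow> eig 0 r \<in> KK"
  unfolding eig_def by (intro KK_intros gam_KK qpow_KK) (simp_all add: hc_0)

lemma of_lpoly_const_mult: "of_lpoly (lmon c 0 * f) = scal c * of_lpoly f"
  by (simp add: of_lpoly_mult scal_def)

definition msym :: "nat \<Rightarrow> lpoly" where
  "msym n = (if n = 0 then 1 else lsym n)"

lemma msym: "msym n \<in> sym_laurent_K" "top_le (msym n) (int n)" "Poly_Mapping.lookup (msym n) (int n) = 1"
proof -
  show "msym n \<in> sym_laurent_K" by (simp add: msym_def lsym_sym sym_K_intros)
  show "top_le (msym n) (int n)" "Poly_Mapping.lookup (msym n) (int n) = 1"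
    by (auto simp: msym_def top_le_def lsym_def lookup_add lmon_def lookup_single lookup_one when_def)
qed

text \<open>A triangular operator with distinct diagonal entries is diagonalisable; the earlier
  eigenpolynomials serve as the basis in which the lower terms are corrected.\<close>

lemma eigenpoly_exists: "\<exists>Q. is_eigenpoly n Q"
proof (induction n rule: less_induct)
  case (less n)
  then obtain Q where Q: "is_eigenpoly j (Q j)" if "j < n" for j by metis
  then have B: "basis_below Q n" by (simp add: basis_below_def is_eigenpoly_def)
  have f: "of_lpoly (msym n) \<in> SZ" by (simp add: SZ_def msym)
  then obtain g where g: "g \<in> sym_laurent_K" "op_apply (opD 0) (of_lpoly (msym n)) = of_lpoly g"
    using opD_SZ[OF f] by (auto simp: SZ_def)
  let ?e = "\<lambda>j. eig 0 (of_nat j)"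
  let ?g = "g - lmon (?e n) 0 * msym n"
  have g': "?g \<in> sym_laurent_K"
    by (intro sym_K_intros const_sym g msym eig_KK) simp
  have t: "top_le g (int n)" "Poly_Mapping.lookup g (int n) = ?e n"
    using opD_top[OF g(2) msym(2)] by (simp_all add: msym)
  have "top_le ?g (int n - 1)"
    unfolding top_le_def
  proof (intro allI impI)
    fix k
    assume k: "int n - 1 < k"
    show "Poly_Mapping.lookup ?g k = 0"
    proof (cases "k = int n")
      case True
      then show ?thesis using t by (simp add: lookup_minus lookup_const_mult msym)
    next
      case False
      then show ?thesis using k t(1) msym(2)[of n] by (simp add: lookup_minus lookup_const_mult top_le_def)
    qed
  qed
  from span_below[OF B g' this] obtain c where c: "\<And>j. c j \<in> KK" "?g = (\<Sum>j<n. lmon (c j) 0 * Q j)"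
    by blast
  have ne: "?e n - ?e j \<noteq> 0" if "j < n" for j using that by (simp add: eig_eq)
  \<comment> \<open>Since D m_n = e_n m_n + sum c_j Q_j, the coefficient x_j of Q_j has to satisfy
    c_j + e_j x_j = e_n x_j.\<close>
  let ?P = "msym n + (\<Sum>j<n. lmon (c j / (?e n - ?e j)) 0 * Q j)"
  have K: "c j / (?e n - ?e j) \<in> KK" for j
    by (intro KK_intros c eig_KK) simp_all
  have P: "?P \<in> sym_laurent_K"
    using Q by (intro sym_K_intros msym sym_K_sum const_sym K) (simp add: is_eigenpoly_def)
  have l: "Poly_Mapping.lookup ?P k = Poly_Mapping.lookup (msym n) k" if "k \<ge> int n" for k
  proof -
    have "Poly_Mapping.lookup (Q j) k = 0" if "j < n" for j
      using Q[OF that] that \<open>k \<ge> int n\<close> by (simp add: is_eigenpoly_def top_le_def)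
    then show ?thesis by (simp add: lookup_add lookup_sum lookup_const_mult)
  qed
  have "op_apply (opD 0) (of_lpoly ?P) = of_lpoly g +
      (\<Sum>j<n. scal (c j / (?e n - ?e j)) * (scal (?e j) * of_lpoly (Q j)))"
    using Q by (simp add: of_lpoly_add op_apply_add g of_lpoly_sum op_apply_sum of_lpoly_const_mult
        op_apply_scal is_eigenpoly_def)
  also have "of_lpoly g = scal (?e n) * of_lpoly (msym n) + (\<Sum>j<n. scal (c j) * of_lpoly (Q j))"
    using arg_cong[OF c(2), of of_lpoly]
    by (simp add: of_lpoly_diff of_lpoly_const_mult of_lpoly_sum diff_eq_eq add.commute)
  also have "\<dots> + (\<Sum>j<n. scal (c j / (?e n - ?e j)) * (scal (?e j) * of_lpoly (Q j))) =
     scal (?e n) * of_lpoly (msym n) + (\<Sum>j<n. scal (c j + c j / (?e n - ?e j) * ?e j) * of_lpoly (Q j))"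
    by (simp only: sum.distrib scal.add scal.mult distrib_right mult.assoc add.assoc)
  also have "(\<Sum>j<n. scal (c j + c j / (?e n - ?e j) * ?e j) * of_lpoly (Q j)) =
     (\<Sum>j<n. scal (?e n) * (scal (c j / (?e n - ?e j)) * of_lpoly (Q j)))"
  proof (rule sum.cong[OF refl])
    fix j
    assume "j \<in> {..<n}"
    then have "c j + c j / (?e n - ?e j) * ?e j = ?e n * (c j / (?e n - ?e j))"
      using ne[of j] by (simp add: field_simps)
    then show "scal (c j + c j / (?e n - ?e j) * ?e j) * of_lpoly (Q j) =
        scal (?e n) * (scal (c j / (?e n - ?e j)) * of_lpoly (Q j))"
      by (simp only: scal.mult mult.assoc)
  qed
  also have "scal (?e n) * of_lpoly (msym n) + \<dots> = scal (?e n) * of_lpoly ?P"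
    by (simp add: of_lpoly_add of_lpoly_sum of_lpoly_const_mult distrib_left sum_distrib_left)
  finally have "op_apply (opD 0) (of_lpoly ?P) = scal (?e n) * of_lpoly ?P" .
  moreover have "top_le ?P (int n)" "Poly_Mapping.lookup ?P (int n) = 1"
    using l msym(2,3)[of n] by (auto simp: top_le_def)
  ultimately show ?case unfolding is_eigenpoly_def using P by blast
qed

definition eigenpoly :: "nat \<Rightarrow> lpoly" where
  "eigenpoly n = (SOME Q. is_eigenpoly n Q)"

lemma eigenpoly: "is_eigenpoly n (eigenpoly n)"
  unfolding eigenpoly_def by (rule someI_ex[OF eigenpoly_exists])

lemma eigenpoly_sym: "eigenpoly n \<in> sym_laurent_K"
  and eigenpoly_opD: "op_apply (opD 0) (of_lpoly (eigenpoly n)) = scal (eig 0 (of_nat n)) * of_lpoly (eigenpoly n)"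
  and eigenpoly_top: "top_le (eigenpoly n) (int n)"
  and eigenpoly_lead: "Poly_Mapping.lookup (eigenpoly n) (int n) = 1"
  using eigenpoly[of n] by (simp_all add: is_eigenpoly_def)

lemma eigenpoly_basis: "basis_below eigenpoly n"
  by (simp add: basis_below_def eigenpoly_sym eigenpoly_top eigenpoly_lead)

lemma eigen_top:
  assumes "op_apply (opD 0) (of_lpoly g) = scal \<mu> * of_lpoly g" "top_le g N" "Poly_Mapping.lookup g N \<noteq> 0"
  shows "\<mu> = eig 0 (of_int N)"
proof -
  have "op_apply (opD 0) (of_lpoly g) = of_lpoly (lmon \<mu> 0 * g)"
    using assms by (simp add: of_lpoly_const_mult)
  from opD_top(2)[OF this assms(2)] show ?thesis using assms(3) by (simp add: lookup_const_mult)
qed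

text \<open>The top exponent determines the eigenvalue, and distinct exponents have distinct
  eigenvalues. After subtraction of a multiple of the eigenpolynomial a nonzero rest would have the
  same top exponent, but its coefficient there has been removed.\<close>

lemma eigen_unique:
  assumes g: "g \<in> sym_laurent_K" "op_apply (opD 0) (of_lpoly g) = scal \<mu> * of_lpoly g"
  shows "g = 0 \<or> (\<exists>j. \<exists>c\<in>KK. \<mu> = eig 0 (of_nat j) \<and> g = lmon c 0 * eigenpoly j)"
proof (cases "g = 0")
  case False
  then obtain N where N: "top_le g N" "Poly_Mapping.lookup g N \<noteq> 0" by (rule obtain_top)
  then obtain j where j: "N = int j" using sym_top_nonneg[OF g(1)] by (metis nonneg_int_cases)
  have \<mu>: "\<mu> = eig 0 (of_nat j)" using eigen_top[OF g(2) N] j by simp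
  let ?c = "Poly_Mapping.lookup g N"
  let ?g = "g - lmon ?c 0 * eigenpoly j"
  have "?g = 0"
  proof (rule ccontr)
    assume "?g \<noteq> 0"
    then obtain M where M: "top_le ?g M" "Poly_Mapping.lookup ?g M \<noteq> 0" by (rule obtain_top)
    have "op_apply (opD 0) (of_lpoly ?g) = scal \<mu> * of_lpoly ?g"
      by (simp add: of_lpoly_diff op_apply_diff of_lpoly_const_mult op_apply_scal g eigenpoly_opD \<mu>)
        (simp add: algebra_simps)
    then have "\<mu> = eig 0 (of_int M)" using M by (rule eigen_top)
    then have "M = N" using \<mu> j by (simp add: eig_eq)
    then show False using M(2) by (simp add: lookup_minus lookup_const_mult eigenpoly_lead j)
  qed
  then show ?thesis using \<mu> sym_lookup_KK[OF g(1)] by (metis right_minus_eq)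
qed simp

text \<open>The change of \<open>gam\<close> under the shift is a power of q that is compensated by
  the change of degree. This is why a shift operator can respect eigenvalues.\<close>

lemma eig_shift: "eig h r = eig 0 (r - degree_shift h)"
proof -
  have d: "degree_shift h = - (hc h 0 + hc h 1 + hc h 2 + hc h 3) / 2"
    by (cases h) (simp add: hc_def)
  have "gam h = gam 0 * qpow (- degree_shift h)"
    unfolding gam_def d by (simp add: hc_0 qpow_add [symmetric] mult.assoc) (simp add: field_simps)
  then have "gam h * qpow r = gam 0 * qpow (r - degree_shift h)"
    by (simp add: qpow_diff qpow_minus field_simps)
  then show ?thesis unfolding eig_def by simp
qed

lemma par_shift_eig: "par_shift h (eig h' r) = eig (h + h') r"
  by (simp add: eig_def ps.simps par_shift_gam)

lemma degree_shift_uminus: "degree_shift (- h) = - degree_shift h"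
  by (cases h) (simp add: field_simps)

lemma degree_shift_add: "degree_shift (h + h') = degree_shift h + degree_shift h'"
  by (cases h; cases h') (simp add: field_simps)

lemma SZ_ratfun_shift:
  assumes "integral_shift h" "x \<in> SZ"
  shows "ratfun_shift h x \<in> SZ"
proof -
  obtain f where f: "f \<in> sym_laurent_K" "x = of_lpoly f" using assms(2) by (auto simp: SZ_def)
  have "Poly_Mapping.map (par_shift h) f \<in> sym_laurent_K"
    using f(1) par_shift_KK[OF assms(1)]
    by (auto simp: sym_laurent_K_def laurent_K_def Poly_Mapping.map.rep_eq when_def KK_intros)
  then show ?thesis by (simp add: f(2) ratfun_shift_of_lpoly SZ_def)
qed

definition shifted_eigenpoly :: "rat4 \<Rightarrow> rat \<Rightarrow> lpoly" where
  "shifted_eigenpoly h r = (if r \<in> \<nat> then Poly_Mapping.map (par_shift h) (eigenpoly (nat \<lfloor>r\<rfloor>)) else 0)"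

text \<open>By \<open>opE_opD\<close> the image is an eigenvector of D_v with the old eigenvalue.
  Shifting the parameters back by -v makes it an eigenvector of D_0, to which
  \<open>eigen_unique\<close> applies.\<close>

lemma opE_eigenpoly:
  assumes I: "I \<in> even_sets"
  shows "\<exists>C\<in>KK. op_apply (opE 0 I) (of_lpoly (eigenpoly m)) =
    scal C * of_lpoly (shifted_eigenpoly (vsh I) (of_nat m + degree_shift (vsh I)))"
proof -
  let ?v = "vsh I"
  let ?f = "op_apply (opE 0 I) (of_lpoly (eigenpoly m))"
  let ?r = "of_nat m + degree_shift ?v"
  have "?f \<in> SZ" using eigenpoly_sym I integral_0 by (intro opE_SZ) (simp_all add: SZ_def)
  then have "ratfun_shift (- ?v) ?f \<in> SZ" by (intro SZ_ratfun_shift integral_uminus integral_vsh)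
  then obtain g where g: "g \<in> sym_laurent_K" "ratfun_shift (- ?v) ?f = of_lpoly g"
    by (auto simp: SZ_def)
  then have f: "?f = ratfun_shift ?v (of_lpoly g)"
    by (metis ratfun_shift_comp ratfun_shift_0 add.right_inverse)
  have "op_apply (opD ?v) ?f = op_apply (opE 0 I) (op_apply (opD 0) (of_lpoly (eigenpoly m)))"
    using opE_opD[OF I, of 0] by (simp flip: op_apply_comp)
  then have D: "op_apply (opD ?v) ?f = scal (eig 0 (of_nat m)) * ?f"
    by (simp add: eigenpoly_opD op_apply_scal)
  have "op_apply (opD 0) (of_lpoly g) = ratfun_shift (- ?v) (op_apply (opD ?v) ?f)"
    unfolding g(2)[symmetric] using op_shift_opD[of "- ?v" ?v] by (simp flip: op_shift_apply)
  also have "\<dots> = scal (eig 0 ?r) * of_lpoly g"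
    unfolding D by (simp add: rs.mult g par_shift_eig) (simp add: eig_shift[of "- ?v"] degree_shift_uminus)
  finally consider "g = 0" | j c where "c \<in> KK" "eig 0 ?r = eig 0 (of_nat j)" "g = lmon c 0 * eigenpoly j"
    using eigen_unique[OF g(1)] by blast
  then show ?thesis
  proof cases
    case 1
    then show ?thesis unfolding f by (intro bexI[of _ 0]) (simp_all add: rs.zero scal.zero KK_intros)
  next
    case 2
    then have "?r = of_nat j" by (simp add: eig_eq)
    then have "shifted_eigenpoly ?v ?r = Poly_Mapping.map (par_shift ?v) (eigenpoly j)"
      by (simp add: shifted_eigenpoly_def)
    then have "?f = scal (par_shift ?v c) * of_lpoly (shifted_eigenpoly ?v ?r)"
      unfolding f 2(3) by (simp add: of_lpoly_const_mult rs.mult ratfun_shift_of_lpoly)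
    then show ?thesis using 2(1) par_shift_KK[OF integral_vsh] by blast
  qed
qed

subsection \<open>The weight\<close>

lemma series_mult_nth: "fps_nth (fps_nth (fps_nth (s * r) m) j) i =
    (\<Sum>a\<le>m. \<Sum>b\<le>j. \<Sum>c\<le>i. fps_nth (fps_nth (fps_nth s a) b) c *
       fps_nth (fps_nth (fps_nth r (m - a)) (j - b)) (i - c))"
  for s r :: series
  by (simp add: fps_mult_nth fps_sum_nth atMost_atLeast0)

lemma series_eqI: "(\<And>m j i. fps_nth (fps_nth (fps_nth s m) j) i = fps_nth (fps_nth (fps_nth r m) j) i) \<Longrightarrow> s = r"
  for s r :: series
  by (simp add: fps_eq_iff)

definition ccoef :: "series \<Rightarrow> kk" where
  "ccoef s = fps_nth (fps_nth (fps_nth s 0) 0) 0"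

lemma ccoef_hom: "ccoef (s * r) = ccoef s * ccoef r" "ccoef (s + r) = ccoef s + ccoef r"
  "ccoef (s - r) = ccoef s - ccoef r" "ccoef 1 = 1" "ccoef 0 = 0"
  by (simp_all add: ccoef_def)

text \<open>The outer layers have coefficients in rings of power series, so invertibility is traced
  through the three layers down to the innermost constant term, which lies in a field.\<close>

lemma series_inverse:
  assumes "ccoef s \<noteq> 0"
  shows "s * inverse s = 1"
proof -
  have 1: "fps_nth s 0 * inverse (fps_nth s 0) = 1"
  proof -
    have "fps_nth (fps_nth s 0) 0 * inverse (fps_nth (fps_nth s 0) 0) = 1"
      using assms by (metis ccoef_def fps_inverse_def fps_right_inverse right_inverse)
    then show ?thesis unfolding fps_inverse_def[of "fps_nth s 0"] by (rule fps_right_inverse)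
  qed
  then show ?thesis unfolding fps_inverse_def[of s] by (rule fps_right_inverse)
qed

lemma series_inverse_unique:
  assumes "s * r = 1"
  shows "inverse s = (r :: series)"
proof -
  have "ccoef s \<noteq> 0" using arg_cong[OF assms, of ccoef] by (auto simp: ccoef_hom)
  then have "s * inverse s = 1" by (rule series_inverse)
  then have "inverse s = inverse s * (s * r)" using assms by simp
  also have "\<dots> = (s * inverse s) * r" by (simp only: ac_simps)
  also have "\<dots> = r" using \<open>s * inverse s = 1\<close> by simp
  finally show ?thesis .
qed

lemma series_frac_eq:
  fixes x x' y y' :: series
  assumes "ccoef y \<noteq> 0" "ccoef y' \<noteq> 0" "x * y' = x' * y"
  shows "x * inverse y = x' * inverse y'"
proof -
  have "x * inverse y = x * (y' * inverse y') * inverse y"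
    using series_inverse[OF assms(2)] by simp
  also have "\<dots> = (x * y') * inverse y * inverse y'" by (simp add: ac_simps)
  also have "\<dots> = x' * (y * inverse y) * inverse y'" unfolding assms(3) by (simp add: ac_simps)
  finally show ?thesis using series_inverse[OF assms(1)] by simp
qed

section \<open>The q-Pochhammer symbols as t-adic limits\<close>

definition pqpoch :: "nat \<Rightarrow> series \<Rightarrow> series" where
  "pqpoch N x = (\<Prod>j<N. 1 - x * (ser_t\<^sup>2) ^ j)"

lemma fps_X_power_factor:
  fixes s r :: "'a::comm_ring_1 fps"
  shows "(\<forall>m<N. fps_nth s m = fps_nth r m) \<longleftrightarrow> (\<exists>u. s = r + fps_X ^ N * u)"
proof
  assume *: "\<forall>m<N. fps_nth s m = fps_nth r m"
  have "s = r + fps_X ^ N * fps_shift N (s - r)"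
    by (rule fps_ext) (use * in \<open>auto simp: fps_X_power_mult_nth\<close>)
  then show "\<exists>u. s = r + fps_X ^ N * u" by blast
qed (auto simp: fps_X_power_mult_nth)

lemma pqpoch_stable:
  assumes "m < N"
  shows "fps_nth (pqpoch N x) m = fps_nth (pqpoch (Suc m) x) m"
  using assms
proof (induction N)
  case (Suc N)
  show ?case
  proof (cases "m = N")
    case False
    then have "m < N" using Suc.prems by simp
    have g: "P * (1 - x * y) = P - y * (x * P)" for P y :: series
      by (simp add: algebra_simps)
    have "pqpoch (Suc N) x = pqpoch N x - fps_X ^ (2 * N) * (x * pqpoch N x)"
      unfolding pqpoch_def prod.lessThan_Suc ser_t_def power_mult [symmetric] by (rule g)
    then have "fps_nth (pqpoch (Suc N) x) m = fps_nth (pqpoch N x) m"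
      using \<open>m < N\<close> by (simp add: fps_X_power_mult_nth)
    then show ?thesis using Suc.IH[OF \<open>m < N\<close>] by simp
  qed simp
qed simp

text \<open>Since q = t^2, a factor with large j changes only coefficients of high order in t. The
  partial products stabilise coefficientwise, and their limit is nonzero because its constant term
  is 1, so \<open>prodinf\<close> is this limit.\<close>

lemma qpoch_nth:
  assumes "ccoef x = 0" "m < N"
  shows "fps_nth (qpoch x) m = fps_nth (pqpoch N x) m"
proof -
  define L where "L = Abs_fps (\<lambda>m. fps_nth (pqpoch (Suc m) x) m)"
  have P: "(\<Prod>j\<le>n. 1 - x * (ser_t\<^sup>2) ^ j) = pqpoch (Suc n) x" for n
    by (simp add: pqpoch_def lessThan_Suc_atMost)
  have "(\<lambda>n. \<Prod>j\<le>n. 1 - x * (ser_t\<^sup>2) ^ j) \<longlonglongrightarrow> L"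
  proof (rule tendsto_fpsI)
    fix m
    show "\<forall>\<^sub>F n in sequentially. fps_nth (\<Prod>j\<le>n. 1 - x * (ser_t\<^sup>2) ^ j) m = fps_nth L m"
      using eventually_ge_at_top[of m]
    proof eventually_elim
      case (elim n)
      then show ?case unfolding P L_def using pqpoch_stable[of m "Suc n" x] by simp
    qed
  qed
  moreover have "L \<noteq> 0"
  proof
    assume "L = 0"
    then have "fps_nth L 0 = 0" by simp
    then have "fps_nth (1 - x) 0 = 0" by (simp add: L_def pqpoch_def)
    then have "ccoef (1 - x) = 0" by (simp add: ccoef_def)
    then show False using assms by (simp add: ccoef_hom)
  qed
  ultimately have "(\<lambda>j. 1 - x * (ser_t\<^sup>2) ^ j) has_prod L"
    by (simp add: has_prod_def raw_has_prod_def)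
  then have "qpoch x = L" unfolding qpoch_def by (metis has_prod_unique)
  then show ?thesis using pqpoch_stable[OF assms(2), of x] by (simp add: L_def)
qed

lemma qpoch_approx:
  assumes "ccoef x = 0"
  shows "\<exists>u. qpoch x = pqpoch N x + ser_t ^ N * u"
  using qpoch_nth[OF assms] fps_X_power_factor[of N "qpoch x" "pqpoch N x"] by (simp add: ser_t_def)

text \<open>Congruence to the partial products modulo all powers of t characterises the symbol,
  which transports it through every homomorphism fixing t.\<close>

lemma qpoch_unique:
  assumes "ccoef x = 0" "\<And>N. \<exists>u. s = pqpoch N x + ser_t ^ N * u"
  shows "s = qpoch x"
proof (rule fps_ext)
  fix m
  obtain u where "s = pqpoch (Suc m) x + ser_t ^ Suc m * u" using assms(2) by blast
  then have "fps_nth s m = fps_nth (pqpoch (Suc m) x) m"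
    using fps_X_power_factor[of "Suc m" s "pqpoch (Suc m) x"] by (auto simp: ser_t_def)
  then show "fps_nth s m = fps_nth (qpoch x) m" using qpoch_nth[OF assms(1), of m "Suc m"] by simp
qed

lemma qpoch_step:
  assumes "ccoef x = 0"
  shows "qpoch x = (1 - x) * qpoch (x * ser_t\<^sup>2)"
proof (rule qpoch_unique[OF assms, symmetric])
  fix N
  have c: "ccoef (x * ser_t\<^sup>2) = 0" by (simp add: ccoef_hom assms)
  obtain u where u: "qpoch (x * ser_t\<^sup>2) = pqpoch N (x * ser_t\<^sup>2) + ser_t ^ N * u"
    using qpoch_approx[OF c] by blast
  have "(1 - x) * pqpoch N (x * ser_t\<^sup>2) = pqpoch (Suc N) x"
    unfolding pqpoch_def by (subst prod.lessThan_Suc_shift) (simp add: mult.assoc mult.left_commute)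
  also have "\<dots> = pqpoch N x + ser_t ^ N * (- (x * ser_t ^ N * pqpoch N x))"
    by (simp add: pqpoch_def algebra_simps power2_eq_square power_mult_distrib)
  finally have "(1 - x) * qpoch (x * ser_t\<^sup>2) =
      pqpoch N x + ser_t ^ N * (- (x * ser_t ^ N * pqpoch N x) + (1 - x) * u)"
    unfolding u distrib_left by (simp add: algebra_simps)
  then show "\<exists>u. (1 - x) * qpoch (x * ser_t\<^sup>2) = pqpoch N x + ser_t ^ N * u" by blast
qed

lemma ccoef_qpoch: "ccoef x = 0 \<Longrightarrow> ccoef (qpoch x) = 1"
  using qpoch_nth[of x 0 1] by (simp add: ccoef_def pqpoch_def)

section \<open>Substitutions in the three-variable series\<close>

locale series_hom =
  fixes \<theta> :: "series \<Rightarrow> series"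
  assumes add: "\<theta> (s + r) = \<theta> s + \<theta> r" and mult: "\<theta> (s * r) = \<theta> s * \<theta> r"
    and one: "\<theta> 1 = 1" and t: "\<theta> ser_t = ser_t"
begin

lemma zero: "\<theta> 0 = 0"
  using add[of 0 0] by (metis add_0_left add_cancel_right_left)

lemma minus: "\<theta> (s - r) = \<theta> s - \<theta> r"
  using add[of "s - r" r] by simp

lemma power: "\<theta> (s ^ n) = \<theta> s ^ n"
  by (induction n) (simp_all add: one mult)

lemma pqpoch: "\<theta> (pqpoch N x) = pqpoch N (\<theta> x)"
  unfolding pqpoch_def by (induction N) (simp_all add: one mult minus power t)

lemma qpoch:
  assumes "ccoef x = 0" "ccoef (\<theta> x) = 0"
  shows "\<theta> (qpoch x) = qpoch (\<theta> x)"
proof (rule qpoch_unique[OF assms(2)])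
  fix N
  obtain u where "qpoch x = pqpoch N x + ser_t ^ N * u" using qpoch_approx[OF assms(1)] by blast
  then have "\<theta> (qpoch x) = pqpoch N (\<theta> x) + ser_t ^ N * \<theta> u"
    by (simp add: add mult pqpoch power t)
  then show "\<exists>u. \<theta> (qpoch x) = pqpoch N (\<theta> x) + ser_t ^ N * u" by blast
qed

lemma inverse:
  assumes "ccoef s \<noteq> 0"
  shows "\<theta> (inverse s) = inverse (\<theta> s)"
  using series_inverse[OF assms] mult one by (metis series_inverse_unique)

end

text \<open>Exchange of z and w; with w = q^(1/2)/z this is the substitution z -> q^(1/2)/z.\<close>

definition ser_swap :: "series \<Rightarrow> series" where
  "ser_swap s = Abs_fps (\<lambda>m. Abs_fps (\<lambda>j. Abs_fps (\<lambda>i. fps_nth (fps_nth (fps_nth s m) i) j)))"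

text \<open>The substitution \<open>z \<mapsto> t z\<close>.\<close>

definition ser_scale :: "series \<Rightarrow> series" where
  "ser_scale s = Abs_fps (\<lambda>m. Abs_fps (\<lambda>j. Abs_fps (\<lambda>i.
     if i \<le> m then fps_nth (fps_nth (fps_nth s (m - i)) j) i else 0)))"

lemma ser_const_nth: "fps_nth (fps_nth (fps_nth (ser_const x) m) j) i = (if m = 0 \<and> j = 0 \<and> i = 0 then x else 0)"
  by (auto simp: ser_const_def fps_const_def)

lemma ser_gen_nth:
  "fps_nth (fps_nth (fps_nth ser_z m) j) i = (if m = 0 \<and> j = 0 \<and> i = 1 then 1 else 0)"
  "fps_nth (fps_nth (fps_nth ser_w m) j) i = (if m = 0 \<and> j = 1 \<and> i = 0 then 1 else 0)"
  "fps_nth (fps_nth (fps_nth ser_t m) j) i = (if m = 1 \<and> j = 0 \<and> i = 0 then 1 else 0)"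
  "fps_nth (fps_nth (fps_nth (1 :: series) m) j) i = (if m = 0 \<and> j = 0 \<and> i = 0 then 1 else 0)"
  by (auto simp: ser_z_def ser_w_def ser_t_def fps_X_def)

lemma ser_mult_gen_nth:
  "fps_nth (fps_nth (fps_nth (ser_t * s) m) j) i = (if m = 0 then 0 else fps_nth (fps_nth (fps_nth s (m - 1)) j) i)"
  "fps_nth (fps_nth (fps_nth (ser_w * s) m) j) i = (if j = 0 then 0 else fps_nth (fps_nth (fps_nth s m) (j - 1)) i)"
  "fps_nth (fps_nth (fps_nth (ser_z * s) m) j) i = (if i = 0 then 0 else fps_nth (fps_nth (fps_nth s m) j) (i - 1))"
  "fps_nth (fps_nth (fps_nth (ser_const x * s) m) j) i = x * fps_nth (fps_nth (fps_nth s m) j) i"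
  by (simp_all add: ser_t_def ser_w_def ser_z_def ser_const_def)

lemma ser_swap_hom: "series_hom ser_swap"
proof
  fix s r :: series
  show "ser_swap (s + r) = ser_swap s + ser_swap r" by (rule series_eqI) (simp add: ser_swap_def)
  show "ser_swap (s * r) = ser_swap s * ser_swap r"
  proof (rule series_eqI)
    fix m j i
    show "fps_nth (fps_nth (fps_nth (ser_swap (s * r)) m) j) i = fps_nth (fps_nth (fps_nth (ser_swap s * ser_swap r) m) j) i"
      unfolding series_mult_nth unfolding ser_swap_def fps_nth_Abs_fps series_mult_nth
      by (intro sum.cong[OF refl] sum.swap)
  qed
  show "ser_swap 1 = 1" "ser_swap ser_t = ser_t"
    by (rule series_eqI; simp add: ser_swap_def ser_gen_nth; blast)+
qed

lemma ser_swap_gen: "ser_swap ser_z = ser_w" "ser_swap ser_w = ser_z" "ser_swap (ser_const x) = ser_const x"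
  by (rule series_eqI; simp add: ser_swap_def ser_gen_nth ser_const_nth; blast)+

lemma ser_scale_hom: "series_hom ser_scale"
proof
  fix s r :: series
  show "ser_scale (s + r) = ser_scale s + ser_scale r" by (rule series_eqI) (simp add: ser_scale_def)
  show "ser_scale (s * r) = ser_scale s * ser_scale r"
  proof (rule series_eqI)
    fix m j i
    let ?S = "\<lambda>a b c. fps_nth (fps_nth (fps_nth s a) b) c" and ?R = "\<lambda>a b c. fps_nth (fps_nth (fps_nth r a) b) c"
    \<comment> \<open>The powers of t contributed by z^c and z^(i-c) add up to t^i, so the summation
      over a only has to be translated by c.\<close>
    have *: "(\<Sum>a\<le>m. (if c \<le> a then ?S (a - c) b c else 0) * (if i - c \<le> m - a then ?R (m - a - (i - c)) (j - b) (i - c) else 0))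
       = (if i \<le> m then \<Sum>a\<le>m - i. ?S a b c * ?R (m - i - a) (j - b) (i - c) else 0)"
      (is "(\<Sum>a\<le>m. ?F a) = _") if c: "c \<le> i" for b c
    proof (cases "i \<le> m")
      case True
      have "(\<Sum>a\<le>m. ?F a) = (\<Sum>a\<in>(\<lambda>a. a + c) ` {..m - i}. ?F a)"
      proof (rule sum.mono_neutral_right)
        show "(\<lambda>a. a + c) ` {..m - i} \<subseteq> {..m}" using True c by auto
        show "\<forall>a\<in>{..m} - (\<lambda>a. a + c) ` {..m - i}. ?F a = 0"
        proof
          fix a
          assume a: "a \<in> {..m} - (\<lambda>a. a + c) ` {..m - i}"
          have "\<not> (c \<le> a \<and> i - c \<le> m - a)"
          proof
            assume "c \<le> a \<and> i - c \<le> m - a"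
            then have "a = (a - c) + c" "a - c \<in> {..m - i}" using True c a by auto
            then show False using a by blast
          qed
          then show "?F a = 0" by auto
        qed
      qed simp
      also have "\<dots> = (\<Sum>a\<le>m - i. ?F (a + c))"
        by (subst sum.reindex) (auto simp: inj_on_def)
      also have "\<dots> = (\<Sum>a\<le>m - i. ?S a b c * ?R (m - i - a) (j - b) (i - c))"
      proof (rule sum.cong[OF refl])
        fix a
        assume a: "a \<in> {..m - i}"
        have "i - c \<le> m - (a + c)" "m - (a + c) - (i - c) = m - i - a" using a True c by auto
        then show "?F (a + c) = ?S a b c * ?R (m - i - a) (j - b) (i - c)" by simp
      qed
      finally show ?thesis using True by simp
    next
      case False
      have "?F a = 0" if "a \<le> m" for a
        using False c that by auto
      then show ?thesis using False by (simp add: sum.neutral)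
    qed
    have "fps_nth (fps_nth (fps_nth (ser_scale s * ser_scale r) m) j) i =
       (\<Sum>b\<le>j. \<Sum>c\<le>i. \<Sum>a\<le>m. (if c \<le> a then ?S (a - c) b c else 0) *
          (if i - c \<le> m - a then ?R (m - a - (i - c)) (j - b) (i - c) else 0))"
      unfolding series_mult_nth unfolding ser_scale_def fps_nth_Abs_fps
      by (subst sum.swap, intro sum.cong[OF refl] sum.swap)
    also have "\<dots> = (\<Sum>b\<le>j. \<Sum>c\<le>i. (if i \<le> m then \<Sum>a\<le>m - i. ?S a b c * ?R (m - i - a) (j - b) (i - c) else 0))"
      by (intro sum.cong[OF refl] *) simp
    also have "\<dots> = (if i \<le> m then \<Sum>b\<le>j. \<Sum>c\<le>i. \<Sum>a\<le>m - i. ?S a b c * ?R (m - i - a) (j - b) (i - c) else 0)"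
      by simp
    also have "(\<Sum>b\<le>j. \<Sum>c\<le>i. \<Sum>a\<le>m - i. ?S a b c * ?R (m - i - a) (j - b) (i - c)) =
        (\<Sum>b\<le>j. \<Sum>a\<le>m - i. \<Sum>c\<le>i. ?S a b c * ?R (m - i - a) (j - b) (i - c))"
      by (intro sum.cong[OF refl] sum.swap)
    also have "\<dots> = (\<Sum>a\<le>m - i. \<Sum>b\<le>j. \<Sum>c\<le>i. ?S a b c * ?R (m - i - a) (j - b) (i - c))"
      by (rule sum.swap)
    finally show "fps_nth (fps_nth (fps_nth (ser_scale (s * r)) m) j) i = fps_nth (fps_nth (fps_nth (ser_scale s * ser_scale r) m) j) i"
      unfolding ser_scale_def fps_nth_Abs_fps series_mult_nth by simp
  qed
  show "ser_scale 1 = 1" "ser_scale ser_t = ser_t"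
    by (rule series_eqI; auto simp: ser_scale_def ser_gen_nth)+
qed

lemma ser_scale_gen: "ser_scale ser_z = ser_t * ser_z" "ser_scale ser_w = ser_w" "ser_scale (ser_const x) = ser_const x"
  by (rule series_eqI; auto simp: ser_scale_def ser_gen_nth ser_const_nth ser_mult_gen_nth)+

interpretation swap: series_hom ser_swap by (rule ser_swap_hom)
interpretation scale: series_hom ser_scale by (rule ser_scale_hom)

lemma ser_swap_swap: "ser_swap (ser_swap s) = s"
  by (rule series_eqI) (simp add: ser_swap_def)

definition ser_scale_w :: "series \<Rightarrow> series" where
  "ser_scale_w s = ser_swap (ser_scale (ser_swap s))"

lemma ser_scale_w_hom: "series_hom ser_scale_w"
  by unfold_locales
    (simp_all add: ser_scale_w_def swap.add swap.mult swap.one swap.t scale.add scale.mult scale.one scale.t)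

interpretation scale_w: series_hom ser_scale_w by (rule ser_scale_w_hom)

lemma ser_scale_w_gen: "ser_scale_w ser_z = ser_z" "ser_scale_w ser_w = ser_t * ser_w" "ser_scale_w (ser_const x) = ser_const x"
  by (simp_all add: ser_scale_w_def ser_swap_gen ser_scale_gen swap.mult swap.t)

text \<open>The coefficient of \<open>z^n\<close> after the substitution \<open>w = t z^(-1)\<close>.\<close>

definition zcoef :: "series \<Rightarrow> int \<Rightarrow> kk fps" where
  "zcoef s n = Abs_fps (\<lambda>l. \<Sum>j\<le>l. if 0 \<le> n + int j then fps_nth (fps_nth (fps_nth s (l - j)) j) (nat (n + int j)) else 0)"

lemma Delta_eq: "Delta n = fps_to_fls (zcoef Delta_series n)"
proof -
  have *: "{j. j \<le> l \<and> 0 \<le> n + int j} = {j\<in>{..l}. 0 \<le> n + int j}" for l by auto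
  show ?thesis unfolding Delta_def zcoef_def * by (simp only: sum.inter_filter[OF finite_atMost])
qed

lemma zcoef_add: "zcoef (s + r) n = zcoef s n + zcoef r n"
  by (rule fps_ext) (auto simp: zcoef_def sum.distrib [symmetric] intro!: sum.cong)

lemma zcoef_const: "zcoef (ser_const x * s) n = fps_const x * zcoef s n"
  by (rule fps_ext) (auto simp: zcoef_def ser_mult_gen_nth sum_distrib_left intro!: sum.cong)

lemma zcoef_diff: "zcoef (s - r) n = zcoef s n - zcoef r n"
  using zcoef_add[of "s - r" r n] by simp

lemma zcoef_t: "zcoef (ser_t * s) n = fps_X * zcoef s n"
proof (rule fps_ext)
  fix l
  show "fps_nth (zcoef (ser_t * s) n) l = fps_nth (fps_X * zcoef s n) l"
  proof (cases l)
    case (Suc k)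
    have "(\<Sum>j\<le>Suc k. if 0 \<le> n + int j then fps_nth (fps_nth (fps_nth (ser_t * s) (Suc k - j)) j) (nat (n + int j)) else 0) =
       (\<Sum>j\<le>k. if 0 \<le> n + int j then fps_nth (fps_nth (fps_nth s (k - j)) j) (nat (n + int j)) else 0)"
      by (auto simp: ser_mult_gen_nth Suc_diff_le simp del: fps_mult_nth_0 intro!: sum.cong)
    then show ?thesis unfolding Suc by (simp add: zcoef_def)
  next
    case 0
    have "(\<Sum>j\<le>(0::nat). F j) = F 0" for F :: "nat \<Rightarrow> kk" by simp
    then show ?thesis unfolding 0 zcoef_def fps_nth_Abs_fps
      by (simp only: diff_self_eq_0 ser_mult_gen_nth) simp
  qed
qed

lemma zcoef_w: "zcoef (ser_w * s) n = fps_X * zcoef s (n + 1)"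
proof (rule fps_ext)
  fix l
  show "fps_nth (zcoef (ser_w * s) n) l = fps_nth (fps_X * zcoef s (n + 1)) l"
  proof (cases l)
    case (Suc k)
    have "(\<Sum>j\<le>Suc k. if 0 \<le> n + int j then fps_nth (fps_nth (fps_nth (ser_w * s) (Suc k - j)) j) (nat (n + int j)) else 0) =
       (\<Sum>j\<le>k. if 0 \<le> n + 1 + int j then fps_nth (fps_nth (fps_nth s (k - j)) j) (nat (n + 1 + int j)) else 0)"
      by (subst sum.atMost_Suc_shift) (auto simp: ser_mult_gen_nth add.assoc simp del: fps_mult_nth_0 intro!: sum.cong)
    then show ?thesis unfolding Suc by (simp add: zcoef_def)
  next
    case 0
    have "(\<Sum>j\<le>(0::nat). F j) = F 0" for F :: "nat \<Rightarrow> kk" by simp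
    then show ?thesis unfolding 0 zcoef_def fps_nth_Abs_fps
      by (simp only: diff_self_eq_0 ser_mult_gen_nth) simp
  qed
qed

lemma zcoef_z: "zcoef (ser_z * s) n = zcoef s (n - 1)"
proof (rule fps_ext)
  fix l
  have "(if 0 \<le> n + int j then fps_nth (fps_nth (fps_nth (ser_z * s) (l - j)) j) (nat (n + int j)) else 0) =
     (if 0 \<le> n - 1 + int j then fps_nth (fps_nth (fps_nth s (l - j)) j) (nat (n - 1 + int j)) else 0)" for j
  proof -
    have "nat (n + int j) - 1 = nat (n - 1 + int j)" by simp
    then show ?thesis by (auto simp: ser_mult_gen_nth)
  qed
  then show "fps_nth (zcoef (ser_z * s) n) l = fps_nth (zcoef s (n - 1)) l" by (simp add: zcoef_def)
qed

text \<open>The coefficient of z^p in s(tz, t/z), as a series in t. For s symmetric in its two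
  arguments it is also the coefficient of z^(-p).\<close>

definition diag_coef :: "series \<Rightarrow> nat \<Rightarrow> kk fps" where
  "diag_coef s p = Abs_fps (\<lambda>l. \<Sum>j\<le>l. if p + 2 * j \<le> l then fps_nth (fps_nth (fps_nth s (l - p - 2 * j)) j) (p + j) else 0)"

lemma zcoef_scale_pos: "zcoef (ser_scale s) (int p) = diag_coef s p"
proof (rule fps_ext)
  fix l
  have "(if 0 \<le> int p + int j then fps_nth (fps_nth (fps_nth (ser_scale s) (l - j)) j) (nat (int p + int j)) else 0) =
      (if p + 2 * j \<le> l then fps_nth (fps_nth (fps_nth s (l - p - 2 * j)) j) (p + j) else 0)" if "j \<le> l" for j
  proof -
    have "nat (int p + int j) = p + j" by simp
    moreover have "(p + j \<le> l - j) = (p + 2 * j \<le> l)" using that by auto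
    moreover have "l - j - (p + j) = l - p - 2 * j" by simp
    ultimately show ?thesis by (simp add: ser_scale_def)
  qed
  then show "fps_nth (zcoef (ser_scale s) (int p)) l = fps_nth (diag_coef s p) l"
    unfolding zcoef_def diag_coef_def fps_nth_Abs_fps by (intro sum.cong) auto
qed

lemma sum_shift_index:
  fixes f :: "nat \<Rightarrow> 'a::comm_monoid_add"
  assumes "\<And>j. j < p \<Longrightarrow> f j = 0" "\<And>j. j + p \<le> l \<Longrightarrow> f (j + p) = g j" "\<And>j. l < j + p \<Longrightarrow> j \<le> l \<Longrightarrow> g j = 0"
  shows "(\<Sum>j\<le>l. f j) = (\<Sum>j\<le>l. g j)"
proof -
  have "(\<Sum>j\<le>l. f j) = (\<Sum>j\<in>{p..l}. f j)"
    by (rule sum.mono_neutral_right) (use assms(1) in auto)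
  also have "\<dots> = (\<Sum>j\<in>{j. j + p \<le> l}. f (j + p))"
    by (rule sum.reindex_bij_witness[of _ "\<lambda>j. j + p" "\<lambda>j. j - p"]) auto
  also have "\<dots> = (\<Sum>j\<in>{j. j + p \<le> l}. g j)"
    by (rule sum.cong) (use assms(2) in auto)
  also have "\<dots> = (\<Sum>j\<le>l. g j)"
  proof (rule sum.mono_neutral_left)
    show "\<forall>j\<in>{..l} - {j. j + p \<le> l}. g j = 0" using assms(3) by (auto simp: not_le)
  qed auto
  finally show ?thesis .
qed

lemma zcoef_scale_neg:
  assumes "ser_swap s = s"
  shows "zcoef (ser_scale s) (- int p) = diag_coef s p"
proof (rule fps_ext)
  fix l
  have sym: "fps_nth (fps_nth (fps_nth s m) i) j = fps_nth (fps_nth (fps_nth s m) j) i" for m i j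
    by (subst assms[symmetric]) (simp add: ser_swap_def)
  show "fps_nth (zcoef (ser_scale s) (- int p)) l = fps_nth (diag_coef s p) l"
    unfolding zcoef_def diag_coef_def fps_nth_Abs_fps
  proof (rule sum_shift_index[where p = p])
    fix j
    assume l: "j + p \<le> l"
    have "l - (j + p) - j = l - p - 2 * j" by simp
    moreover have "(j \<le> l - (j + p)) = (p + 2 * j \<le> l)" using l by auto
    moreover have "nat (- int p + int (j + p)) = j" by simp
    ultimately show "(if 0 \<le> - int p + int (j + p) then fps_nth (fps_nth (fps_nth (ser_scale s) (l - (j + p))) (j + p)) (nat (- int p + int (j + p))) else 0) =
         (if p + 2 * j \<le> l then fps_nth (fps_nth (fps_nth s (l - p - 2 * j)) j) (p + j) else 0)"
      using sym[of "l - p - 2 * j" j "p + j"] by (simp add: ser_scale_def add.commute)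
  qed auto
qed

lemma ser_scale_w_nth: "fps_nth (fps_nth (fps_nth (ser_scale_w s) m) j) i =
    (if j \<le> m then fps_nth (fps_nth (fps_nth s (m - j)) j) i else 0)"
  by (simp add: ser_scale_w_def ser_swap_def ser_scale_def)

text \<open>Here the series is s(z, t^2/z), which is s(t y, t/y) for z = t y; the power of t is the
  effect of this rescaling on z^p.\<close>

lemma zcoef_scale_w_pos: "fps_X ^ p * zcoef (ser_scale_w s) (int p) = diag_coef s p"
proof (rule fps_ext)
  fix l
  show "fps_nth (fps_X ^ p * zcoef (ser_scale_w s) (int p)) l = fps_nth (diag_coef s p) l"
  proof (cases "l < p")
    case True
    then have "fps_nth (diag_coef s p) l = 0"
      unfolding diag_coef_def fps_nth_Abs_fps by (intro sum.neutral) auto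
    then show ?thesis using True by (simp add: fps_X_power_mult_nth)
  next
    case False
    have "fps_nth (fps_X ^ p * zcoef (ser_scale_w s) (int p)) l =
        (\<Sum>j\<le>l - p. fps_nth (fps_nth (fps_nth (ser_scale_w s) (l - p - j)) j) (nat (int p + int j)))"
      using False by (simp add: fps_X_power_mult_nth zcoef_def)
    also have "\<dots> = (\<Sum>j\<le>l - p. if p + 2 * j \<le> l then fps_nth (fps_nth (fps_nth s (l - p - 2 * j)) j) (p + j) else 0)"
    proof (rule sum.cong[OF refl])
      fix j
      assume j: "j \<in> {..l - p}"
      then have "(j \<le> l - p - j) = (p + 2 * j \<le> l)" "l - p - j - j = l - p - 2 * j" "nat (int p + int j) = p + j"
        using False by auto
      then show "fps_nth (fps_nth (fps_nth (ser_scale_w s) (l - p - j)) j) (nat (int p + int j)) =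
          (if p + 2 * j \<le> l then fps_nth (fps_nth (fps_nth s (l - p - 2 * j)) j) (p + j) else 0)"
        by (simp add: ser_scale_w_nth)
    qed
    also have "\<dots> = fps_nth (diag_coef s p) l"
      unfolding diag_coef_def fps_nth_Abs_fps
      by (rule sum.mono_neutral_left) (use False in auto)
    finally show ?thesis .
  qed
qed

lemma zcoef_scale_w_neg:
  assumes "ser_swap s = s"
  shows "zcoef (ser_scale_w s) (- int p) = fps_X ^ p * diag_coef s p"
proof (rule fps_ext)
  fix l
  have sym: "fps_nth (fps_nth (fps_nth s m) i) j = fps_nth (fps_nth (fps_nth s m) j) i" for m i j
    by (subst assms[symmetric]) (simp add: ser_swap_def)
  have "fps_nth (zcoef (ser_scale_w s) (- int p)) l =
      (\<Sum>j\<le>l. if 2 * p + 2 * j \<le> l then fps_nth (fps_nth (fps_nth s (l - 2 * p - 2 * j)) j) (p + j) else 0)"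
    unfolding zcoef_def fps_nth_Abs_fps
  proof (rule sum_shift_index[where p = p])
    fix j
    assume l: "j + p \<le> l"
    have "l - (j + p) - (j + p) = l - 2 * p - 2 * j" by simp
    moreover have "(j + p \<le> l - (j + p)) = (2 * p + 2 * j \<le> l)" using l by auto
    moreover have "nat (- int p + int (j + p)) = j" by simp
    ultimately show "(if 0 \<le> - int p + int (j + p) then fps_nth (fps_nth (fps_nth (ser_scale_w s) (l - (j + p))) (j + p)) (nat (- int p + int (j + p))) else 0) =
         (if 2 * p + 2 * j \<le> l then fps_nth (fps_nth (fps_nth s (l - 2 * p - 2 * j)) j) (p + j) else 0)"
      using sym[of "l - 2 * p - 2 * j" j "p + j"] by (simp add: ser_scale_w_nth add.commute)
  qed auto
  also have "\<dots> = fps_nth (fps_X ^ p * diag_coef s p) l"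
  proof (cases "l < p")
    case True
    then show ?thesis by (auto simp: fps_X_power_mult_nth intro!: sum.neutral)
  next
    case False
    have "(\<Sum>j\<le>l. if 2 * p + 2 * j \<le> l then fps_nth (fps_nth (fps_nth s (l - 2 * p - 2 * j)) j) (p + j) else 0) =
      (\<Sum>j\<le>l - p. if 2 * p + 2 * j \<le> l then fps_nth (fps_nth (fps_nth s (l - 2 * p - 2 * j)) j) (p + j) else 0)"
      by (rule sum.mono_neutral_right) auto
    also have "\<dots> = (\<Sum>j\<le>l - p. if p + 2 * j \<le> l - p then fps_nth (fps_nth (fps_nth s (l - p - p - 2 * j)) j) (p + j) else 0)"
    proof (rule sum.cong[OF refl])
      fix j
      have "(2 * p + 2 * j \<le> l) = (p + 2 * j \<le> l - p)" "l - 2 * p - 2 * j = l - p - p - 2 * j"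
        using False by auto
      then show "(if 2 * p + 2 * j \<le> l then fps_nth (fps_nth (fps_nth s (l - 2 * p - 2 * j)) j) (p + j) else 0) =
         (if p + 2 * j \<le> l - p then fps_nth (fps_nth (fps_nth s (l - p - p - 2 * j)) j) (p + j) else 0)"
        by simp
    qed
    finally show ?thesis using False by (simp add: fps_X_power_mult_nth diag_coef_def)
  qed
  finally show "fps_nth (zcoef (ser_scale_w s) (- int p)) l = fps_nth (fps_X ^ p * diag_coef s p) l" .
qed

lemma series_inverse_mult:
  fixes l l1 l2 :: series
  assumes "l = l1 * l2" "l1 * inverse l1 = 1" "l2 * inverse l2 = 1"
  shows "l * (inverse l1 * inverse l2) = 1"
proof -
  have "l * (inverse l1 * inverse l2) = (l1 * inverse l1) * (l2 * inverse l2)"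
    unfolding assms(1) by (simp only: ac_simps)
  then show ?thesis using assms by simp
qed

section \<open>Hidden symmetries of the weight\<close>

definition gamma_ser :: "series \<Rightarrow> series \<Rightarrow> series \<Rightarrow> series \<Rightarrow> series \<Rightarrow> series" where
  "gamma_ser A B C D x = qpoch (x\<^sup>2) * inverse (qpoch (A * x) * qpoch (B * x) * qpoch (C * x) * qpoch (D * x))"

lemma (in series_hom) gamma_ser:
  assumes "ccoef x = 0" "ccoef (\<theta> x) = 0"
  shows "\<theta> (gamma_ser A B C D x) = gamma_ser (\<theta> A) (\<theta> B) (\<theta> C) (\<theta> D) (\<theta> x)"
proof -
  have c: "ccoef (qpoch (E * x)) = 1" "ccoef (qpoch (E * \<theta> x)) = 1" for E
    using assms by (simp_all add: ccoef_qpoch ccoef_hom)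
  have q: "\<theta> (qpoch (E * x)) = qpoch (\<theta> E * \<theta> x)" for E
    using assms by (subst qpoch) (simp_all add: ccoef_hom mult)
  have q2: "\<theta> (qpoch (x\<^sup>2)) = qpoch ((\<theta> x)\<^sup>2)"
    using assms by (subst qpoch) (simp_all add: ccoef_hom mult power2_eq_square)
  show ?thesis
    unfolding gamma_ser_def by (simp add: mult q q2 inverse ccoef_hom c)
qed

definition ca :: series where "ca = ser_const par_a"
definition cb :: series where "cb = ser_const par_b"
definition cc :: series where "cc = ser_const (par_c * qpow (-1/2))"
definition cd :: series where "cd = ser_const (par_d * qpow (-1/2))"

lemmas const_defs = ca_def cb_def cc_def cd_def

lemma ccoef_gen: "ccoef ser_z = 0" "ccoef ser_w = 0" "ccoef ser_t = 0"
  by (simp_all add: ccoef_def ser_gen_nth)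

lemma Delta_series_eq: "Delta_series = qpoch (ser_z\<^sup>2) * qpoch (ser_w\<^sup>2) * inverse
    (qpoch (ca * ser_z) * qpoch (cb * ser_z) * qpoch (cc * ser_t * ser_z) * qpoch (cd * ser_t * ser_z) *
     qpoch (ca * ser_t * ser_w) * qpoch (cb * ser_t * ser_w) * qpoch (cc * ser_w) * qpoch (cd * ser_w))"
  by (simp only: Delta_series_def Let_def const_defs)

lemma qpoch_step': "ccoef x = 0 \<Longrightarrow> y = x * ser_t\<^sup>2 \<Longrightarrow> qpoch x = (1 - x) * qpoch y"
  using qpoch_step by simp

text \<open>Splitting off the first factors of the symbols of z^2, az and bz leaves a series in tz
  and w that is invariant under their exchange.\<close>

lemma Delta_series_ab:
  fixes H
  defines "H \<equiv> gamma_ser (ca * ser_t) (cb * ser_t) cc cd ser_z * gamma_ser (ca * ser_t) (cb * ser_t) cc cd ser_w"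
  shows "(1 - ca * ser_z) * ((1 - cb * ser_z) * Delta_series) = (1 - ser_z * ser_z) * ser_scale H"
    and "ser_swap H = H"
proof -
  have s: "ser_scale ca = ca" "ser_scale cb = cb" "ser_scale cc = cc" "ser_scale cd = cd"
    "ser_swap ca = ca" "ser_swap cb = cb" "ser_swap cc = cc" "ser_swap cd = cd"
    by (simp_all add: const_defs ser_scale_gen ser_swap_gen)
  show "ser_swap H = H"
    unfolding H_def by (simp add: swap.mult swap.gamma_ser ccoef_gen ser_swap_gen s swap.t mult.commute)
  have H: "ser_scale H = gamma_ser (ca * ser_t) (cb * ser_t) cc cd (ser_t * ser_z) * gamma_ser (ca * ser_t) (cb * ser_t) cc cd ser_w"
    unfolding H_def by (simp add: scale.mult scale.gamma_ser ccoef_gen ccoef_hom ser_scale_gen s scale.t)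
  let ?R = "qpoch (cc * ser_t * ser_z) * qpoch (cd * ser_t * ser_z) *
     qpoch (ca * ser_t * ser_w) * qpoch (cb * ser_t * ser_w) * qpoch (cc * ser_w) * qpoch (cd * ser_w)"
  have st: "qpoch (ser_z\<^sup>2) = (1 - ser_z * ser_z) * qpoch ((ser_t * ser_z)\<^sup>2)"
    "qpoch (ca * ser_z) = (1 - ca * ser_z) * qpoch (ca * ser_t * (ser_t * ser_z))"
    "qpoch (cb * ser_z) = (1 - cb * ser_z) * qpoch (cb * ser_t * (ser_t * ser_z))"
    by (simp_all only: power2_eq_square)
      (rule qpoch_step'; simp add: ccoef_hom ccoef_gen power2_eq_square ac_simps)+
  have c: "ccoef (qpoch (x * ser_z)) = 1" "ccoef (qpoch (x * ser_w)) = 1" "ccoef (qpoch (x * (y * ser_z))) = 1"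
    "ccoef (qpoch (x * (y * ser_w))) = 1" "ccoef (qpoch (x * (y * (y' * ser_z)))) = 1" for x y y'
    by (simp_all add: ccoef_qpoch ccoef_hom ccoef_gen)
  have "(1 - ca * ser_z) * ((1 - cb * ser_z) * Delta_series) =
     ((1 - ca * ser_z) * (1 - cb * ser_z) * qpoch (ser_z\<^sup>2) * qpoch (ser_w\<^sup>2)) * inverse (qpoch (ca * ser_z) * qpoch (cb * ser_z) * ?R)"
    by (simp add: Delta_series_eq mult.assoc)
  also have "\<dots> = ((1 - ser_z * ser_z) * qpoch ((ser_t * ser_z)\<^sup>2) * qpoch (ser_w\<^sup>2)) *
     inverse (qpoch (ca * ser_t * (ser_t * ser_z)) * qpoch (cb * ser_t * (ser_t * ser_z)) * ?R)"
    by (rule series_frac_eq, simp only: ccoef_hom mult.assoc c, simp,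
        simp only: ccoef_hom mult.assoc c, simp, simp only: st, simp only: ac_simps)
  also have "\<dots> = (1 - ser_z * ser_z) * ser_scale H"
  proof -
    have "inverse (qpoch (ca * ser_t * (ser_t * ser_z)) * qpoch (cb * ser_t * (ser_t * ser_z)) * ?R) =
      inverse (qpoch (ca * ser_t * (ser_t * ser_z)) * qpoch (cb * ser_t * (ser_t * ser_z)) * qpoch (cc * (ser_t * ser_z)) * qpoch (cd * (ser_t * ser_z))) *
      inverse (qpoch (ca * ser_t * ser_w) * qpoch (cb * ser_t * ser_w) * qpoch (cc * ser_w) * qpoch (cd * ser_w))"
      (is "inverse ?L = inverse ?L1 * inverse ?L2")
    proof (rule series_inverse_unique)
      have "?L = ?L1 * ?L2" by (simp add: mult.assoc)
      moreover have "?L1 * inverse ?L1 = 1" "?L2 * inverse ?L2 = 1"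
        by (rule series_inverse; simp only: ccoef_hom mult.assoc c; simp)+
      ultimately show "?L * (inverse ?L1 * inverse ?L2) = 1"
        by (rule series_inverse_mult)
    qed
    then show ?thesis unfolding H gamma_ser_def by (simp only: ac_simps)
  qed
  finally show "(1 - ca * ser_z) * ((1 - cb * ser_z) * Delta_series) = (1 - ser_z * ser_z) * ser_scale H" .
qed

text \<open>The counterpart for w: after splitting off the first factors of the symbols of w^2 = q
  z^(-2), c/z and d/z, a series in z and tw remains that is invariant under their exchange.\<close>

lemma Delta_series_cd:
  fixes H
  defines "H \<equiv> gamma_ser ca cb (cc * ser_t) (cd * ser_t) ser_z * gamma_ser ca cb (cc * ser_t) (cd * ser_t) ser_w"
  shows "(1 - cc * ser_w) * ((1 - cd * ser_w) * Delta_series) = (1 - ser_w * ser_w) * ser_scale_w H"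
    and "ser_swap H = H"
proof -
  have s: "ser_scale_w ca = ca" "ser_scale_w cb = cb" "ser_scale_w cc = cc" "ser_scale_w cd = cd"
    "ser_swap ca = ca" "ser_swap cb = cb" "ser_swap cc = cc" "ser_swap cd = cd"
    by (simp_all add: const_defs ser_scale_w_gen ser_swap_gen)
  show "ser_swap H = H"
    unfolding H_def by (simp add: swap.mult swap.gamma_ser ccoef_gen ser_swap_gen s swap.t mult.commute)
  have H: "ser_scale_w H = gamma_ser ca cb (cc * ser_t) (cd * ser_t) ser_z * gamma_ser ca cb (cc * ser_t) (cd * ser_t) (ser_t * ser_w)"
    unfolding H_def by (simp add: scale_w.mult scale_w.gamma_ser ccoef_gen ccoef_hom ser_scale_w_gen s scale_w.t)
  let ?R = "qpoch (ca * ser_z) * qpoch (cb * ser_z) * qpoch (cc * ser_t * ser_z) * qpoch (cd * ser_t * ser_z) *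
     qpoch (ca * ser_t * ser_w) * qpoch (cb * ser_t * ser_w)"
  have st: "qpoch (ser_w\<^sup>2) = (1 - ser_w * ser_w) * qpoch ((ser_t * ser_w)\<^sup>2)"
    "qpoch (cc * ser_w) = (1 - cc * ser_w) * qpoch (cc * ser_t * (ser_t * ser_w))"
    "qpoch (cd * ser_w) = (1 - cd * ser_w) * qpoch (cd * ser_t * (ser_t * ser_w))"
    by (simp_all only: power2_eq_square)
      (rule qpoch_step'; simp add: ccoef_hom ccoef_gen power2_eq_square ac_simps)+
  have c: "ccoef (qpoch (x * ser_z)) = 1" "ccoef (qpoch (x * ser_w)) = 1" "ccoef (qpoch (x * (y * ser_z))) = 1"
    "ccoef (qpoch (x * (y * ser_w))) = 1" "ccoef (qpoch (x * (y * (y' * ser_w)))) = 1" for x y y'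
    by (simp_all add: ccoef_qpoch ccoef_hom ccoef_gen)
  have "(1 - cc * ser_w) * ((1 - cd * ser_w) * Delta_series) =
     ((1 - cc * ser_w) * (1 - cd * ser_w) * qpoch (ser_z\<^sup>2) * qpoch (ser_w\<^sup>2)) * inverse (?R * qpoch (cc * ser_w) * qpoch (cd * ser_w))"
    by (simp add: Delta_series_eq mult.assoc)
  also have "\<dots> = ((1 - ser_w * ser_w) * qpoch ((ser_t * ser_w)\<^sup>2) * qpoch (ser_z\<^sup>2)) *
     inverse (?R * qpoch (cc * ser_t * (ser_t * ser_w)) * qpoch (cd * ser_t * (ser_t * ser_w)))"
    by (rule series_frac_eq, simp only: ccoef_hom mult.assoc c, simp,
        simp only: ccoef_hom mult.assoc c, simp, simp only: st, simp only: ac_simps)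
  also have "\<dots> = (1 - ser_w * ser_w) * ser_scale_w H"
  proof -
    have "inverse (?R * qpoch (cc * ser_t * (ser_t * ser_w)) * qpoch (cd * ser_t * (ser_t * ser_w))) =
      inverse (qpoch (ca * ser_z) * qpoch (cb * ser_z) * qpoch (cc * ser_t * ser_z) * qpoch (cd * ser_t * ser_z)) *
      inverse (qpoch (ca * (ser_t * ser_w)) * qpoch (cb * (ser_t * ser_w)) * qpoch (cc * ser_t * (ser_t * ser_w)) * qpoch (cd * ser_t * (ser_t * ser_w)))"
      (is "inverse ?L = inverse ?L1 * inverse ?L2")
    proof (rule series_inverse_unique)
      have "?L = ?L1 * ?L2" by (simp add: mult.assoc)
      moreover have "?L1 * inverse ?L1 = 1" "?L2 * inverse ?L2 = 1"
        by (rule series_inverse; simp only: ccoef_hom mult.assoc c; simp)+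
      ultimately show "?L * (inverse ?L1 * inverse ?L2) = 1"
        by (rule series_inverse_mult)
    qed
    then show ?thesis unfolding H gamma_ser_def by (simp only: ac_simps)
  qed
  finally show "(1 - cc * ser_w) * ((1 - cd * ser_w) * Delta_series) = (1 - ser_w * ser_w) * ser_scale_w H" .
qed

text \<open>\<open>Delta_series_ab\<close> in terms of coefficients: multiplied by (1-az)(1-bz), the
  weight is 1 - z^2 times a series invariant under z -> 1/z, with coefficients
  \<open>\<Theta>\<close>.\<close>

lemma Delta_ab:
  shows "\<exists>\<Theta> :: nat \<Rightarrow> kk fls. \<forall>n. Delta n - fls_const (par_a + par_b) * Delta (n - 1) +
    fls_const (par_a * par_b) * Delta (n - 2) = \<Theta> (nat \<bar>n\<bar>) - \<Theta> (nat \<bar>n - 2\<bar>)"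
proof -
  define H where "H = gamma_ser (ca * ser_t) (cb * ser_t) cc cd ser_z * gamma_ser (ca * ser_t) (cb * ser_t) cc cd ser_w"
  note D = Delta_series_ab[folded H_def]
  define \<Theta> where "\<Theta> p = fps_to_fls (diag_coef H p)" for p
  have Z: "zcoef (ser_scale H) n = diag_coef H (nat \<bar>n\<bar>)" for n
  proof (cases "n \<ge> 0")
    case True
    then show ?thesis using zcoef_scale_pos[of H "nat n"] by simp
  next
    case False
    then show ?thesis using zcoef_scale_neg[OF D(2), of "nat (- n)"] by simp
  qed
  have "zcoef ((1 - ca * ser_z) * ((1 - cb * ser_z) * Delta_series)) n = zcoef Delta_series n
     - fps_const par_b * zcoef Delta_series (n - 1) - fps_const par_a * zcoef Delta_series (n - 1)
     + fps_const par_a * (fps_const par_b * zcoef Delta_series (n - 2))" for n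
    unfolding const_defs left_diff_distrib right_diff_distrib
    by (simp add: zcoef_diff zcoef_const zcoef_z mult.assoc right_diff_distrib)
  moreover have "zcoef ((1 - ser_z * ser_z) * ser_scale H) n = zcoef (ser_scale H) n - zcoef (ser_scale H) (n - 2)" for n
    by (simp add: left_diff_distrib zcoef_diff zcoef_z mult.assoc)
  ultimately have "zcoef Delta_series n
     - fps_const par_b * zcoef Delta_series (n - 1) - fps_const par_a * zcoef Delta_series (n - 1)
     + fps_const par_a * (fps_const par_b * zcoef Delta_series (n - 2)) = diag_coef H (nat \<bar>n\<bar>) - diag_coef H (nat \<bar>n - 2\<bar>)" for n
    unfolding D(1) Z by metis
  from arg_cong[OF this, of fps_to_fls] show ?thesis
    by (intro exI[of _ \<Theta>] allI)
      (simp add: \<Theta>_def Delta_eq fls_plus_const [symmetric] fps_to_fls_plus fps_to_fls_minus fls_times_fps_to_fls algebra_simps flip: fls_const_mult_const)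
qed

text \<open>Multiplied by (1-c/z)(1-d/z), the weight is 1 - q z^(-2) times a series invariant under
  z -> q/z; the factor t^(-n) expresses this invariance.\<close>

lemma Delta_cd:
  fixes C D :: kk
  defines "C \<equiv> par_c * qpow (-1/2)" and "D \<equiv> par_d * qpow (-1/2)"
  shows "\<exists>\<Theta> :: nat \<Rightarrow> kk fls. \<forall>n. Delta n - fls_X * fls_const (C + D) * Delta (n + 1) +
    fls_X ^ 2 * fls_const (C * D) * Delta (n + 2) =
    fls_X_intpow (- n) * \<Theta> (nat \<bar>n\<bar>) - fls_X_intpow (- n) * \<Theta> (nat \<bar>n + 2\<bar>)"
proof -
  define H where "H = gamma_ser ca cb (cc * ser_t) (cd * ser_t) ser_z * gamma_ser ca cb (cc * ser_t) (cd * ser_t) ser_w"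
  note D = Delta_series_cd[folded H_def]
  define \<Theta> where "\<Theta> p = fps_to_fls (diag_coef H p)" for p
  have X: "fps_to_fls (fps_X ^ p) = (fls_X_intpow (int p) :: kk fls)" for p
    by (simp add: fps_to_fls_power fls_X_power_conv_shift_1)
  have Z: "fps_to_fls (zcoef (ser_scale_w H) n) = fls_X_intpow (- n) * \<Theta> (nat \<bar>n\<bar>)" for n
  proof (cases "n \<ge> 0")
    case True
    then have "fps_X ^ nat n * zcoef (ser_scale_w H) n = diag_coef H (nat n)"
      using zcoef_scale_w_pos[of "nat n" H] by simp
    from arg_cong[OF this, of fps_to_fls] have "fls_X_intpow n * fps_to_fls (zcoef (ser_scale_w H) n) = \<Theta> (nat n)"
      using True by (simp add: fls_times_fps_to_fls X \<Theta>_def)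
    then have "fls_X_intpow (- n) * \<Theta> (nat n) = (fls_X_intpow (- n) * fls_X_intpow n) * fps_to_fls (zcoef (ser_scale_w H) n)"
      by (simp only: mult.assoc)
    also have "\<dots> = fps_to_fls (zcoef (ser_scale_w H) n)"
      by (subst fls_X_intpow_times_fls_X_intpow) simp
    finally show ?thesis using True by simp
  next
    case False
    then show ?thesis using zcoef_scale_w_neg[OF D(2), of "nat (- n)"] X[of "nat (- n)"]
      by (simp add: fls_times_fps_to_fls \<Theta>_def)
  qed
  have "zcoef ((1 - cc * ser_w) * ((1 - cd * ser_w) * Delta_series)) n = zcoef Delta_series n
     - fps_const D * (fps_X * zcoef Delta_series (n + 1)) - fps_const C * (fps_X * zcoef Delta_series (n + 1))
     + fps_const C * (fps_X * (fps_const D * (fps_X * zcoef Delta_series (n + 2))))" for n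
    unfolding const_defs left_diff_distrib right_diff_distrib C_def [symmetric] D_def [symmetric]
    by (simp add: zcoef_diff zcoef_const zcoef_w mult.assoc right_diff_distrib add.commute[of _ 2])
  moreover have "zcoef ((1 - ser_w * ser_w) * ser_scale_w H) n = zcoef (ser_scale_w H) n - fps_X * (fps_X * zcoef (ser_scale_w H) (n + 2))" for n
    by (simp add: left_diff_distrib zcoef_diff zcoef_w mult.assoc add.commute[of _ 2])
  ultimately have "zcoef Delta_series n
     - fps_const D * (fps_X * zcoef Delta_series (n + 1)) - fps_const C * (fps_X * zcoef Delta_series (n + 1))
     + fps_const C * (fps_X * (fps_const D * (fps_X * zcoef Delta_series (n + 2)))) =
     zcoef (ser_scale_w H) n - fps_X * (fps_X * zcoef (ser_scale_w H) (n + 2))" for n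
    unfolding D(1) by metis
  from arg_cong[OF this, of fps_to_fls]
  have main: "Delta n - fls_const D * (fls_X * Delta (n + 1)) - fls_const C * (fls_X * Delta (n + 1))
     + fls_const C * (fls_X * (fls_const D * (fls_X * Delta (n + 2)))) =
     fls_X_intpow (- n) * \<Theta> (nat \<bar>n\<bar>) - fls_X * (fls_X * (fls_X_intpow (- (n + 2)) * \<Theta> (nat \<bar>n + 2\<bar>)))" for n
    unfolding Z [symmetric] Delta_eq
    by (simp add: fps_to_fls_plus fps_to_fls_minus fls_times_fps_to_fls)
  have x: "fls_X * (fls_X * (fls_X_intpow (- (n + 2)) * y)) = fls_X_intpow (- n) * (y :: kk fls)" for n y
  proof -
    have "(fls_X_intpow (- n) :: kk fls) = fls_X_intpow 1 * (fls_X_intpow 1 * fls_X_intpow (- (n + 2)))"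
      unfolding fls_X_intpow_times_fls_X_intpow by simp
    then show ?thesis unfolding fls_X_conv_shift_1 by (simp only: mult.assoc)
  qed
  show ?thesis
    by (intro exI[of _ \<Theta>] allI) (use main[unfolded x] in \<open>simp add: algebra_simps power2_eq_square add.commute[of 2] flip: fls_plus_const fls_const_mult_const\<close>)
qed

text \<open>The power z^(-n) requires at least n factors w = t/z, each of order one in t.\<close>

lemma Delta_neg_order: "l < int n \<Longrightarrow> fls_nth (Delta (- int n)) l = 0"
proof -
  assume l: "l < int n"
  show ?thesis
  proof (cases "l < 0")
    case False
    then have "fps_nth (zcoef Delta_series (- int n)) (nat l) = 0"
      unfolding zcoef_def fps_nth_Abs_fps using l by (intro sum.neutral) auto
    then show ?thesis using False by (simp add: Delta_eq)
  qed (simp add: Delta_eq)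
qed

lemma Delta_order: "l < 0 \<Longrightarrow> fls_nth (Delta n) l = 0"
  by (simp add: Delta_eq)

lemma Delta_0_0: "fls_nth (Delta 0) 0 = 1"
proof -
  have "ccoef Delta_series = 1"
  proof -
    let ?d = "qpoch (ca * ser_z) * qpoch (cb * ser_z) * qpoch (cc * ser_t * ser_z) * qpoch (cd * ser_t * ser_z) *
     qpoch (ca * ser_t * ser_w) * qpoch (cb * ser_t * ser_w) * qpoch (cc * ser_w) * qpoch (cd * ser_w)"
    have d: "ccoef ?d = 1" by (simp add: ccoef_hom ccoef_qpoch ccoef_gen)
    then have "ccoef ?d * ccoef (inverse ?d) = 1"
      unfolding ccoef_hom(1)[symmetric] by (subst series_inverse) (simp_all add: ccoef_hom)
    then have "ccoef (inverse ?d) = 1" using d by simp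
    then show ?thesis unfolding Delta_series_eq ccoef_hom(1)
      by (simp add: ccoef_qpoch ccoef_hom ccoef_gen power2_eq_square)
  qed
  then show ?thesis by (simp add: Delta_eq zcoef_def ccoef_def)
qed

subsection \<open>The expansion of \<open>K\<close> and the pairing\<close>

lemma sum_mon_nz:
  fixes \<alpha> :: "'a \<Rightarrow> expo"
  assumes "finite G" "inj_on \<alpha> G" "g0 \<in> G" "c g0 \<noteq> 0"
  shows "(\<Sum>g\<in>G. of_rat (c g) * mon (\<alpha> g)) \<noteq> 0"
proof
  assume z: "(\<Sum>g\<in>G. of_rat (c g) * mon (\<alpha> g)) = 0"
  have s: "of_rat x * mon h = Fraction_Field.Fract (Poly_Mapping.single h x) 1" for x h
    unfolding fract_of_rat[symmetric] by (simp add: mon_def mult_single)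
  have F: "Fraction_Field.Fract (\<Sum>i\<in>I. f i) 1 = (\<Sum>i\<in>I. Fraction_Field.Fract (f i) 1)"
    for f :: "'a \<Rightarrow> (expo \<Rightarrow>\<^sub>0 rat)" and I
    by (induction I rule: infinite_finite_induct)
      (simp_all add: Zero_fract_def [symmetric], metis add_fract mult_1 mult.right_neutral one_neq_zero)
  have "Fraction_Field.Fract (\<Sum>g\<in>G. Poly_Mapping.single (\<alpha> g) (c g)) 1 = 0"
    unfolding F using z by (simp only: s)
  then have "(\<Sum>g\<in>G. Poly_Mapping.single (\<alpha> g) (c g)) = 0"
    by (simp add: Zero_fract_def eq_fract)
  then have "Poly_Mapping.lookup (\<Sum>g\<in>G. Poly_Mapping.single (\<alpha> g) (c g)) (\<alpha> g0) = 0" by simp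
  moreover have "Poly_Mapping.lookup (\<Sum>g\<in>G. Poly_Mapping.single (\<alpha> g) (c g)) (\<alpha> g0) =
      (\<Sum>g\<in>G. if g = g0 then c g0 else 0)"
    unfolding lookup_sum lookup_single
    by (rule sum.cong) (use assms(2,3) in \<open>auto simp: when_def inj_on_def\<close>)
  ultimately show False using assms by simp
qed

definition t_mon :: "expo \<Rightarrow> kk fls" where
  "t_mon g = fls_const (mon g * qpow (- t_degree g / 2)) * fls_X_intpow \<lfloor>t_degree g\<rfloor>"

lemma t_degree_add: "t_degree (g + h) = t_degree g + t_degree h"
  by (simp add: t_degree_def lookup_add)

lemma t_degree_Ints: "g \<in> K_exponents \<Longrightarrow> t_degree g \<in> \<int>"
  by (simp add: t_degree_def K_exponents_def)

lemma t_mon_add: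
  assumes "g \<in> K_exponents" "h \<in> K_exponents"
  shows "t_mon (g + h) = t_mon g * t_mon h"
proof -
  have f: "\<lfloor>t_degree g + t_degree h\<rfloor> = \<lfloor>t_degree g\<rfloor> + \<lfloor>t_degree h\<rfloor>"
    using t_degree_Ints[OF assms(1)] by (auto elim!: Ints_cases)
  have q: "qpow (- (t_degree g + t_degree h) / 2) = qpow (- t_degree g / 2) * qpow (- t_degree h / 2)"
    by (simp add: qpow_add [symmetric] add_divide_distrib diff_divide_distrib)
  have X: "(fls_X_intpow (a + b) :: kk fls) = fls_X_intpow a * fls_X_intpow b" for a b
    by (simp add: fls_X_intpow_times_fls_X_intpow)
  show ?thesis
    unfolding t_mon_def t_degree_add f q mon_add X
    by (simp only: fls_const_mult_const [symmetric] ac_simps)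
qed

lemma fls_const_emb: "field_emb (fls_const :: kk \<Rightarrow> kk fls)"
  by unfold_locales (simp_all add: fls_plus_const fls_const_mult_const)

interpretation t_exp: fract_extension K_laurent "eval_mon t_mon"
proof
  show "eval_mon t_mon 1 = 1"
    by (rule eval_mon_1) (simp add: t_mon_def t_degree_def mon_0)
  show "1 \<in> K_laurent" by (rule K_laurent_1)
  fix u v :: "expo \<Rightarrow>\<^sub>0 rat"
  show "eval_mon t_mon (u + v) = eval_mon t_mon u + eval_mon t_mon v" by (rule eval_mon_add)
  assume u: "u \<in> K_laurent"
  show "eval_mon t_mon u \<noteq> 0" if "u \<noteq> 0"
  proof -
    obtain g0 where g0: "g0 \<in> Poly_Mapping.keys u" using \<open>u \<noteq> 0\<close> by fastforce
    \<comment> \<open>The terms of u with the same order in t as one chosen term contribute distinct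
      monomials to the coefficient of t^N, so nothing cancels.\<close>
    define N where "N = \<lfloor>t_degree g0\<rfloor>"
    define G where "G = {g \<in> Poly_Mapping.keys u. \<lfloor>t_degree g\<rfloor> = N}"
    let ?\<alpha> = "\<lambda>g. g + Poly_Mapping.single ISqrtQ (- of_int N)"
    have nth: "fls_nth (of_rat x * t_mon g) N = (if \<lfloor>t_degree g\<rfloor> = N then of_rat x * mon (?\<alpha> g) else 0)"
      if "g \<in> Poly_Mapping.keys u" for g x
    proof -
      have r: "(of_rat x :: kk fls) = fls_const (of_rat x)"
        using field_emb_of_rat[OF fls_const_emb] by simp
      have "t_degree g = of_int N" if "\<lfloor>t_degree g\<rfloor> = N"
        using t_degree_Ints[of g] u \<open>g \<in> Poly_Mapping.keys u\<close> that by (auto simp: K_laurent_def elim!: Ints_cases)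
      then have "mon g * qpow (- t_degree g / 2) = mon (?\<alpha> g)" if "\<lfloor>t_degree g\<rfloor> = N"
        using that by (simp add: qpow_def mon_add)
      then show ?thesis
        unfolding r t_mon_def mult.assoc[symmetric] fls_const_mult_const by auto
    qed
    have "fls_nth (eval_mon t_mon u) N = (\<Sum>g\<in>Poly_Mapping.keys u. if \<lfloor>t_degree g\<rfloor> = N then of_rat (Poly_Mapping.lookup u g) * mon (?\<alpha> g) else 0)"
      unfolding eval_mon_def fls_nth_sum by (rule sum.cong[OF refl]) (rule nth)
    also have "\<dots> = (\<Sum>g\<in>G. of_rat (Poly_Mapping.lookup u g) * mon (?\<alpha> g))"
      unfolding G_def by (simp add: sum.inter_filter)
    also have "\<dots> \<noteq> 0"
      by (rule sum_mon_nz[of _ _ g0]) (use g0 in \<open>auto simp: G_def N_def inj_on_def in_keys_iff\<close>)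
    finally show ?thesis by auto
  qed
  assume v: "v \<in> K_laurent"
  show "u + v \<in> K_laurent" "u * v \<in> K_laurent" using u v by (simp_all add: K_laurent_add K_laurent_mult)
  show "eval_mon t_mon (u * v) = eval_mon t_mon u * eval_mon t_mon v"
    by (rule eval_mon_mult, rule t_mon_add) (use u v in \<open>auto simp: K_laurent_def\<close>)
qed

lemma t_expand_eq: "t_expand = fract_ext K_laurent (eval_mon t_mon)"
  unfolding t_expand_def t_mon_def ..

lemma te_add: "x \<in> KK \<Longrightarrow> y \<in> KK \<Longrightarrow> t_expand (x + y) = t_expand x + t_expand y"
  and te_mult: "x \<in> KK \<Longrightarrow> y \<in> KK \<Longrightarrow> t_expand (x * y) = t_expand x * t_expand y"
  and te_1: "t_expand 1 = 1"
  unfolding t_expand_eq KK_eq by (rule t_exp.ext_add t_exp.ext_mult t_exp.ext_one; assumption)+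

lemma te_0: "t_expand 0 = 0"
  using te_add[of 0 0] KK_intros(1) by (metis add_0_left add_cancel_right_left)

lemma te_uminus: "x \<in> KK \<Longrightarrow> t_expand (- x) = - t_expand x"
  using te_add[of x "- x"] KK_intros(5)[of x] by (simp add: te_0 eq_neg_iff_add_eq_0 add.commute)

lemma te_nz: "x \<in> KK \<Longrightarrow> x \<noteq> 0 \<Longrightarrow> t_expand x \<noteq> 0"
  using te_mult[of x "inverse x"] KK_intros(7)[of x] te_1 by auto

lemma te_mon: "g \<in> K_exponents \<Longrightarrow> t_expand (mon g) = t_mon g"
  unfolding t_expand_eq mon_def by (simp add: t_exp.ext_of K_laurent_single eval_mon_single)

lemma par_expo_K: "i < 4 \<Longrightarrow> par_expo i \<in> K_exponents"
  by (erule less_4_cases) (simp_all add: par_expo_def K_exponents_def lookup_minus lookup_single when_def)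

lemma te_par: "i < 4 \<Longrightarrow> t_expand (par i) =
    (if i < 2 then fls_const (par i) else fls_const (par i * qpow (-1/2)) * fls_X)"
proof -
  assume i: "i < 4"
  have "t_degree (par_expo i) = (if i < 2 then 0 else 1)"
    using i by (elim less_4_cases) (simp_all add: t_degree_def par_expo_def lookup_minus lookup_single)
  then have "t_mon (par_expo i) = (if i < 2 then fls_const (mon (par_expo i)) else fls_const (mon (par_expo i) * qpow (-1/2)) * fls_X)"
    by (simp add: t_mon_def fls_X_conv_shift_1)
  then show ?thesis
    using i te_uminus[OF mon_KK[OF par_expo_K[OF i]]] te_mon[OF par_expo_K[OF i]]
    by (simp add: par_mon field_emb.minus[OF fls_const_emb])
qed

lemma te_qpow: "t_expand (qpow (of_int n / 2)) = fls_X_intpow n"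
proof -
  have "t_expand (qpow (of_int n / 2)) = t_mon (Poly_Mapping.single ISqrtQ (of_int n))"
    unfolding qpow_def by (subst te_mon) (simp_all add: K_exponents_def lookup_single when_def)
  also have "\<dots> = fls_X_intpow n"
  proof -
    have "mon (Poly_Mapping.single ISqrtQ (of_int n)) * qpow (- of_int n / 2) = 1"
      unfolding qpow_def mon_add[symmetric] single_add[symmetric] by (simp add: mon_0)
    then show ?thesis by (simp add: t_mon_def t_degree_def lookup_single)
  qed
  finally show ?thesis .
qed

section \<open>The constant term functional\<close>

text \<open>The constant term of f times the weight. On the symmetric sums \<open>lsym\<close>,
  which are fixed by the involution, the pairing is \<open>Lam\<close> of the product
  (\<open>pairing_lsym\<close>).\<close>

definition Lam :: "lpoly \<Rightarrow> kk fls" where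
  "Lam f = lin_ext (\<lambda>n x. t_expand x * Delta (- n)) f"

lemma Lam_sum: "finite I \<Longrightarrow> Poly_Mapping.keys f \<subseteq> I \<Longrightarrow>
    Lam f = (\<Sum>n\<in>I. t_expand (Poly_Mapping.lookup f n) * Delta (- n))"
  unfolding Lam_def lin_ext_def by (rule sum_superset_lookup) (simp_all add: te_0)

lemma Lam_add: "f \<in> laurent_K \<Longrightarrow> g \<in> laurent_K \<Longrightarrow> Lam (f + g) = Lam f + Lam g"
  unfolding Lam_def
  by (rule lin_ext_add_on[where C = KK]) (simp_all add: te_0 te_add distrib_right laurent_K_def)

lemma Lam_0: "Lam 0 = 0"
  by (simp add: Lam_def lin_ext_def)

lemma Lam_sum_fun: "(\<And>i. i \<in> I \<Longrightarrow> f i \<in> laurent_K) \<Longrightarrow> Lam (\<Sum>i\<in>I. f i) = (\<Sum>i\<in>I. Lam (f i))"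
  by (induction I rule: infinite_finite_induct) (simp_all add: Lam_0 Lam_add LK.sum_in)

lemma Lam_const_mult:
  assumes "x \<in> KK" "f \<in> laurent_K"
  shows "Lam (lmon x 0 * f) = t_expand x * Lam f"
proof -
  have "Poly_Mapping.keys (lmon x 0 * f) \<subseteq> Poly_Mapping.keys f"
    by (auto simp: in_keys_iff lookup_const_mult)
  from Lam_sum[OF finite_keys this] Lam_sum[OF finite_keys subset_refl, of f] show ?thesis
    using assms by (simp add: lookup_const_mult te_mult laurent_K_def sum_distrib_left mult.assoc)
qed

lemma lookup_lmon_mult: "Poly_Mapping.lookup (lmon x m * f) n = x * Poly_Mapping.lookup f (n - m)"
  unfolding lookup_mult_sum by (cases "x = 0") (simp_all add: lmon_def)

lemma Lam_lmon_mult: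
  assumes "x \<in> KK" "f \<in> laurent_K"
  shows "Lam (lmon x m * f) = (\<Sum>k\<in>Poly_Mapping.keys f. t_expand x * (t_expand (Poly_Mapping.lookup f k) * Delta (- k - m)))"
proof -
  have "Poly_Mapping.keys (lmon x m * f) \<subseteq> (\<lambda>k. k + m) ` Poly_Mapping.keys f"
  proof
    fix n
    assume "n \<in> Poly_Mapping.keys (lmon x m * f)"
    then have "n - m \<in> Poly_Mapping.keys f" by (simp add: in_keys_iff lookup_lmon_mult)
    then have "(n - m) + m \<in> (\<lambda>k. k + m) ` Poly_Mapping.keys f" by (rule imageI)
    then show "n \<in> (\<lambda>k. k + m) ` Poly_Mapping.keys f" by simp
  qed
  from Lam_sum[OF _ this] have "Lam (lmon x m * f) =
      (\<Sum>n\<in>(\<lambda>k. k + m) ` Poly_Mapping.keys f. t_expand (x * Poly_Mapping.lookup f (n - m)) * Delta (- n))"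
    by (simp add: lookup_lmon_mult)
  also have "\<dots> = (\<Sum>k\<in>Poly_Mapping.keys f. t_expand (x * Poly_Mapping.lookup f k) * Delta (- (k + m)))"
    by (subst sum.reindex) (simp_all add: inj_on_def)
  finally show ?thesis
    using assms by (simp add: te_mult laurent_K_def mult.assoc)
qed

lemma sum_antisym:
  fixes F :: "int \<Rightarrow> kk fls"
  assumes "finite I" "uminus ` I = I" "\<And>k. k \<in> I \<Longrightarrow> F (- k) = - F k"
  shows "(\<Sum>k\<in>I. F k) = 0"
proof -
  have "(\<Sum>k\<in>I. F k) = (\<Sum>k\<in>uminus ` I. F k)" using assms(2) by simp
  also have "\<dots> = (\<Sum>k\<in>I. F (- k))" by (subst sum.reindex) (auto simp: inj_on_def)
  also have "\<dots> = - (\<Sum>k\<in>I. F k)" by (simp add: assms(3) sum_negf)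
  finally show ?thesis by simp
qed

lemma sym_keys: "f \<in> sym_laurent_K \<Longrightarrow> uminus ` Poly_Mapping.keys f = Poly_Mapping.keys f"
proof -
  assume f: "f \<in> sym_laurent_K"
  have "- k \<in> Poly_Mapping.keys f" if "k \<in> Poly_Mapping.keys f" for k
    using that sym_lookup[OF f] by (simp add: in_keys_iff)
  then show ?thesis by force
qed

text \<open>The Laurent polynomials (1-az)(1-bz)/z and, below, (z-c)(z-d)/z, with which the weight
  becomes antisymmetric.\<close>

definition Pab :: lpoly where
  "Pab = lmon 1 (-1) + (lmon (- (par_a + par_b)) 0 + lmon (par_a * par_b) 1)"

definition Pcd :: lpoly where
  "Pcd = lmon 1 1 + (lmon (- (par_c + par_d)) 0 + lmon (par_c * par_d) (-1))"

lemma par_abcd_KK: "par_a \<in> KK" "par_b \<in> KK" "par_c \<in> KK" "par_d \<in> KK"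
  using par_KK[of 0] par_KK[of 1] par_KK[of 2] par_KK[of 3] by (simp_all add: par_def)

lemma te_abcd: "t_expand par_a = fls_const par_a" "t_expand par_b = fls_const par_b"
  "t_expand par_c = fls_const (par_c * qpow (-1/2)) * fls_X" "t_expand par_d = fls_const (par_d * qpow (-1/2)) * fls_X"
  using te_par[of 0] te_par[of 1] te_par[of 2] te_par[of 3] by (simp_all add: par_def)

lemma Pab_LK: "Pab \<in> laurent_K" and Pcd_LK: "Pcd \<in> laurent_K"
  unfolding Pab_def Pcd_def by (intro LK_intros lmon_LK KK_intros par_abcd_KK)+

lemma Lam_trinomial:
  assumes "f \<in> laurent_K" "x \<in> KK" "y \<in> KK"
  shows "Lam ((lmon 1 m + (lmon (- x) 0 + lmon y (- m))) * f) =
    (\<Sum>k\<in>Poly_Mapping.keys f. t_expand (Poly_Mapping.lookup f k) *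
      (Delta (- k - m) - t_expand x * Delta (- k) + t_expand y * Delta (- k + m)))"
proof -
  have "Lam ((lmon 1 m + (lmon (- x) 0 + lmon y (- m))) * f) =
      Lam (lmon 1 m * f) + (Lam (lmon (- x) 0 * f) + Lam (lmon y (- m) * f))"
    unfolding distrib_right by (simp add: Lam_add LK_intros lmon_LK KK_intros assms)
  also have "\<dots> = (\<Sum>k\<in>Poly_Mapping.keys f. t_expand 1 * (t_expand (Poly_Mapping.lookup f k) * Delta (- k - m)) +
      (t_expand (- x) * (t_expand (Poly_Mapping.lookup f k) * Delta (- k - 0)) +
       t_expand y * (t_expand (Poly_Mapping.lookup f k) * Delta (- k - - m))))"
    using assms by (subst (1 2 3) Lam_lmon_mult) (simp_all add: KK_intros sum.distrib)
  finally show ?thesis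
    using assms by (simp add: te_1 te_uminus algebra_simps)
qed

text \<open>By \<open>Delta_ab\<close> the weight times this factor is 1/z - z times a series
  invariant under z -> 1/z. It is antisymmetric, and its constant term against a symmetric f
  vanishes.\<close>

lemma Lam_Pab:
  assumes "f \<in> sym_laurent_K"
  shows "Lam (Pab * f) = 0"
proof -
  obtain \<Theta> :: "nat \<Rightarrow> kk fls" where \<Theta>: "\<And>n. Delta n - fls_const (par_a + par_b) * Delta (n - 1) +
    fls_const (par_a * par_b) * Delta (n - 2) = \<Theta> (nat \<bar>n\<bar>) - \<Theta> (nat \<bar>n - 2\<bar>)"
    using Delta_ab by blast
  have te: "t_expand (par_a + par_b) = fls_const (par_a + par_b)" "t_expand (par_a * par_b) = fls_const (par_a * par_b)"
    by (simp_all add: te_add te_mult par_abcd_KK te_abcd fls_plus_const fls_const_mult_const)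
  have "Lam (Pab * f) = (\<Sum>k\<in>Poly_Mapping.keys f. t_expand (Poly_Mapping.lookup f k) *
      (\<Theta> (nat \<bar>1 - k\<bar>) - \<Theta> (nat \<bar>- 1 - k\<bar>)))"
  proof -
    have "Delta (- k - - 1) - t_expand (par_a + par_b) * Delta (- k) + t_expand (par_a * par_b) * Delta (- k + - 1) =
       \<Theta> (nat \<bar>1 - k\<bar>) - \<Theta> (nat \<bar>- 1 - k\<bar>)" for k
    proof -
      have e: "- k + - 1 = 1 - k - 2" "- k - - 1 = 1 - k" "- k = 1 - k - 1" by simp_all
      show ?thesis unfolding te e(1,2) using \<Theta>[of "1 - k"] by simp
    qed
    then show ?thesis
      using assms par_abcd_KK Lam_trinomial[of f "par_a + par_b" "par_a * par_b" "-1"]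
      by (simp add: Pab_def KK_intros sym_iff_refl)
  qed
  also have "\<dots> = 0"
  proof (rule sum_antisym[OF finite_keys sym_keys[OF assms]])
    fix k :: int
    have "\<bar>1 - - k\<bar> = \<bar>- 1 - k\<bar>" "\<bar>- 1 - - k\<bar> = \<bar>1 - k\<bar>" by simp_all
    then show "t_expand (Poly_Mapping.lookup f (- k)) * (\<Theta> (nat \<bar>1 - - k\<bar>) - \<Theta> (nat \<bar>- 1 - - k\<bar>)) =
      - (t_expand (Poly_Mapping.lookup f k) * (\<Theta> (nat \<bar>1 - k\<bar>) - \<Theta> (nat \<bar>- 1 - k\<bar>)))"
      unfolding sym_lookup[OF assms] by (simp add: algebra_simps)
  qed
  finally show ?thesis .
qed

lemma keys_lT: "Poly_Mapping.keys (lT n f) = Poly_Mapping.keys f"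
  by (auto simp: in_keys_iff lookup_lT)

text \<open>By \<open>Delta_cd\<close> the weight times this factor is z - q/z times a series
  invariant under z -> q/z, hence antisymmetric under this substitution, while f(q^(-1/2) z) is
  invariant.\<close>

lemma Lam_Pcd:
  assumes "f \<in> sym_laurent_K"
  shows "Lam (Pcd * lT (-1) f) = 0"
proof -
  let ?C = "par_c * qpow (-1/2)" and ?D = "par_d * qpow (-1/2)"
  obtain \<Theta> :: "nat \<Rightarrow> kk fls" where \<Theta>: "\<And>n. Delta n - fls_X * fls_const (?C + ?D) * Delta (n + 1) +
    fls_X ^ 2 * fls_const (?C * ?D) * Delta (n + 2) =
    fls_X_intpow (- n) * \<Theta> (nat \<bar>n\<bar>) - fls_X_intpow (- n) * \<Theta> (nat \<bar>n + 2\<bar>)"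
    using Delta_cd by blast
  have te: "t_expand (par_c + par_d) = fls_X * fls_const (?C + ?D)" "t_expand (par_c * par_d) = fls_X ^ 2 * fls_const (?C * ?D)"
  proof -
    have "fls_const ?C * fls_X + fls_const ?D * fls_X = fls_X * fls_const (?C + ?D)"
      by (simp only: fls_plus_const [symmetric, of ?C ?D] distrib_left mult.commute[of fls_X])
    then show "t_expand (par_c + par_d) = fls_X * fls_const (?C + ?D)"
      by (simp only: te_add par_abcd_KK te_abcd)
    show "t_expand (par_c * par_d) = fls_X ^ 2 * fls_const (?C * ?D)"
      unfolding te_mult[OF par_abcd_KK(3,4)] te_abcd
      unfolding fls_const_mult_const [symmetric, of ?C ?D] by (simp only: power2_eq_square ac_simps)
  qed
  have fK: "f \<in> laurent_K" "lT (-1) f \<in> laurent_K" using assms lT_LK by (auto simp: sym_iff_refl)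
  have tl: "t_expand (Poly_Mapping.lookup (lT (-1) f) k) = fls_X_intpow (- k) * t_expand (Poly_Mapping.lookup f k)" for k
  proof -
    have "t_expand (qpow (of_int (- k) / 2) * Poly_Mapping.lookup f k) = fls_X_intpow (- k) * t_expand (Poly_Mapping.lookup f k)"
      using fK by (subst te_mult) (simp_all only: te_qpow, auto simp: laurent_K_def qpow_KK)
    then show ?thesis by (simp add: lookup_lT)
  qed
  have X: "fls_X_intpow (- k) * (fls_X_intpow (k + 1) * y) = fls_X * y" for k and y :: "kk fls"
  proof -
    have "fls_X_intpow (- k) * fls_X_intpow (k + 1) = (fls_X_intpow 1 :: kk fls)"
      unfolding fls_X_intpow_times_fls_X_intpow by simp
    then show ?thesis unfolding mult.assoc [symmetric] fls_X_conv_shift_1 by (simp only:)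
  qed
  have "Lam (Pcd * lT (-1) f) = (\<Sum>k\<in>Poly_Mapping.keys f. t_expand (Poly_Mapping.lookup f k) *
      (fls_X * (\<Theta> (nat \<bar>- k - 1\<bar>) - \<Theta> (nat \<bar>1 - k\<bar>))))"
  proof -
    have "fls_X_intpow (- k) * (Delta (- k - 1) - t_expand (par_c + par_d) * Delta (- k) + t_expand (par_c * par_d) * Delta (- k + 1)) =
       fls_X * (\<Theta> (nat \<bar>- k - 1\<bar>) - \<Theta> (nat \<bar>1 - k\<bar>))" for k
    proof -
      have "Delta (- k - 1) - t_expand (par_c + par_d) * Delta (- k) + t_expand (par_c * par_d) * Delta (- k + 1) =
         fls_X_intpow (k + 1) * (\<Theta> (nat \<bar>- k - 1\<bar>) - \<Theta> (nat \<bar>1 - k\<bar>))"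
      proof -
        have i: "- (- k - 1) = k + 1" "- k - 1 + 1 = - k" "- k - 1 + 2 = 1 - k" "- k + 1 = 1 - k"
          by simp_all
        show ?thesis
          using \<Theta>[of "- k - 1"] unfolding te i right_diff_distrib .
      qed
      then show ?thesis by (simp only: X)
    qed
    then have "fls_X_intpow (- k) * (c * (Delta (- k - 1) - t_expand (par_c + par_d) * Delta (- k) + t_expand (par_c * par_d) * Delta (- k + 1))) =
       c * (fls_X * (\<Theta> (nat \<bar>- k - 1\<bar>) - \<Theta> (nat \<bar>1 - k\<bar>)))" for k c
      by (simp only: mult.left_commute)
    then show ?thesis
      using fK par_abcd_KK Lam_trinomial[of "lT (-1) f" "par_c + par_d" "par_c * par_d" 1]
      by (simp only: Pcd_def KK_intros keys_lT tl mult.assoc) 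
  qed
  also have "\<dots> = 0"
  proof (rule sum_antisym[OF finite_keys sym_keys[OF assms]])
    fix k :: int
    have "\<bar>- (- k) - 1\<bar> = \<bar>1 - k\<bar>" "\<bar>1 - - k\<bar> = \<bar>- k - 1\<bar>" by simp_all
    then show "t_expand (Poly_Mapping.lookup f (- k)) * (fls_X * (\<Theta> (nat \<bar>- (- k) - 1\<bar>) - \<Theta> (nat \<bar>1 - - k\<bar>))) =
      - (t_expand (Poly_Mapping.lookup f k) * (fls_X * (\<Theta> (nat \<bar>- k - 1\<bar>) - \<Theta> (nat \<bar>1 - k\<bar>))))"
      unfolding sym_lookup[OF assms] by (simp add: algebra_simps)
  qed
  finally show ?thesis .
qed

subsection \<open>Orthogonality\<close>

lemma upar_0_abcd: "upar 0 0 = par_a" "upar 0 1 = par_b" "upar 0 2 = par_c" "upar 0 3 = par_d"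
  using upar_0[of 0] upar_0[of 1] upar_0[of 2] upar_0[of 3] by (simp_all add: par_def)

text \<open>The difference of the two sides of the self-adjointness relation, where
  \<open>(t y - 1/(t y)) kp = fp * g - f * gp\<close> and \<open>(y / t - t / y) km = f * gm - fm * g\<close>.\<close>

lemma adjoint_identity:
  fixes a b c d y t f g fp fm gp gm kp km :: "'a::field"
  assumes nz: "y \<noteq> 0" "t \<noteq> 0" "y^2 \<noteq> 1" "t^2*y^2 \<noteq> 1" "y^2 \<noteq> t^2"
    and kp: "(t*y - 1/(t*y)) * kp = fp * g - f * gp"
    and km: "(y/t - t/y) * km = f * gm - fm * g"
  defines "P \<equiv> (1 - a*y) * (1 - b*y) * (1 - c*y) * (1 - d*y)"
    and "P' \<equiv> (y - a) * (y - b) * (y - c) * (y - d)"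
    and "m \<equiv> - ((1 - c*y) * (1 - d*y) * kp / (t*y))" and "m' \<equiv> - ((y - c) * (y - d) * km / (t*y))"
  shows "P / ((1 - y^2) * (1 - t^2*y^2)) * (fp * g - f * gp) + P' / ((y^2 - 1) * (y^2 - t^2)) * (fm * g - f * gm) =
     (1 - a*b) * m' - inverse y * (1 - a*y) * (1 - b*y) * ((m - m') / (y - 1/y))"
proof -
  have nz': "1 - y^2 \<noteq> 0" "1 - t^2*y^2 \<noteq> 0" "y^2 - t^2 \<noteq> 0" "y^2 - 1 \<noteq> 0" using nz by auto
  have kp': "fp * g - f * gp = - ((1 - t^2*y^2) * kp / (t*y))"
    unfolding kp[symmetric] using nz by (simp add: field_simps power2_eq_square)
  have "f * gm - fm * g = (y^2 - t^2) * km / (t*y)"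
    unfolding km[symmetric] using nz by (simp add: field_simps power2_eq_square)
  then have km': "fm * g - f * gm = - ((y^2 - t^2) * km / (t*y))"
    by (simp add: algebra_simps)
  have 1: "P / ((1 - y^2) * (1 - t^2*y^2)) * (fp * g - f * gp) = - (P * kp / (t * y * (1 - y^2)))"
    unfolding kp' using nz nz' by simp
  have 2: "P' / ((y^2 - 1) * (y^2 - t^2)) * (fm * g - f * gm) = P' * km / (t * y * (1 - y^2))"
  proof -
    have "P' / ((y^2 - 1) * (y^2 - t^2)) * (fm * g - f * gm) = - (P' * km / (t * y * (y^2 - 1)))"
      unfolding km' using nz nz' by simp
    also have "\<dots> = P' * km / (t * y * (1 - y^2))"
    proof -
      have "t * y * (y^2 - 1) = - (t * y * (1 - y^2))" by (simp add: algebra_simps)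
      then show ?thesis by (simp only: divide_minus_right minus_minus)
    qed
    finally show ?thesis .
  qed
  have 3: "inverse y * (1 - a*y) * (1 - b*y) * ((m - m') / (y - 1/y)) = - ((1 - a*y) * (1 - b*y) * (m - m') / (1 - y^2))"
  proof -
    have "y - 1/y = - ((1 - y^2) / y)" using nz by (simp add: field_simps power2_eq_square)
    then show ?thesis using nz nz' by simp
  qed
  have "- (P * kp / (t * y)) + P' * km / (t * y) = (1 - a*b) * (1 - y^2) * m' + (1 - a*y) * (1 - b*y) * (m - m')"
    unfolding P_def P'_def m_def m'_def using nz(1,2)
    by (simp add: divide_simps) (simp add: algebra_simps power2_eq_square)
  then have "(- (P * kp / (t * y)) + P' * km / (t * y)) / (1 - y^2) =
      ((1 - a*b) * (1 - y^2) * m' + (1 - a*y) * (1 - b*y) * (m - m')) / (1 - y^2)" by simp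
  then show ?thesis unfolding 1 2 3 using nz'(1) by (simp add: add_divide_distrib diff_divide_distrib)
qed

lemma Acoef_0_values:
  "Acoef 0 zz = (1 - scal par_a * zz) * (1 - scal par_b * zz) * (1 - scal par_c * zz) * (1 - scal par_d * zz) /
     ((1 - zz^2) * (1 - scal tt^2 * zz^2))"
  "Acoef 0 (1 / zz) = (zz - scal par_a) * (zz - scal par_b) * (zz - scal par_c) * (zz - scal par_d) /
     ((zz^2 - 1) * (zz^2 - scal tt^2))"
proof -
  show "Acoef 0 zz = (1 - scal par_a * zz) * (1 - scal par_b * zz) * (1 - scal par_c * zz) * (1 - scal par_d * zz) /
     ((1 - zz^2) * (1 - scal tt^2 * zz^2))"
    unfolding Acoef_def Af_def prod_4 upar_0_abcd ..
  have t: "scal tt \<noteq> 0" by (simp add: scal.eq_zero)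
  have "(\<Prod>i<4. 1 - scal (upar 0 i) * (1 / zz)) = (zz - scal par_a) * (zz - scal par_b) * (zz - scal par_c) * (zz - scal par_d) / zz^4"
    unfolding prod_4 upar_0_abcd by (simp add: field_simps power4_eq_xxxx)
  then show "Acoef 0 (1 / zz) = (zz - scal par_a) * (zz - scal par_b) * (zz - scal par_c) * (zz - scal par_d) /
     ((zz^2 - 1) * (zz^2 - scal tt^2))"
    unfolding Acoef_def Af_def denoms(3)[OF zz_nz t] by simp
qed

lemma of_lpoly_Pab: "of_lpoly Pab = inverse zz * (1 - scal par_a * zz) * (1 - scal par_b * zz)"
  unfolding Pab_def of_lpoly_add of_lpoly_lmon
  by (simp add: scal.simps power_int_minus field_simps)

lemma of_lpoly_Pcd: "of_lpoly Pcd = (zz - scal par_c) * (zz - scal par_d) / zz"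
  unfolding Pcd_def of_lpoly_add of_lpoly_lmon
  by (simp add: scal.simps power_int_minus field_simps)

text \<open>Through the q-Wronskian k = (Tf T^(-1)g - T^(-1)f Tg)/(z - 1/z), which is symmetric, gam
  (Df g - f Dg) becomes a combination of \<open>Pcd * lT (-1) \<kappa>\<close> and
  \<open>Pab * s\<close> with s symmetric (\<open>adjoint_identity\<close>). \<open>Lam\<close>
  kills both.\<close>

lemma opD_symmetric:
  assumes f: "f \<in> sym_laurent_K" and g: "g \<in> sym_laurent_K"
    and F: "F \<in> laurent_K" "op_apply (opD 0) (of_lpoly f) = of_lpoly F"
    and G: "G \<in> laurent_K" "op_apply (opD 0) (of_lpoly g) = of_lpoly G"
  shows "Lam (F * g) = Lam (f * G)"
proof -
  let ?f = "of_lpoly f" and ?g = "of_lpoly g" and ?t = "scal tt"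
  have t: "?t \<noteq> 0" by (simp add: scal.eq_zero)
  have fg: "?f \<in> SZ" "?g \<in> SZ" using f g by (simp_all add: SZ_def)
  obtain k where k: "k \<in> SZ" "k * (zz - 1 / zz) = T_pow 1 ?f * T_pow (-1) ?g - zinv (T_pow 1 ?f * T_pow (-1) ?g)"
    using antisym_quotient[of "T_pow 1 ?f * T_pow (-1) ?g"] fg by (meson LZ_intros(2) LZ_T SZ_LZ)
  have k2: "k * (zz - 1 / zz) = T_pow 1 ?f * T_pow (-1) ?g - T_pow (-1) ?f * T_pow 1 ?g"
    using k(2) by (simp add: zinv.mult zinv_T_pow SZ_zinv fg)
  have kp: "(?t * zz - 1 / (?t * zz)) * T_pow 1 k = T_pow 2 ?f * ?g - ?f * T_pow 2 ?g"
    using arg_cong[OF k2, of "T_pow 1"] by (simp add: T.simps T_pow_T_pow T_1_zz mult.commute)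
  have km: "(zz / ?t - ?t / zz) * T_pow (-1) k = ?f * T_pow (-2) ?g - T_pow (-2) ?f * ?g"
    using arg_cong[OF k2, of "T_pow (-1)"] by (simp add: T.simps T_pow_T_pow T_1_zz mult.commute)
  \<comment> \<open>m is chosen so that its reflection m' is a multiple of (z-c)(z-d)/z times
    T^(-1)k, and so that (m - m')/(z - 1/z) is symmetric: the forms required by
    \<open>Lam_Pcd\<close> and \<open>Lam_Pab\<close>.\<close>
  define m where "m = - ((1 - scal par_c * zz) * (1 - scal par_d * zz) * T_pow 1 k / (?t * zz))"
  define m' where "m' = - ((zz - scal par_c) * (zz - scal par_d) * T_pow (-1) k / (?t * zz))"
  have zm: "zinv m = m'"
  proof -
    have "zinv m = - ((1 - scal par_c * inverse zz) * (1 - scal par_d * inverse zz) * T_pow (-1) k / (?t * inverse zz))"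
      by (simp add: m_def zinv.simps zinv_zz zinv_T_pow SZ_zinv k)
    also have "\<dots> = m'" unfolding m'_def using t by (simp add: field_simps)
    finally show ?thesis .
  qed
  have mLZ: "m \<in> LZ"
  proof -
    \<comment> \<open>The sign is expressed by 1, differences and products, the operations under
      which \<open>LZ_intros\<close> closes \<open>LZ\<close>.\<close>
    have "m = (0 - 1 * 1) * ((1 - scal par_c * zz) * (1 - scal par_d * zz) * T_pow 1 k * (scal (inverse tt) * zz powi (-1)))"
    proof -
      have gen: "- (X / (u * v)) = (0 - 1 * 1) * (X * (inverse u * inverse v))" for X u v :: kz
        by (simp add: field_class.field_divide_inverse)
      have "zz powi (-1) = inverse zz" by (simp add: power_int_minus)
      then show ?thesis unfolding m_def scal.inverse by (simp only: gen)
    qed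
    also have "\<dots> = (1 - 1 - 1 * 1) * ((1 - scal par_c * zz) * (1 - scal par_d * zz) * T_pow 1 k * (scal (inverse tt) * zz powi (-1)))"
      by simp
    also have "\<dots> \<in> LZ"
      using k(1) by (intro LZ_intros LZ_scal LZ_zz LZ_zz' LZ_T SZ_LZ par_abcd_KK KK_intros qpow_KK) simp_all
    finally show ?thesis .
  qed
  obtain s where s: "s \<in> sym_laurent_K" "of_lpoly s * (zz - 1 / zz) = m - m'"
    using antisym_quotient[OF mLZ] unfolding zm SZ_def by auto
  have s': "(m - m') / (zz - 1 / zz) = of_lpoly s"
    using s(2) zz_minus_inverse_nz by (simp add: field_simps)
  obtain \<kappa> where \<kappa>: "\<kappa> \<in> sym_laurent_K" "k = of_lpoly \<kappa>" using k(1) by (auto simp: SZ_def)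
  have m'_eq: "m' = of_lpoly (lmon (- inverse tt) 0 * (Pcd * lT (-1) \<kappa>))"
    unfolding of_lpoly_const_mult unfolding of_lpoly_mult of_lpoly_Pcd m'_def \<kappa>(2) T_of_lpoly
    by (simp add: scal.simps field_simps)
  have "scal (gam 0) * (of_lpoly F * ?g - ?f * of_lpoly G) =
      Acoef 0 zz * (T_pow 2 ?f * ?g - ?f * T_pow 2 ?g) + Acoef 0 (1 / zz) * (T_pow (-2) ?f * ?g - ?f * T_pow (-2) ?g)"
    unfolding F(2)[symmetric] G(2)[symmetric] opD_apply by (simp add: scal.simps algebra_simps)
  also have "\<dots> = (1 - scal par_a * scal par_b) * m' - inverse zz * (1 - scal par_a * zz) * (1 - scal par_b * zz) * ((m - m') / (zz - 1 / zz))"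
    unfolding Acoef_0_values m_def m'_def by (rule adjoint_identity[OF zz_nz t zz_neqs kp km])
  also have "\<dots> = of_lpoly (lmon (1 - par_a * par_b) 0 * (lmon (- inverse tt) 0 * (Pcd * lT (-1) \<kappa>)) - Pab * s)"
    unfolding s' unfolding m'_eq of_lpoly_diff of_lpoly_const_mult[of "1 - par_a * par_b"] of_lpoly_mult[of Pab] of_lpoly_Pab
    by (simp add: scal.simps)
  finally have "of_lpoly (lmon (gam 0) 0 * (F * g - f * G)) =
     of_lpoly (lmon (1 - par_a * par_b) 0 * (lmon (- inverse tt) 0 * (Pcd * lT (-1) \<kappa>)) - Pab * s)"
    by (simp only: of_lpoly_const_mult of_lpoly_diff[of "F * g" "f * G"] of_lpoly_mult[of F g] of_lpoly_mult[of f G])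
  then have eq: "lmon (gam 0) 0 * (F * g - f * G) + Pab * s =
     lmon (1 - par_a * par_b) 0 * (lmon (- inverse tt) 0 * (Pcd * lT (-1) \<kappa>))"
    by (simp add: of_lpoly_eq)
  have K: "f \<in> laurent_K" "g \<in> laurent_K" "s \<in> laurent_K" "\<kappa> \<in> laurent_K"
    using f g s(1) \<kappa>(1) by (simp_all add: sym_iff_refl)
  have gK: "gam 0 \<in> KK" by (rule gam_KK) (simp add: hc_0)
  have tK: "- inverse tt \<in> KK" "1 - par_a * par_b \<in> KK"
    by (intro KK_intros qpow_KK par_abcd_KK; simp)+
  have L: "F * g - f * G \<in> laurent_K" "Pab * s \<in> laurent_K" "Pcd * lT (-1) \<kappa> \<in> laurent_K"
    using K F G by (intro LK_intros Pab_LK Pcd_LK lT_LK; simp)+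
  have "t_expand (gam 0) * Lam (F * g - f * G) + Lam (Pab * s) =
     t_expand (1 - par_a * par_b) * (t_expand (- inverse tt) * Lam (Pcd * lT (-1) \<kappa>))"
    using arg_cong[OF eq, of Lam] L gK tK
    by (simp add: Lam_add Lam_const_mult LK_intros lmon_LK)
  then have "t_expand (gam 0) * Lam (F * g - f * G) = 0"
    by (simp add: Lam_Pab Lam_Pcd s \<kappa>)
  then have "Lam (F * g - f * G) = 0" using te_nz[OF gK] by simp
  moreover have "Lam (F * g) = Lam (F * g - f * G) + Lam (f * G)"
    using K F G L by (subst Lam_add [symmetric]) (auto intro!: LK_intros)
  ultimately show ?thesis by simp
qed

text \<open>Self-adjointness moves D from one factor to the other; the eigenvalues differ, also
  after the injective expansion in t.\<close>

lemma eigenpoly_orthogonal: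
  assumes "i \<noteq> j"
  shows "Lam (eigenpoly i * eigenpoly j) = 0"
proof -
  let ?e = "\<lambda>i. eig 0 (of_nat i)"
  have K: "?e i \<in> KK" for i by (rule eig_KK) simp
  have Q: "eigenpoly i \<in> laurent_K" for i using eigenpoly_sym by (simp add: sym_iff_refl)
  have "Lam ((lmon (?e i) 0 * eigenpoly i) * eigenpoly j) = Lam (eigenpoly i * (lmon (?e j) 0 * eigenpoly j))"
    by (rule opD_symmetric[OF eigenpoly_sym eigenpoly_sym])
      (simp_all add: eigenpoly_opD of_lpoly_const_mult LK_intros lmon_LK K Q)
  then have "Lam (lmon (?e i) 0 * (eigenpoly i * eigenpoly j)) = Lam (lmon (?e j) 0 * (eigenpoly i * eigenpoly j))"
    by (simp only: ac_simps)
  then have "t_expand (?e i) * Lam (eigenpoly i * eigenpoly j) = t_expand (?e j) * Lam (eigenpoly i * eigenpoly j)"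
    by (simp add: Lam_const_mult K Q LK_intros)
  moreover have "t_expand (?e i) \<noteq> t_expand (?e j)"
  proof
    assume "t_expand (?e i) = t_expand (?e j)"
    then have "t_expand (?e i - ?e j) = 0"
      using te_add[OF K[of i] KK_intros(5)[OF K[of j]]] te_uminus[OF K[of j]] by simp
    then have "?e i = ?e j" using te_nz KK_intros(6)[OF K K] by (metis right_minus_eq)
    then show False using assms by (simp add: eig_eq)
  qed
  ultimately show ?thesis by simp
qed

section \<open>Nondegeneracy of the pairing\<close>

lemma fls_nth_mult_order:
  fixes f g :: "kk fls"
  assumes "\<And>i. i < a \<Longrightarrow> fls_nth f i = 0" "\<And>i. i < b \<Longrightarrow> fls_nth g i = 0"
  shows "n < a + b \<Longrightarrow> fls_nth (f * g) n = 0" "fls_nth (f * g) (a + b) = fls_nth f a * fls_nth g b"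
proof -
  have *: "fls_nth (f * g) n = 0" if "n < a + b" "\<And>i. i < a \<Longrightarrow> fls_nth f i = 0" "\<And>i. i < b \<Longrightarrow> fls_nth g i = 0" for n a b
  proof (cases "f = 0 \<or> g = 0")
    case False
    then have "a \<le> fls_subdegree f" "b \<le> fls_subdegree g"
      using that fls_subdegree_geI by auto
    then show ?thesis using that by (intro fls_times_nth_eq0) simp
  qed auto
  show "n < a + b \<Longrightarrow> fls_nth (f * g) n = 0" using * assms by blast
  show "fls_nth (f * g) (a + b) = fls_nth f a * fls_nth g b"
  proof (cases "fls_nth f a = 0 \<or> fls_nth g b = 0")
    case False
    then have "fls_subdegree f = a" "fls_subdegree g = b"
      using assms by (auto intro!: fls_subdegree_eqI)
    then show ?thesis using fls_times_base[of f g] by simp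
  next
    case True
    then show ?thesis
    proof
      assume 0: "fls_nth f a = 0"
      then have "fls_nth f i = 0" if "i < a + 1" for i using assms(1) that by (cases "i = a") auto
      then have "fls_nth (f * g) (a + b) = 0" using assms(2) by (intro *[of _ "a + 1" b]) auto
      then show ?thesis using 0 by simp
    next
      assume 0: "fls_nth g b = 0"
      then have "fls_nth g i = 0" if "i < b + 1" for i using assms(2) that by (cases "i = b") auto
      then have "fls_nth (f * g) (a + b) = 0" using assms(1) by (intro *[of _ a "b + 1"]) auto
      then show ?thesis using 0 by simp
    qed
  qed
qed

text \<open>Take \<open>j\<close> maximal such that the coefficient of \<open>z^j\<close> in \<open>r\<close> has minimal order in \<open>t\<close>.
  In the pairing of \<open>r\<close> with \<open>z^j\<close> only the coefficient of \<open>z^(-j)\<close> contributes to this order.\<close>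

lemma Lam_lmon_nz:
  assumes r: "r \<in> sym_laurent_K" "r \<noteq> 0"
  shows "\<exists>j. Lam (lmon 1 j * r) \<noteq> 0"
proof -
  let ?r = "\<lambda>k. t_expand (Poly_Mapping.lookup r k)"
  let ?K = "Poly_Mapping.keys r"
  have rK: "r \<in> laurent_K" using r by (simp add: sym_iff_refl)
  have nz: "?r k \<noteq> 0" if "k \<in> ?K" for k
    using that rK by (intro te_nz) (auto simp: laurent_K_def in_keys_iff)
  have K: "?K \<noteq> {}" "finite ?K" using r(2) by auto
  define \<mu> where "\<mu> = Min ((\<lambda>k. fls_subdegree (?r k)) ` ?K)"
  define M where "M = {k \<in> ?K. fls_subdegree (?r k) = \<mu>}"
  have \<mu>: "\<mu> \<le> fls_subdegree (?r k)" if "k \<in> ?K" for k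
    unfolding \<mu>_def using K that by (intro Min_le) auto
  have "\<mu> \<in> (\<lambda>k. fls_subdegree (?r k)) ` ?K" unfolding \<mu>_def using K by (intro Min_in) auto
  then have M: "M \<noteq> {}" "finite M" using K by (auto simp: M_def)
  have Msym: "- k \<in> M" if "k \<in> M" for k
    using that sym_lookup[OF r(1), of k] by (simp add: M_def in_keys_iff)
  define j where "j = Max M"
  have jM: "j \<in> M" and jmax: "\<And>k. k \<in> M \<Longrightarrow> k \<le> j" unfolding j_def using M by auto
  have j0: "j \<ge> 0" using jmax[OF Msym[OF jM]] by simp
  have ord: "fls_nth (?r k) i = 0" if "i < \<mu>" for i k
  proof (cases "k \<in> ?K")
    case True
    then show ?thesis using \<mu>[OF True] that by (intro fls_eq0_below_subdegree) simp
  qed (simp add: in_keys_iff te_0)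
  have ord': "fls_nth (?r k) i = 0" if "i < \<mu> + 1" "k \<notin> M" for i k
  proof (cases "k \<in> ?K")
    case True
    then have "\<mu> < fls_subdegree (?r k)" using \<mu>[OF True] \<open>k \<notin> M\<close> by (simp add: M_def order_less_le)
    then show ?thesis using that by (intro fls_eq0_below_subdegree) simp
  qed (simp add: in_keys_iff te_0)
  have "fls_nth (Lam (lmon 1 j * r)) \<mu> = (\<Sum>k\<in>?K. fls_nth (?r k * Delta (- k - j)) \<mu>)"
    using rK by (subst Lam_lmon_mult) (simp_all add: KK_intros te_1 fls_nth_sum)
  also have "\<dots> = (\<Sum>k\<in>?K. if k = - j then fls_nth (?r (- j)) \<mu> else 0)"
  proof (rule sum.cong[OF refl])
    fix k
    assume "k \<in> ?K"
    consider "k = - j" | "k > - j" | "k < - j" by linarith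
    then show "fls_nth (?r k * Delta (- k - j)) \<mu> = (if k = - j then fls_nth (?r (- j)) \<mu> else 0)"
    proof cases
      case 1
      have "fls_nth (?r (- j) * Delta 0) (\<mu> + 0) = fls_nth (?r (- j)) \<mu> * fls_nth (Delta 0) 0"
        by (rule fls_nth_mult_order(2)) (simp_all add: ord Delta_order)
      then show ?thesis using 1 by (simp add: Delta_0_0)
    next
      case 2
      then obtain p where p: "- k - j = - int p" "p > 0"
        by (metis diff_minus_eq_add minus_diff_commute minus_diff_eq zero_less_diff zero_less_imp_eq_int uminus_add_conv_diff add.commute diff_gt_0_iff_gt)
      have "fls_nth (?r k * Delta (- int p)) \<mu> = 0"
        by (rule fls_nth_mult_order(1)[of \<mu> _ "int p"]) (use p(2) ord Delta_neg_order in auto)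
      then show ?thesis using 2 p by simp
    next
      case 3
      have "k \<notin> M"
      proof
        assume "k \<in> M"
        then have "- k \<le> j" using Msym jmax by blast
        then show False using 3 by simp
      qed
      then have "fls_nth (?r k * Delta (- k - j)) \<mu> = 0"
        by (intro fls_nth_mult_order(1)[of "\<mu> + 1" _ 0]) (use ord' Delta_order in auto)
      then show ?thesis using 3 by simp
    qed
  qed
  also have "\<dots> = fls_nth (?r (- j)) \<mu>"
    using Msym[OF jM] by (simp add: M_def)
  also have "\<dots> \<noteq> 0"
    using Msym[OF jM] nz by (auto simp: M_def)
  finally show ?thesis by (intro exI[of _ j]) auto
qed

lemma par_ab_neq_1: "1 - par_a * par_b \<noteq> 0"
  using par_prod_neq_qpow[of 0 1 0] by (simp add: par_def)

text \<open>Some z^j pairs nontrivially with r (\<open>Lam_lmon_nz\<close>). Modulo products of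
  \<open>Pab\<close> with symmetric elements, which \<open>Lam\<close> kills even after
  multiplication by r, (1-ab) z^j is the negative of a symmetric element, and ab is not 1.\<close>

lemma Lam_nondegenerate:
  assumes r: "r \<in> sym_laurent_K" "r \<noteq> 0"
  shows "\<exists>s\<in>sym_laurent_K. Lam (r * s) \<noteq> 0"
proof -
  obtain j where j: "Lam (lmon 1 j * r) \<noteq> 0" using Lam_lmon_nz[OF r] by blast
  \<comment> \<open>Let s and w be the antisymmetrisations of z^(-j) \<open>Pab\<close> and z^(-j),
    divided by z - 1/z. As \<open>Pab\<close> itself antisymmetrises to -(1-ab)(z - 1/z), the
    product rule gives s + (1-ab) z^j = \<open>Pab\<close> w.\<close>
  let ?x = "of_lpoly Pab * zz powi (- j)"
  have xLZ: "?x \<in> LZ" by (intro LZ_intros LZ_zz) (simp add: LZ_def Pab_LK)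
  obtain s where s: "s \<in> sym_laurent_K" "of_lpoly s * (zz - 1 / zz) = ?x - zinv ?x"
    using antisym_quotient[OF xLZ] by (auto simp: SZ_def)
  obtain w where w: "w \<in> sym_laurent_K" "of_lpoly w * (zz - 1 / zz) = zz powi (- j) - zinv (zz powi (- j))"
    using antisym_quotient[OF LZ_zz[of "- j"]] by (auto simp: SZ_def)
  have zj: "zinv (zz powi (- j)) = zz powi j"
    by (simp add: zinv.inverse zinv.power_int zinv_zz power_int_minus power_int_inverse)
  have P: "of_lpoly Pab - zinv (of_lpoly Pab) = - (1 - scal par_a * scal par_b) * (zz - 1 / zz)"
    unfolding of_lpoly_Pab by (simp add: zinv.simps zinv_zz field_simps power2_eq_square)
  have "(of_lpoly s + (1 - scal par_a * scal par_b) * zz powi j) * (zz - 1 / zz) = of_lpoly Pab * of_lpoly w * (zz - 1 / zz)"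
  proof -
    have "(of_lpoly s + (1 - scal par_a * scal par_b) * zz powi j) * (zz - 1 / zz) =
        ?x - zinv (of_lpoly Pab) * zz powi j + ((1 - scal par_a * scal par_b) * (zz - 1 / zz)) * zz powi j"
      unfolding distrib_right s(2) zinv.mult zj by (simp only: ac_simps)
    also have "(1 - scal par_a * scal par_b) * (zz - 1 / zz) = zinv (of_lpoly Pab) - of_lpoly Pab"
      using P by (simp add: algebra_simps)
    also have "?x - zinv (of_lpoly Pab) * zz powi j + (zinv (of_lpoly Pab) - of_lpoly Pab) * zz powi j =
        of_lpoly Pab * (zz powi (- j) - zz powi j)"
      by (simp add: algebra_simps)
    also have "\<dots> = of_lpoly Pab * of_lpoly w * (zz - 1 / zz)"
      unfolding mult.assoc w(2) zj ..
    finally show ?thesis .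
  qed
  then have "of_lpoly s + (1 - scal par_a * scal par_b) * zz powi j = of_lpoly Pab * of_lpoly w"
    using zz_minus_inverse_nz by simp
  then have "of_lpoly (s + lmon (1 - par_a * par_b) 0 * lmon 1 j) = of_lpoly (Pab * w)"
    by (simp add: of_lpoly_add of_lpoly_const_mult of_lpoly_mult of_lpoly_lmon scal.simps)
  then have "s + lmon (1 - par_a * par_b) 0 * lmon 1 j = Pab * w" by (simp add: of_lpoly_eq)
  then have "r * (s + lmon (1 - par_a * par_b) 0 * lmon 1 j) = r * (Pab * w)" by simp
  then have eq: "r * s + lmon (1 - par_a * par_b) 0 * (lmon 1 j * r) = Pab * (w * r)"
    by (simp add: distrib_left ac_simps)
  have K: "r \<in> laurent_K" "s \<in> laurent_K" "1 - par_a * par_b \<in> KK"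
    using r s by (simp_all add: sym_iff_refl par_abcd_KK KK_intros)
  have "Lam (r * s) + t_expand (1 - par_a * par_b) * Lam (lmon 1 j * r) = 0"
    using arg_cong[OF eq, of Lam] K w(1) r(1)
    by (simp add: Lam_add LK_intros lmon_LK KK_intros Lam_const_mult Lam_Pab sym_K_intros)
  moreover have "t_expand (1 - par_a * par_b) * Lam (lmon 1 j * r) \<noteq> 0"
    using j te_nz[OF K(3)] par_ab_neq_1 by simp
  ultimately show ?thesis using s(1) by (metis add_0_left)
qed

text \<open>With vanishing norm the eigenpolynomial would be orthogonal to the whole basis of
  eigenpolynomials, against nondegeneracy.\<close>

lemma eigenpoly_norm_nz: "Lam (eigenpoly j * eigenpoly j) \<noteq> 0"
proof
  assume 0: "Lam (eigenpoly j * eigenpoly j) = 0"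
  have "eigenpoly j \<noteq> 0" using eigenpoly_lead[of j] by auto
  then obtain s where s: "s \<in> sym_laurent_K" "Lam (eigenpoly j * s) \<noteq> 0"
    using Lam_nondegenerate eigenpoly_sym by blast
  obtain N where "top_le s N"
    using obtain_top[of s] by (metis lookup_zero top_le_def)
  then have "top_le s (int (nat (N + 1)) - 1)" by (rule top_le_mono) simp
  then obtain c where c: "\<And>i. c i \<in> KK" "s = (\<Sum>i<nat (N + 1). lmon (c i) 0 * eigenpoly i)"
    using span_below[OF eigenpoly_basis s(1)] by blast
  have Q: "eigenpoly i \<in> laurent_K" for i using eigenpoly_sym by (simp add: sym_iff_refl)
  have "eigenpoly j * s = (\<Sum>i<nat (N + 1). lmon (c i) 0 * (eigenpoly j * eigenpoly i))"
    unfolding c(2) by (simp add: sum_distrib_left mult.left_commute)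
  then have "Lam (eigenpoly j * s) = (\<Sum>i<nat (N + 1). t_expand (c i) * Lam (eigenpoly j * eigenpoly i))"
    by (simp add: Lam_sum_fun LK_intros lmon_LK c(1) Q Lam_const_mult)
  also have "\<dots> = 0"
  proof (rule sum.neutral, rule ballI)
    fix i
    show "t_expand (c i) * Lam (eigenpoly j * eigenpoly i) = 0"
      using 0 eigenpoly_orthogonal[of j i] by (cases "i = j") auto
  qed
  finally show False using s(2) by simp
qed

lemma lstar_lsym: "lstar (lsym m) = lsym m"
proof (cases "m = 0")
  case True
  have "lsym 0 = lmon 2 0" by (simp add: lsym_def lmon_def single_add [symmetric])
  moreover have "lstar (lmon 2 0) = lmon 2 0"
    by (simp add: lstar_def lmon_def star.numeral del: single_numeral)
  ultimately show ?thesis unfolding True by simp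
next
  case False
  then have "Poly_Mapping.keys (lsym m) = {int m, - int m}"
    by (auto simp: lsym_def lmon_def in_keys_iff lookup_add lookup_single when_def split: if_splits)
  then show ?thesis unfolding lstar_def using False
    by (simp add: lsym_def lookup_add lmon_def lookup_single star.one)
qed

lemma pairing_lsym: "pairing p (lsym m) = Lam (p * lsym m)"
  unfolding pairing_def lstar_lsym Lam_def lin_ext_def ..

lemma lsym_basis: "basis_below lsym n"
  unfolding basis_below_def
proof (intro allI impI conjI)
  fix j
  show "lsym j \<in> sym_laurent_K" by (rule lsym_sym)
  show "top_le (lsym j) (int j)" "Poly_Mapping.lookup (lsym j) (int j) \<noteq> 0"
    by (auto simp: top_le_def lsym_def lookup_add lmon_def lookup_single when_def)
qed

text \<open>The Askey--Wilson polynomials are the eigenpolynomials.\<close>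

lemma AW_eq: "AW n = eigenpoly n"
proof -
  let ?P = "\<lambda>p. p \<in> sym_laurent_K \<and> (if n = 0 then p = 1
      else (\<exists>e. (\<forall>j<n. e j \<in> KK) \<and> p = lsym n + (\<Sum>j<n. lmon (e j) 0 * lsym j)) \<and>
           (\<forall>m<n. pairing p (lsym m) = 0))"
  have Q: "eigenpoly i \<in> laurent_K" for i using eigenpoly_sym by (simp add: sym_iff_refl)
  have lK: "lsym i \<in> laurent_K" for i using lsym_sym by (simp add: sym_iff_refl)
  have lead: "top_le (p - eigenpoly n) (int n - 1)"
    if "top_le p (int n)" "Poly_Mapping.lookup p (int n) = 1" for p
    unfolding top_le_def
  proof (intro allI impI)
    fix k
    assume "int n - 1 < k"
    then show "Poly_Mapping.lookup (p - eigenpoly n) k = 0"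
      using that eigenpoly_top[of n] eigenpoly_lead[of n]
      by (cases "k = int n") (auto simp: lookup_minus top_le_def)
  qed
  show ?thesis
  proof (cases "n = 0")
    case True
    have "top_le (1 - eigenpoly n) (int n - 1)"
      by (rule lead) (simp_all add: True top_le_def lookup_one when_def)
    then have "1 - eigenpoly n = 0"
      using span_below[of eigenpoly 0 "1 - eigenpoly n"] eigenpoly_sym sym_K_intros True
      by (auto simp: basis_below_def)
    then have "eigenpoly n = 1" by simp
    then show ?thesis unfolding AW_def using True by (auto simp: sym_K_intros)
  next
    case False
    have lsym_lead: "top_le (lsym n) (int n)" "Poly_Mapping.lookup (lsym n) (int n) = 1"
      using msym[of n] False by (simp_all add: msym_def)
    have ex: "?P (eigenpoly n)"
    proof -
      have "eigenpoly n - lsym n \<in> sym_laurent_K" by (intro sym_K_intros eigenpoly_sym lsym_sym)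
      moreover have "top_le (eigenpoly n - lsym n) (int n - 1)"
        using lead[OF lsym_lead] by (auto simp: top_le_def lookup_minus)
      ultimately obtain e where e: "\<And>j. e j \<in> KK" "eigenpoly n - lsym n = (\<Sum>j<n. lmon (e j) 0 * lsym j)"
        using span_below[OF lsym_basis] by blast
      have "eigenpoly n = lsym n + (\<Sum>j<n. lmon (e j) 0 * lsym j)"
        unfolding e(2)[symmetric] by simp
      then have E: "\<exists>e. (\<forall>j<n. e j \<in> KK) \<and> eigenpoly n = lsym n + (\<Sum>j<n. lmon (e j) 0 * lsym j)"
        using e(1) by (intro exI[of _ e] conjI allI impI)
      have "pairing (eigenpoly n) (lsym m) = 0" if "m < n" for m
      proof -
        have "top_le (lsym m) (int n - 1)" using that by (auto simp: top_le_def lsym_def lookup_add lmon_def lookup_single when_def)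
        then obtain c where c: "\<And>i. c i \<in> KK" "lsym m = (\<Sum>i<n. lmon (c i) 0 * eigenpoly i)"
          using span_below[OF eigenpoly_basis lsym_sym] by blast
        have "eigenpoly n * lsym m = (\<Sum>i<n. lmon (c i) 0 * (eigenpoly n * eigenpoly i))"
          unfolding c(2) by (simp add: sum_distrib_left mult.left_commute)
        then have "Lam (eigenpoly n * lsym m) = (\<Sum>i<n. t_expand (c i) * Lam (eigenpoly n * eigenpoly i))"
          by (simp add: Lam_sum_fun LK_intros lmon_LK c(1) Q Lam_const_mult)
        also have "\<dots> = 0"
          by (rule sum.neutral) (auto simp: eigenpoly_orthogonal)
        finally show ?thesis by (simp add: pairing_lsym)
      qed
      then have Z: "\<forall>m<n. pairing (eigenpoly n) (lsym m) = 0" by (intro allI impI)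
      show ?thesis unfolding if_not_P[OF False] by (intro conjI eigenpoly_sym E Z)
    qed
    moreover have "p = eigenpoly n" if p: "?P p" for p
    proof -
      obtain e where e: "\<And>j. j < n \<Longrightarrow> e j \<in> KK" "p = lsym n + (\<Sum>j<n. lmon (e j) 0 * lsym j)"
        using p False by auto
      have z: "Poly_Mapping.lookup (lmon (e j) 0 * lsym j) k = 0" if "j < n" "k \<ge> int n" for j k
        unfolding lookup_const_mult using that by (simp add: lsym_def lookup_add lmon_def lookup_single when_def)
      have "top_le p (int n)" "Poly_Mapping.lookup p (int n) = 1"
        using lsym_lead unfolding e(2) by (auto simp: top_le_def lookup_add lookup_sum z)
      then have "top_le (p - eigenpoly n) (int n - 1)" by (rule lead)
      moreover have ps: "p - eigenpoly n \<in> sym_laurent_K" using p by (auto intro!: sym_K_intros eigenpoly_sym)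
      ultimately obtain c where c: "\<And>i. c i \<in> KK" "p - eigenpoly n = (\<Sum>i<n. lmon (c i) 0 * eigenpoly i)"
        using span_below[OF eigenpoly_basis] by blast
      have pK: "p \<in> laurent_K" using p by (simp add: sym_iff_refl)
      have orth: "Lam ((p - eigenpoly n) * lsym m) = 0" if "m < n" for m
      proof -
        have "Lam (p * lsym m) = 0" "Lam (eigenpoly n * lsym m) = 0"
          using p ex that False by (simp_all add: pairing_lsym)
        moreover have "Lam (p * lsym m) = Lam ((p - eigenpoly n) * lsym m) + Lam (eigenpoly n * lsym m)"
          using pK Q lK by (subst Lam_add [symmetric]) (simp_all add: LK_intros left_diff_distrib)
        ultimately show ?thesis by simp
      qed
      \<comment> \<open>Both p and the eigenpolynomial are orthogonal to everything of lower degree.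
        Pairing their difference with the i-th eigenpolynomial isolates c_i times a nonzero
        norm.\<close>
      have "c i = 0" if i: "i < n" for i
      proof -
        have "top_le (eigenpoly i) (int n - 1)" using i eigenpoly_top[of i] by (auto intro: top_le_mono)
        then obtain b where b: "\<And>m. b m \<in> KK" "eigenpoly i = (\<Sum>m<n. lmon (b m) 0 * lsym m)"
          using span_below[OF lsym_basis eigenpoly_sym] by blast
        have "(p - eigenpoly n) * eigenpoly i = (\<Sum>m<n. lmon (b m) 0 * ((p - eigenpoly n) * lsym m))"
          by (subst b(2)) (simp add: sum_distrib_left mult.left_commute)
        then have "Lam ((p - eigenpoly n) * eigenpoly i) = (\<Sum>m<n. t_expand (b m) * Lam ((p - eigenpoly n) * lsym m))"
          using pK by (simp add: Lam_sum_fun LK_intros lmon_LK b(1) Q lK Lam_const_mult)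
        also have "\<dots> = 0" by (rule sum.neutral) (auto simp: orth)
        finally have 0: "Lam ((p - eigenpoly n) * eigenpoly i) = 0" .
        have "(p - eigenpoly n) * eigenpoly i = (\<Sum>m<n. lmon (c m) 0 * (eigenpoly m * eigenpoly i))"
          unfolding c(2) by (simp add: sum_distrib_right mult.assoc)
        then have "Lam ((p - eigenpoly n) * eigenpoly i) = (\<Sum>m<n. t_expand (c m) * Lam (eigenpoly m * eigenpoly i))"
          by (simp add: Lam_sum_fun LK_intros lmon_LK c(1) Q Lam_const_mult)
        also have "\<dots> = (\<Sum>m<n. if m = i then t_expand (c i) * Lam (eigenpoly i * eigenpoly i) else 0)"
          by (rule sum.cong) (auto simp: eigenpoly_orthogonal)
        finally have "t_expand (c i) * Lam (eigenpoly i * eigenpoly i) = 0" using 0 i by simp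
        then have "t_expand (c i) = 0" using eigenpoly_norm_nz by simp
        then show ?thesis using te_nz c(1) by blast
      qed
      then have "p - eigenpoly n = 0" unfolding c(2) by (intro sum.neutral) (simp add: lmon_def)
      then show ?thesis by simp
    qed
    ultimately show ?thesis unfolding AW_def by (rule the_equality)
  qed
qed

lemma AW_shifted_eq: "AW_shifted h r = shifted_eigenpoly h r"
  by (simp add: AW_shifted_def shifted_eigenpoly_def AW_eq)

subsection \<open>Rational functions as quotients of polynomials\<close>

definition ev :: "kk poly \<Rightarrow> kz" where
  "ev p = (\<Sum>i\<le>Polynomial.degree p. scal (Polynomial.coeff p i) * zz ^ i)"

lemma ev_bound: "Polynomial.degree p \<le> n \<Longrightarrow> ev p = (\<Sum>i\<le>n. scal (Polynomial.coeff p i) * zz ^ i)"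
  unfolding ev_def by (rule sum.mono_neutral_left) (auto simp: coeff_eq_0 scal.zero)

lemma ev_0 [simp]: "ev 0 = 0"
  by (simp add: ev_def scal.zero)

lemma ev_pCons: "ev (pCons a p) = scal a + zz * ev p"
proof -
  have "ev (pCons a p) = (\<Sum>i\<le>Suc (Polynomial.degree p). scal (Polynomial.coeff (pCons a p) i) * zz ^ i)"
    by (rule ev_bound) (simp add: degree_pCons_le)
  also have "\<dots> = scal a + zz * ev p"
    by (subst sum.atMost_Suc_shift) (simp add: ev_def sum_distrib_left algebra_simps)
  finally show ?thesis .
qed

lemma ev_add: "ev (p + q) = ev p + ev q"
  by (induction p q rule: poly_induct2) (simp_all add: ev_pCons scal.add algebra_simps)

lemma ev_smult: "ev (Polynomial.smult a p) = scal a * ev p"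
  by (induction p) (simp_all add: ev_pCons scal.mult algebra_simps)

lemma ev_mult: "ev (p * q) = ev p * ev q"
  by (induction p) (simp_all add: mult_pCons_left ev_add ev_smult ev_pCons scal.zero algebra_simps)

lemma ev_uminus: "ev (- p) = - ev p"
  using ev_smult[of "-1" p] by (simp add: scal.simps)

lemma ev_1: "ev 1 = 1"
  by (simp add: ev_def scal.one)

lemma ev_diff: "ev (p - q) = ev p - ev q"
  using ev_add[of p "- q"] by (simp add: ev_uminus)

lemma ev_prod: "ev (\<Prod>i\<in>I. p i) = (\<Prod>i\<in>I. ev (p i))"
  by (induction I rule: infinite_finite_induct) (simp_all add: ev_1 ev_mult)

lemma ev_of_lpoly: "ev p = of_lpoly (\<Sum>i\<le>Polynomial.degree p. lmon (Polynomial.coeff p i) (int i))"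
  by (simp add: ev_def of_lpoly_sum of_lpoly_lmon)

lemma ev_eq_0: "ev p = 0 \<longleftrightarrow> p = 0"
proof
  assume "ev p = 0"
  then have 0: "(\<Sum>i\<le>Polynomial.degree p. lmon (Polynomial.coeff p i) (int i)) = 0"
    by (simp add: ev_of_lpoly)
  have "Polynomial.lead_coeff p = Poly_Mapping.lookup (\<Sum>i\<le>Polynomial.degree p. lmon (Polynomial.coeff p i) (int i)) (int (Polynomial.degree p))"
    by (simp add: lookup_sum lmon_def lookup_single when_def)
  then show "p = 0" unfolding 0 by simp
qed simp

lemma ev_eq: "ev p = ev q \<longleftrightarrow> p = q"
  using ev_eq_0[of "p - q"] by (simp add: ev_diff)

definition sh :: "rat \<Rightarrow> kk poly \<Rightarrow> kk poly" where
  "sh e p = pcompose p [:0, qpow e:]"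

lemma sh_mult: "sh e (p * q) = sh e p * sh e q" and sh_add: "sh e (p + q) = sh e p + sh e q"
  and sh_0 [simp]: "sh e 0 = 0" and sh_1 [simp]: "sh e 1 = 1"
  by (simp_all add: sh_def pcompose_mult pcompose_add pcompose_1)

lemma poly_sh: "poly (sh e p) x = poly p (qpow e * x)"
  by (simp add: sh_def poly_pcompose mult.commute)

lemma sh_sh: "sh e (sh e' p) = sh (e + e') p"
  unfolding sh_def pcompose_assoc [symmetric] by (simp add: pcompose_pCons qpow_add mult.commute)

lemma sh_zero [simp]: "sh 0 p = p"
  by (simp add: sh_def)

lemma sh_eq_0: "sh e p = 0 \<longleftrightarrow> p = 0"
  using sh_sh[of "- e" e p] by (metis sh_0 add.left_inverse sh_zero)

lemma degree_sh: "Polynomial.degree (sh e p) = Polynomial.degree p"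
  by (simp add: sh_def degree_pcompose)

lemma lead_coeff_sh: "Polynomial.lead_coeff (sh e p) = qpow (of_nat (Polynomial.degree p) * e) * Polynomial.lead_coeff p"
  by (simp add: sh_def lead_coeff_comp qpow_power)

lemma T_ev: "T_pow n (ev p) = ev (sh (of_int n / 2) p)"
  by (induction p)
    (simp_all add: sh_def T.zero ev_pCons ev_mult ev_add ev_smult T.add T.mult T_pow_zz pcompose_pCons scal.zero algebra_simps)

lemma ev_monom: "ev (Polynomial.monom x n) = scal x * zz ^ n"
  by (induction n) (simp_all add: monom_0 monom_Suc ev_pCons scal.zero)

lemma kz_as_ev: "\<exists>f g. x = ev f / ev g \<and> g \<noteq> 0 \<and> (\<forall>p. p dvd f \<longrightarrow> p dvd g \<longrightarrow> p dvd 1)"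
proof -
  have lp: "\<exists>p m. of_lpoly f = ev p / zz ^ m" for f
  proof (induction f rule: poly_mapping_add_induct)
    case (single k x)
    have "of_lpoly (Poly_Mapping.single k x) = scal x * zz powi k"
      using of_lpoly_lmon by (simp add: lmon_def)
    moreover have "zz powi k = zz ^ nat k / zz ^ nat (- k)"
      by (cases k rule: int_cases2) (simp_all add: power_int_minus field_simps)
    ultimately show ?case by (intro exI[of _ "Polynomial.monom x (nat k)"] exI[of _ "nat (- k)"]) (simp add: ev_monom)
  next
    case (add f g)
    then obtain p m p' m' where *: "of_lpoly f = ev p / zz ^ m" "of_lpoly g = ev p' / zz ^ m'" by blast
    have z: "zz ^ n = ev (Polynomial.monom 1 n)" for n
      by (simp add: ev_monom scal.one)
    have "of_lpoly (f + g) = ev (p * Polynomial.monom 1 m' + p' * Polynomial.monom 1 m) / zz ^ (m + m')"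
      by (simp add: of_lpoly_add * ev_add ev_mult z [symmetric] power_add field_simps)
    then show ?case by blast
  qed
  have "\<exists>f g. x = ev f / ev g \<and> g \<noteq> 0"
  proof -
    obtain u v where uv: "x = of_lpoly u / of_lpoly v" "v \<noteq> 0"
      by (cases x) (auto simp: Fract_of_lpoly)
    obtain p m p' m' where *: "of_lpoly u = ev p / zz ^ m" "of_lpoly v = ev p' / zz ^ m'" using lp by blast
    have z: "zz ^ n = ev (Polynomial.monom 1 n)" for n
      by (simp add: ev_monom scal.one)
    have p': "p' \<noteq> 0"
      using uv(2) *(2) by (metis ev_0 div_0 of_lpoly_eq_0)
    have "x = ev (p * Polynomial.monom 1 m') / ev (p' * Polynomial.monom 1 m)"
      unfolding uv(1) * ev_mult z [symmetric] by simp
    moreover have "p' * Polynomial.monom 1 m \<noteq> 0" using p' by (simp add: monom_eq_0_iff)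
    ultimately show ?thesis by blast
  qed
  then obtain n where "\<exists>f g. x = ev f / ev g \<and> g \<noteq> 0 \<and> Polynomial.degree g = n" by blast
  then have "\<exists>n. \<exists>f g. x = ev f / ev g \<and> g \<noteq> 0 \<and> Polynomial.degree g = n" ..
  \<comment> \<open>A denominator of least degree leaves no common factor.\<close>
  from LeastI_ex[OF this] obtain f g where fg: "x = ev f / ev g" "g \<noteq> 0"
    and min: "Polynomial.degree g = (LEAST n. \<exists>f g. x = ev f / ev g \<and> g \<noteq> 0 \<and> Polynomial.degree g = n)" by blast
  have "p dvd 1" if "p dvd f" "p dvd g" for p
  proof -
    obtain f' g' where f': "f = p * f'" "g = p * g'"
      using \<open>p dvd f\<close> \<open>p dvd g\<close> unfolding dvd_def by blast
    have nz: "p \<noteq> 0" "g' \<noteq> 0" using fg(2) f' by auto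
    then have "x = ev f' / ev g'" using fg(1) by (simp add: f' ev_mult ev_eq_0)
    then have "Polynomial.degree g \<le> Polynomial.degree g'"
      unfolding min using nz by (intro Least_le) blast
    then have "Polynomial.degree p = 0" using nz by (simp add: f' degree_mult_eq)
    then show ?thesis using nz is_unit_iff_degree by blast
  qed
  with fg show ?thesis by blast
qed

lemma qpow_inj_mult: "x \<noteq> 0 \<Longrightarrow> inj (\<lambda>n::nat. x * qpow (s * of_nat n))" if "s \<noteq> 0"
  using that by (auto simp: inj_def qpow_eq)

lemma poly_orbit_not_all_roots:
  assumes "p \<noteq> (0 :: kk poly)" "x \<noteq> 0" "s \<noteq> 0"
  shows "\<exists>n. poly p (x * qpow (s * of_nat n)) \<noteq> 0"
proof (rule ccontr)
  assume "\<not> ?thesis"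
  then have "range (\<lambda>n. x * qpow (s * of_nat n)) \<subseteq> {y. poly p y = 0}" by auto
  then have "finite (range (\<lambda>n. x * qpow (s * of_nat n)))"
    using poly_roots_finite[OF assms(1)] finite_subset by blast
  then show False using finite_imageD[OF _ qpow_inj_mult[OF assms(3,2)]] by simp
qed

text \<open>A first order \<open>q\<close>-difference equation with a rational solution: along a \<open>q\<close>-orbit the zeros of
  \<open>R\<^sub>1\<close> have to be compensated by zeros of \<open>R\<^sub>2\<close>.\<close>

lemma first_order_orbit:
  fixes R1 R2 :: "kk poly"
  assumes c: "c \<noteq> 0" "T_pow 2 c * ev R1 = scal \<kappa> * c * ev R2" "\<kappa> \<noteq> 0"
    and x: "poly R1 x = 0" "x \<noteq> 0"
  shows "\<exists>e::int. poly R2 (x * qpow (of_int e)) = 0"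
proof (rule ccontr)
  assume no: "\<not> ?thesis"
  obtain f g where fg0: "c = ev f / ev g" "g \<noteq> 0" "\<forall>p. p dvd f \<longrightarrow> p dvd g \<longrightarrow> p dvd 1"
    using kz_as_ev[of c] by blast
  note fg = fg0(1,2) fg0(3)[rule_format]
  have f: "f \<noteq> 0" using c(1) fg(1) by auto
  have "ev (sh 1 f * g * R1) = ev (Polynomial.smult \<kappa> (f * sh 1 g * R2))"
    using c(2) fg(2) unfolding fg(1) T.divide T_ev ev_mult ev_smult
    by (simp add: field_simps ev_eq_0 sh_eq_0)
  then have eq: "sh 1 f * g * R1 = Polynomial.smult \<kappa> (f * sh 1 g * R2)" by (simp add: ev_eq)
  have eqx: "poly f (qpow 1 * y) * poly g y * poly R1 y = \<kappa> * (poly f y * poly g (qpow 1 * y) * poly R2 y)" for y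
    using arg_cong[OF eq, of "\<lambda>p. poly p y"] by (simp add: poly_sh)
  have cop: "\<not> (poly f y = 0 \<and> poly g y = 0)" for y
  proof
    assume "poly f y = 0 \<and> poly g y = 0"
    then have "[:- y, 1:] dvd 1" using fg(3)[of "[:- y, 1:]"] by (simp add: poly_eq_0_iff_dvd)
    then show False by (simp add: is_unit_iff_degree)
  qed
  have R2: "poly R2 (x * qpow s) \<noteq> 0" if "s \<in> \<int>" for s
    using no that by (auto elim: Ints_cases)
  have step: "qpow 1 * (x * qpow s) = x * qpow (s + 1)" for s by (simp add: qpow_add)
  \<comment> \<open>As R2 has no zero on the orbit, the zero of R1 forces one of f or g. Coprimality
    then propagates a zero of f to all x q^(-n), or a zero of g to all x q^(n+1), which is too
    many.\<close>
  have "poly f x = 0 \<or> poly g (x * qpow 1) = 0"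
    using eqx[of x] x(1) c(3) R2[of 0] by (auto simp: mult.commute)
  then show False
  proof
    assume f0: "poly f x = 0"
    have "poly f (x * qpow (-1 * of_nat n)) = 0" for n
    proof (induction n)
      case (Suc n)
      have s: "- 1 * of_nat (Suc n) + 1 = (-1 * of_nat n :: rat)" by simp
      have "poly g (x * qpow (-1 * of_nat n)) \<noteq> 0" using Suc cop by blast
      moreover have "poly R2 (x * qpow (-1 * of_nat (Suc n))) \<noteq> 0" by (rule R2) simp
      ultimately show ?case
        using eqx[of "x * qpow (-1 * of_nat (Suc n))"] Suc c(3) unfolding step s by simp
    qed (simp add: f0)
    then show False using poly_orbit_not_all_roots[OF f x(2), of "-1"] by auto
  next
    assume g1: "poly g (x * qpow 1) = 0"
    have "poly g (x * qpow 1 * qpow (1 * of_nat n)) = 0" for n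
    proof (induction n)
      case (Suc n)
      let ?y = "x * qpow (of_nat n + 1)"
      have y: "x * qpow 1 * qpow (1 * of_nat n) = ?y" "x * qpow 1 * qpow (1 * of_nat (Suc n)) = qpow 1 * ?y"
        by (simp_all add: qpow_add)
      have "poly f ?y \<noteq> 0" using Suc cop unfolding y by blast
      moreover have "poly R2 ?y \<noteq> 0" by (rule R2) simp
      ultimately show ?case
        using eqx[of ?y] Suc c(3) unfolding y by simp
    qed (simp add: g1)
    then show False using poly_orbit_not_all_roots[OF fg(2), of "x * qpow 1" 1] x(2) by auto
  qed
qed

text \<open>In the leading coefficients of the cleared equation the dilation of numerator and
  denominator contributes integral powers of q only.\<close>

lemma first_order_degree:
  fixes R1 R2 :: "kk poly"
  assumes c: "c \<noteq> 0" "T_pow 2 c * ev R1 = scal \<kappa> * c * ev R2"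
    and R: "Polynomial.lead_coeff R1 = qpow s * Polynomial.lead_coeff R2" "R2 \<noteq> 0"
  shows "\<exists>m::int. \<kappa> = qpow (s + of_int m)"
proof -
  obtain f g where fg0: "c = ev f / ev g" "g \<noteq> 0" "\<forall>p. p dvd f \<longrightarrow> p dvd g \<longrightarrow> p dvd 1"
    using kz_as_ev[of c] by blast
  note fg = fg0(1,2) fg0(3)[rule_format]
  have f: "f \<noteq> 0" using c(1) fg(1) by auto
  have "ev (sh 1 f * g * R1) = ev (Polynomial.smult \<kappa> (f * sh 1 g * R2))"
    using c(2) fg(2) unfolding fg(1) T.divide T_ev ev_mult ev_smult
    by (simp add: field_simps ev_eq_0 sh_eq_0)
  then have eq: "sh 1 f * g * R1 = Polynomial.smult \<kappa> (f * sh 1 g * R2)" by (simp add: ev_eq)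
  let ?n = "of_nat (Polynomial.degree f) :: rat" and ?m = "of_nat (Polynomial.degree g) :: rat"
  have "qpow ?n * Polynomial.lead_coeff f * Polynomial.lead_coeff g * (qpow s * Polynomial.lead_coeff R2) =
     \<kappa> * (Polynomial.lead_coeff f * (qpow ?m * Polynomial.lead_coeff g) * Polynomial.lead_coeff R2)"
    using arg_cong[OF eq, of Polynomial.lead_coeff] unfolding lead_coeff_mult lead_coeff_smult lead_coeff_sh R(1) by simp
  then have "qpow ?n * qpow s * (Polynomial.lead_coeff f * Polynomial.lead_coeff g * Polynomial.lead_coeff R2) =
      \<kappa> * qpow ?m * (Polynomial.lead_coeff f * Polynomial.lead_coeff g * Polynomial.lead_coeff R2)"
    by (simp only: ac_simps)
  then have "qpow ?n * qpow s = \<kappa> * qpow ?m" using f fg(2) R(2) by simp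
  then have "\<kappa> = qpow (s + (?n - ?m))" by (simp add: qpow_add qpow_diff field_simps)
  then show ?thesis by (intro exI[of _ "int (Polynomial.degree f) - int (Polynomial.degree g)"]) simp
qed

text \<open>Write x = f/g. Any u with (T^2 u) g = u T^2 g has the same top exponent as g. Take u = f
  - c g with c chosen to remove the coefficient at that exponent; then u must vanish.\<close>

lemma T_2_constant:
  assumes "T_pow 2 x = x"
  shows "\<exists>c. x = scal c"
proof -
  obtain f g where fg: "x = of_lpoly f / of_lpoly g" "g \<noteq> 0"
    by (cases x) (auto simp: Fract_of_lpoly)
  have of_g: "of_lpoly g \<noteq> 0" "of_lpoly (lT 2 g) \<noteq> 0"
    using fg(2) T.eq_zero[of 2 "of_lpoly g"] by (simp_all add: T_of_lpoly)
  have "of_lpoly (lT 2 f * g) = of_lpoly (f * lT 2 g)"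
    using assms of_g unfolding fg(1) T.divide T_of_lpoly of_lpoly_mult by (simp add: field_simps)
  then have eq: "lT 2 f * g = f * lT 2 g" by (simp add: of_lpoly_eq)
  obtain m where m: "top_le g m" "Poly_Mapping.lookup g m \<noteq> 0" using fg(2) by (rule obtain_top)
  have lead: "n = m" if "lT 2 u * g = u * lT 2 g" "top_le u n" "Poly_Mapping.lookup u n \<noteq> 0" for u n
  proof -
    have "qpow (of_int n) * Poly_Mapping.lookup u n * Poly_Mapping.lookup g m =
        Poly_Mapping.lookup u n * (qpow (of_int m) * Poly_Mapping.lookup g m)"
      using arg_cong[OF that(1), of "\<lambda>w. Poly_Mapping.lookup w (n + m)"]
      unfolding top_mult(2)[OF top_le_lT[OF that(2)] m(1)] top_mult(2)[OF that(2) top_le_lT[OF m(1)]] lookup_lT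
      by simp
    then have "qpow (of_int n) = qpow (of_int m)" using that(3) m(2) by simp
    then show ?thesis by (simp add: qpow_eq)
  qed
  define c where "c = Poly_Mapping.lookup f m / Poly_Mapping.lookup g m"
  let ?u = "f - lmon c 0 * g"
  have lTc: "lT 2 (lmon c 0 * g) = lmon c 0 * lT 2 g" "lT 2 (f - lmon c 0 * g) = lT 2 f - lT 2 (lmon c 0 * g)"
    by (rule poly_mapping_eqI, simp add: lookup_lT lookup_const_mult lookup_minus right_diff_distrib)+
  have u: "lT 2 ?u * g = ?u * lT 2 g"
    unfolding lTc left_diff_distrib eq by (simp only: ac_simps)
  have "?u = 0"
  proof (rule ccontr)
    assume "?u \<noteq> 0"
    then obtain n where n: "top_le ?u n" "Poly_Mapping.lookup ?u n \<noteq> 0" by (rule obtain_top)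
    then have "n = m" using lead[OF u] by blast
    then show False using n(2) m(2) by (simp add: lookup_minus lookup_const_mult c_def)
  qed
  then have "of_lpoly f = scal c * of_lpoly g" by (simp add: of_lpoly_const_mult [symmetric])
  then have "x = scal c" using of_g by (simp add: fg(1))
  then show ?thesis ..
qed

subsection \<open>Second order equations: absence of poles\<close>

lemma prime_elem_sh: "prime_elem p \<Longrightarrow> prime_elem (sh e p)"
proof -
  assume p: "prime_elem p"
  have inv: "sh (- e) (sh e r) = r" "sh e (sh (- e) r) = r" for r by (simp_all add: sh_sh)
  have dvd: "sh e r dvd s \<longleftrightarrow> r dvd sh (- e) s" for r s
    by (metis dvd_def inv sh_mult)
  show ?thesis
    unfolding prime_elem_def
  proof (intro conjI allI impI)
    show "sh e p \<noteq> 0" using p by (simp add: sh_eq_0 prime_elem_def)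
    show "\<not> sh e p dvd 1" using p by (simp add: dvd prime_elem_def)
    show "sh e p dvd r \<or> sh e p dvd s" if "sh e p dvd r * s" for r s
      using that p by (auto simp: dvd sh_mult prime_elem_def)
  qed
qed

lemma sh_dvd_iff: "sh e r dvd sh e s \<longleftrightarrow> r dvd s"
proof
  assume "sh e r dvd sh e s"
  then obtain k where "sh e s = sh e r * k" by (auto elim: dvdE)
  then have "sh (- e) (sh e s) = sh (- e) (sh e r) * sh (- e) k" by (simp add: sh_mult)
  then show "r dvd s" by (simp add: sh_sh)
qed (auto simp: sh_mult elim!: dvdE)

text \<open>Equality of degrees makes the two dilates proportional. The nonzero constant term fixes
  the factor as 1, and the leading coefficients then compare the exponents.\<close>

lemma sh_dvd_eq:
  assumes "sh e p dvd sh e' p" "poly p 0 \<noteq> 0" "Polynomial.degree p > 0"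
  shows "e = e'"
proof -
  have p: "p \<noteq> 0" using assms(2) by auto
  obtain k where k: "sh e' p = sh e p * k" using assms(1) by (auto elim: dvdE)
  have k0: "k \<noteq> 0" using k p sh_eq_0[of e' p] by auto
  have "Polynomial.degree k = 0"
    using arg_cong[OF k, of Polynomial.degree] k0 p by (simp add: degree_mult_eq degree_sh sh_eq_0)
  then obtain c where c: "k = [:c:]" by (rule degree_eq_zeroE)
  have "poly p 0 = poly p 0 * c"
    using arg_cong[OF k, of "\<lambda>r. poly r 0"] by (simp add: poly_sh c)
  then have c1: "c = 1" using assms(2) by simp
  have "Polynomial.lead_coeff (sh e' p) = Polynomial.lead_coeff (sh e p)"
    using k by (simp add: c c1 one_pCons [symmetric])
  then have "qpow (of_nat (Polynomial.degree p) * e') = qpow (of_nat (Polynomial.degree p) * e)"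
    using p by (simp add: lead_coeff_sh)
  then show ?thesis using assms(3) by (simp add: qpow_eq)
qed

text \<open>Different dilates of p are primes not dividing each other. The product of those dividing
  g therefore divides g, and its degree bounds their number.\<close>

lemma finite_orbit_divisors:
  assumes p: "prime_elem p" "poly p 0 \<noteq> 0" and g: "g \<noteq> (0 :: kk poly)"
  shows "finite {e::int. sh (of_int e) p dvd g}"
proof (rule ccontr)
  assume "infinite {e::int. sh (of_int e) p dvd g}"
  then obtain A where A: "A \<subseteq> {e::int. sh (of_int e) p dvd g}" "finite A" "card A = Suc (Polynomial.degree g)"
    using infinite_arbitrarily_large by blast
  have p0: "p \<noteq> 0" using p(2) by auto
  have dp: "Polynomial.degree p > 0"
    using p(1) p0 is_unit_iff_degree[of p] by (auto simp: prime_elem_def)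
  have not: "\<not> sh (of_int e) p dvd (\<Prod>i\<in>B. sh (of_int i) p)" if "finite B" "e \<notin> B" for e :: int and B
    using that
  proof (induction B)
    case empty
    then show ?case using prime_elem_sh[OF p(1)] by (simp add: prime_elem_def)
  next
    case (insert i B)
    have "\<not> sh (of_int e) p dvd sh (of_int i) p"
      using sh_dvd_eq[of "of_int e" p "of_int i"] p(2) dp insert.prems by auto
    then show ?case
      using insert prime_elem_dvd_mult_iff[OF prime_elem_sh[OF p(1)]] by simp
  qed
  have "(\<Prod>i\<in>B. sh (of_int i) p) dvd g" if "B \<subseteq> A" "finite B" for B
    using that(2,1)
  proof (induction B)
    case (insert i B)
    then obtain k where k: "g = (\<Prod>i\<in>B. sh (of_int i) p) * k" by (auto elim: dvdE)
    have "sh (of_int i) p dvd g" using insert.prems A(1) by auto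
    then have "sh (of_int i) p dvd k"
      using not[OF insert.hyps] prime_elem_dvd_mult_iff[OF prime_elem_sh[OF p(1)]] unfolding k by blast
    then show ?case using insert.hyps unfolding k by (simp add: mult_dvd_mono mult.commute)
  qed simp
  then have "(\<Prod>i\<in>A. sh (of_int i) p) dvd g" using A by blast
  then have "Polynomial.degree (\<Prod>i\<in>A. sh (of_int i) p) \<le> Polynomial.degree g"
    using g by (rule dvd_imp_degree_le)
  moreover have "Polynomial.degree (\<Prod>i\<in>A. sh (of_int i) p) = (\<Sum>i\<in>A. Polynomial.degree p)"
    using p0 by (subst degree_prod_eq_sum_degree) (simp_all add: sh_eq_0 degree_sh)
  moreover have "(\<Sum>i\<in>A. Polynomial.degree p) \<ge> (\<Sum>i\<in>A. 1)"
    by (rule sum_mono) (use dp in simp)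
  ultimately show False using A(3) by simp
qed

text \<open>A substitute for an algebraically closed coefficient field: every prime factor has a
  root, so that common prime factors can be compared through roots.\<close>

definition splits :: "kk poly \<Rightarrow> bool" where
  "splits a \<longleftrightarrow> (\<forall>p. prime_elem p \<longrightarrow> p dvd a \<longrightarrow> (\<exists>x. poly p x = 0))"

lemma splits_mult: "splits a \<Longrightarrow> splits b \<Longrightarrow> splits (a * b)"
  by (auto simp: splits_def prime_elem_dvd_mult_iff)

lemma splits_prod: "(\<And>i. i \<in> I \<Longrightarrow> splits (f i)) \<Longrightarrow> splits (\<Prod>i\<in>I. f i)"
  by (induction I rule: infinite_finite_induct) (auto simp: splits_mult, auto simp: splits_def prime_elem_def)

lemma splits_linear: "b \<noteq> 0 \<Longrightarrow> splits [:a, b:]"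
  unfolding splits_def
proof (intro allI impI)
  fix p
  assume b: "b \<noteq> 0" and p: "prime_elem p" "p dvd [:a, b:]"
  obtain k where k: "[:a, b:] = p * k" using p(2) by (auto elim: dvdE)
  have "p \<noteq> 0" "k \<noteq> 0" using k b by auto
  then have "Polynomial.degree p + Polynomial.degree k = 1"
    using arg_cong[OF k, of Polynomial.degree] b by (simp add: degree_mult_eq)
  moreover have "Polynomial.degree p \<noteq> 0"
    using p(1) \<open>p \<noteq> 0\<close> is_unit_iff_degree[of p] by (auto simp: prime_elem_def)
  ultimately have "Polynomial.degree p = 1" by simp
  moreover obtain u r where r: "p = pCons u r" by (cases p)
  ultimately have "r \<noteq> 0" "Polynomial.degree r = 0"
    by (auto simp: degree_pCons_eq_if split: if_splits)
  then obtain v where v: "r = [:v:]" "v \<noteq> 0" by (auto elim: degree_eq_zeroE)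
  then have uv: "p = [:u, v:]" "v \<noteq> 0" using r by simp_all
  then show "\<exists>x. poly p x = 0" by (intro exI[of _ "- u / v"]) simp
qed

text \<open>The cleared form of a T^2 r + b T^(-2) r + c r = 0 with r = f/g. Among the dilates of p
  dividing g take the two extreme ones. Just beyond the last, only T^2 r has this pole, so a must
  cancel it; just before the first, only T^(-2) r has it, so b must. The resulting roots of a and b
  lie on one q-orbit at a distance excluded by hypothesis.\<close>

lemma no_poles:
  fixes a b c f g :: "kk poly"
  assumes cop: "\<And>p. p dvd f \<Longrightarrow> p dvd g \<Longrightarrow> p dvd 1" and g: "g \<noteq> 0"
    and eq: "a * sh 1 f * sh (-1) g * g + b * sh (-1) f * sh 1 g * g + c * f * sh 1 g * sh (-1) g = 0"
    and a: "splits a"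
    and nc: "\<And>x y l. poly a x = 0 \<Longrightarrow> poly b y = 0 \<Longrightarrow> (l::int) \<ge> 2 \<Longrightarrow> y \<noteq> x * qpow (of_int l)"
    and p: "prime_elem p" "p dvd g"
  shows "poly p 0 = 0"
proof (rule ccontr)
  assume p0: "poly p 0 \<noteq> 0"
  let ?p = "\<lambda>e::int. sh (of_int e) p"
  define J where "J = {e. ?p e dvd g}"
  have J: "finite J" "0 \<in> J"
    using finite_orbit_divisors[OF p(1) p0 g] p(2) by (simp_all add: J_def)
  define u where "u = Max J"
  define l where "l = Min J"
  have ul: "u \<in> J" "l \<in> J" "\<And>e. e \<in> J \<Longrightarrow> e \<le> u" "\<And>e. e \<in> J \<Longrightarrow> l \<le> e"
    unfolding u_def l_def using J by (auto intro!: Max_in Min_in)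
  have lu: "l \<le> u" using ul by blast
  have pr: "prime_elem (?p e)" for e by (rule prime_elem_sh[OF p(1)])
  have sh1: "?p (e + 1) dvd sh 1 r \<longleftrightarrow> ?p e dvd r" "?p (e - 1) dvd sh (-1) r \<longleftrightarrow> ?p e dvd r" for e r
    using sh_dvd_iff[of 1 "?p e" r] sh_dvd_iff[of "-1" "?p e" r] by (simp_all add: sh_sh add.commute[of 1])
  have notf: "\<not> ?p e dvd f" if "e \<in> J" for e
    using that cop[of "?p e"] pr[of e] by (auto simp: J_def prime_elem_def)
  have nJ: "u + 1 \<notin> J" "u + 2 \<notin> J" "l - 1 \<notin> J" "l - 2 \<notin> J"
    using ul(3)[of "u + 1"] ul(3)[of "u + 2"] ul(4)[of "l - 1"] ul(4)[of "l - 2"] by auto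
  have "?p (u + 1) dvd a"
  proof -
    have "?p (u + 1) dvd sh 1 g" using ul(1) unfolding sh1(1) J_def by simp
    then have "?p (u + 1) dvd - (b * sh (-1) f * sh 1 g * g + c * f * sh 1 g * sh (-1) g)"
      by (intro dvd_minus_iff[THEN iffD2] dvd_add) (auto intro: dvd_mult dvd_mult2)
    also have "- (b * sh (-1) f * sh 1 g * g + c * f * sh 1 g * sh (-1) g) = a * sh 1 f * sh (-1) g * g"
      by (rule minus_unique) (use eq in \<open>simp add: algebra_simps\<close>)
    finally have "?p (u + 1) dvd a * sh 1 f * sh (-1) g * g" .
    moreover have "\<not> ?p (u + 1) dvd sh 1 f" using notf[OF ul(1)] unfolding sh1(1) .
    moreover have "\<not> ?p (u + 1) dvd sh (-1) g"
      using nJ(2) sh1(2)[of "u + 2" g] unfolding J_def add_diff_eq[symmetric] by (simp add: add.commute[of 1])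
    moreover have "\<not> ?p (u + 1) dvd g" using nJ(1) by (simp add: J_def)
    ultimately show ?thesis unfolding prime_elem_dvd_mult_iff[OF pr] by blast
  qed
  moreover have "?p (l - 1) dvd b"
  proof -
    have "?p (l - 1) dvd sh (-1) g" using ul(2) unfolding sh1(2) J_def by simp
    then have "?p (l - 1) dvd - (a * sh 1 f * sh (-1) g * g + c * f * sh 1 g * sh (-1) g)"
      by (intro dvd_minus_iff[THEN iffD2] dvd_add) (auto intro: dvd_mult dvd_mult2)
    also have "- (a * sh 1 f * sh (-1) g * g + c * f * sh 1 g * sh (-1) g) = b * sh (-1) f * sh 1 g * g"
      by (rule minus_unique) (use eq in \<open>simp add: algebra_simps\<close>)
    finally have "?p (l - 1) dvd b * sh (-1) f * sh 1 g * g" .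
    moreover have "\<not> ?p (l - 1) dvd sh (-1) f" using notf[OF ul(2)] unfolding sh1(2) .
    moreover have "\<not> ?p (l - 1) dvd sh 1 g"
      using nJ(4) sh1(1)[of "l - 2" g] unfolding J_def by simp
    moreover have "\<not> ?p (l - 1) dvd g" using nJ(3) by (simp add: J_def)
    ultimately show ?thesis unfolding prime_elem_dvd_mult_iff[OF pr] by blast
  qed
  ultimately obtain x where x: "poly (?p (u + 1)) x = 0" "poly a x = 0"
    using a pr[of "u + 1"] unfolding splits_def by (metis dvd_trans poly_eq_0_iff_dvd)
  \<comment> \<open>Passing from the dilate u + 1 to the dilate l - 1 multiplies roots by q^(u-l+2),
    with exponent at least 2 because l <= u.\<close>
  let ?y = "x * qpow (of_int (u - l + 2))"
  have "poly (?p (l - 1)) ?y = poly (?p (u + 1)) x"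
  proof -
    have "qpow (of_int (l - 1)) * ?y = qpow (of_int (l - 1) + of_int (u - l + 2)) * x"
      unfolding qpow_add by (simp only: ac_simps)
    also have "of_int (l - 1) + of_int (u - l + 2) = (of_int (u + 1) :: rat)" by simp
    finally show ?thesis unfolding poly_sh by (rule arg_cong)
  qed
  then have "poly b ?y = 0"
    using x(1) \<open>?p (l - 1) dvd b\<close> by (metis dvd_trans poly_eq_0_iff_dvd)
  then show False using nc[OF x(2), of ?y "u - l + 2"] lu by simp
qed

subsection \<open>Gauge transformations\<close>

text \<open>The multipliers T^2(g)/g, by which conjugation with a nonzero rational function g
  changes the coefficient of T^2.\<close>

definition gauge :: "kz set" where
  "gauge = {y. y \<noteq> 0 \<and> (\<exists>g. g \<noteq> 0 \<and> T_pow 2 g = y * g)}"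

lemma gauge_1: "1 \<in> gauge"
  unfolding gauge_def by (auto intro!: exI[of _ 1] simp: T.one)

lemma gauge_mult: "x \<in> gauge \<Longrightarrow> y \<in> gauge \<Longrightarrow> x * y \<in> gauge"
proof -
  assume "x \<in> gauge" "y \<in> gauge"
  then obtain g g' where "x \<noteq> 0" "g \<noteq> 0" "T_pow 2 g = x * g" "y \<noteq> 0" "g' \<noteq> 0" "T_pow 2 g' = y * g'"
    by (auto simp: gauge_def)
  then show ?thesis unfolding gauge_def
    by (auto intro!: exI[of _ "g * g'"] simp: T.mult)
qed

lemma gauge_inverse: "x \<in> gauge \<Longrightarrow> inverse x \<in> gauge"
proof -
  assume "x \<in> gauge"
  then obtain g where "x \<noteq> 0" "g \<noteq> 0" "T_pow 2 g = x * g" by (auto simp: gauge_def)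
  then show ?thesis unfolding gauge_def
    by (auto intro!: exI[of _ "inverse g"] simp: T.inverse)
qed

lemma gauge_prod: "(\<And>i. i \<in> I \<Longrightarrow> f i \<in> gauge) \<Longrightarrow> (\<Prod>i\<in>I. f i) \<in> gauge"
  by (induction I rule: infinite_finite_induct) (simp_all add: gauge_1 gauge_mult)

lemma gauge_qpow: "r \<in> \<int> \<Longrightarrow> scal (qpow r) \<in> gauge"
proof -
  assume "r \<in> \<int>"
  then obtain m where r: "r = of_int m" by (auto elim: Ints_cases)
  have "T_pow 2 (zz powi m) = scal (qpow r) * zz powi m"
    by (simp add: T.power_int T_1_zz power_int_mult_distrib r qpow_power_int flip: scal.power_int)
  then show ?thesis unfolding gauge_def by (auto simp: scal.eq_zero intro!: exI[of _ "zz powi m"])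
qed

definition lf :: "kk \<Rightarrow> kk \<Rightarrow> kz" where
  "lf a b = scal a + scal b * zz"

lemma lf_ev: "lf a b = ev [:a, b:]"
  by (simp add: lf_def ev_pCons scal.zero)

lemma lf_nz: "a \<noteq> 0 \<or> b \<noteq> 0 \<Longrightarrow> lf a b \<noteq> 0"
  by (auto simp: lf_ev ev_eq_0)

lemma T_lf: "T_pow n (lf a b) = lf a (b * qpow (of_int n / 2))"
  by (simp add: lf_def T.simps T_pow_zz scal.mult)

lemma gauge_lf_step: "a \<noteq> 0 \<Longrightarrow> lf a b / lf a (b * qpow 1) \<in> gauge"
proof -
  assume a: "a \<noteq> 0"
  have "T_pow 2 (1 / lf a b) = lf a b / lf a (b * qpow 1) * (1 / lf a b)"
    using lf_nz[of a] a by (simp add: T.divide T.one T_lf)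
  then show ?thesis unfolding gauge_def using lf_nz[of a] a by (auto intro!: exI[of _ "1 / lf a b"])
qed

lemma gauge_lf_nat: "a \<noteq> 0 \<Longrightarrow> lf a b / lf a (b * qpow (of_nat n)) \<in> gauge"
proof (induction n)
  case 0
  then show ?case using lf_nz[of a b] gauge_1 by simp
next
  case (Suc n)
  have "lf a b / lf a (b * qpow (of_nat (Suc n))) =
     (lf a b / lf a (b * qpow (of_nat n))) * (lf a (b * qpow (of_nat n)) / lf a (b * qpow (of_nat n) * qpow 1))"
    using lf_nz[of a "b * qpow (of_nat n)"] Suc.prems by (simp add: qpow_add mult.assoc mult.commute[of "qpow 1"])
  then show ?case using gauge_mult[OF Suc.IH[OF Suc.prems] gauge_lf_step[OF Suc.prems]] by metis
qed

text \<open>Linear factors whose zeros lie on the same q-orbit differ by a gauge factor. One step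
  uses g = 1/(a + bz); several steps telescope, in either direction.\<close>

lemma gauge_lf:
  assumes "a \<noteq> 0" "e - e' \<in> \<int>"
  shows "lf a (b * qpow e) / lf a (b * qpow e') \<in> gauge"
proof -
  obtain m where m: "e = e' + of_int m" using assms(2) by (metis Ints_cases diff_add_cancel add.commute)
  show ?thesis
  proof (cases m rule: int_cases2)
    case (nonpos n)
    have "b * qpow e' = (b * qpow e) * qpow (of_nat n)"
      by (simp add: m nonpos mult.assoc flip: qpow_add)
    from gauge_lf_nat[OF assms(1), of "b * qpow e" n, folded this] show ?thesis .
  next
    case (nonneg n)
    have "b * qpow e = (b * qpow e') * qpow (of_nat n)"
      by (simp add: m nonneg mult.assoc flip: qpow_add)
    from gauge_inverse[OF gauge_lf_nat[OF assms(1), of "b * qpow e'" n, folded this]] show ?thesis by simp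
  qed
qed

subsection \<open>The twisted eigenvalue equation\<close>

lemma upar_prod_neq_qpow: "i < 4 \<Longrightarrow> j < 4 \<Longrightarrow> upar h i * upar h j \<noteq> qpow r"
proof
  assume ij: "i < 4" "j < 4" "upar h i * upar h j = qpow r"
  then have "par i * par j * qpow (hc h i + hc h j) = qpow r"
    by (simp add: upar_def qpow_add ac_simps)
  then have "par i * par j = qpow (r - (hc h i + hc h j))"
    unfolding qpow_diff by (simp add: field_simps)
  then show False using par_prod_neq_qpow ij by blast
qed

lemma upar_neq_upar_qpow: "i < 4 \<Longrightarrow> j < 4 \<Longrightarrow> i \<noteq> j \<Longrightarrow> upar h i \<noteq> upar h j * qpow r"
proof
  assume ij: "i < 4" "j < 4" "i \<noteq> j" "upar h i = upar h j * qpow r"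
  then have "par i * qpow (hc h i) = par j * qpow (hc h j + r)"
    by (simp add: upar_def qpow_add ac_simps)
  then have "par i = par j * qpow (hc h j + r - hc h i)"
    unfolding qpow_diff[of "hc h j + r"] by (simp add: field_simps)
  then show False using par_neq_par_qpow ij by blast
qed

text \<open>Multiplication of A(z) by this function replaces 1 - u_i z by q^(1/2)(z - u_i/q), that
  is, up to a constant, the parameter u_i by q/u_i for i in I.\<close>

definition tphi :: "rat4 \<Rightarrow> nat set \<Rightarrow> kz" where
  "tphi h I = (\<Prod>i\<in>I. scal tt * lf (- upar h i / qpow 1) 1 / lf 1 (- upar h i))"

text \<open>The equation D' r = lam r with \<open>lam 0 I\<close>, multiplied by
  \<open>gam h\<close>. D' arises from D_h by multiplying the coefficient of T^2 by
  \<open>tphi h I\<close> and adjusting that of T^(-2) as conjugation would, with unchanged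
  T^0.\<close>

definition twisted_eigen :: "rat4 \<Rightarrow> nat set \<Rightarrow> kz \<Rightarrow> bool" where
  "twisted_eigen h I r \<longleftrightarrow> Acoef h zz * tphi h I * T_pow 2 r + Acoef h (1 / zz) * T_pow (-2) (1 / tphi h I) * T_pow (-2) r =
     (Acoef h zz + Acoef h (1 / zz) + scal (gam h * (lam 0 I - gam h - 1 / gam h))) * r"

lemma lf_upar_nz [simp]: "i < 4 \<Longrightarrow> lf (- upar h i / qpow 1) 1 \<noteq> 0" "lf 1 (- upar h i) \<noteq> 0" "lf a 1 \<noteq> 0" "lf 1 a \<noteq> 0"
  by (simp_all add: lf_nz)

lemma tphi_nz: "I \<in> even_sets \<Longrightarrow> tphi h I \<noteq> 0"
  unfolding tphi_def by (auto simp: prod_zero_iff even_sets_def finite_subset scal.eq_zero)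

lemma T_inv_tphi:
  assumes I: "I \<in> even_sets"
  shows "T_pow (-2) (1 / tphi h I) = (\<Prod>i\<in>I. scal tt * lf 1 (- upar h i / qpow 1) / lf (- upar h i) 1)"
proof -
  have "T_pow (-2) (1 / tphi h I) = (\<Prod>i\<in>I. 1 / T_pow (-2) (scal tt * lf (- upar h i / qpow 1) 1 / lf 1 (- upar h i)))"
    unfolding tphi_def by (simp add: T.simps prod_dividef)
  also have "\<dots> = (\<Prod>i\<in>I. scal tt * lf 1 (- upar h i / qpow 1) / lf (- upar h i) 1)"
  proof (rule prod.cong[OF refl])
    fix i
    assume "i \<in> I"
    have e: "lf (- (upar h i / qpow 1)) (1 / qpow 1) = lf (- upar h i) 1 / scal (qpow 1)"
      by (simp add: lf_def scal.simps field_simps)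
    have q: "scal (qpow 1) = scal tt * scal tt"
      by (simp add: tt_square [symmetric] scal.mult power2_eq_square)
    show "1 / T_pow (-2) (scal tt * lf (- upar h i / qpow 1) 1 / lf 1 (- upar h i)) = scal tt * lf 1 (- upar h i / qpow 1) / lf (- upar h i) 1"
      by (simp add: T.simps T_lf qpow_minus e inverse_eq_divide) (simp add: q scal.eq_zero)
  qed
  finally show ?thesis .
qed

lemma zinv_lf: "zinv (lf a b) = lf b a / zz"
  by (simp add: lf_def zinv.simps zinv_zz field_simps)

lemma zinv_tphi:
  assumes I: "I \<in> even_sets"
  shows "zinv (tphi h I) = T_pow (-2) (1 / tphi h I)"
  unfolding T_inv_tphi[OF I] unfolding tphi_def zinv.prod
  by (rule prod.cong) (simp_all add: zinv.simps zinv_lf)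

lemma twisted_eigen_zinv:
  assumes I: "I \<in> even_sets" and r: "twisted_eigen h I r"
  shows "twisted_eigen h I (zinv r)"
proof -
  have z: "zinv (1 / zz) = zz" unfolding zinv.divide zinv.one zinv_zz by (metis divide_inverse inverse_inverse_eq mult_1)
  have t: "zinv (T_pow (-2) (1 / tphi h I)) = tphi h I"
    using zinv_tphi[OF I] by (metis zinv_zinv)
  have "zinv (Acoef h zz * tphi h I * T_pow 2 r + Acoef h (1 / zz) * T_pow (-2) (1 / tphi h I) * T_pow (-2) r) =
     zinv ((Acoef h zz + Acoef h (1 / zz) + scal (gam h * (lam 0 I - gam h - 1 / gam h))) * r)"
    using r by (simp add: twisted_eigen_def)
  then show ?thesis
    unfolding twisted_eigen_def unfolding zinv.add zinv.mult t unfolding zinv_Acoef z zinv_zz inverse_eq_divide zinv_tphi[OF I] zinv_T_pow zinv_scal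
    by (simp add: algebra_simps)
qed

text \<open>\<open>twa\<close>, \<open>twb\<close> and \<open>twc\<close> are the coefficients of
  T^2, T^(-2) and T^0 in the twisted equation after multiplication by the common denominator
  \<open>twd\<close>.\<close>

definition twa :: "rat4 \<Rightarrow> nat set \<Rightarrow> kk poly" where
  "twa h I = (\<Prod>i\<in>{..<4} - I. [:1, - upar h i:]) * (\<Prod>i\<in>I. [:- upar h i / qpow 1 * tt, tt:]) * ([:- tt, 1:] * [:tt, 1:])"

definition twb :: "rat4 \<Rightarrow> nat set \<Rightarrow> kk poly" where
  "twb h I = - ((\<Prod>i\<in>{..<4} - I. [:- upar h i, 1:]) * (\<Prod>i\<in>I. [:tt, - upar h i / qpow 1 * tt:]) * ([:1, - tt:] * [:1, tt:]))"

definition twd :: "kk poly" where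
  "twd = ([:1, -1:] * [:1, 1:]) * ([:1, - tt:] * [:1, tt:]) * ([:- tt, 1:] * [:tt, 1:])"

definition twc :: "rat4 \<Rightarrow> nat set \<Rightarrow> kk poly" where
  "twc h I = - ((\<Prod>i<4. [:1, - upar h i:]) * ([:- tt, 1:] * [:tt, 1:]) - (\<Prod>i<4. [:- upar h i, 1:]) * ([:1, - tt:] * [:1, tt:])
     + Polynomial.smult (gam h * (lam 0 I - gam h - 1 / gam h)) twd)"

lemma ev_quadratics:
  "ev ([:1, -1:] * [:1, 1:]) = 1 - zz^2"
  "ev ([:- tt, 1:] * [:tt, 1:]) = zz^2 - scal (qpow 1)"
  "ev ([:1, - tt:] * [:1, tt:]) = 1 - scal (qpow 1) * zz^2"
  unfolding ev_mult lf_ev [symmetric] lf_def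
  by (simp_all add: tt_square [symmetric] scal.simps power2_eq_square algebra_simps)

lemma twisted_eigen_poly:
  assumes I: "I \<in> even_sets"
  shows "twisted_eigen h I r \<longleftrightarrow> ev (twa h I) * T_pow 2 r + ev (twb h I) * T_pow (-2) r + ev (twc h I) * r = 0"
proof -
  let ?q = "scal (qpow 1)"
  let ?d = "(1 - zz^2) * (1 - ?q * zz^2) * (zz^2 - ?q)"
  note dA = Acoef_clear(1) Acoef_clear(2,3)[of h]
  let ?\<mu> = "gam h * (lam 0 I - gam h - 1 / gam h)"
  have sub: "I \<subseteq> {..<4}" using I by (simp add: even_sets_def)
  have P1: "(\<Prod>i<4. 1 - scal (upar h i) * zz) = (\<Prod>i<4. lf 1 (- upar h i))"
    "(\<Prod>i<4. zz - scal (upar h i)) = (\<Prod>i<4. lf (- upar h i) 1)"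
    by (simp_all add: lf_def scal.simps)
  have split: "(\<Prod>i<4. f i) = (\<Prod>i\<in>{..<4} - I. f i) * (\<Prod>i\<in>I. f i)" for f :: "nat \<Rightarrow> kz"
    using sub by (intro prod.subset_diff) auto
  have a: "?d * Acoef h zz * tphi h I = ev (twa h I)"
  proof -
    have "(\<Prod>i\<in>I. lf 1 (- upar h i)) * tphi h I = (\<Prod>i\<in>I. scal tt * lf (- upar h i / qpow 1) 1)"
      unfolding tphi_def prod.distrib [symmetric] by (rule prod.cong) simp_all
    also have "\<dots> = (\<Prod>i\<in>I. ev [:- upar h i / qpow 1 * tt, tt:])"
      by (rule prod.cong) (simp_all add: lf_def ev_pCons scal.simps algebra_simps)
    finally have "(\<Prod>i\<in>{..<4} - I. lf 1 (- upar h i)) * ((\<Prod>i\<in>I. lf 1 (- upar h i)) * tphi h I) * (zz^2 - ?q) = ev (twa h I)"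
      unfolding twa_def unfolding ev_mult[of _ "[:- tt, 1:] * [:tt, 1:]"] unfolding ev_quadratics unfolding ev_mult ev_prod lf_ev by simp
    then show ?thesis unfolding dA P1 split by (simp only: ac_simps)
  qed
  have b: "?d * Acoef h (1 / zz) * T_pow (-2) (1 / tphi h I) = ev (twb h I)"
  proof -
    have "(\<Prod>i\<in>I. lf (- upar h i) 1) * T_pow (-2) (1 / tphi h I) = (\<Prod>i\<in>I. scal tt * lf 1 (- upar h i / qpow 1))"
      unfolding T_inv_tphi[OF I] prod.distrib [symmetric] by (rule prod.cong) simp_all
    also have "\<dots> = (\<Prod>i\<in>I. ev [:tt, - upar h i / qpow 1 * tt:])"
      by (rule prod.cong) (simp_all add: lf_def ev_pCons scal.simps algebra_simps)
    finally have "- ((\<Prod>i\<in>{..<4} - I. lf (- upar h i) 1) * ((\<Prod>i\<in>I. lf (- upar h i) 1) * T_pow (-2) (1 / tphi h I)) * (1 - ?q * zz^2)) = ev (twb h I)"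
      unfolding twb_def ev_uminus unfolding ev_mult[of _ "[:1, - tt:] * [:1, tt:]"] unfolding ev_quadratics unfolding ev_mult ev_prod lf_ev by simp
    then show ?thesis unfolding dA P1 split by (simp only: mult_minus_left mult_minus_right ac_simps)
  qed
  have d: "ev twd = ?d" unfolding twd_def ev_mult[of "_ * _" "_ * _"] ev_quadratics ..
  have c: "ev (twc h I) = - (?d * (Acoef h zz + Acoef h (1 / zz) + scal ?\<mu>))"
    unfolding twc_def ev_uminus ev_add ev_diff ev_smult d distrib_left dA P1
    unfolding ev_mult[of _ "_ * _"] ev_quadratics ev_prod lf_ev by simp
  have "twisted_eigen h I r \<longleftrightarrow> ?d * (Acoef h zz * tphi h I * T_pow 2 r + Acoef h (1 / zz) * T_pow (-2) (1 / tphi h I) * T_pow (-2) r) =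
     ?d * ((Acoef h zz + Acoef h (1 / zz) + scal ?\<mu>) * r)"
    unfolding twisted_eigen_def using dA(1) by simp
  also have "\<dots> \<longleftrightarrow> ev (twa h I) * T_pow 2 r + ev (twb h I) * T_pow (-2) r = - (ev (twc h I)) * r"
    unfolding a[symmetric] b[symmetric] c by (simp only: distrib_left distrib_right mult.assoc mult_minus_left minus_minus)
  also have "\<dots> \<longleftrightarrow> ev (twa h I) * T_pow 2 r + ev (twb h I) * T_pow (-2) r + ev (twc h I) * r = 0"
    by (simp add: eq_neg_iff_add_eq_0)
  finally show ?thesis .
qed

lemma poly_twa_roots:
  assumes "I \<in> even_sets" "poly (twa h I) x = 0"
  shows "(\<exists>i<4. i \<notin> I \<and> x = 1 / upar h i) \<or> (\<exists>i\<in>I. x = upar h i / qpow 1) \<or> x = tt \<or> x = - tt"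
proof -
  have fin: "finite I" using assms(1) by (auto simp: even_sets_def finite_subset)
  from assms(2) consider i where "i < 4" "i \<notin> I" "1 - x * upar h i = 0" | i where "i \<in> I" "x * tt = upar h i / qpow 1 * tt"
    | "x = tt" | "x = - tt"
    using fin unfolding twa_def poly_mult mult_eq_0_iff by (auto simp: poly_prod prod_zero_iff eq_neg_iff_add_eq_0 add.commute)
  then show ?thesis
  proof cases
    case 1
    then have "x = 1 / upar h i" by (simp add: field_simps)
    then show ?thesis using 1 by blast
  next
    case 2
    then have "x = upar h i / qpow 1" using 2(2) unfolding mult_cancel_right by simp
    then show ?thesis using 2 by blast
  qed auto
qed

lemma poly_twb_roots:
  assumes "I \<in> even_sets" "poly (twb h I) x = 0"
  shows "(\<exists>i<4. i \<notin> I \<and> x = upar h i) \<or> (\<exists>i\<in>I. x = qpow 1 / upar h i) \<or> x = 1 / tt \<or> x = - 1 / tt"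
proof -
  have fin: "finite I" using assms(1) by (auto simp: even_sets_def finite_subset)
  from assms(2) consider i where "i < 4" "i \<notin> I" "x = upar h i" | i where "i \<in> I" "tt = x * (upar h i / qpow 1 * tt)"
    | "1 = x * tt" | "1 + x * tt = 0"
    using fin unfolding twb_def poly_minus poly_mult mult_eq_0_iff neg_equal_0_iff_equal by (auto simp: poly_prod prod_zero_iff)
  then show ?thesis
  proof cases
    case 2
    then have "x = qpow 1 / upar h i" using even_sets_subset[OF assms(1)] by (simp add: field_simps)
    then show ?thesis using 2 by blast
  next
    case 3
    then have "x = 1 / tt" by (simp add: field_simps)
    then show ?thesis by blast
  next
    case 4
    then have "x = - 1 / tt" by (simp add: field_simps eq_neg_iff_add_eq_0 add.commute)
    then show ?thesis by blast
  qed auto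
qed

text \<open>By genericity of the parameters, x and y can share a q-orbit only when x is q^(1/2) and
  y is q^(-1/2) up to signs. Then y is x/q up to sign, which is incompatible with an exponent l >=
  2.\<close>

lemma tw_roots_apart:
  assumes I: "I \<in> even_sets" and x: "poly (twa h I) x = 0" and y: "poly (twb h I) y = 0" and l: "l \<ge> (2::int)"
  shows "y \<noteq> x * qpow (of_int l)"
proof
  assume yx: "y = x * qpow (of_int l)"
  note up = upar_prod_neq_qpow and ud = upar_neq_upar_qpow
  have less: "i < 4" if "i \<in> I" for i using even_sets_subset[OF I] that .
  have t: "tt * tt = qpow 1" using tt_square by (simp add: power2_eq_square)
  have sq: "i < 4 \<Longrightarrow> s = 1 \<or> s = -1 \<Longrightarrow> upar h i \<noteq> s * qpow r" for i s r
    using up[of i i h "r + r"] unfolding qpow_add by auto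
  have tts: "\<exists>s. (s = 1 \<or> s = -1) \<and> x = s * y" if "x = y \<or> x = - y" for x y :: kk
    using that by (metis mult_1 mult_minus1)
  from poly_twa_roots[OF I x] tts[of x tt] consider (a1) i where "i < 4" "i \<notin> I" "x = 1 / upar h i" | (a2) i where "i \<in> I" "x = upar h i / qpow 1"
    | (a3) s where "s = 1 \<or> s = -1" "x = s * tt" by blast
  note ca = this
  have sg: "a * s = b \<Longrightarrow> a = s * b" if "s = 1 \<or> s = -1" for a b s :: kk
    using that by auto
  have tty: "- 1 / tt = - (1 / tt)" by simp
  from poly_twb_roots[OF I y] tts[of y "1 / tt"] consider (b1) i where "i < 4" "i \<notin> I" "y = upar h i" | (b2) i where "i \<in> I" "y = qpow 1 / upar h i"
    | (b3) s where "s = 1 \<or> s = -1" "y = s * (1 / tt)" unfolding tty by blast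
  note cb = this
  show False
    using ca
  proof cases
    case (a1 i)
    show False using cb
    proof cases
      case (b1 j)
      then have "upar h i * upar h j = qpow (of_int l)" using yx a1 by (simp add: field_simps)
      then show False using up a1 b1 by blast
    next
      case (b2 j)
      then have "upar h i * qpow 1 = upar h j * qpow (of_int l)" using yx a1 less[of j] by (simp add: field_simps)
      then have "upar h i = upar h j * qpow (of_int l - 1)" unfolding qpow_diff by (simp add: field_simps)
      moreover have "i \<noteq> j" using a1 b2 by auto
      ultimately show False using ud a1 b2 less by blast
    next
      case (b3 s)
      then have "upar h i * s = qpow (of_int l) * tt" using yx a1 by (simp add: field_simps)
      then have "upar h i = s * qpow (of_int l + 1/2)" unfolding qpow_add by (rule sg[OF b3(1)])
      then show False using sq a1 b3 by blast
    qed
  next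
    case (a2 i)
    show False using cb
    proof cases
      case (b1 j)
      then have "upar h j = upar h i * qpow (of_int l - 1)" using yx a2 unfolding qpow_diff by simp
      moreover have "i \<noteq> j" using a2 b1 by auto
      ultimately show False using ud a2 b1 less by blast
    next
      case (b2 j)
      then have "upar h i * upar h j = qpow (1 + 1 - of_int l)"
        using yx a2 less[of j] less[of i] unfolding qpow_diff qpow_add by (simp add: field_simps)
      then show False using up a2 b2 less by blast
    next
      case (b3 s)
      then have "upar h i * (qpow (of_int l) * tt) = s * qpow 1" using yx a2 by (simp add: field_simps)
      then have "upar h i = s * qpow (1 - (of_int l + 1/2))"
        unfolding qpow_diff qpow_add by (simp add: field_simps)
      then show False using sq a2 b3 less by blast
    qed
  next
    case (a3 s)
    show False using cb
    proof cases
      case (b1 j)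
      then have "upar h j = s * qpow (1/2 + of_int l)" using yx a3 unfolding qpow_add by (simp add: mult.assoc)
      then show False using sq a3 b1 by blast
    next
      case (b2 j)
      then have "s * (upar h j * (tt * qpow (of_int l))) = qpow 1" using yx a3 less[of j] by (simp add: field_simps)
      then have "upar h j * (tt * qpow (of_int l)) = s * qpow 1" using sg[OF a3(1)] by (metis mult.commute)
      then have "upar h j = s * qpow (1 - (1/2 + of_int l))"
        unfolding qpow_diff[of 1] qpow_add[of "1/2"] by (simp add: field_simps)
      then show False using sq a3 b2 less by blast
    next
      case (b3 s')
      then have "s' = s * (tt * tt * qpow (of_int l))" using yx a3 by (simp add: field_simps)
      then have "s' = s * qpow (1 + of_int l)" by (simp add: t qpow_add)
      then have "qpow (1 + of_int l) = qpow 0 \<or> qpow (1 + of_int l) = - qpow 0"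
        using a3(1) b3(1) by (auto simp: minus_equation_iff)
      then show False using l qpow_neq_minus[of "1 + of_int l" 0] unfolding qpow_eq by auto
    qed
  qed
qed

lemma splits_twa: "I \<in> even_sets \<Longrightarrow> splits (twa h I)"
  unfolding twa_def using even_sets_subset
  by (intro splits_mult splits_prod splits_linear) auto

text \<open>By \<open>no_poles\<close> every prime factor of the reduced denominator vanishes at 0,
  so the denominator is a constant times a power of z.\<close>

lemma twisted_eigen_laurent:
  assumes I: "I \<in> even_sets" and r: "twisted_eigen h I r"
  shows "\<exists>w. r = of_lpoly w"
proof -
  obtain f g where fg0: "r = ev f / ev g" "g \<noteq> 0" "\<forall>p. p dvd f \<longrightarrow> p dvd g \<longrightarrow> p dvd 1"
    using kz_as_ev[of r] by blast
  note fg = fg0(1,2) fg0(3)[rule_format]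
  have nz: "ev g \<noteq> 0" "ev (sh 1 g) \<noteq> 0" "ev (sh (-1) g) \<noteq> 0"
    using fg(2) by (simp_all add: ev_eq_0 sh_eq_0)
  have T: "T_pow 2 r = ev (sh 1 f) / ev (sh 1 g)" "T_pow (-2) r = ev (sh (-1) f) / ev (sh (-1) g)"
    by (simp_all add: fg(1) T.divide T_ev)
  have "ev (twa h I * sh 1 f * sh (-1) g * g + twb h I * sh (-1) f * sh 1 g * g + twc h I * f * sh 1 g * sh (-1) g) =
     (ev (twa h I) * T_pow 2 r + ev (twb h I) * T_pow (-2) r + ev (twc h I) * r) * (ev (sh 1 g) * ev (sh (-1) g) * ev g)"
    unfolding T unfolding fg(1) ev_add ev_mult using nz by (simp add: field_simps)
  then have eqn: "twa h I * sh 1 f * sh (-1) g * g + twb h I * sh (-1) f * sh 1 g * g + twc h I * f * sh 1 g * sh (-1) g = 0"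
    using r unfolding twisted_eigen_poly[OF I] by (simp add: ev_eq_0)
  have np: "poly p 0 = 0" if "prime_elem p" "p dvd g" for p
    by (rule no_poles[OF _ fg(2) eqn splits_twa[OF I] _ that]) (use fg(3) tw_roots_apart[OF I] in blast)+
  obtain m g' where g': "g = [:0, 1:] ^ m * g'" "poly g' 0 \<noteq> 0"
    using order_decomp[OF fg(2), of 0] by (auto simp: poly_eq_0_iff_dvd)
  have "Polynomial.degree g' = 0"
  proof (rule ccontr)
    assume d: "Polynomial.degree g' \<noteq> 0"
    have g'0: "g' \<noteq> 0" using g'(2) by auto
    obtain p where p: "irreducible p" "p dvd g'"
      using d g'0
    proof (induction "Polynomial.degree g'" arbitrary: g' thesis rule: less_induct)
      case less
      show ?case
      proof (cases "irreducible g'")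
        case True
        show ?thesis using less.prems(1)[OF True dvd_refl] .
      next
        case False
        have nu: "\<not> g' dvd 1" using less.prems(2,3) is_unit_iff_degree[of g'] by simp
        obtain a b where ab: "g' = a * b" "\<not> a dvd 1" "\<not> b dvd 1"
          using False less.prems(3) nu unfolding irreducible_def by blast
        have "a \<noteq> 0" "b \<noteq> 0" using less.prems(3) ab(1) by auto
        then have da: "Polynomial.degree a \<noteq> 0" "Polynomial.degree b \<noteq> 0"
          using ab is_unit_iff_degree by blast+
        then have "Polynomial.degree a < Polynomial.degree g'"
          using \<open>a \<noteq> 0\<close> \<open>b \<noteq> 0\<close> by (simp add: ab(1) degree_mult_eq)
        then obtain p where "irreducible p" "p dvd a" using less.hyps[of a] da \<open>a \<noteq> 0\<close> by blast
        then show ?thesis using less.prems(1) ab(1) by (meson dvd_mult2)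
      qed
    qed
    have "poly p 0 = 0"
      using np[OF field_poly_irreducible_imp_prime[OF p(1)]] p(2) unfolding g'(1) by (meson dvd_mult)
    then show False using p(2) g'(2) by (metis dvd_def mult_zero_left poly_mult)
  qed
  then obtain c where c: "g' = [:c:]" by (rule degree_eq_zeroE)
  have "ev ([:0, 1:] ^ m) = zz ^ m" by (induction m) (simp_all add: ev_1 ev_mult, simp add: ev_pCons scal.simps)
  then have "ev g = zz ^ m * scal c" by (simp add: g'(1) c ev_smult mult.commute)
  moreover have "c \<noteq> 0" using g'(2) c by auto
  ultimately have "r = ev f * (scal (1 / c) * zz powi (- int m))"
    by (simp add: fg(1) scal.simps power_int_minus field_simps)
  also have "\<dots> = of_lpoly ((\<Sum>i\<le>Polynomial.degree f. lmon (Polynomial.coeff f i) (int i)) * lmon (1 / c) (- int m))"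
    by (simp add: of_lpoly_mult of_lpoly_lmon ev_of_lpoly)
  finally show ?thesis by blast
qed

section \<open>Degrees of solutions of the twisted equation\<close>

text \<open>The inner product of h and v_I. It is the exponent of q by which \<open>rho h I\<close>
  differs from \<open>rho 0 I\<close> (\<open>rho_shift\<close>), and its sign decides whether E_I
  can be split off.\<close>

definition nI :: "rat4 \<Rightarrow> nat set \<Rightarrow> rat" where
  "nI h I = (\<Sum>i<4. hc (vsh I) i * hc h i)"

lemma sum_4: "(\<Sum>i<4::nat. f i) = f 0 + f 1 + f 2 + (f 3 :: 'a::comm_monoid_add)"
  by (simp add: eval_nat_numeral add.assoc)

lemma nI_alt:
  assumes I: "I \<in> even_sets"
  shows "nI h I = (\<Sum>i<4. hc h i) / 2 - (\<Sum>i\<in>I. hc h i)"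
proof -
  have sub: "I \<subseteq> {..<4}" and fin: "finite I" using I by (auto simp: even_sets_def finite_subset)
  have "nI h I = (\<Sum>i<4. hc h i / 2 - (if i \<in> I then hc h i else 0))"
    unfolding nI_def by (rule sum.cong) (simp_all add: hc_vsh)
  also have "\<dots> = (\<Sum>i<4. hc h i / 2) - (\<Sum>i\<in>{..<4} \<inter> I. hc h i)"
    unfolding sum_subtractf by (simp add: sum.inter_restrict)
  also have "{..<4} \<inter> I = I" using sub by auto
  finally show ?thesis by (simp add: sum_divide_distrib)
qed

lemma qpow_sum: "qpow (\<Sum>i\<in>I. f i) = (\<Prod>i\<in>I. qpow (f i))"
  by (induction I rule: infinite_finite_induct) (simp_all add: qpow_add)

lemma rho_shift:
  assumes I: "I \<in> even_sets"
  shows "rho h I = rho 0 I * qpow (nI h I)"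
proof -
  have "((\<Sum>i<4. hc h i) - 1) / 2 = (- 1) / 2 + (\<Sum>i<4. hc h i) / 2" by (simp add: diff_divide_distrib)
  moreover have g: "gam k = sqrt_ab * sqrt_cd * qpow (((\<Sum>i<4. hc k i) - 1) / 2)" for k
    by (simp add: gam_def sum_4)
  moreover have "(\<Sum>i<4. hc 0 i) = 0" by (simp add: hc_0)
  ultimately have "gam h = gam 0 * qpow ((\<Sum>i<4. hc h i) / 2)"
    by (simp only: qpow_add mult.assoc diff_0)
  moreover have "(\<Prod>i\<in>I. upar h i) = (\<Prod>i\<in>I. upar 0 i) * qpow (\<Sum>i\<in>I. hc h i)"
    unfolding qpow_sum prod.distrib [symmetric] using even_sets_subset[OF I]
    by (intro prod.cong refl) (simp add: upar_0, simp add: upar_def)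
  ultimately show ?thesis
    unfolding rho_def nI_alt[OF I] qpow_diff by (simp add: mult.assoc)
qed

lemma rho_mon:
  assumes I: "I \<in> even_sets"
  shows "\<exists>g. (rho 0 I = mon g \<or> rho 0 I = - mon g) \<and> (Poly_Mapping.lookup g ISqrtAB = 1 \<or> Poly_Mapping.lookup g ISqrtAB = -1)"
proof -
  have fin: "finite I" using I by (auto simp: even_sets_def finite_subset)
  have "J \<subseteq> {..<4} \<Longrightarrow> \<exists>g. ((\<Prod>i\<in>J. par i) = mon g \<or> (\<Prod>i\<in>J. par i) = - mon g) \<and>
      Poly_Mapping.lookup g ISqrtAB = (if 0 \<in> J then 2 else 0)" if "finite J" for J
    using that
  proof induction
    case empty
    show ?case by (intro exI[of _ 0]) (simp add: mon_0)
  next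
    case (insert i J)
    then obtain g where g: "(\<Prod>i\<in>J. par i) = mon g \<or> (\<Prod>i\<in>J. par i) = - mon g"
      "Poly_Mapping.lookup g ISqrtAB = (if 0 \<in> J then 2 else 0)" by auto
    have i: "i < 4" using insert by auto
    have "Poly_Mapping.lookup (par_expo i) ISqrtAB = (if i = 0 then 2 else 0)"
      using i by (auto elim!: less_4_cases simp: par_expo_def lookup_minus lookup_single)
    then show ?case
      using insert.hyps g i
      by (intro exI[of _ "par_expo i + g"]) (auto simp: par_mon mon_add lookup_add)
  qed
  then obtain g where g: "(\<Prod>i\<in>I. par i) = mon g \<or> (\<Prod>i\<in>I. par i) = - mon g"
    "Poly_Mapping.lookup g ISqrtAB = (if 0 \<in> I then 2 else 0)"
    using fin I by (auto simp: even_sets_def)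
  have u: "(\<Prod>i\<in>I. upar 0 i) = (\<Prod>i\<in>I. par i)"
    using even_sets_subset[OF I] by (intro prod.cong) (simp_all add: upar_0)
  obtain e where e: "qpow (of_nat (card I) / 2) * gam 0 = mon e" "Poly_Mapping.lookup e ISqrtAB = 1"
  proof
    show "qpow (of_nat (card I) / 2) * gam 0 = mon (Poly_Mapping.single ISqrtAB 1 + Poly_Mapping.single ISqrtCD 1 +
        Poly_Mapping.single ISqrtQ (2 * (of_nat (card I) / 2 + (-1) / 2)))"
      unfolding mon_add qpow_def[symmetric] qpow_add gam_def sqrt_ab_def sqrt_cd_def by (simp add: hc_0)
  qed (simp add: lookup_add lookup_single)
  have "rho 0 I = mon (e - g) \<or> rho 0 I = - mon (e - g)"
    using g(1) unfolding rho_def u e(1) mon_minus by auto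
  then show ?thesis using e(2) g(2) by (intro exI[of _ "e - g"]) (auto simp: lookup_minus)
qed

text \<open>The exponent of sqrt(-ab) in \<open>rho 0 I\<close> is 1 or -1.\<close>

lemma rho_square_neq:
  assumes "I \<in> even_sets"
  shows "rho 0 I ^ 2 \<noteq> qpow r"
proof
  assume *: "rho 0 I ^ 2 = qpow r"
  obtain g where g: "rho 0 I = mon g \<or> rho 0 I = - mon g" "Poly_Mapping.lookup g ISqrtAB = 1 \<or> Poly_Mapping.lookup g ISqrtAB = -1"
    using rho_mon[OF assms] by blast
  then have "mon (g + g) = qpow r" using * by (auto simp: mon_add power2_eq_square)
  then show False using mon_eq_qpow[of "g + g" r ISqrtAB] g(2) by (auto simp: lookup_add)
qed

lemma lf_of_lpoly: "lf a b = of_lpoly (lin a b 1)"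
  by (simp add: lf_def of_lpoly_lin)

text \<open>The top coefficients give x + 1/x = y + 1/y for x = rho_h q^N and y = rho_0, where rho_h
  is rho_0 times q to the power \<open>nI h I\<close>. Since rho_0^2 is not a power of q, x y = 1 is
  impossible, so x = y.\<close>

lemma twisted_eigen_top:
  assumes I: "I \<in> even_sets" and w: "twisted_eigen h I (of_lpoly w)" "top_le w N" "Poly_Mapping.lookup w N \<noteq> 0"
  shows "of_int N = - nI h I"
proof -
  let ?g = "gam h"
  define \<mu> where "\<mu> = ?g * (lam 0 I - ?g - 1 / ?g)"
  \<comment> \<open>As in \<open>opD_top\<close>, all polynomials have degree at most 6, so the
    equation is compared at the exponent 6 + N.\<close>
  define d where "d = lin 1 (-1) 2 * lin 1 (- qpow 1) 2 * lin (- qpow 1) 1 2"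
  define a where "a = (\<Prod>i\<in>{..<4} - I. lin 1 (- upar h i) 1) * (\<Prod>i\<in>I. lin (- upar h i / qpow 1 * tt) tt 1) * lin (- qpow 1) 1 2"
  define b where "b = - ((\<Prod>i\<in>{..<4} - I. lin (- upar h i) 1 1) * (\<Prod>i\<in>I. lin tt (- upar h i / qpow 1 * tt) 1) * lin 1 (- qpow 1) 2)"
  define c where "c = - ((\<Prod>i<4. lin 1 (- upar h i) 1) * lin (- qpow 1) 1 2 - (\<Prod>i<4. lin (- upar h i) 1 1) * lin 1 (- qpow 1) 2 + lmon \<mu> 0 * d)"
  have fin: "finite I" using I by (auto simp: even_sets_def finite_subset)
  have q: "zz^2 - scal (qpow 1) = of_lpoly (lin (- qpow 1) 1 2)" "1 - scal (qpow 1) * zz^2 = of_lpoly (lin 1 (- qpow 1) 2)"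
    "1 - zz^2 = of_lpoly (lin 1 (-1) 2)"
    by (simp_all add: of_lpoly_lin scal.simps)
  have evd: "ev twd = of_lpoly d"
    unfolding twd_def unfolding ev_mult[of "_ * _" "_ * _"] unfolding ev_quadratics q d_def of_lpoly_mult ..
  have eva: "ev (twa h I) = of_lpoly a"
    unfolding twa_def unfolding ev_mult[of _ "[:- tt, 1:] * [:tt, 1:]"] unfolding ev_quadratics
    unfolding ev_mult ev_prod lf_ev[symmetric] lf_of_lpoly q a_def of_lpoly_mult of_lpoly_prod ..
  have evb: "ev (twb h I) = of_lpoly b"
    unfolding twb_def ev_uminus unfolding ev_mult[of _ "[:1, - tt:] * [:1, tt:]"] unfolding ev_quadratics
    unfolding ev_mult ev_prod lf_ev[symmetric] lf_of_lpoly q b_def of_lpoly_uminus of_lpoly_mult of_lpoly_prod ..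
  have evc: "ev (twc h I) = of_lpoly c"
    unfolding twc_def ev_uminus ev_add ev_diff ev_smult evd \<mu>_def[symmetric]
    unfolding ev_mult[of _ "_ * _"] unfolding ev_quadratics
    unfolding ev_prod lf_ev[symmetric] lf_of_lpoly q c_def of_lpoly_uminus of_lpoly_add of_lpoly_diff of_lpoly_mult of_lpoly_prod unfolding scal_def ..
  have "of_lpoly (a * lT 2 w + b * lT (-2) w + c * w) = 0"
    using w(1) unfolding twisted_eigen_poly[OF I] eva evb evc T_of_lpoly of_lpoly_add of_lpoly_mult by simp
  then have eq: "a * lT 2 w + b * lT (-2) w + c * w = 0" by simp
  have card: "card ({..<4} - I) + card I = 4" "even (card I)" "even (card ({..<4} - I))"
    using card_compl[OF I] I by (auto simp: even_sets_def)
  have neg: "(\<Prod>i\<in>J. - f i) = (\<Prod>i\<in>J. f i)" if "even (card J)" for J and f :: "nat \<Rightarrow> kk"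
    using that by (simp add: prod_uminus)
  have intc: "int (card ({..<4} - I)) + int (card I) + 2 = 6" using card(1) by linarith
  have td: "top_le d 6" "Poly_Mapping.lookup d 6 = qpow 1"
    using top_mult[OF top_mult(1)[OF top_lin(1) top_lin(1)] top_lin(1), of 2 2 2 1 "-1" 1 "- qpow 1" "- qpow 1" 1]
      top_mult(2)[OF top_lin(1) top_lin(1), of 2 2 1 "-1" 1 "- qpow 1"]
    by (simp_all add: d_def top_lin)
  have tl: "top_le (\<Prod>i\<in>J. lin (f i) (g i) 1) (int (card J)) \<and>
      Poly_Mapping.lookup (\<Prod>i\<in>J. lin (f i) (g i) 1) (int (card J)) = (\<Prod>i\<in>J. g i)" if "finite J" for J and f g :: "nat \<Rightarrow> kk"
    using top_prod[OF that, of "\<lambda>i. lin (f i) (g i) 1" "\<lambda>_. 1"] by (simp add: top_lin)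
  have tlq: "top_le (lin x y 2) 2" "Poly_Mapping.lookup (lin x y 2) 2 = y" for x y
    by (simp_all add: top_lin)
  note t1 = tl[OF finite_Diff[OF finite_lessThan, of 4 I]] and t2 = tl[OF fin]
  have tr: "top_le ((\<Prod>i\<in>{..<4} - I. lin (f i) (g i) 1) * (\<Prod>i\<in>I. lin (f' i) (g' i) 1) * lin x y 2) 6"
    "Poly_Mapping.lookup ((\<Prod>i\<in>{..<4} - I. lin (f i) (g i) 1) * (\<Prod>i\<in>I. lin (f' i) (g' i) 1) * lin x y 2) 6 =
      (\<Prod>i\<in>{..<4} - I. g i) * (\<Prod>i\<in>I. g' i) * y" for f g f' g' x y
    using top_mult[OF top_mult(1)[OF conjunct1[OF t1] conjunct1[OF t2]] tlq(1), of f g f' g' x y]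
    unfolding top_mult(2)[OF conjunct1[OF t1] conjunct1[OF t2]] intc conjunct2[OF t1] conjunct2[OF t2] tlq(2) by blast+
  have ta: "top_le a 6" "Poly_Mapping.lookup a 6 = (\<Prod>i\<in>{..<4} - I. upar h i) * tt ^ card I"
    using tr[of "\<lambda>_. 1" "\<lambda>i. - upar h i" "\<lambda>i. - upar h i / qpow 1 * tt" "\<lambda>_. tt" "- qpow 1" 1]
    unfolding a_def neg[OF card(3)] by simp_all
  have tb: "top_le b 6" "Poly_Mapping.lookup b 6 = qpow 1 * (\<Prod>i\<in>I. upar h i / qpow 1 * tt)"
    using tr[of "\<lambda>i. - upar h i" "\<lambda>_. 1" "\<lambda>_. tt" "\<lambda>i. - (upar h i / qpow 1 * tt)" 1 "- qpow 1"]
    unfolding b_def neg[OF card(2)] by (simp_all add: top_le_def mult.commute)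
  have l0: "top_le (lmon x 0) 0" "Poly_Mapping.lookup (lmon x 0) 0 = x" for x
    by (simp_all add: top_le_def lmon_def lookup_single)
  have four: "int (card {..<4::nat}) = 4" by simp
  note t4 = tl[OF finite_lessThan[of 4], unfolded four]
  have c1: "top_le ((\<Prod>i<4. lin 1 (- upar h i) 1) * lin (- qpow 1) 1 2) 6"
      "Poly_Mapping.lookup ((\<Prod>i<4. lin 1 (- upar h i) 1) * lin (- qpow 1) 1 2) 6 = ?g ^ 2 * qpow 1"
    using top_mult[OF conjunct1[OF t4] tlq(1), of "\<lambda>_. 1" "\<lambda>i. - upar h i" "- qpow 1" 1] conjunct2[OF t4, of "\<lambda>_. 1" "\<lambda>i. - upar h i"]
    by (simp_all add: tlq gam_square) (simp add: prod_4)
  have c2: "top_le ((\<Prod>i<4. lin (- upar h i) 1 1) * lin 1 (- qpow 1) 2) 6"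
      "Poly_Mapping.lookup ((\<Prod>i<4. lin (- upar h i) 1 1) * lin 1 (- qpow 1) 2) 6 = - qpow 1"
    using top_mult[OF conjunct1[OF t4] tlq(1), of "\<lambda>i. - upar h i" "\<lambda>_. 1" 1 "- qpow 1"] conjunct2[OF t4, of "\<lambda>i. - upar h i" "\<lambda>_. 1"]
    by (simp_all add: tlq)
  have c3: "top_le (lmon \<mu> 0 * d) 6" "Poly_Mapping.lookup (lmon \<mu> 0 * d) 6 = \<mu> * qpow 1"
    using top_mult[OF l0(1) td(1), of \<mu>] td by (simp_all add: l0)
  have tc: "top_le c 6" "Poly_Mapping.lookup c 6 = - (?g ^ 2 * qpow 1 + qpow 1 + \<mu> * qpow 1)"
    unfolding c_def using top_le_diff[OF _ top_le_add[OF top_le_diff[OF c1(1) c2(1)] c3(1)], of 0] c1(2) c2(2) c3(2)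
    by (simp add: top_le_def, simp add: lookup_minus lookup_add)
  have R: "rho h I = tt ^ card I * ?g / (\<Prod>i\<in>I. upar h i)"
    by (simp add: rho_def qpow_power)
  have P: "(\<Prod>i\<in>I. upar h i) \<noteq> 0" by (rule prod_upar_nz[OF I])
  have P': "(\<Prod>i\<in>{..<4} - I. upar h i) = ?g ^ 2 * qpow 1 / (\<Prod>i\<in>I. upar h i)"
    using prod_upar_split[OF I, of h] P by (simp add: field_simps)
  have a6: "Poly_Mapping.lookup a 6 = ?g * qpow 1 * rho h I"
    unfolding ta(2) P' R by (simp add: power2_eq_square)
  have "(\<Prod>i\<in>I. upar h i / qpow 1 * tt) * tt ^ card I = (\<Prod>i\<in>I. upar h i)"
  proof -
    have "(\<Prod>i\<in>I. upar h i / qpow 1 * tt) * tt ^ card I = (\<Prod>i\<in>I. (upar h i / qpow 1 * tt) * tt)"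
      unfolding prod.distrib by simp
    also have "\<dots> = (\<Prod>i\<in>I. upar h i)"
    proof (rule prod.cong[OF refl])
      fix i
      have "x / (y * y) * y * y = x" if "y \<noteq> 0" for x y :: kk using that by simp
      note cancel = this
      show "upar h i / qpow 1 * tt * tt = upar h i"
        unfolding tt_square[unfolded power2_eq_square, symmetric] by (rule cancel[OF qpow_nz])
    qed
    finally show ?thesis .
  qed
  then have b6: "Poly_Mapping.lookup b 6 = ?g * qpow 1 / rho h I"
    unfolding tb(2) R using P by (simp add: field_simps)
  have c6: "Poly_Mapping.lookup c 6 = - (?g * qpow 1 * lam 0 I)"
    unfolding tc(2) \<mu>_def by (simp add: field_simps power2_eq_square)
  have "(Poly_Mapping.lookup a 6 * qpow (of_int N) + Poly_Mapping.lookup b 6 * qpow (- of_int N) + Poly_Mapping.lookup c 6) * Poly_Mapping.lookup w N = 0"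
    using top_difference_op(2)[OF ta(1) tb(1) tc(1) w(2)] unfolding eq by simp
  then have "Poly_Mapping.lookup a 6 * qpow (of_int N) + Poly_Mapping.lookup b 6 * qpow (- of_int N) + Poly_Mapping.lookup c 6 = 0"
    using w(3) mult_eq_0_iff by blast
  then have "?g * qpow 1 * (rho h I * qpow (of_int N) + 1 / (rho h I * qpow (of_int N)) - lam 0 I) = 0"
    unfolding a6 b6 c6 qpow_minus by (simp add: algebra_simps inverse_eq_divide)
  then have "rho h I * qpow (of_int N) + 1 / (rho h I * qpow (of_int N)) = rho 0 I + 1 / rho 0 I"
    by (simp add: lam_def)
  moreover have s: "rho h I * qpow (of_int N) = rho 0 I * qpow (nI h I + of_int N)"
    by (simp add: rho_shift[OF I, of h] qpow_add)
  ultimately have "rho 0 I * qpow (nI h I + of_int N) = rho 0 I \<or> rho 0 I * qpow (nI h I + of_int N) * rho 0 I = 1"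
    using add_inverse_eq[of "rho 0 I * qpow (nI h I + of_int N)" "rho 0 I"] I by simp
  then show ?thesis
  proof
    assume "rho 0 I * qpow (nI h I + of_int N) = rho 0 I"
    then have "nI h I + of_int N = 0" using I by (simp add: qpow_eq_1)
    then show ?thesis by linarith
  next
    assume "rho 0 I * qpow (nI h I + of_int N) * rho 0 I = 1"
    then have "rho 0 I ^ 2 = qpow (- (nI h I + of_int N))"
      unfolding qpow_minus power2_eq_square by (metis inverse_unique mult.assoc mult.commute)
    then show ?thesis using rho_square_neq[OF I] by blast
  qed
qed

text \<open>The reflection of r solves the same equation, so both have the negative top exponent
  \<open>- nI h I\<close>. The bottom exponent of r would then exceed its top exponent.\<close>

lemma twisted_eigen_0:
  assumes I: "I \<in> even_sets" and n: "nI h I > 0" and r: "twisted_eigen h I r"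
  shows "r = 0"
proof (rule ccontr)
  assume r0: "r \<noteq> 0"
  obtain w where w: "r = of_lpoly w" using twisted_eigen_laurent[OF I r] by blast
  have z: "zinv r = of_lpoly (refl w)" by (simp add: w zinv_of_lpoly)
  have w0: "w \<noteq> 0" "refl w \<noteq> 0"
    using r0 z zinv.eq_zero[of r] by (auto simp: w)
  obtain N where N: "top_le w N" "Poly_Mapping.lookup w N \<noteq> 0" using obtain_top[OF w0(1)] .
  obtain M where M: "top_le (refl w) M" "Poly_Mapping.lookup (refl w) M \<noteq> 0" using obtain_top[OF w0(2)] .
  have "of_int N = - nI h I" "of_int M = - nI h I"
    using twisted_eigen_top[OF I r[unfolded w] N] twisted_eigen_top[OF I twisted_eigen_zinv[OF I r, unfolded z] M] by simp_all
  then have "N < 0" "M < 0" using n by linarith+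
  moreover have "- M \<le> N" using N(1) M(2) unfolding top_le_def lookup_refl by (meson linorder_not_less)
  ultimately show False by simp
qed

subsection \<open>Intertwining operators\<close>

lemma op_comp_add: "op_comp (S + S') U = op_comp S U + op_comp S' U" "op_comp U (S + S') = op_comp U S + op_comp U S'"
  and op_comp_diff: "op_comp (S - S') U = op_comp S U - op_comp S' U" "op_comp U (S - S') = op_comp U S - op_comp U S'"
  and op_comp_assoc: "op_comp (op_comp S S') U = op_comp S (op_comp S' U)"
  and op_comp_uminus: "op_comp (- S) U = - op_comp S U"
  and op_comp_sum: "op_comp (\<Sum>i\<in>A. F i) U = (\<Sum>i\<in>A. op_comp (F i) U)"
  by (rule op_eqI; simp add: op_apply_comp op_apply_add_op op_apply_add op_apply_diff_op op_apply_diff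
      op_apply_uminus_op op_apply_sum_op)+

lemma op_comp_0 [simp]: "op_comp 0 S = 0" "op_comp S 0 = 0"
  by (rule op_eqI; simp add: op_apply_comp)+

lemma op_comp_single: "op_comp (Poly_Mapping.single k x) (Poly_Mapping.single n c) =
    Poly_Mapping.single (k + n) (x * T_pow k c)"
  by (rule op_eqI) (simp add: op_apply_comp op_apply_single T.mult T_pow_T_pow mult.assoc)

lemma lookup_comp_single:
  "Poly_Mapping.lookup (op_comp S (Poly_Mapping.single n c)) m = Poly_Mapping.lookup S (m - n) * T_pow (m - n) c"
  by (induction S rule: poly_mapping_add_induct)
    (auto simp: op_comp_single op_comp_add lookup_add lookup_single when_def algebra_simps)

lemma lookup_single_comp:
  "Poly_Mapping.lookup (op_comp (Poly_Mapping.single n c) S) m = c * T_pow n (Poly_Mapping.lookup S (m - n))"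
  by (induction S rule: poly_mapping_add_induct)
    (auto simp: op_comp_single op_comp_add lookup_add lookup_single when_def algebra_simps T.simps)

lemma op_inv_comp: "op_inv (op_comp S S') = op_comp (op_inv S) (op_inv S')"
  by (rule op_eqI) (simp add: op_apply_comp op_inv_apply')

lemma op_inv_add: "op_inv (S + S') = op_inv S + op_inv S'" and op_inv_diff: "op_inv (S - S') = op_inv S - op_inv S'"
  by (rule op_eqI; simp add: op_apply_add_op op_apply_diff_op op_inv_apply' zinv.add zinv.diff)+

lemma op_shift_inv: "op_shift h (op_inv S) = op_inv (op_shift h S)"
  by (rule poly_mapping_eqI) (simp add: lookup_op_shift lookup_op_inv ratfun_shift_zinv)

lemma op_sum_single: "S = (\<Sum>n\<in>Poly_Mapping.keys S. Poly_Mapping.single n (Poly_Mapping.lookup S n))"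
  by (rule poly_mapping_eqI) (simp add: lookup_sum lookup_single when_def in_keys_iff)

definition RK_op :: "diff_op \<Rightarrow> bool" where
  "RK_op S \<longleftrightarrow> (\<forall>n. Poly_Mapping.lookup S n \<in> ratfun_K)"

text \<open>The properties of a shift operator with which the division argument works; in this form
  they pass to right quotients (\<open>intertw_peel\<close>).\<close>

definition intertw :: "rat4 \<Rightarrow> diff_op \<Rightarrow> bool" where
  "intertw h S \<longleftrightarrow> RK_op S \<and> op_inv S = S \<and> op_comp S (opD 0) = op_comp (opD h) S"

text \<open>The polynomials P_m are eigenvectors on both sides and, by \<open>eig_shift\<close>,
  with the same eigenvalue. They span the symmetric Laurent polynomials, on which an operator is
  determined.\<close>

lemma shift_ops_intertw:
  assumes "S \<in> shift_ops h"
  shows "intertw h S"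
  unfolding intertw_def
proof (intro conjI)
  have S: "RK_op S" "\<And>f. f \<in> sym_laurent_K \<Longrightarrow> op_apply S (of_lpoly f) \<in> SZ"
    and ev: "\<And>m. \<exists>C\<in>KK. op_apply S (of_lpoly (eigenpoly m)) =
        scal C * of_lpoly (shifted_eigenpoly h (of_nat m + degree_shift h))"
    using assms by (auto simp: shift_ops_def symmetric_diff_op_def RK_op_def SZ_def AW_eq AW_shifted_eq)
  show "RK_op S" by (rule S)
  show "op_inv S = S"
    by (rule op_eqI_sym) (simp add: op_inv_apply' sym_zinv S SZ_zinv)
  show "op_comp S (opD 0) = op_comp (opD h) S"
  proof (rule op_eqI_sym)
    fix f
    assume f: "f \<in> sym_laurent_K"
    have "\<exists>n. top_le f (int n - 1)"
    proof (cases "f = 0")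
      case False
      then obtain N where N: "top_le f N" using obtain_top by blast
      then show ?thesis using top_le_mono[OF N, of "int (nat (N + 1)) - 1"] by (intro exI[of _ "nat (N + 1)"]) simp
    qed (simp add: top_le_def)
    then obtain n c where c: "f = (\<Sum>j<n. lmon (c j) 0 * eigenpoly j)"
      using span_below[OF eigenpoly_basis f] by blast
    have ev': "op_apply S (op_apply (opD 0) (of_lpoly (eigenpoly j))) = op_apply (opD h) (op_apply S (of_lpoly (eigenpoly j)))" for j
    proof -
      obtain C where C: "op_apply S (of_lpoly (eigenpoly j)) = scal C * of_lpoly (shifted_eigenpoly h (of_nat j + degree_shift h))"
        using ev by blast
      have "op_apply (opD h) (of_lpoly (shifted_eigenpoly h (of_nat j + degree_shift h))) =
          scal (eig 0 (of_nat j)) * of_lpoly (shifted_eigenpoly h (of_nat j + degree_shift h))"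
      proof (cases "of_nat j + degree_shift h \<in> \<nat>")
        case True
        then obtain k where k: "of_nat j + degree_shift h = of_nat k" by (auto elim: Nats_cases)
        have "op_apply (opD h) (ratfun_shift h (of_lpoly (eigenpoly k))) = ratfun_shift h (op_apply (opD 0) (of_lpoly (eigenpoly k)))"
          using op_shift_apply[of h "opD 0"] by (simp add: op_shift_opD)
        also have "\<dots> = scal (eig h (of_nat k)) * ratfun_shift h (of_lpoly (eigenpoly k))"
          by (simp add: eigenpoly_opD rs.mult par_shift_eig)
        also have "eig h (of_nat k) = eig 0 (of_nat j)"
          unfolding eig_shift[of h] k[symmetric] by simp
        finally show ?thesis unfolding k by (simp add: shifted_eigenpoly_def ratfun_shift_of_lpoly)
      qed (simp add: shifted_eigenpoly_def)
      then show ?thesis unfolding eigenpoly_opD op_apply_scal C by (simp add: mult.left_commute)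
    qed
    show "op_apply (op_comp S (opD 0)) (of_lpoly f) = op_apply (op_comp (opD h) S) (of_lpoly f)"
      unfolding c of_lpoly_sum of_lpoly_const_mult op_apply_comp op_apply_sum op_apply_scal ev' ..
  qed
qed

definition dA :: "rat4 \<Rightarrow> kz" where "dA h = scal (1 / gam h) * Acoef h zz"

definition dB :: "rat4 \<Rightarrow> kz" where "dB h = scal (gam h + 1 / gam h) - dA h - zinv (dA h)"

lemma opD_split: "opD h = Poly_Mapping.single 2 (dA h) + Poly_Mapping.single (-2) (zinv (dA h)) + Poly_Mapping.single 0 (dB h)"
  by (simp add: opD_def dA_def dB_def zinv.mult zinv_Acoef zinv_zz inverse_eq_divide algebra_simps)

lemma intertw_coeffs:
  assumes "intertw h S"
  shows "Poly_Mapping.lookup S (n - 2) * T_pow (n - 2) (dA 0) + Poly_Mapping.lookup S (n + 2) * T_pow (n + 2) (zinv (dA 0)) +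
      Poly_Mapping.lookup S n * T_pow n (dB 0) =
    dA h * T_pow 2 (Poly_Mapping.lookup S (n - 2)) + zinv (dA h) * T_pow (-2) (Poly_Mapping.lookup S (n + 2)) + dB h * Poly_Mapping.lookup S n"
proof -
  have "Poly_Mapping.lookup (op_comp S (opD 0)) n = Poly_Mapping.lookup (op_comp (opD h) S) n"
    using assms by (simp add: intertw_def)
  then show ?thesis
    unfolding opD_split by (simp add: op_comp_add lookup_add lookup_comp_single lookup_single_comp)
qed

text \<open>The coefficient of T^(N+2) in the relation also involves the coefficients of S at N+2
  and N+4; when these vanish a first order equation is left.\<close>

lemma intertw_top:
  assumes "intertw h S" "Poly_Mapping.lookup S (N + 2) = 0" "Poly_Mapping.lookup S (N + 4) = 0"
  shows "Poly_Mapping.lookup S N * T_pow N (dA 0) = dA h * T_pow 2 (Poly_Mapping.lookup S N)"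
  using intertw_coeffs[OF assms(1), of "N + 2"] assms(2,3) by (simp add: T.zero add.assoc)

lemma Acoef_ev: "Acoef h (scal s * zz) = ev (\<Prod>i<4. [:1, - (upar h i * s):]) / ev ([:1, 0, - (s * s):] * [:1, 0, - (qpow 1 * (s * s)):])"
proof -
  have "ev [:1, 0, - y:] = 1 - scal y * zz^2" for y
    by (simp add: ev_pCons scal.simps power2_eq_square algebra_simps)
  moreover have "ev [:1, - y:] = 1 - scal y * zz" for y
    by (simp add: ev_pCons scal.simps algebra_simps)
  ultimately show ?thesis
    unfolding Acoef_def Af_def ev_prod ev_mult
    by (simp add: scal.mult power_mult_distrib scal.power[symmetric] tt_square mult.assoc)
       (simp add: scal.mult power2_eq_square mult.assoc)
qed

text \<open>The coefficient c of T^N is a rational solution of the first order equation of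
  \<open>intertw_top\<close>. The zero 1/u_i on one side must be compensated on its q-orbit
  (\<open>first_order_orbit\<close>), by genericity through the same parameter, which gives the
  first claim. Leading coefficients (\<open>first_order_degree\<close>) give the second.\<close>

lemma intertw_lattice:
  assumes S: "intertw h S" and N: "Poly_Mapping.lookup S (N + 2) = 0" "Poly_Mapping.lookup S (N + 4) = 0" "Poly_Mapping.lookup S N \<noteq> 0"
  shows "i < 4 \<Longrightarrow> hc h i - of_int N / 2 \<in> \<int>" and "(\<Sum>i<4. hc h i) / 2 \<in> \<int>"
proof -
  let ?c = "Poly_Mapping.lookup S N"
  define s where "s = qpow (of_int N / 2)"
  have s0: "s \<noteq> 0" by (simp add: s_def)
  define P where "P = (\<lambda>h s. \<Prod>i<4. [:1, - (upar h i * s):])"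
  define Q where "Q = (\<lambda>s. [:1, 0, - (s * s):] * [:1, 0, - (qpow 1 * (s * s)):])"
  have Q0: "ev (Q s) \<noteq> 0" for s by (simp add: Q_def ev_eq_0 del: mult_pCons_left mult_pCons_right)
  have eq: "T_pow 2 ?c * ev (P h 1 * Q s) = scal (gam h / gam 0) * ?c * ev (P 0 s * Q 1)"
  proof -
    have A: "Acoef h zz = ev (P h 1) / ev (Q 1)" "T_pow N (Acoef 0 zz) = ev (P 0 s) / ev (Q s)"
      using Acoef_ev[of h 1] Acoef_ev[of 0 s] by (simp_all add: T_Acoef T_pow_zz s_def[symmetric] P_def Q_def scal.one)
    have "?c * (scal (1 / gam 0) * (ev (P 0 s) / ev (Q s))) = scal (1 / gam h) * (ev (P h 1) / ev (Q 1)) * T_pow 2 ?c"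
      using intertw_top[OF S N(1,2)] by (simp add: dA_def T.mult A)
    then show ?thesis using Q0 by (simp add: ev_mult scal.divide scal.one scal.eq_zero field_simps)
  qed
  have kap: "gam h / gam 0 = qpow ((\<Sum>i<4. hc h i) / 2)"
  proof -
    have g: "gam k = sqrt_ab * sqrt_cd * qpow (((\<Sum>i<4. hc k i) - 1) / 2)" for k
      by (simp add: gam_def sum_4)
    have "sqrt_ab * sqrt_cd \<noteq> 0" by (simp add: sqrt_ab_def sqrt_cd_def)
    then show ?thesis unfolding g diff_divide_distrib qpow_diff by (simp add: hc_0)
  qed
  note lead = lead_coeff_mult lead_coeff_prod lead_coeff_pCons
  have "Polynomial.lead_coeff (P h 1 * Q s) = qpow (\<Sum>i<4. hc h i) * Polynomial.lead_coeff (P 0 s * Q 1)"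
  proof -
    have LP: "Polynomial.lead_coeff (P h s) = (\<Prod>i<4. upar h i * s)" if "s \<noteq> 0" for h s
    proof -
      have "Polynomial.lead_coeff (P h s) = (\<Prod>i<4. Polynomial.lead_coeff [:1, - (upar h i * s):])"
        unfolding P_def by (rule lead_coeff_prod)
      also have "\<dots> = (\<Prod>i<4. - (upar h i * s))"
        using that by (intro prod.cong) simp_all
      also have "\<dots> = (\<Prod>i<4. upar h i * s)" by (simp add: prod_uminus)
      finally show ?thesis .
    qed
    have LQ: "Polynomial.lead_coeff (Q s) = qpow 1 * s ^ 4" if "s \<noteq> 0" for s
      unfolding Q_def lead_coeff_mult using that by (simp add: power4_eq_xxxx)
    have "(\<Prod>i<4. upar h i) = (\<Prod>i<4. upar 0 i) * qpow (\<Sum>i<4. hc h i)"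
      unfolding qpow_sum prod.distrib [symmetric] by (intro prod.cong refl) (simp add: upar_0, simp add: upar_def)
    then show ?thesis
      unfolding lead_coeff_mult LP[OF s0] LQ[OF s0] LP[OF one_neq_zero] LQ[OF one_neq_zero]
      by (simp add: prod.distrib)
  qed
  moreover have "P 0 s * Q 1 \<noteq> 0"
    using Q0[of 1] s0 by (auto simp: P_def ev_eq_0 prod_zero_iff)
  ultimately obtain m :: int where "gam h / gam 0 = qpow ((\<Sum>i<4. hc h i) + of_int m)"
    using first_order_degree[OF N(3) eq] by blast
  then have "(\<Sum>i<4. hc h i) / 2 = (\<Sum>i<4. hc h i) + of_int m" unfolding kap qpow_eq .
  \<comment> \<open>The scalar gam_h/gam_0 carries half the sum of the entries of h, the leading
    coefficients carry the full sum; the difference is an integer.\<close>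
  then have "(\<Sum>i<4. hc h i) / 2 = - of_int m" by (simp add: field_simps)
  then show "(\<Sum>i<4. hc h i) / 2 \<in> \<int>" by simp
  show "hc h i - of_int N / 2 \<in> \<int>" if i: "i < 4"
  proof -
    have "poly (P h 1 * Q s) (1 / upar h i) = 0"
      using i unfolding P_def poly_mult poly_prod by (auto simp: prod_zero_iff)
    then obtain e :: int where e: "poly (P 0 s * Q 1) (1 / upar h i * qpow (of_int e)) = 0"
      using first_order_orbit[OF N(3) eq] i by fastforce
    define x where "x = qpow (of_int e) / upar h i"
    have x: "poly (P 0 s * Q 1) x = 0" using e by (simp add: x_def)
    have xu: "x * upar h i = qpow (of_int e)" using i by (simp add: x_def)
    have xx: "x * x * (upar h i * upar h i) = qpow (of_int e + of_int e)"
      using xu unfolding qpow_add by (metis mult.assoc mult.left_commute)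
    \<comment> \<open>A zero of the numerator identifies the parameter; a zero of a denominator
      would make u_i^2 a power of q.\<close>
    from x consider j where "j < 4" "1 = x * (upar 0 j * s)" | "x * x = 1" | "qpow 1 * (x * x) = 1"
      unfolding P_def Q_def poly_mult poly_prod mult_eq_0_iff by (auto simp: prod_zero_iff algebra_simps)
    then show ?thesis
    proof cases
      case (1 j)
      have "upar h i = (x * (upar 0 j * s)) * upar h i" unfolding 1(2)[symmetric] by simp
      also have "\<dots> = (x * upar h i) * (upar 0 j * s)" by (simp only: ac_simps)
      finally have "upar h i = qpow (of_int e) * (upar 0 j * s)" unfolding xu .
      then have "par i * qpow (hc h i) = par j * qpow (of_int e + of_int N / 2)"
        using 1(1) by (simp add: upar_0 s_def qpow_add ac_simps) (simp add: upar_def ac_simps)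
      then have pij: "par i = par j * qpow (of_int e + of_int N / 2 - hc h i)"
        unfolding qpow_diff[of "of_int e + of_int N / 2"] by (simp add: field_simps)
      then have "i = j" using par_neq_par_qpow[OF i 1(1)] by blast
      then have "qpow (of_int e + of_int N / 2 - hc h i) = 1" using pij i by simp
      then have "hc h i - of_int N / 2 = of_int e" by (simp add: qpow_eq_1)
      then show ?thesis by simp
    next
      case 2
      then show ?thesis using xx upar_prod_neq_qpow[OF i i] by simp
    next
      case 3
      then have "upar h i * upar h i = qpow 1 * (x * x) * (upar h i * upar h i)" by simp
      also have "\<dots> = qpow 1 * qpow (of_int e + of_int e)" unfolding mult.assoc[of "qpow 1"] xx ..
      finally have "upar h i * upar h i = qpow 1 * qpow (of_int e + of_int e)" .
      then show ?thesis using upar_prod_neq_qpow[OF i i] unfolding qpow_add[symmetric] by blast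
    qed
  qed
qed

text \<open>In each parity class of exponents the largest one, N, meets the hypotheses of
  \<open>intertw_lattice\<close>, so the first entry of h is congruent to N/2 modulo the integers.
  Hence only one class occurs.\<close>

lemma intertw_parity:
  assumes S: "intertw h S" "S \<noteq> 0"
  shows "\<exists>j::int. (\<forall>n. Poly_Mapping.lookup S n \<noteq> 0 \<longrightarrow> even (n - j)) \<and> (\<forall>i<4. hc h i - of_int j / 2 \<in> \<int>) \<and> (\<Sum>i<4. hc h i) / 2 \<in> \<int>"
proof -
  have top: "\<exists>N. even (N - n) \<and> Poly_Mapping.lookup S N \<noteq> 0 \<and> Poly_Mapping.lookup S (N + 2) = 0 \<and> Poly_Mapping.lookup S (N + 4) = 0"
    if n: "Poly_Mapping.lookup S n \<noteq> 0" for n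
  proof -
    define A where "A = {m \<in> Poly_Mapping.keys S. even (m - n)}"
    have A: "finite A" "n \<in> A" using n by (simp_all add: A_def in_keys_iff)
    have mx: "Max A \<in> A" "\<And>m. m \<in> A \<Longrightarrow> m \<le> Max A" using A by (auto intro: Max_in)
    have "Max A + 2 \<notin> A" "Max A + 4 \<notin> A" using mx(2) by fastforce+
    then show ?thesis using mx(1) unfolding A_def by (intro exI[of _ "Max A"]) (auto simp: A_def in_keys_iff)
  qed
  obtain n where n: "Poly_Mapping.lookup S n \<noteq> 0" using S(2) by (metis poly_mapping_eqI lookup_zero)
  obtain j where j: "Poly_Mapping.lookup S j \<noteq> 0" "Poly_Mapping.lookup S (j + 2) = 0" "Poly_Mapping.lookup S (j + 4) = 0"
    using top[OF n] by blast
  note L = intertw_lattice[OF S(1) j(2,3,1)]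
  have "even (m - j)" if m: "Poly_Mapping.lookup S m \<noteq> 0" for m
  proof -
    obtain N where N: "even (N - m)" "Poly_Mapping.lookup S N \<noteq> 0" "Poly_Mapping.lookup S (N + 2) = 0" "Poly_Mapping.lookup S (N + 4) = 0"
      using top[OF m] by blast
    have "(hc h 0 - of_int j / 2) - (hc h 0 - of_int N / 2) \<in> \<int>"
      by (rule Ints_diff) (use L(1)[of 0] intertw_lattice(1)[OF S(1) N(3,4,2), of 0] in auto)
    then obtain k where "(hc h 0 - of_int j / 2) - (hc h 0 - of_int N / 2) = of_int k" by (auto elim: Ints_cases)
    then have "of_int (N - j) = (of_int (2 * k) :: rat)" by (simp add: field_simps)
    then have "N - j = 2 * k" by (simp only: of_int_eq_iff)
    then show ?thesis using N(1) by presburger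
  qed
  then show ?thesis using L by blast
qed

subsection \<open>Right division by the elementary operators\<close>

definition eA :: "nat set \<Rightarrow> kz" where "eA I = cA 0 I zz / (zz - 1 / zz)"

text \<open>Modulo left multiples of \<open>opE 0 I\<close>, the operator T is congruent to this
  function times T^(-1).\<close>

definition sig :: "nat set \<Rightarrow> kz" where "sig I = - (zinv (eA I) / eA I)"

lemma opE_split: "opE 0 I = Poly_Mapping.single 1 (eA I) + Poly_Mapping.single (-1) (zinv (eA I))"
proof -
  have "- (cA 0 I (inverse zz) / (zz - inverse zz)) = cA 0 I (inverse zz) / (inverse zz - zz)"
    by (metis minus_diff_eq minus_divide_right)
  then have "- (cA 0 I (inverse zz) / (zz - inverse zz)) = zinv (eA I)"
    unfolding eA_def zinv.divide zinv.diff zinv.one zinv_cA zinv_zz inverse_eq_divide by (simp add: inverse_eq_divide)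
  then show ?thesis
    by (simp add: opE_def two_term_op_def eA_def inverse_eq_divide single_uminus[symmetric] del: single_uminus)
qed

lemma cA_zz: "cA 0 I zz = inverse (zz ^ (card I div 2)) * (\<Prod>i\<in>I. lf 1 (- upar 0 i / tt))"
  by (simp add: cA_def cAf_def lf_def scal.simps)

lemma eA_nz [simp]: "eA I \<noteq> 0"
  unfolding eA_def cA_zz using zz_minus_inverse_nz by (cases "finite I") (auto simp: prod_zero_iff)

lemma zinv_eA_nz [simp]: "zinv (eA I) \<noteq> 0"
  by (simp add: zinv.eq_zero)

lemma eA_RK: "I \<in> even_sets \<Longrightarrow> eA I \<in> ratfun_K"
  unfolding eA_def cA_zz lf_def using even_sets_subset[of I]
  by (intro RK_intros zz_RK scal_RK KK_intros qpow_KK) (auto simp: upar_0 par_KK)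

lemma sig_eq:
  assumes I: "I \<in> even_sets"
  shows "sig I = (\<Prod>i\<in>I. lf (- upar 0 i / tt) 1 / lf 1 (- upar 0 i / tt))"
proof -
  have n: "card I div 2 + card I div 2 = card I" using I by (auto simp: even_sets_def elim!: evenE)
  let ?m = "card I div 2"
  have zn: "zz ^ card I = zz ^ ?m * zz ^ ?m" by (metis n power_add)
  have "zinv (cA 0 I zz) = zz ^ ?m * ((\<Prod>i\<in>I. lf (- upar 0 i / tt) 1) / zz ^ card I)"
    unfolding cA_zz zinv.mult zinv.inverse zinv.power zinv.prod zinv_lf zinv_zz by (simp add: prod_dividef power_inverse)
  also have "\<dots> = (\<Prod>i\<in>I. lf (- upar 0 i / tt) 1) / zz ^ ?m"
    unfolding zn by simp
  finally have z: "zinv (cA 0 I zz) = (\<Prod>i\<in>I. lf (- upar 0 i / tt) 1) / zz ^ ?m" .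
  have cancel: "- (p / m / - d / (inverse m * p' / d)) = p / p'" if "m \<noteq> 0" "d \<noteq> 0" for p p' m d :: kz
    using that by (cases "p' = 0") (simp_all add: field_simps)
  have d: "zinv (zz - 1 / zz) = - (zz - 1 / zz)"
    unfolding zinv.diff zinv.divide zinv.one zinv_zz by (simp add: inverse_eq_divide)
  show ?thesis
    unfolding sig_def eA_def zinv.divide d z unfolding cA_zz prod_dividef
    by (rule cancel) (simp, rule zz_minus_inverse_nz)
qed

lemma opE_comp_single: "op_comp (Poly_Mapping.single n d) (opE 0 I) =
    Poly_Mapping.single (n + 1) (d * T_pow n (eA I)) + Poly_Mapping.single (n - 1) (d * T_pow n (zinv (eA I)))"
  by (simp add: opE_split op_comp_add op_comp_single)

text \<open>In Y E the top term of Y is raised by T and its bottom term lowered by T^(-1), without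
  cancellation; a nonzero left multiple of E thus has at least two terms.\<close>

lemma opE_comp_eq_single:
  assumes "op_comp Y (opE 0 I) = Poly_Mapping.single n c"
  shows "Y = 0"
proof (rule ccontr)
  assume "Y \<noteq> 0"
  then have ne: "Poly_Mapping.keys Y \<noteq> {}" by simp
  define N where "N = Max (Poly_Mapping.keys Y)"
  define M where "M = Min (Poly_Mapping.keys Y)"
  have NM: "N \<in> Poly_Mapping.keys Y" "M \<in> Poly_Mapping.keys Y" "\<And>k. k \<in> Poly_Mapping.keys Y \<Longrightarrow> M \<le> k \<and> k \<le> N"
    unfolding N_def M_def using ne by (auto intro: Max_in Min_in)
  have l: "Poly_Mapping.lookup (op_comp Y (opE 0 I)) m =
      Poly_Mapping.lookup Y (m - 1) * T_pow (m - 1) (eA I) + Poly_Mapping.lookup Y (m + 1) * T_pow (m + 1) (zinv (eA I))" for m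
    by (simp add: opE_split op_comp_add lookup_add lookup_comp_single)
  have "Poly_Mapping.lookup Y (N + 1 + 1) = 0" "Poly_Mapping.lookup Y (M - 1 - 1) = 0"
    using NM(3)[of "N + 1 + 1"] NM(3)[of "M - 1 - 1"] by (auto simp: in_keys_iff)
  then have "Poly_Mapping.lookup (op_comp Y (opE 0 I)) (N + 1) \<noteq> 0" "Poly_Mapping.lookup (op_comp Y (opE 0 I)) (M - 1) \<noteq> 0"
    using NM(1,2) unfolding l by (simp_all add: in_keys_iff T.eq_zero)
  then have "N + 1 = n" "M - 1 = n" unfolding assms lookup_single by (auto simp: when_def split: if_splits)
  then show False using NM(3)[OF NM(1)] by simp
qed

lemma opE_cancel: "op_comp Y (opE 0 I) = op_comp Y' (opE 0 I) \<Longrightarrow> Y = Y'"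
  using opE_comp_eq_single[of "Y - Y'" I 0 0] by (simp add: op_comp_diff)

text \<open>Subtracting left multiples of E reduces T^(j+2) and T^(j-2) to T^j by means of
  \<open>sig\<close>. The single term left over is again a left multiple of E, hence zero.\<close>

lemma opE_remainder:
  assumes "op_comp Y (opE 0 I) = Poly_Mapping.single (j + 2) x + Poly_Mapping.single (j - 2) y + Poly_Mapping.single j w"
  shows "x * T_pow (j + 1) (sig I) + y / T_pow (j - 1) (sig I) + w = 0"
proof -
  let ?a = "eA I"
  let ?w = "x * T_pow (j + 1) (sig I) + y / T_pow (j - 1) (sig I) + w"
  define Y' where "Y' = Y - Poly_Mapping.single (j + 1) (x / T_pow (j + 1) ?a) - Poly_Mapping.single (j - 1) (y / T_pow (j - 1) (zinv ?a))"
  have nz: "T_pow n ?a \<noteq> 0" "T_pow n (zinv ?a) \<noteq> 0" for n by (simp_all add: T.eq_zero)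
  have e: "j + 1 + 1 = j + 2" "j + 1 - 1 = j" "j - 1 + 1 = j" "j - 1 - 1 = j - 2" by simp_all
  have "op_comp Y' (opE 0 I) = Poly_Mapping.single j ?w"
    unfolding Y'_def op_comp_diff assms opE_comp_single e
    using nz by (simp add: sig_def T.minus T.divide single_add[symmetric] single_diff[symmetric] algebra_simps)
  moreover from this have "Y' = 0" by (rule opE_comp_eq_single)
  ultimately show ?thesis by (metis op_comp_0(1) single_eq_zero_iff)
qed

text \<open>D - lam is a left multiple of E_I by the factorisation, so D reduces to lam.\<close>

lemma opD_remainder:
  assumes I: "I \<in> even_sets"
  shows "dA 0 * T_pow 1 (sig I) + zinv (dA 0) / T_pow (-1) (sig I) + dB 0 = scal (lam 0 I)"
proof -
  let ?Y = "op_comp (Poly_Mapping.single 0 (scal (nu 0 I))) (opE (0 + vsh I) ({..<4} - I))"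
  have "op_comp ?Y (opE 0 I) = opD 0 - Poly_Mapping.single 0 (scal (lam 0 I))"
    by (rule op_eqI) (simp add: op_apply_comp op_apply_single op_apply_diff_op opE_fact[OF I, of 0, simplified])
  also have "opD 0 - Poly_Mapping.single 0 (scal (lam 0 I)) = Poly_Mapping.single (0 + 2) (dA 0) + Poly_Mapping.single (0 - 2) (zinv (dA 0)) + Poly_Mapping.single 0 (dB 0 - scal (lam 0 I))"
    by (simp add: opD_split single_diff)
  finally have "op_comp ?Y (opE 0 I) = \<dots>" .
  from opE_remainder[OF this] show ?thesis by (simp add: algebra_simps)
qed

text \<open>Each step subtracts a left multiple of E that moves the exponent by 2 towards j; the
  induction runs in both directions.\<close>

lemma opE_divide_single:
  assumes I: "I \<in> even_sets" and c: "c \<in> ratfun_K"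
  shows "\<exists>X r. RK_op X \<and> Poly_Mapping.single (j + 2 * k) c = op_comp X (opE 0 I) + Poly_Mapping.single j r"
  using c
proof (induction k arbitrary: c rule: int_induct[where k = 0])
  case base
  show ?case by (rule exI[of _ 0], rule exI[of _ c]) (simp add: RK_op_def RK_intros)
next
  case (step1 k)
  let ?n = "j + 2 * k + 1"
  define d where "d = c / T_pow ?n (eA I)"
  have d: "d \<in> ratfun_K" unfolding d_def by (intro RK_intros T_pow_RK eA_RK I step1.prems)
  have "- d * T_pow ?n (zinv (eA I)) \<in> ratfun_K" by (intro RK_intros T_pow_RK zinv_RK eA_RK I d)
  then obtain X r where X: "RK_op X" "Poly_Mapping.single (j + 2 * k) (- d * T_pow ?n (zinv (eA I))) = op_comp X (opE 0 I) + Poly_Mapping.single j r"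
    using step1.IH by blast
  have e: "?n + 1 = j + 2 * (k + 1)" "?n - 1 = j + 2 * k" by simp_all
  have "Poly_Mapping.single (j + 2 * (k + 1)) c = op_comp (Poly_Mapping.single ?n d) (opE 0 I) + Poly_Mapping.single (j + 2 * k) (- d * T_pow ?n (zinv (eA I)))"
    using opE_comp_single[of ?n d I] unfolding e by (simp add: single_uminus d_def T.eq_zero)
  then have "Poly_Mapping.single (j + 2 * (k + 1)) c = op_comp (Poly_Mapping.single ?n d + X) (opE 0 I) + Poly_Mapping.single j r"
    unfolding X(2) op_comp_add by (simp add: add.assoc)
  moreover have "RK_op (Poly_Mapping.single ?n d + X)"
    using X(1) d by (auto simp: RK_op_def lookup_add lookup_single when_def RK_intros)
  ultimately show ?case by blast
next
  case (step2 k)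
  let ?n = "j + 2 * k - 1"
  define d where "d = c / T_pow ?n (zinv (eA I))"
  have d: "d \<in> ratfun_K" unfolding d_def by (intro RK_intros T_pow_RK zinv_RK eA_RK I step2.prems)
  have "- d * T_pow ?n (eA I) \<in> ratfun_K" by (intro RK_intros T_pow_RK eA_RK I d)
  then obtain X r where X: "RK_op X" "Poly_Mapping.single (j + 2 * k) (- d * T_pow ?n (eA I)) = op_comp X (opE 0 I) + Poly_Mapping.single j r"
    using step2.IH by blast
  have e: "?n - 1 = j + 2 * (k - 1)" "?n + 1 = j + 2 * k" by simp_all
  have "Poly_Mapping.single (j + 2 * (k - 1)) c = op_comp (Poly_Mapping.single ?n d) (opE 0 I) + Poly_Mapping.single (j + 2 * k) (- d * T_pow ?n (eA I))"
    using opE_comp_single[of ?n d I] unfolding e by (simp add: single_uminus d_def T.eq_zero)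
  then have "Poly_Mapping.single (j + 2 * (k - 1)) c = op_comp (Poly_Mapping.single ?n d + X) (opE 0 I) + Poly_Mapping.single j r"
    unfolding X(2) op_comp_add by (simp add: add.assoc)
  moreover have "RK_op (Poly_Mapping.single ?n d + X)"
    using X(1) d by (auto simp: RK_op_def lookup_add lookup_single when_def RK_intros)
  ultimately show ?case by blast
qed

lemma opE_divide:
  assumes I: "I \<in> even_sets" and S: "RK_op S" "\<And>n. Poly_Mapping.lookup S n \<noteq> 0 \<Longrightarrow> even (n - j)"
  shows "\<exists>X r. RK_op X \<and> S = op_comp X (opE 0 I) + Poly_Mapping.single j r"
proof -
  have "\<exists>X r. RK_op X \<and> Poly_Mapping.single n (Poly_Mapping.lookup S n) = op_comp X (opE 0 I) + Poly_Mapping.single j r"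
    if n: "n \<in> Poly_Mapping.keys S" for n
  proof -
    have "even (n - j)" using n S(2) by (simp add: in_keys_iff)
    then obtain k where "n = j + 2 * k" by (metis add_diff_cancel_left' diff_add_cancel evenE add.commute)
    then show ?thesis using opE_divide_single[OF I, of "Poly_Mapping.lookup S n" j k] S(1) by (simp add: RK_op_def)
  qed
  then obtain X r where X: "\<And>n. n \<in> Poly_Mapping.keys S \<Longrightarrow> RK_op (X n) \<and>
      Poly_Mapping.single n (Poly_Mapping.lookup S n) = op_comp (X n) (opE 0 I) + Poly_Mapping.single j (r n)" by metis
  have sj: "(\<Sum>n\<in>A. Poly_Mapping.single j (r n)) = Poly_Mapping.single j (\<Sum>n\<in>A. r n)" for A
    by (induction A rule: infinite_finite_induct) (simp_all add: single_add)
  have "S = (\<Sum>n\<in>Poly_Mapping.keys S. op_comp (X n) (opE 0 I) + Poly_Mapping.single j (r n))"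
    using op_sum_single[of S] X by (metis (mono_tags, lifting) sum.cong)
  also have "\<dots> = op_comp (\<Sum>n\<in>Poly_Mapping.keys S. X n) (opE 0 I) + Poly_Mapping.single j (\<Sum>n\<in>Poly_Mapping.keys S. r n)"
    by (simp add: sum.distrib op_comp_sum sj)
  finally have "S = \<dots>" .
  moreover have "RK_op (\<Sum>n\<in>Poly_Mapping.keys S. X n)"
    using X by (auto simp: RK_op_def lookup_sum intro!: RK_intros)
  ultimately show ?thesis by blast
qed

section \<open>Vanishing of the remainder\<close>

lemma T_sig:
  assumes I: "I \<in> even_sets"
  shows "T_pow n (sig I) = (\<Prod>i\<in>I. lf (- upar 0 i / tt) (qpow (of_int n / 2)) / lf 1 (- upar 0 i / tt * qpow (of_int n / 2)))"
  unfolding sig_eq[OF I] by (simp add: T.prod T.divide T_lf)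

lemma sum_hc_Ints:
  assumes I: "I \<in> even_sets" and h: "\<And>i. i < 4 \<Longrightarrow> hc h i - of_int j / 2 \<in> \<int>"
  shows "(\<Sum>i\<in>I. hc h i) \<in> \<int>"
proof -
  have "(\<Sum>i\<in>I. hc h i - of_int j / 2) \<in> \<int>" using h even_sets_subset[OF I] by (intro Ints_sum) auto
  moreover have "(\<Sum>i\<in>I. of_int j / 2 :: rat) \<in> \<int>"
  proof -
    obtain m where "card I = 2 * m" using I by (auto simp: even_sets_def elim: evenE)
    then have "(\<Sum>i\<in>I. of_int j / 2 :: rat) = of_int (int m * j)" by simp
    then show ?thesis by (simp only: Ints_of_int)
  qed
  ultimately have "(\<Sum>i\<in>I. hc h i - of_int j / 2) + (\<Sum>i\<in>I. of_int j / 2) \<in> \<int>" by (rule Ints_add)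
  then show ?thesis unfolding sum.distrib[symmetric] by simp
qed

text \<open>For h = 0 and j = 0 the two functions agree. In general the zeros of corresponding
  linear factors differ by the powers h_i + j/2 and h_i - j/2 of q up to sign, which are integral,
  and the constants multiply to an integral power of q because I is even.\<close>

lemma tphi_sig_gauge:
  assumes I: "I \<in> even_sets" and h: "\<And>i. i < 4 \<Longrightarrow> hc h i - of_int j / 2 \<in> \<int>"
  shows "tphi h I / T_pow (j + 1) (sig I) \<in> gauge"
proof -
  have fin: "finite I" using I by (auto simp: even_sets_def finite_subset)
  have sumI: "(\<Sum>i\<in>I. hc h i) \<in> \<int>" by (rule sum_hc_Ints[OF I h])
  have "tphi h I / T_pow (j + 1) (sig I) = (\<Prod>i\<in>I. scal (qpow (hc h i)) *
     (lf (-1) (1 / upar 0 i * qpow (1 - hc h i)) / lf (-1) (1 / upar 0 i * qpow (1 + of_int j / 2)) *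
     (lf 1 (- upar 0 i * qpow (of_int j / 2)) / lf 1 (- upar 0 i * qpow (hc h i)))))"
    unfolding tphi_def T_sig[OF I] prod_dividef[symmetric]
  proof (rule prod.cong[OF refl])
    fix i
    assume "i \<in> I"
    then have i: "i < 4" by (rule even_sets_subset[OF I])
    let ?u = "upar 0 i"
    have u: "?u \<noteq> 0" using i by simp
    have uh: "upar h i = ?u * qpow (hc h i)" using i by (simp add: upar_0) (simp add: upar_def)
    have scale: "lf (x * a) (x * b) = scal x * lf a b" for x a b
      by (simp add: lf_def scal.mult algebra_simps)
    have q1: "qpow (of_int (j + 1) / 2) = tt * qpow (of_int j / 2)"
      by (simp add: qpow_add[symmetric] add_divide_distrib add.commute)
    have n1: "lf (- upar h i / qpow 1) 1 = scal (?u * qpow (hc h i) / qpow 1) * lf (-1) (1 / ?u * qpow (1 - hc h i))"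
      unfolding scale[symmetric] uh qpow_diff using u by simp
    have n2: "lf (- ?u / tt) (qpow (of_int (j + 1) / 2)) = scal (?u / tt) * lf (-1) (1 / ?u * qpow (1 + of_int j / 2))"
    proof -
      have "?u / tt * (1 / ?u * qpow (1 + of_int j / 2)) = qpow (1 + of_int j / 2) / tt" using u by simp
      also have "\<dots> = qpow (of_int (j + 1) / 2)"
        unfolding qpow_diff[symmetric] by (rule arg_cong[of _ _ qpow]) (simp add: field_simps)
      finally show ?thesis unfolding scale[symmetric] by simp
    qed
    have n3: "lf 1 (- ?u / tt * qpow (of_int (j + 1) / 2)) = lf 1 (- ?u * qpow (of_int j / 2))"
      unfolding q1 by simp
    have cc: "scal tt * scal (?u * qpow (hc h i) / qpow 1) / scal (?u / tt) = scal (qpow (hc h i))"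
    proof -
      have "tt * (?u * qpow (hc h i) / qpow 1) / (?u / tt) = qpow (hc h i) * (tt * tt / qpow 1)"
        using u by simp
      also have "tt * tt / qpow 1 = 1" using tt_square by (simp add: power2_eq_square)
      finally show ?thesis by (simp add: scal.mult[symmetric] scal.divide[symmetric])
    qed
    have su: "scal (?u / tt) \<noteq> 0" using u by (simp add: scal.eq_zero)
    have alg: "a * (b * x) / y / (e * x' / y') = a * b / e * (x / x' * (y' / y))" for a b e x x' y y' :: kz
      by (simp add: ac_simps)
    show "scal tt * lf (- upar h i / qpow 1) 1 / lf 1 (- upar h i) / (lf (- ?u / tt) (qpow (of_int (j + 1) / 2)) / lf 1 (- ?u / tt * qpow (of_int (j + 1) / 2))) =
        scal (qpow (hc h i)) * (lf (-1) (1 / ?u * qpow (1 - hc h i)) / lf (-1) (1 / ?u * qpow (1 + of_int j / 2)) *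
         (lf 1 (- ?u * qpow (of_int j / 2)) / lf 1 (- ?u * qpow (hc h i))))"
      unfolding n1 n2 n3 alg cc by (simp add: uh)
  qed
  also have "\<dots> = scal (qpow (\<Sum>i\<in>I. hc h i)) * (\<Prod>i\<in>I.
     lf (-1) (1 / upar 0 i * qpow (1 - hc h i)) / lf (-1) (1 / upar 0 i * qpow (1 + of_int j / 2)) *
     (lf 1 (- upar 0 i * qpow (of_int j / 2)) / lf 1 (- upar 0 i * qpow (hc h i))))"
    unfolding prod.distrib[of "\<lambda>i. scal (qpow (hc h i))"] qpow_sum scal.prod ..
  also have "\<dots> \<in> gauge"
  proof (intro gauge_mult gauge_qpow sumI gauge_prod gauge_lf)
    fix i
    assume "i \<in> I"
    then have "hc h i - of_int j / 2 \<in> \<int>" using h even_sets_subset[OF I] by blast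
    then obtain m where m: "hc h i = of_int m + of_int j / 2" by (metis Ints_cases diff_add_cancel)
    have "of_int j / 2 - hc h i = of_int (- m)" "(1 - hc h i) - (1 + of_int j / 2) = of_int (- m - j)"
      unfolding m by (simp_all add: field_simps)
    then show "of_int j / 2 - hc h i \<in> \<int>" "(1 - hc h i) - (1 + of_int j / 2) \<in> \<int>"
      by (simp_all only: Ints_of_int)
  qed simp_all
  finally show ?thesis .
qed

text \<open>Reduction of the right-hand side modulo left multiples of E_I gives a second order
  equation for r with eigenvalue lam. The function g from \<open>tphi_sig_gauge\<close> turns r/g
  into a solution of \<open>twisted_eigen\<close>, which vanishes for positive
  \<open>nI h I\<close>.\<close>

lemma remainder_0:
  assumes I: "I \<in> even_sets" and n: "nI h I > 0" and h: "\<And>i. i < 4 \<Longrightarrow> hc h i - of_int j / 2 \<in> \<int>"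
    and Y: "op_comp Y (opE 0 I) = op_comp (opD h) (Poly_Mapping.single j r) - op_comp (Poly_Mapping.single j r) (opD 0)"
  shows "r = 0"
proof -
  let ?s = "\<lambda>n. T_pow n (sig I)"
  define \<psi> where "\<psi> = ?s (j + 1)"
  have s0: "?s n \<noteq> 0" for n by (simp add: T.eq_zero sig_def)
  have "op_comp Y (opE 0 I) = Poly_Mapping.single (j + 2) (dA h * T_pow 2 r - r * T_pow j (dA 0)) +
      Poly_Mapping.single (j - 2) (zinv (dA h) * T_pow (-2) r - r * T_pow j (zinv (dA 0))) +
      Poly_Mapping.single j (dB h * r - r * T_pow j (dB 0))"
    unfolding Y opD_split op_comp_add op_comp_single by (simp add: single_diff add.commute)
  from opE_remainder[OF this]
  have "dA h * T_pow 2 r * ?s (j + 1) + zinv (dA h) * T_pow (-2) r / ?s (j - 1) + dB h * r =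
      r * (T_pow j (dA 0) * ?s (j + 1) + T_pow j (zinv (dA 0)) / ?s (j - 1) + T_pow j (dB 0))"
    by (simp add: algebra_simps diff_divide_distrib)
  also have "T_pow j (dA 0) * ?s (j + 1) + T_pow j (zinv (dA 0)) / ?s (j - 1) + T_pow j (dB 0) = scal (lam 0 I)"
    using arg_cong[OF opD_remainder[OF I], of "T_pow j"] by (simp add: T.add T.mult T.divide T_pow_T_pow)
  finally have "dA h * T_pow 2 r * \<psi> + zinv (dA h) * T_pow (-2) r * T_pow (-2) (1 / \<psi>) + dB h * r = r * scal (lam 0 I)"
    by (simp add: \<psi>_def T.divide T.one T_pow_T_pow)
  from arg_cong[OF this, of "\<lambda>x. scal (gam h) * x"]
  have eq: "Acoef h zz * \<psi> * T_pow 2 r + Acoef h (1 / zz) * T_pow (-2) (1 / \<psi>) * T_pow (-2) r =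
     (Acoef h zz + Acoef h (1 / zz) + scal (gam h * (lam 0 I - gam h - 1 / gam h))) * r"
  proof -
    have g: "scal (gam h) * dA h = Acoef h zz" "scal (gam h) * zinv (dA h) = Acoef h (1 / zz)"
      "scal (gam h) * dB h = scal (gam h * (gam h + 1 / gam h)) - Acoef h zz - Acoef h (1 / zz)"
      by (simp_all add: dB_def dA_def zinv.mult zinv_Acoef zinv_zz right_diff_distrib mult.assoc[symmetric] scal.mult[symmetric] scal.one inverse_eq_divide)
    assume "scal (gam h) * (dA h * T_pow 2 r * \<psi> + zinv (dA h) * T_pow (-2) r * T_pow (-2) (1 / \<psi>) + dB h * r) = scal (gam h) * (r * scal (lam 0 I))"
    then have "(scal (gam h) * dA h) * T_pow 2 r * \<psi> + (scal (gam h) * zinv (dA h)) * T_pow (-2) r * T_pow (-2) (1 / \<psi>) + (scal (gam h) * dB h) * r = (scal (gam h) * scal (lam 0 I)) * r"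
      by (simp only: distrib_left ac_simps)
    then have E: "Acoef h zz * T_pow 2 r * \<psi> + Acoef h (1 / zz) * T_pow (-2) r * T_pow (-2) (1 / \<psi>) + (scal (gam h * (gam h + 1 / gam h)) - Acoef h zz - Acoef h (1 / zz)) * r = scal (gam h * lam 0 I) * r"
      unfolding g scal.mult .
    have L: "gam h * (lam 0 I - gam h - 1 / gam h) = gam h * lam 0 I - gam h * (gam h + 1 / gam h)"
      by (simp add: algebra_simps)
    show ?thesis unfolding L scal.diff using E by (simp add: algebra_simps)
  qed
  obtain g where g: "g \<noteq> 0" "T_pow 2 g = tphi h I / \<psi> * g"
    using tphi_sig_gauge[OF I h] by (auto simp: gauge_def \<psi>_def)
  have \<psi>0: "\<psi> \<noteq> 0" by (simp add: \<psi>_def s0)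
  have t0: "tphi h I \<noteq> 0" by (rule tphi_nz[OF I])
  \<comment> \<open>Applying T^(-2) to the gauge relation gives the change of the coefficient of
    T^(-2).\<close>
  have "g = T_pow (-2) (T_pow 2 g)" by (simp add: T_pow_T_pow)
  also have "\<dots> = T_pow (-2) (tphi h I) / T_pow (-2) \<psi> * T_pow (-2) g" unfolding g(2) T.mult T.divide ..
  finally have gm: "T_pow (-2) (1 / \<psi>) * T_pow (-2) g = T_pow (-2) (1 / tphi h I) * g"
    using t0 by (simp add: T.divide T.one T.eq_zero field_simps)
  have gp: "\<psi> * T_pow 2 g = tphi h I * g" unfolding g(2) using \<psi>0 by simp
  define r' where "r' = r / g"
  have r: "r = g * r'" using g(1) by (simp add: r'_def)
  have "g * (Acoef h zz * tphi h I * T_pow 2 r' + Acoef h (1 / zz) * T_pow (-2) (1 / tphi h I) * T_pow (-2) r') =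
      Acoef h zz * (tphi h I * g) * T_pow 2 r' + Acoef h (1 / zz) * (T_pow (-2) (1 / tphi h I) * g) * T_pow (-2) r'"
    by (simp only: distrib_left ac_simps)
  also have "\<dots> = Acoef h zz * \<psi> * T_pow 2 r + Acoef h (1 / zz) * T_pow (-2) (1 / \<psi>) * T_pow (-2) r"
    unfolding gp[symmetric] gm[symmetric] r T.mult by (simp only: ac_simps)
  also have "\<dots> = g * ((Acoef h zz + Acoef h (1 / zz) + scal (gam h * (lam 0 I - gam h - 1 / gam h))) * r')"
    unfolding eq unfolding r by (simp only: ac_simps)
  finally have "twisted_eigen h I r'"
    unfolding twisted_eigen_def using g(1) by simp
  then have "r' = 0" by (rule twisted_eigen_0[OF I n])
  then show ?thesis by (simp add: r)
qed

text \<open>Divide: S = X E_I + r T^j. Since E_I D_0 = D_v E_I, the relation for S shows that D_h r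
  T^j - r T^j D_0 is a left multiple of E_I, so r = 0. Cancelling E_I transfers the intertwining
  relation and the symmetry to X, and a parameter shift by -v_I makes it start at k.\<close>

lemma intertw_peel:
  assumes I: "I \<in> even_sets" and S: "intertw h S" and n: "nI h I > 0"
  shows "\<exists>S'. intertw (h - vsh I) S' \<and> S = op_comp (op_shift (vsh I) S') (opE 0 I)"
proof -
  obtain j where j: "\<And>n. Poly_Mapping.lookup S n \<noteq> 0 \<Longrightarrow> even (n - j)" "S \<noteq> 0 \<Longrightarrow> \<forall>i<4. hc h i - of_int j / 2 \<in> \<int>"
    using intertw_parity[OF S] by (cases "S = 0") auto
  have RK: "RK_op S" and inv: "op_inv S = S" and D: "op_comp S (opD 0) = op_comp (opD h) S"
    using S by (simp_all add: intertw_def)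
  note ED = opE_opD[OF I, of 0, simplified]
  obtain X where X: "RK_op X" "S = op_comp X (opE 0 I)"
  proof (cases "S = 0")
    case True
    then show ?thesis using that[of 0] by (simp add: RK_op_def RK_intros)
  next
    case False
    obtain X r where X: "RK_op X" "S = op_comp X (opE 0 I) + Poly_Mapping.single j r"
      using opE_divide[OF I RK j(1)] by blast
    have "op_comp (op_comp X (opD (vsh I)) - op_comp (opD h) X) (opE 0 I) =
        op_comp (opD h) (Poly_Mapping.single j r) - op_comp (Poly_Mapping.single j r) (opD 0)"
      using D unfolding X(2) op_comp_add op_comp_diff op_comp_assoc ED by (simp add: algebra_simps)
    then have "r = 0" using remainder_0[OF I n] j(2)[OF False] by blast
    then show ?thesis using that X by simp
  qed
  have "op_comp (op_comp X (opD (vsh I))) (opE 0 I) = op_comp (op_comp (opD h) X) (opE 0 I)"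
    using D unfolding X(2) op_comp_assoc ED .
  then have XD: "op_comp X (opD (vsh I)) = op_comp (opD h) X" by (rule opE_cancel)
  have "op_comp (op_inv X) (opE 0 I) = op_comp X (opE 0 I)"
    using inv unfolding X(2) op_inv_comp op_inv_opE .
  then have Xinv: "op_inv X = X" by (rule opE_cancel)
  let ?S = "op_shift (- vsh I) X"
  have "intertw (h - vsh I) ?S"
    unfolding intertw_def
  proof (intro conjI)
    show "RK_op ?S"
      using X(1) ratfun_shift_RK[OF integral_uminus[OF integral_vsh]] by (simp add: RK_op_def lookup_op_shift)
    show "op_inv ?S = ?S" by (simp add: op_shift_inv[symmetric] Xinv)
    show "op_comp ?S (opD 0) = op_comp (opD (h - vsh I)) ?S"
      using arg_cong[OF XD, of "op_shift (- vsh I)"] by (simp add: op_shift_comp op_shift_opD)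
  qed
  moreover have "op_shift (vsh I) ?S = X" by (simp add: op_shift_shift op_shift_0)
  ultimately show ?thesis using X(2) by metis
qed

subsection \<open>The spaces of shift operators\<close>

lemma shift_ops_iff: "S \<in> shift_ops h \<longleftrightarrow> RK_op S \<and> (\<forall>f\<in>SZ. op_apply S f \<in> SZ) \<and>
    (\<forall>m. \<exists>C\<in>KK. op_apply S (of_lpoly (eigenpoly m)) =
       scal C * of_lpoly (shifted_eigenpoly h (of_nat m + degree_shift h)))"
  by (auto simp: shift_ops_def symmetric_diff_op_def RK_op_def SZ_def AW_eq AW_shifted_eq)

lemma RK_op_add: "RK_op S \<Longrightarrow> RK_op S' \<Longrightarrow> RK_op (S + S')"
  and RK_op_diff: "RK_op S \<Longrightarrow> RK_op S' \<Longrightarrow> RK_op (S - S')"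
  and RK_op_single: "c \<in> ratfun_K \<Longrightarrow> RK_op (Poly_Mapping.single n c)"
  and RK_op_0: "RK_op 0"
  by (simp_all add: RK_op_def lookup_add lookup_minus lookup_single when_def RK_intros)

lemma RK_op_scalar: "x \<in> KK \<Longrightarrow> RK_op (scalar_op x)"
  unfolding scalar_op_def by (intro RK_op_single scal_RK)

lemma RK_op_comp: "RK_op S \<Longrightarrow> RK_op S' \<Longrightarrow> RK_op (op_comp S S')"
  unfolding RK_op_def op_comp_def lookup_sum lookup_single when_def
  by (auto intro!: RK_intros T_pow_RK)

lemma shift_ops_0: "0 \<in> shift_ops h"
proof -
  have "\<exists>C\<in>KK. 0 = scal C * x" for x by (rule bexI[of _ 0]) (simp_all add: scal.zero KK_intros)
  then show ?thesis unfolding shift_ops_iff by (intro conjI allI ballI) (simp_all only: op_apply_0_op RK_op_0 SZ_intros)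
qed

lemma shift_ops_add:
  assumes "S \<in> shift_ops h" "S' \<in> shift_ops h"
  shows "S + S' \<in> shift_ops h"
  unfolding shift_ops_iff
proof (intro conjI allI ballI)
  show "RK_op (S + S')" "\<And>f. f \<in> SZ \<Longrightarrow> op_apply (S + S') f \<in> SZ"
    using assms by (simp_all add: shift_ops_iff RK_op_add op_apply_add_op SZ_intros)
  fix m
  let ?f = "of_lpoly (shifted_eigenpoly h (of_nat m + degree_shift h))"
  obtain C C' where "C \<in> KK" "op_apply S (of_lpoly (eigenpoly m)) = scal C * ?f"
    "C' \<in> KK" "op_apply S' (of_lpoly (eigenpoly m)) = scal C' * ?f"
    using assms unfolding shift_ops_iff by blast
  then show "\<exists>C\<in>KK. op_apply (S + S') (of_lpoly (eigenpoly m)) = scal C * ?f"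
    by (intro bexI[of _ "C + C'"]) (simp_all add: op_apply_add_op scal.add distrib_right KK_intros)
qed

lemma shift_ops_sum: "(\<And>i. i \<in> A \<Longrightarrow> F i \<in> shift_ops h) \<Longrightarrow> (\<Sum>i\<in>A. F i) \<in> shift_ops h"
  by (induction A rule: infinite_finite_induct) (simp_all add: shift_ops_0 shift_ops_add)

lemma op_apply_scalar: "op_apply (op_comp (scalar_op x) S) f = scal x * op_apply S f"
  by (simp add: scalar_op_def op_apply_comp op_apply_single)

lemma shift_ops_scalar:
  assumes "S \<in> shift_ops h" "x \<in> KK"
  shows "op_comp (scalar_op x) S \<in> shift_ops h"
  unfolding shift_ops_iff
proof (intro conjI allI ballI)
  show "RK_op (op_comp (scalar_op x) S)"
    using assms by (intro RK_op_comp) (simp_all add: scalar_op_def RK_op_single scal_RK shift_ops_iff)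
  show "op_apply (op_comp (scalar_op x) S) f \<in> SZ" if "f \<in> SZ" for f
    using assms that by (simp add: op_apply_scalar shift_ops_iff SZ_intros SZ_scal)
  fix m
  let ?f = "of_lpoly (shifted_eigenpoly h (of_nat m + degree_shift h))"
  obtain C where "C \<in> KK" "op_apply S (of_lpoly (eigenpoly m)) = scal C * ?f"
    using assms unfolding shift_ops_iff by blast
  then show "\<exists>C\<in>KK. op_apply (op_comp (scalar_op x) S) (of_lpoly (eigenpoly m)) = scal C * ?f"
    using assms(2) by (intro bexI[of _ "x * C"]) (simp_all add: op_apply_scalar scal.mult mult.assoc KK_intros)
qed

lemma op_comp_scalar_minus: "op_comp (scalar_op (-1)) S = - S"
  by (rule op_eqI) (simp add: op_apply_scalar op_apply_uminus_op scal.simps)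

lemma shift_ops_uminus: "S \<in> shift_ops h \<Longrightarrow> - S \<in> shift_ops h"
  using shift_ops_scalar[of S h "-1"] by (simp add: op_comp_scalar_minus KK_intros)

lemma scalar_op_shift_ops: "x \<in> KK \<Longrightarrow> scalar_op x \<in> shift_ops 0"
proof -
  assume x: "x \<in> KK"
  have "shifted_eigenpoly 0 (of_nat m + degree_shift 0) = eigenpoly m" for m
  proof -
    have "degree_shift 0 = 0" by (simp add: zero_prod_def)
    moreover have "Poly_Mapping.map (par_shift 0) f = f" for f :: lpoly
      by (rule poly_mapping_eqI) (simp add: Poly_Mapping.map.rep_eq when_def par_shift_0)
    ultimately show ?thesis by (simp add: shifted_eigenpoly_def)
  qed
  then show ?thesis
    using x by (auto simp: shift_ops_iff scalar_op_def RK_op_single scal_RK op_apply_single SZ_intros SZ_scal)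
qed

lemma opE_shift_ops:
  assumes I: "I \<in> even_sets"
  shows "opE 0 I \<in> shift_ops (vsh I)"
  unfolding shift_ops_iff
proof (intro conjI allI ballI)
  show "RK_op (opE 0 I)"
    unfolding opE_split by (intro RK_op_add RK_op_single zinv_RK eA_RK I)
qed (rule opE_SZ[OF integral_0 I], assumption, rule opE_eigenpoly[OF I])

text \<open>All entries of h are congruent to the same j/2 modulo the integers. So shifts that carry
  nonzero operators map K into itself.\<close>

lemma intertw_integral:
  assumes "intertw h S" "S \<noteq> 0"
  shows "integral_shift h"
proof -
  obtain j :: int where j: "\<And>i. i < 4 \<Longrightarrow> hc h i - of_int j / 2 \<in> \<int>"
    using intertw_parity[OF assms] by blast
  have two: "hc h i + hc h k \<in> \<int>" if "i < 4" "k < 4" for i k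
  proof -
    have "(hc h i - of_int j / 2) + (hc h k - of_int j / 2) + of_int j \<in> \<int>"
      by (intro Ints_add j that Ints_of_int)
    then show ?thesis by simp
  qed
  show ?thesis
    unfolding integral_shift_def mult_2 by (intro conjI allI impI two) simp_all
qed

text \<open>If the right factor is nonzero, its shift is integral, so shifting the parameters of the
  left factor keeps its coefficients over K. If the intermediate degree is not a natural number, the
  right factor already sends P_m to 0.\<close>

lemma shift_ops_comp:
  assumes S: "S \<in> shift_ops h" "S' \<in> shift_ops h'"
  shows "op_comp (op_shift h' S) S' \<in> shift_ops (h + h')"
proof (cases "S' = 0")
  case False
  have int: "integral_shift h'" using intertw_integral[OF shift_ops_intertw[OF S(2)] False] .
  show ?thesis
    unfolding shift_ops_iff
  proof (intro conjI allI ballI)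
    show "RK_op (op_comp (op_shift h' S) S')"
      using S ratfun_shift_RK[OF int] by (intro RK_op_comp) (simp_all add: shift_ops_iff RK_op_def lookup_op_shift)
    show "op_apply (op_comp (op_shift h' S) S') f \<in> SZ" if "f \<in> SZ" for f
      using S that by (simp add: op_apply_comp op_shift_apply' shift_ops_iff SZ_ratfun_shift int integral_uminus)
    fix m
    let ?r = "of_nat m + degree_shift h'"
    have d: "of_nat m + degree_shift (h + h') = ?r + degree_shift h" by (simp add: degree_shift_add)
    obtain C where C: "C \<in> KK" "op_apply S' (of_lpoly (eigenpoly m)) = scal C * of_lpoly (shifted_eigenpoly h' ?r)"
      using S(2) unfolding shift_ops_iff by blast
    show "\<exists>C\<in>KK. op_apply (op_comp (op_shift h' S) S') (of_lpoly (eigenpoly m)) =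
        scal C * of_lpoly (shifted_eigenpoly (h + h') (of_nat m + degree_shift (h + h')))"
    proof (cases "?r \<in> \<nat>")
      case True
      then obtain n where n: "?r = of_nat n" by (auto elim: Nats_cases)
      obtain C' where C': "C' \<in> KK" "op_apply S (of_lpoly (eigenpoly n)) = scal C' * of_lpoly (shifted_eigenpoly h (of_nat n + degree_shift h))"
        using S(1) unfolding shift_ops_iff by blast
      have sh: "ratfun_shift h' (of_lpoly (shifted_eigenpoly h x)) = of_lpoly (shifted_eigenpoly (h + h') x)" for x
      proof -
        have "Poly_Mapping.map (par_shift h') (Poly_Mapping.map (par_shift h) f) = Poly_Mapping.map (par_shift (h + h')) f" for f :: lpoly
          by (rule poly_mapping_eqI) (simp add: Poly_Mapping.map.rep_eq when_def par_shift_comp add.commute ps.zero ps.eq_zero)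
        moreover have "Poly_Mapping.map (par_shift h') 0 = (0 :: lpoly)"
          by (rule poly_mapping_eqI) (simp add: Poly_Mapping.map.rep_eq)
        ultimately show ?thesis by (simp add: shifted_eigenpoly_def ratfun_shift_of_lpoly)
      qed
      have "of_lpoly (shifted_eigenpoly h' (of_nat n)) = ratfun_shift h' (of_lpoly (eigenpoly n))"
        by (simp add: shifted_eigenpoly_def ratfun_shift_of_lpoly)
      then have "op_apply (op_comp (op_shift h' S) S') (of_lpoly (eigenpoly m)) =
          scal C * ratfun_shift h' (op_apply S (of_lpoly (eigenpoly n)))"
        unfolding op_apply_comp C(2) n op_apply_scal by (simp add: op_shift_apply)
      also have "\<dots> = scal (C * par_shift h' C') * of_lpoly (shifted_eigenpoly (h + h') (of_nat m + degree_shift (h + h')))"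
        unfolding C'(2) rs.mult sh d n by (simp add: scal.mult mult.assoc)
      finally show ?thesis using C(1) C'(1) par_shift_KK[OF int] by (intro bexI[of _ "C * par_shift h' C'"]) (auto intro: KK_intros)
    next
      case False
      then have "op_apply (op_comp (op_shift h' S) S') (of_lpoly (eigenpoly m)) = 0"
        by (simp add: op_apply_comp C(2) shifted_eigenpoly_def)
      then show ?thesis by (intro bexI[of _ 0]) (simp_all add: scal.zero KK_intros)
    qed
  qed
qed (simp add: shift_ops_0)

subsection \<open>The generators\<close>

lemma even_sets_enum:
  assumes I: "I \<in> even_sets"
  shows "I \<in> {{}, {0, 1}, {0, 2}, {0, 3}, {1, 2}, {1, 3}, {2, 3}, {0, 1, 2, 3}}"
  using I
proof (cases rule: even_sets_cases)
  case (2 i j k l)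
  then have "i < 4" "j < 4" using even_sets_subset[OF I] by simp_all
  then show ?thesis
    using \<open>i \<noteq> j\<close> unfolding \<open>I = {i, j}\<close> by (elim less_4_cases) (simp_all add: insert_commute)
qed (simp_all add: less_4)

lemma two_term_op_scale: "two_term_op (\<lambda>x. scal c * A x) = op_comp (scalar_op c) (two_term_op A)"
  by (simp add: two_term_op_def scalar_op_def op_comp_diff op_comp_single)

lemma scal_half: "scal (x * qpow (-1/2)) = scal x / scal tt"
  unfolding qpow_half_minus scal.mult scal.inverse by (rule field_class.field_divide_inverse[symmetric])

lemma Gq_plus_opE: "Gq_plus = opE 0 {}"
proof -
  have "cA 0 {} = (\<lambda>_. 1)" by (rule ext) (simp add: cA_def cAf_def)
  then show ?thesis by (simp add: Gq_plus_def opE_def)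
qed

lemma Gq_minus_opE: "Gq_minus = op_comp (scalar_op (1 / tt)) (opE 0 {0, 1, 2, 3})"
proof -
  have "coeff_A1 = (\<lambda>x. scal (1 / tt) * cA 0 {0, 1, 2, 3} x)"
  proof
    fix x
    have "coeff_A1 x = scal (1 * qpow (-1/2)) * inverse (x\<^sup>2) * ((1 - scal (par 0 * qpow (-1/2)) * x) * ((1 - scal (par 1 * qpow (-1/2)) * x) *
     ((1 - scal (par 2 * qpow (-1/2)) * x) * (1 - scal (par 3 * qpow (-1/2)) * x))))"
      unfolding coeff_A1_def by (simp add: par_def mult.assoc)
    then show "coeff_A1 x = scal (1 / tt) * cA 0 {0, 1, 2, 3} x"
      unfolding scal_half by (simp add: cA_def cAf_def upar_0 scal.divide scal.one power2_eq_square)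
  qed
  then show ?thesis unfolding Gq_minus_def opE_def two_term_op_scale[symmetric] by simp
qed

lemma Eq_opE:
  assumes "i < 4" "j < 4" "i \<noteq> j"
  shows "Eq (Suc i) (Suc j) = op_comp (scalar_op (-1)) (opE 0 {i, j})"
proof -
  have "coeff_A2 (par i) (par j) = (\<lambda>x. scal (-1) * cA 0 {i, j} x)"
    using assms by (intro ext) (simp only: coeff_A2_def scal_half, simp add: cA_def cAf_def upar_0 scal.simps)
  then show ?thesis unfolding Eq_def opE_def two_term_op_scale[symmetric] by (simp add: par_def)
qed

lemma Eq_opEs:
  "Eq 1 2 = op_comp (scalar_op (-1)) (opE 0 {0, 1})" "Eq 1 3 = op_comp (scalar_op (-1)) (opE 0 {0, 2})"
  "Eq 1 4 = op_comp (scalar_op (-1)) (opE 0 {0, 3})" "Eq 2 3 = op_comp (scalar_op (-1)) (opE 0 {1, 2})"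
  "Eq 2 4 = op_comp (scalar_op (-1)) (opE 0 {1, 3})" "Eq 3 4 = op_comp (scalar_op (-1)) (opE 0 {2, 3})"
  using Eq_opE[of 0 1] Eq_opE[of 0 2] Eq_opE[of 0 3] Eq_opE[of 1 2] Eq_opE[of 1 3] Eq_opE[of 2 3]
  by (simp_all add: eval_nat_numeral)

lemma vsh_values:
  "v1 = vsh {}" "- v1 = vsh {0, 1, 2, 3}" "- v2 = vsh {0, 1}" "- v3 = vsh {0, 2}" "- v4 = vsh {0, 3}"
  "v4 = vsh {1, 2}" "v3 = vsh {1, 3}" "v2 = vsh {2, 3}"
  by (simp_all add: vsh_def v1_def v2_def v3_def v4_def)

lemma shift_generators_eq: "shift_generators =
  {Poly_Mapping.single (vsh {}) (opE 0 {}),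
   Poly_Mapping.single (vsh {0, 1, 2, 3}) (op_comp (scalar_op (1 / tt)) (opE 0 {0, 1, 2, 3}))} \<union>
   (\<lambda>I. Poly_Mapping.single (vsh I) (op_comp (scalar_op (-1)) (opE 0 I))) ` {{0, 1}, {0, 2}, {0, 3}, {1, 2}, {1, 3}, {2, 3}}"
  unfolding shift_generators_def Gq_plus_opE Gq_minus_opE Eq_opEs image_insert image_empty
  unfolding vsh_values(2-5) unfolding vsh_values(1,6-8) by blast

lemma even_sets_values: "{} \<in> even_sets" "{0, 1, 2, 3} \<in> even_sets" "{0, 1} \<in> even_sets" "{0, 2} \<in> even_sets"
  "{0, 3} \<in> even_sets" "{1, 2} \<in> even_sets" "{1, 3} \<in> even_sets" "{2, 3} \<in> even_sets"
  by (auto simp: even_sets_def)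

subsection \<open>The algebra of shift operators\<close>

abbreviation (input) gens :: "(rat4 \<Rightarrow>\<^sub>0 diff_op) set" where
  "gens \<equiv> generate_ring shift_algebra (shift_scalars \<union> shift_generators)"

definition gen :: "rat4 \<Rightarrow> diff_op \<Rightarrow> bool" where
  "gen h S \<longleftrightarrow> Poly_Mapping.single h S \<in> gens"

lemma shift_algebra_simps:
  "X \<oplus>\<^bsub>shift_algebra\<^esub> Y = X + Y" "\<zero>\<^bsub>shift_algebra\<^esub> = 0" "\<one>\<^bsub>shift_algebra\<^esub> = Poly_Mapping.single 0 (scalar_op 1)"
  "X \<in> carrier shift_algebra \<longleftrightarrow> (\<forall>h. Poly_Mapping.lookup X h \<in> shift_ops h)"
  "X \<otimes>\<^bsub>shift_algebra\<^esub> Y = (\<Sum>h\<in>Poly_Mapping.keys X. \<Sum>h'\<in>Poly_Mapping.keys Y.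
        Poly_Mapping.single (h + h') (op_comp (op_shift h' (Poly_Mapping.lookup X h)) (Poly_Mapping.lookup Y h')))"
  by (simp_all add: shift_algebra_def scalar_op_def scal.one)

lemma shift_algebra_uminus:
  assumes "X \<in> carrier shift_algebra"
  shows "\<ominus>\<^bsub>shift_algebra\<^esub> X = - X"
proof -
  have "- X \<in> carrier shift_algebra"
    using assms by (simp add: shift_algebra_simps shift_ops_uminus)
  then have "- X \<in> carrier shift_algebra \<and> X + - X = 0 \<and> - X + X = 0" by simp
  moreover have "y = - X" if "y \<in> carrier shift_algebra \<and> X + y = 0 \<and> y + X = 0" for y
    using that by (metis add_eq_0_iff)
  ultimately show ?thesis
    unfolding a_inv_def m_inv_def by (intro the_equality) (simp_all add: shift_algebra_simps)
qed

lemma single_carrier: "S \<in> shift_ops h \<Longrightarrow> Poly_Mapping.single h S \<in> carrier shift_algebra"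
proof -
  assume "S \<in> shift_ops h"
  then have "Poly_Mapping.lookup (Poly_Mapping.single h S) k \<in> shift_ops k" for k
    by (cases "h = k") (simp_all add: lookup_single shift_ops_0)
  then show ?thesis unfolding shift_algebra_simps by blast
qed

lemma gens_subset: "gens \<subseteq> carrier shift_algebra"
proof
  fix X
  assume "X \<in> gens"
  then show "X \<in> carrier shift_algebra"
  proof induction
    case one
    show ?case unfolding shift_algebra_simps(3) by (intro single_carrier scalar_op_shift_ops KK_intros)
  next
    case (incl X)
    have t: "1 / tt \<in> KK" "-1 \<in> KK" by (intro KK_intros qpow_KK; simp)+
    from incl consider x where "x \<in> KK" "X = Poly_Mapping.single 0 (scalar_op x)" | "X \<in> shift_generators"
      by (auto simp: shift_scalars_def)
    then show ?case
    proof cases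
      case 1
      then show ?thesis by (simp add: single_carrier scalar_op_shift_ops)
    next
      case 2
      then show ?thesis
        unfolding shift_generators_eq using even_sets_values t
        by (auto intro!: single_carrier shift_ops_scalar opE_shift_ops)
    qed
  next
    case (a_inv X)
    then show ?case by (simp add: shift_algebra_uminus) (simp add: shift_algebra_simps shift_ops_uminus)
  next
    case (eng_add X Y)
    then show ?case by (simp add: shift_algebra_simps lookup_add shift_ops_add)
  next
    case (eng_mult X Y)
    then have c: "Poly_Mapping.lookup X h \<in> shift_ops h" "Poly_Mapping.lookup Y h \<in> shift_ops h" for h
      unfolding shift_algebra_simps by blast+
    have "Poly_Mapping.lookup (Poly_Mapping.single (h + h')
        (op_comp (op_shift h' (Poly_Mapping.lookup X h)) (Poly_Mapping.lookup Y h'))) k \<in> shift_ops k" for h h' k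
      using shift_ops_comp[OF c(1)[of h] c(2)[of h']]
      by (cases "h + h' = k") (simp_all add: lookup_single when_def shift_ops_0)
    then show ?case unfolding shift_algebra_simps lookup_sum by (intro allI shift_ops_sum)
  qed
qed

lemma gen_add: "gen h S \<Longrightarrow> gen h S' \<Longrightarrow> gen h (S + S')"
  unfolding gen_def single_add using generate_ring.eng_add[of _ shift_algebra] by (simp add: shift_algebra_simps)

lemma gen_comp:
  assumes "gen h S" "gen h' S'"
  shows "gen (h + h') (op_comp (op_shift h' S) S')"
proof -
  have "Poly_Mapping.single h S \<otimes>\<^bsub>shift_algebra\<^esub> Poly_Mapping.single h' S' =
      Poly_Mapping.single (h + h') (op_comp (op_shift h' S) S')"
    unfolding shift_algebra_simps by (cases "S = 0"; cases "S' = 0") simp_all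
  then show ?thesis using assms generate_ring.eng_mult unfolding gen_def by metis
qed

lemma gen_scalar: "x \<in> KK \<Longrightarrow> gen 0 (scalar_op x)"
  unfolding gen_def by (intro generate_ring.incl) (simp add: shift_scalars_def)

text \<open>Scalars are not central: multiplication by x on an operator with shift h is the product
  with the scalar in which the parameters are shifted by -h.\<close>

lemma gen_scale:
  assumes "gen h S" "integral_shift h" "x \<in> KK"
  shows "gen h (op_comp (scalar_op x) S)"
proof -
  have "op_shift h (scalar_op (par_shift (- h) x)) = scalar_op x"
    by (rule poly_mapping_eqI)
      (simp add: scalar_op_def lookup_op_shift lookup_single when_def rs.zero par_shift_comp par_shift_0)
  then show ?thesis
    using gen_comp[OF gen_scalar[OF par_shift_KK[OF integral_uminus[OF assms(2)] assms(3)]] assms(1)] by simp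
qed

lemma gen_0: "gen h 0"
proof -
  have "gen 0 (scalar_op 0)" by (rule gen_scalar) (rule KK_intros)
  then show ?thesis by (simp add: gen_def scalar_op_def scal.zero)
qed

text \<open>The generators are the elementary operators up to the invertible scalars q^(-1/2) and
  -1.\<close>

lemma gen_opE:
  assumes I: "I \<in> even_sets"
  shows "gen (vsh I) (opE 0 I)"
proof -
  have K: "tt \<in> KK" "-1 \<in> KK" by (intro KK_intros qpow_KK; simp)+
  have s: "op_comp (scalar_op x) (op_comp (scalar_op (1 / x)) S) = S" if "x \<noteq> 0" for x S
    using that by (intro op_eqI) (simp add: op_apply_scalar mult.assoc[symmetric] scal.mult[symmetric] scal.one)
  have g: "gen (vsh J) (opE 0 J)" if "Poly_Mapping.single (vsh J) (op_comp (scalar_op (1 / x)) (opE 0 J)) \<in> shift_generators" "x \<in> KK" "x \<noteq> 0" for J x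
  proof -
    have "gen (vsh J) (op_comp (scalar_op (1 / x)) (opE 0 J))"
      unfolding gen_def using that(1) by (intro generate_ring.incl) simp
    then show ?thesis using gen_scale[OF _ integral_vsh that(2)] s[OF that(3)] by metis
  qed
  consider "I = {}" | "I = {0, 1, 2, 3}" | "I \<in> {{0, 1}, {0, 2}, {0, 3}, {1, 2}, {1, 3}, {2, 3}}"
    using even_sets_enum[OF I] by auto
  then show ?thesis
  proof cases
    case 1
    then show ?thesis unfolding gen_def by (intro generate_ring.incl) (simp add: shift_generators_eq)
  next
    case 2
    then show ?thesis using g[of I tt] K by (simp add: shift_generators_eq)
  next
    case 3
    then have "Poly_Mapping.single (vsh I) (op_comp (scalar_op (1 / (-1))) (opE 0 I)) \<in> shift_generators"
      unfolding shift_generators_eq by (intro UnI2 image_eqI[of _ _ I]) simp_all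
    then show ?thesis using g K by force
  qed
qed

text \<open>The factorisation with empty I writes D through the two elementary operators of the
  empty and the full set.\<close>

lemma gen_opD: "gen 0 (opD 0)"
proof -
  let ?U = "{..<4} - {} :: nat set"
  have K: "nu 0 {} \<in> KK" "lam 0 {} \<in> KK"
    unfolding nu_def lam_def rho_def by (intro KK_intros qpow_KK gam_KK; simp add: hc_0)+
  have U: "?U \<in> even_sets" by (rule even_sets_compl[OF empty_even_sets])
  have "opD 0 = op_comp (scalar_op (nu 0 {})) (op_comp (op_shift (vsh {}) (opE 0 ?U)) (opE 0 {})) + scalar_op (lam 0 {})"
    unfolding op_shift_opE[OF U]
    by (rule op_eqI) (simp add: op_apply_add_op op_apply_scalar op_apply_comp opE_fact[OF empty_even_sets, of 0, simplified] scalar_op_def op_apply_single)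
  moreover have "gen 0 (op_comp (op_shift (vsh {}) (opE 0 ?U)) (opE 0 {}))"
    using gen_comp[OF gen_opE[OF U] gen_opE[OF empty_even_sets]] by (simp only: vsh_compl[of "{}"]) simp
  ultimately show ?thesis using gen_add[OF gen_scale[OF _ integral_0 K(1)] gen_scalar[OF K(2)]] by metis
qed

subsection \<open>Operators commuting with the Askey--Wilson operator\<close>

lemma op_inv_scalar: "op_inv (scalar_op x) = scalar_op x"
  by (rule poly_mapping_eqI) (simp add: scalar_op_def lookup_op_inv lookup_single when_def zinv.zero)

primrec opDp :: "nat \<Rightarrow> diff_op" where
  "opDp 0 = scalar_op 1"
| "opDp (Suc m) = op_comp (opDp m) (opD 0)"

lemma dA_nz: "dA h \<noteq> 0"
proof -
  have "(\<Prod>i<4. [:1, - (upar h i * 1):]) \<noteq> 0" by (simp add: prod_zero_iff)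
  then show ?thesis
    using Acoef_ev[of h 1] by (simp add: dA_def scal.one scal.eq_zero ev_eq_0 del: mult_pCons_left mult_pCons_right)
qed

lemma dA_RK: "dA 0 \<in> ratfun_K" and dB_RK: "dB 0 \<in> ratfun_K"
proof -
  have g: "gam 0 \<in> KK" by (rule gam_KK) (simp add: hc_0)
  have u: "upar 0 i \<in> KK" if "i < 4" for i using that by (simp add: upar_0 par_KK)
  show A: "dA 0 \<in> ratfun_K"
    unfolding dA_def Acoef_def Af_def using g u
    by (intro RK_intros scal_RK zz_RK KK_intros qpow_KK) auto
  show "dB 0 \<in> ratfun_K"
    unfolding dB_def using g by (intro RK_intros A zinv_RK scal_RK KK_intros)
qed

lemma RK_op_opD: "RK_op (opD 0)"
  unfolding opD_split by (intro RK_op_add RK_op_single dA_RK dB_RK zinv_RK)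

lemma opDp:
  shows "intertw 0 (opDp m)" and "gen 0 (opDp m)"
    and "n > 2 * int m \<Longrightarrow> Poly_Mapping.lookup (opDp m) n = 0" and "Poly_Mapping.lookup (opDp m) (2 * int m) \<noteq> 0"
proof (induction m arbitrary: n)
  case 0
  {
    case 1
    have "op_comp (scalar_op 1) S = S" "op_comp S (scalar_op 1) = S" for S
      by (rule op_eqI; simp add: op_apply_comp scalar_op_def op_apply_single scal.one del: single_one)+
    then show ?case by (simp add: intertw_def op_inv_scalar RK_op_scalar KK_intros)
  next
    case 2
    show ?case unfolding opDp.simps by (intro gen_scalar KK_intros)
  next
    case 3
    then show ?case by (simp add: scalar_op_def lookup_single)
  next
    case 4
    show ?case by (simp add: scalar_op_def scal.eq_zero)
  }
next
  case (Suc m)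
  have l: "Poly_Mapping.lookup (opDp (Suc m)) n = Poly_Mapping.lookup (opDp m) (n - 2) * T_pow (n - 2) (dA 0) +
      Poly_Mapping.lookup (opDp m) (n + 2) * T_pow (n + 2) (zinv (dA 0)) + Poly_Mapping.lookup (opDp m) n * T_pow n (dB 0)" for n
    unfolding opDp.simps opD_split by (simp add: op_comp_add lookup_add lookup_comp_single)
  {
    case 1
    have c: "op_comp (opDp m) (opD 0) = op_comp (opD 0) (opDp m)"
      using Suc.IH(1) by (simp add: intertw_def)
    then have "op_comp (op_comp (opDp m) (opD 0)) (opD 0) = op_comp (opD 0) (op_comp (opDp m) (opD 0))"
      by (metis op_comp_assoc)
    then show ?case using Suc.IH(1) by (simp add: intertw_def RK_op_comp RK_op_opD op_inv_comp op_inv_opD)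
  next
    case 2
    show ?case using gen_comp[OF Suc.IH(2) gen_opD] by (simp add: op_shift_0)
  next
    case 3
    then show ?case unfolding l using Suc.IH(3)[of "n - 2"] Suc.IH(3)[of n] Suc.IH(3)[of "n + 2"] by simp
  next
    case 4
    show ?case unfolding l using Suc.IH(3)[of "2 * int (Suc m) + 2"] Suc.IH(3)[of "2 * int (Suc m)"] Suc.IH(4)
      by (simp add: T.eq_zero dA_nz)
  }
qed

text \<open>An operator commuting with D has even top exponent N = 2m by
  \<open>intertw_lattice\<close>. Its top coefficient and that of D^m solve the same first order
  equation, so their quotient is invariant under T^2 and hence a constant in K; subtracting the
  multiple of D^m lowers the top exponent. An operator with negative exponents only is zero by the
  symmetry z -> 1/z.\<close>

lemma intertw_0_gen:
  assumes "intertw 0 S" "\<And>n. n \<ge> int N \<Longrightarrow> Poly_Mapping.lookup S n = 0"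
  shows "gen 0 S"
  using assms
proof (induction N arbitrary: S)
  case 0
  have "Poly_Mapping.lookup S n = 0" for n
  proof (cases "n \<ge> 0")
    case False
    have "Poly_Mapping.lookup S n = Poly_Mapping.lookup (op_inv S) n" using 0(1) by (simp add: intertw_def)
    also have "\<dots> = 0" unfolding lookup_op_inv using 0(2)[of "- n"] False by (simp add: zinv.zero)
    finally show ?thesis .
  qed (use 0 in simp)
  then have "S = 0" by (intro poly_mapping_eqI) simp
  then show ?case by (simp add: gen_0)
next
  case (Suc N)
  let ?c = "Poly_Mapping.lookup S (int N)"
  show ?case
  proof (cases "?c = 0")
    case True
    have "Poly_Mapping.lookup S n = 0" if "n \<ge> int N" for n
      using that True Suc.prems(2)[of n] by (cases "n = int N") auto
    then show ?thesis using Suc by blast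
  next
    case False
    have z: "Poly_Mapping.lookup S (int N + 2) = 0" "Poly_Mapping.lookup S (int N + 4) = 0"
      using Suc.prems(2) by simp_all
    have "hc 0 0 - of_int (int N) / 2 \<in> \<int>" using intertw_lattice(1)[OF Suc.prems(1) z False, of 0] by simp
    then have "- (of_nat N / 2 :: rat) \<in> \<int>" by (simp add: hc_0)
    then obtain k where "- (of_nat N / 2 :: rat) = of_int k" by (rule Ints_cases)
    then have "(of_int (int N) :: rat) = of_int (- 2 * k)" by (simp add: field_simps)
    then have "int N = - 2 * k" by (simp only: of_int_eq_iff)
    then have "even N" by presburger
    then obtain m where m: "N = 2 * m" by (auto elim: evenE)
    let ?d = "Poly_Mapping.lookup (opDp m) (int N)"
    have d: "?d \<noteq> 0" using opDp(4)[of m] by (simp add: m)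
    have zd: "Poly_Mapping.lookup (opDp m) (int N + 2) = 0" "Poly_Mapping.lookup (opDp m) (int N + 4) = 0"
      using opDp(3)[of m] by (simp_all add: m)
    note e = intertw_top[OF Suc.prems(1) z] intertw_top[OF opDp(1)[of m] zd]
    have tA: "T_pow (int N) (dA 0) \<noteq> 0" by (simp add: T.eq_zero dA_nz)
    have "dA 0 * T_pow 2 ?c * ?d = dA 0 * T_pow 2 ?d * ?c" unfolding e[symmetric] by (simp only: ac_simps)
    then have "T_pow 2 ?c * ?d = T_pow 2 ?d * ?c" using dA_nz[of 0] by simp
    then have "T_pow 2 (?c / ?d) = ?c / ?d"
      using d by (simp add: T.divide T.eq_zero frac_eq_eq mult.commute)
    then obtain \<kappa> where \<kappa>: "?c / ?d = scal \<kappa>" using T_2_constant by blast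
    have "?c / ?d \<in> ratfun_K" using Suc.prems(1) opDp(1)[of m] by (intro RK_intros) (simp_all add: intertw_def RK_op_def)
    then have K: "\<kappa> \<in> KK" unfolding \<kappa> by (rule scal_RK_imp)
    let ?U = "op_comp (scalar_op \<kappa>) (opDp m)"
    have lU: "Poly_Mapping.lookup ?U n = scal \<kappa> * Poly_Mapping.lookup (opDp m) n" for n
      by (simp add: scalar_op_def lookup_single_comp)
    have comm: "op_comp (scalar_op \<kappa>) (op_comp (opD 0) S) = op_comp (opD 0) (op_comp (scalar_op \<kappa>) S)" for S
      by (rule op_eqI) (simp add: op_apply_comp scalar_op_def op_apply_single op_apply_scal)
    have "intertw 0 ?U"
      using opDp(1)[of m] by (simp add: intertw_def RK_op_comp RK_op_scalar K op_inv_comp op_inv_scalar op_comp_assoc comm)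
    then have i: "intertw 0 (S - ?U)"
      using Suc.prems(1) by (simp add: intertw_def RK_op_diff op_inv_diff op_comp_diff)
    have "Poly_Mapping.lookup (S - ?U) n = 0" if "n \<ge> int N" for n
    proof (cases "n = int N")
      case True
      have "?c = scal \<kappa> * ?d" using \<kappa> d by (simp add: field_simps)
      then show ?thesis by (simp add: True lookup_minus lU)
    next
      case False
      then show ?thesis using that Suc.prems(2)[of n] opDp(3)[of m n] by (simp add: lookup_minus lU m)
    qed
    then have "gen 0 (S - ?U)" by (rule Suc.IH[OF i])
    moreover have "gen 0 ?U" by (rule gen_scale[OF opDp(2) integral_0 K])
    ultimately have "gen 0 (S - ?U + ?U)" by (rule gen_add)
    then show ?thesis by simp
  qed
qed

section \<open>Descent on the shift\<close>

text \<open>The sum of the absolute values of the coordinates of h in the orthonormal basis v_1,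
  ..., v_4.\<close>

definition shift_size :: "rat4 \<Rightarrow> rat" where
  "shift_size h = \<bar>nI h {}\<bar> + \<bar>nI h {2, 3}\<bar> + \<bar>nI h {1, 3}\<bar> + \<bar>nI h {1, 2}\<bar>"

lemma nI_values:
  "nI (a, b, c, d) {} = (a + b + c + d) / 2" "nI (a, b, c, d) {0, 1, 2, 3} = - (a + b + c + d) / 2"
  "nI (a, b, c, d) {2, 3} = (a + b - c - d) / 2" "nI (a, b, c, d) {0, 1} = - (a + b - c - d) / 2"
  "nI (a, b, c, d) {1, 3} = (a - b + c - d) / 2" "nI (a, b, c, d) {0, 2} = - (a - b + c - d) / 2"
  "nI (a, b, c, d) {1, 2} = (a - b - c + d) / 2" "nI (a, b, c, d) {0, 3} = - (a - b - c + d) / 2"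
  by (simp_all add: nI_def sum_4 hc_vsh) (simp_all add: hc_def field_simps)

lemma shift_size_eq: "shift_size (a, b, c, d) =
    \<bar>(a + b + c + d) / 2\<bar> + \<bar>(a + b - c - d) / 2\<bar> + \<bar>(a - b + c - d) / 2\<bar> + \<bar>(a - b - c + d) / 2\<bar>"
  by (simp only: shift_size_def nI_values)

text \<open>By orthonormality, subtracting v_I moves exactly one coordinate, by 1 towards 0.\<close>

lemma shift_size_vsh:
  assumes "I \<in> even_sets" "nI h I \<ge> 1"
  shows "shift_size (h - vsh I) = shift_size h - 1"
proof -
  obtain a b c d where h: "h = (a, b, c, d)" by (cases h)
  have red: "x \<ge> 1 \<Longrightarrow> \<bar>x - 1\<bar> = \<bar>x\<bar> - 1" "- x \<ge> 1 \<Longrightarrow> \<bar>x + 1\<bar> = \<bar>x\<bar> - 1" for x :: rat by auto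
  define x where "x = (a + b + c + d) / 2"
  define y where "y = (a + b - c - d) / 2"
  define z where "z = (a - b + c - d) / 2"
  define w where "w = (a - b - c + d) / 2"
  have s: "shift_size h = \<bar>x\<bar> + \<bar>y\<bar> + \<bar>z\<bar> + \<bar>w\<bar>"
    by (simp only: h shift_size_eq x_def y_def z_def w_def)
  have t: "shift_size (h - (a', b', c', d')) = \<bar>x - (a' + b' + c' + d') / 2\<bar> + \<bar>y - (a' + b' - c' - d') / 2\<bar> +
      \<bar>z - (a' - b' + c' - d') / 2\<bar> + \<bar>w - (a' - b' - c' + d') / 2\<bar>" for a' b' c' d'
  proof -
    have "(a - a' + (b - b') + (c - c') + (d - d')) / 2 = x - (a' + b' + c' + d') / 2"
      "(a - a' + (b - b') - (c - c') - (d - d')) / 2 = y - (a' + b' - c' - d') / 2"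
      "(a - a' - (b - b') + (c - c') - (d - d')) / 2 = z - (a' - b' + c' - d') / 2"
      "(a - a' - (b - b') - (c - c') + (d - d')) / 2 = w - (a' - b' - c' + d') / 2"
      by (simp_all add: x_def y_def z_def w_def field_simps)
    then show ?thesis unfolding h diff_Pair shift_size_eq by (simp only:)
  qed
  have n: "nI h {} = x" "nI h {0, 1, 2, 3} = - x" "nI h {2, 3} = y" "nI h {0, 1} = - y"
    "nI h {1, 3} = z" "nI h {0, 2} = - z" "nI h {1, 2} = w" "nI h {0, 3} = - w"
    unfolding h nI_values x_def y_def z_def w_def minus_divide_left by (rule refl)+
  have v: "vsh {} = (1/2, 1/2, 1/2, 1/2)" "vsh {0, 1, 2, 3} = (-1/2, -1/2, -1/2, -1/2)"
    "vsh {2, 3} = (1/2, 1/2, -1/2, -1/2)" "vsh {0, 1} = (-1/2, -1/2, 1/2, 1/2)"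
    "vsh {1, 3} = (1/2, -1/2, 1/2, -1/2)" "vsh {0, 2} = (-1/2, 1/2, -1/2, 1/2)"
    "vsh {1, 2} = (1/2, -1/2, -1/2, 1/2)" "vsh {0, 3} = (-1/2, 1/2, 1/2, -1/2)"
    by (simp_all add: vsh_def)
  show ?thesis
    using even_sets_enum[OF assms(1)] assms(2) unfolding insert_iff empty_iff
    by (elim disjE; simp only: n v t s simp_thms; simp add: red)
qed

lemma nI_Ints:
  assumes "intertw h S" "S \<noteq> 0" "I \<in> even_sets"
  shows "nI h I \<in> \<int>"
proof -
  obtain j :: int where j: "\<And>i. i < 4 \<Longrightarrow> hc h i - of_int j / 2 \<in> \<int>" "(\<Sum>i<4. hc h i) / 2 \<in> \<int>"
    using intertw_parity[OF assms(1,2)] by blast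
  show ?thesis unfolding nI_alt[OF assms(3)] by (intro Ints_diff j(2) sum_hc_Ints[OF assms(3) j(1)])
qed

text \<open>The vectors v_I are an orthonormal basis together with its negatives, so some inner
  product is positive unless h = 0.\<close>

lemma nI_pos_exists:
  assumes "h \<noteq> 0"
  shows "\<exists>I\<in>even_sets. nI h I > 0"
proof (rule ccontr)
  assume "\<not> ?thesis"
  then have le: "nI h I \<le> 0" if "I \<in> even_sets" for I using that by (meson not_le_imp_less)
  obtain a b c d where h: "h = (a, b, c, d)" by (cases h)
  have z: "x = 0" if "x / 2 \<le> 0" "- x / 2 \<le> 0" for x :: rat using that by linarith
  note l = even_sets_values[THEN le, unfolded h nI_values]
  have "a + b + c + d = 0" "a + b - c - d = 0" "a - b + c - d = 0" "a - b - c + d = 0"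
    by (rule z[OF l(1,2)], rule z[OF l(8,3)], rule z[OF l(7,4)], rule z[OF l(6,5)])
  then have "a = 0" "b = 0" "c = 0" "d = 0" by linarith+
  then show False using assms by (simp add: h zero_prod_def)
qed

text \<open>Induction on a bound for the size. For a nonzero intertwiner the inner products are
  integers, so a positive one is at least 1, and splitting off E_I lowers the size by 1. The
  induction ends at h = 0, where \<open>intertw_0_gen\<close> applies.\<close>

lemma intertw_gen:
  assumes "intertw h S" "shift_size h < of_nat n"
  shows "gen h S"
  using assms
proof (induction n arbitrary: h S)
  case 0
  then show ?case by (simp add: shift_size_def)
next
  case (Suc n)
  show ?case
  proof (cases "S = 0 \<or> h = 0")
    case True
    show ?thesis
    proof (cases "S = 0")
      case False
      then have h: "h = 0" using True by simp
      obtain N where N: "\<And>k. k \<in> Poly_Mapping.keys S \<Longrightarrow> k < int N"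
      proof
        fix k
        assume "k \<in> Poly_Mapping.keys S"
        then have "k \<le> Max (Poly_Mapping.keys S)" by simp
        then show "k < int (nat (Max (Poly_Mapping.keys S) + 1))" by simp
      qed
      have "Poly_Mapping.lookup S k = 0" if "k \<ge> int N" for k
        using N[of k] that by (auto simp: in_keys_iff)
      then show ?thesis using intertw_0_gen[of S N] Suc.prems(1) unfolding h by blast
    qed (simp add: gen_0)
  next
    case False
    then obtain I where I: "I \<in> even_sets" "nI h I > 0" using nI_pos_exists by blast
    have "nI h I \<in> \<int>" using nI_Ints[OF Suc.prems(1) _ I(1)] False by blast
    then have "nI h I \<ge> 1" using I(2) by (auto elim!: Ints_cases)
    then have sz: "shift_size (h - vsh I) < of_nat n" using shift_size_vsh[OF I(1)] Suc.prems(2) by simp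
    obtain S' where S': "intertw (h - vsh I) S'" "S = op_comp (op_shift (vsh I) S') (opE 0 I)"
      using intertw_peel[OF I(1) Suc.prems(1) I(2)] by blast
    from gen_comp[OF Suc.IH[OF S'(1) sz] gen_opE[OF I(1)]] show ?thesis
      by (simp add: S'(2))
  qed
qed

theorem corollary3p32:
  "generate_ring shift_algebra (shift_scalars \<union> shift_generators) = carrier shift_algebra"
proof
  show "gens \<subseteq> carrier shift_algebra" by (rule gens_subset)
  show "carrier shift_algebra \<subseteq> gens"
  proof
    fix X
    assume X: "X \<in> carrier shift_algebra"
    have single: "Poly_Mapping.single h (Poly_Mapping.lookup X h) \<in> gens" for h
    proof -
      obtain n where "shift_size h < of_nat n" using reals_Archimedean2[of "shift_size h"] by blast
      moreover have "Poly_Mapping.lookup X h \<in> shift_ops h"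
        using X unfolding shift_algebra_simps by blast
      ultimately show ?thesis using intertw_gen[OF shift_ops_intertw] unfolding gen_def by blast
    qed
    have "0 \<in> gens" using gen_0[of 0] by (simp add: gen_def)
    then have all: "(\<Sum>h\<in>A. Poly_Mapping.single h (Poly_Mapping.lookup X h)) \<in> gens" for A
      using single generate_ring.eng_add[of _ shift_algebra]
      by (induction A rule: infinite_finite_induct) (simp_all add: shift_algebra_simps)
    have eq: "(\<Sum>h\<in>Poly_Mapping.keys X. Poly_Mapping.single h (Poly_Mapping.lookup X h)) = X"
      by (rule poly_mapping_eqI) (simp add: lookup_sum lookup_single when_def in_keys_iff)
    show "X \<in> gens" using all[of "Poly_Mapping.keys X"] unfolding eq .
  qed
qed

end
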